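(* Let $k\ge0$ be an integer and $f\in H^{k+\frac12,0}(\mathbb{R}\times\mathbb{T})\cap L^2(|x|^{2(k+\frac12)}\,dxdy)$. Assume that for some fixed time $t\neq0$, $U(t)f\in L^2(|x|^{2(k+\frac12)}\,dxdy)$. (i) If $k=0$ or $k=1$, then $$U(t)\mathcal{H}_x(x^kf)\in L^2(|x|\,dxdy)\quad\text{if and only if}\quad \mathcal{H}_x(x^kf)\in L^2(|x|\,dxdy).$$ (ii) If $k\ge2$, then $$U(t)(x^kf)\in L^2(|x|\,dxdy)\quad\text{if and only if}\quad \int_{\mathbb{T}}\int_{\mathbb{R}}e^{-i\eta y}x^{k-2}f(x,y)\,dxdy=0\ \text{ for all }\eta\in\mathbb{Z}.$$ Moreover, assuming either of these two (equivalent) conditions, $$U(t)\mathcal{H}_x(x^kf)\in L^2(|x|\,dxdy)\quad\text{if and only if}\quad \mathcal{H}_x(x^kf)\in L^2(|x|\,dxdy).$$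
   Context: $\mathbb{T}=\mathbb{R}/2\pi\mathbb{Z}$; $\langle x\rangle=(1+|x|^2)^{1/2}$. $L^2(|x|^{2\theta}\,dxdy)$ is the space of functions on $\mathbb{R}\times\mathbb{T}$ that are square integrable with respect to $|x|^{2\theta}\,dxdy$. The Fourier transform is $\widehat f(\xi,\eta)=\int_{\mathbb{T}}\int_{\mathbb{R}}f(x,y)e^{-ix\xi-iy\eta}\,dxdy$, $\xi\in\mathbb{R}$, $\eta\in\mathbb{Z}$. $\mathcal{H}_x$ is the Hilbert transform in $x$: $\widehat{\mathcal{H}_xf}(\xi,\eta)=-i\,\mathrm{sign}(\xi)\widehat f(\xi,\eta)$. For $s\ge0$, $H^{s,0}(\mathbb{R}\times\mathbb{T})$ is defined by the norm $\|f\|_{H^{s,0}}=\|J_x^sf\|_{L^2}$, where $\widehat{J_x^sf}(\xi,\eta)=\langle\xi\rangle^s\widehat f(\xi,\eta)$. $\{U(t)\}_{t\in\mathbb{R}}$ is the unitary group of the linear equation $\partial_tv-\mathcal{H}_x\partial_x^2v-\mathcal{H}_x\partial_y^2v=0$ on $\mathbb{R}\times\mathbb{T}$, i.e. $$U(t)f(x,y)=\frac{1}{(2\pi)^2}\sum_{\eta\in\mathbb{Z}}\int_{\mathbb{R}}e^{it\omega(\xi,\eta)+ix\xi+iy\eta}\widehat f(\xi,\eta)\,d\xi,\qquad \omega(\xi,\eta)=\mathrm{sign}(\xi)\xi^2+\mathrm{sign}(\xi)\eta^2.$$ *)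

theory Defs
  imports "HOL-Analysis.Analysis"
begin

text \<open>
  The circle \<open>\<real>/2\<pi>\<int>\<close> is represented by its fundamental domain \<open>[0, 2\<pi>)\<close>, so a function on
  \<open>\<real> \<times> \<T>\<close> is a map \<open>f :: real \<times> real \<Rightarrow> complex\<close> of which only the values on \<open>\<real> \<times> [0, 2\<pi>)\<close>
  matter. Elements of \<open>L\<^sup>2\<close> are represented by functions, equality being equality almost everywhere.
\<close>

definition cylinder :: "(real \<times> real) measure" where
  "cylinder = lborel \<Otimes>\<^sub>M restrict_space lborel {0..<2 * pi}"

definition dual_cylinder :: "(real \<times> int) measure" where
  "dual_cylinder = lborel \<Otimes>\<^sub>M count_space UNIV"

definition L2 :: "'a measure \<Rightarrow> ('a \<Rightarrow> complex) set" where
  "L2 M = {f \<in> borel_measurable M. integrable M (\<lambda>z. (cmod (f z))\<^sup>2)}"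

definition weighted_L2 :: "real \<Rightarrow> (real \<times> real \<Rightarrow> complex) set" where
  "weighted_L2 \<theta> = L2 (density cylinder (\<lambda>(x, y). ennreal (\<bar>x\<bar> powr (2 * \<theta>))))"

definition L2_tendsto ::
    "'a measure \<Rightarrow> (nat \<Rightarrow> 'a \<Rightarrow> complex) \<Rightarrow> ('a \<Rightarrow> complex) \<Rightarrow> bool" where
  "L2_tendsto M u g \<longleftrightarrow>
    (\<lambda>n. \<integral>\<^sup>+ z. ennreal ((cmod (u n z - g z))\<^sup>2) \<partial>M) \<longlonglongrightarrow> 0"

text \<open>
  The integral defining the Fourier transform converges absolutely only on \<open>L\<^sup>1\<close>. On \<open>L\<^sup>2\<close> it is
  understood in the sense of Plancherel: as the limit in \<open>L\<^sup>2\<close> of the integrals over \<open>\<bar>x\<bar> \<le> n\<close>.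
  The inverse transform is treated in the same way.
\<close>

definition fourier_trunc ::
    "nat \<Rightarrow> (real \<times> real \<Rightarrow> complex) \<Rightarrow> real \<times> int \<Rightarrow> complex" where
  "fourier_trunc n f = (\<lambda>(\<xi>, \<eta>).
    LINT (x, y):{- real n..real n} \<times> {0..<2 * pi}|cylinder.
      f (x, y) * exp (- \<i> * of_real (x * \<xi>) - \<i> * of_real (y * of_int \<eta>)))"

definition fourier :: "(real \<times> real \<Rightarrow> complex) \<Rightarrow> real \<times> int \<Rightarrow> complex" where
  "fourier f = (SOME F. F \<in> L2 dual_cylinder \<and>
    L2_tendsto dual_cylinder (\<lambda>n. fourier_trunc n f) F)"

definition inverse_fourier_trunc ::
    "nat \<Rightarrow> (real \<times> int \<Rightarrow> complex) \<Rightarrow> real \<times> real \<Rightarrow> complex" where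
  "inverse_fourier_trunc n F = (\<lambda>(x, y).
    1 / (2 * of_real pi)\<^sup>2 * (\<Sum>\<eta>\<in>{- int n..int n}. LINT \<xi>:{- real n..real n}|lborel.
      exp (\<i> * of_real (x * \<xi>) + \<i> * of_real (y * of_int \<eta>)) * F (\<xi>, \<eta>)))"

definition inverse_fourier :: "(real \<times> int \<Rightarrow> complex) \<Rightarrow> real \<times> real \<Rightarrow> complex" where
  "inverse_fourier F = (SOME g. g \<in> L2 cylinder \<and>
    L2_tendsto cylinder (\<lambda>n. inverse_fourier_trunc n F) g)"

definition hilbert_x :: "(real \<times> real \<Rightarrow> complex) \<Rightarrow> real \<times> real \<Rightarrow> complex" where
  "hilbert_x f = (SOME g. g \<in> L2 cylinder \<and>
    (AE (\<xi>, \<eta>) in dual_cylinder. fourier g (\<xi>, \<eta>) = - \<i> * of_real (sgn \<xi>) * fourier f (\<xi>, \<eta>)))"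

definition jbracket :: "real \<Rightarrow> real" where
  "jbracket x = sqrt (1 + \<bar>x\<bar>\<^sup>2)"

text \<open>
  The anisotropic Sobolev space \<open>H\<^bsup>s,0\<^esup>\<close>, for \<open>s \<ge> 0\<close>; the function \<open>g\<close> is \<open>J\<^sub>x\<^sup>s f\<close>.
\<close>

definition sobolev_x :: "real \<Rightarrow> (real \<times> real \<Rightarrow> complex) set" where
  "sobolev_x s = {f \<in> L2 cylinder. \<exists>g \<in> L2 cylinder.
    AE (\<xi>, \<eta>) in dual_cylinder. fourier g (\<xi>, \<eta>) = of_real (jbracket \<xi> powr s) * fourier f (\<xi>, \<eta>)}"

definition dispersion :: "real \<Rightarrow> int \<Rightarrow> real" where
  "dispersion \<xi> \<eta> = sgn \<xi> * \<xi>\<^sup>2 + sgn \<xi> * (of_int \<eta>)\<^sup>2"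

definition propagator :: "real \<Rightarrow> (real \<times> real \<Rightarrow> complex) \<Rightarrow> real \<times> real \<Rightarrow> complex" where
  "propagator t f =
    inverse_fourier (\<lambda>(\<xi>, \<eta>). exp (\<i> * of_real (t * dispersion \<xi> \<eta>)) * fourier f (\<xi>, \<eta>))"

definition mult_x_pow :: "nat \<Rightarrow> (real \<times> real \<Rightarrow> complex) \<Rightarrow> real \<times> real \<Rightarrow> complex" where
  "mult_x_pow k f = (\<lambda>(x, y). of_real (x ^ k) * f (x, y))"

end

theory Submission
  imports Defs "HOL-Computational_Algebra.Polynomial"
begin

text \<open>
  Everything is decided on the Fourier side, at the single frequency \<open>\<xi> = 0\<close>, where the symbol of the
  propagator switches from one smooth phase to another.

  By Plancherel's theorem the weight \<open>|x|\<close> becomes the Gagliardo energy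
  \<open>\<integral>\<integral> |u(\<zeta>,\<eta>) - u(\<xi>,\<eta>)|\<^sup>2 / (\<zeta> - \<xi>)\<^sup>2\<close> of the transform, that is, half a derivative in \<open>\<xi>\<close>
  (\<open>weighted_L2_half_iff_energy\<close>), and multiplication by \<open>-ix\<close> becomes differentiation in \<open>\<xi>\<close>. The
  propagator multiplies the transform by \<open>P(t)\<close> on \<open>\<xi> > 0\<close> and by \<open>P(-t)\<close> on \<open>\<xi> < 0\<close>, where
  \<open>P(T) = exp(iT(\<xi>\<^sup>2 + \<eta>\<^sup>2))\<close>. Each of these phases is harmless taken on the whole line: it keeps the energy
  of \<open>u\<close> finite as soon as \<open>u\<close> and \<open>|\<xi>|\<^sup>1\<^sup>/\<^sup>2 u\<close> are square integrable (\<open>energy_phase_finite\<close>), and for the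
  transform of \<open>x\<^sup>k f\<close> this follows by interpolating between the decay and the smoothness of \<open>f\<close>
  (\<open>fourier_moment_interpolation\<close>). Only the switch can do damage, and its price is exactly a Hardy
  integral: cutting off a function of finite energy at \<open>\<xi> = 0\<close> leaves the energy finite if and only if
  \<open>\<integral>|u|\<^sup>2/|\<xi>|\<close> over \<open>\<xi> < 0\<close> is finite (\<open>energy_neg_part_finite_iff\<close>).

  Let \<open>G\<close> be the transform of \<open>x\<^sup>k f\<close>. Membership in \<open>L\<^sup>2(|x|)\<close> of \<open>U(t)(x\<^sup>k f)\<close>, of \<open>U(t)H(x\<^sup>k f)\<close> and of
  \<open>H(x\<^sup>k f)\<close> therefore means that the Hardy integral of \<open>(P(t) - P(-t))G\<close>, of \<open>(P(t) + P(-t))G\<close> and of \<open>G\<close>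
  is finite, respectively. The first two functions add up to \<open>2P(t)G\<close>. So once the first integral is finite,
  the other two are finite or infinite together, which is the equivalence for the Hilbert transforms.

  It remains to decide when the first integral is finite (\<open>jump_hardy\<close>). Let \<open>\<phi>\<close> and \<open>\<psi>\<close> be the transforms
  of \<open>f\<close> and \<open>U(t)f\<close>. The weighted bounds for both functions imply that \<open>\<phi>\<close> and \<open>\<psi>\<close> have \<open>k\<close> derivatives in \<open>\<xi>\<close>, the last
  one of finite energy. The \<open>k\<close>-th derivative of \<open>P(t)\<phi> - \<psi>\<close> has finite energy near \<open>0\<close> and vanishes for \<open>\<xi> > 0\<close>,
  which forces its Hardy integral over \<open>(-1,0)\<close> to be finite; on \<open>\<xi> < 0\<close> it equals
  \<open>\<Sum>\<^sub>i C(k,i) S\<^sub>i \<phi>\<^sup>(\<^sup>k\<^sup>-\<^sup>i\<^sup>)\<close> with \<open>S\<^sub>i\<close> the \<open>i\<close>-th derivative of \<open>P(t) - P(-t)\<close>. The term \<open>i = 0\<close> is the one in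
  question. The term \<open>i = 1\<close> is harmless because \<open>S\<^sub>1 = O(\<xi>)\<close>. For \<open>i \<ge> 3\<close>, continuity of the lower derivatives of
  \<open>\<psi>\<close> at \<open>0\<close> gives \<open>\<Sum>\<^sub>i C(j,i) S\<^sub>i(0) \<phi>\<^sup>(\<^sup>j\<^sup>-\<^sup>i\<^sup>)(0) = 0\<close> for \<open>j < k\<close>; as \<open>S\<^sub>1(0) = 0\<close> while \<open>S\<^sub>0(0)\<close> and \<open>S\<^sub>2(0)\<close> do not
  both vanish, \<open>\<phi>\<^sup>(\<^sup>j\<^sup>)(0) = 0\<close> for all \<open>j \<le> k - 3\<close>, and a function vanishing at \<open>0\<close> with a square integrable
  derivative has a finite Hardy integral. Hence for \<open>k \<le> 1\<close> the integral is finite, and for \<open>k \<ge> 2\<close> it is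
  finite exactly if that of the term \<open>i = 2\<close> is, which means \<open>\<phi>\<^sup>(\<^sup>k\<^sup>-\<^sup>2\<^sup>)(0,\<eta>) = 0\<close> for every \<open>\<eta>\<close>: the moment condition.
  (At those \<open>\<eta>\<close> where \<open>S\<^sub>0(0) \<noteq> 0\<close>, the same equations already give \<open>\<phi>\<^sup>(\<^sup>j\<^sup>)(0) = 0\<close> for all \<open>j < k\<close>.)

  Two foundations carry this. Plancherel's theorem on the cylinder is assembled from Parseval's
  identity on the circle, itself a consequence of the Stone-Weierstrass theorem, and from its counterpart on
  the line, which follows by averaging Parseval's identity over modulations. Derivatives in \<open>\<xi>\<close> are handled in integrated form
  (\<open>antideriv\<close>), since the one of order \<open>k\<close> is only a square integrable function.
\<close>

section \<open>Mean square convergence\<close>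

definition sq_norm :: "'a measure \<Rightarrow> ('a \<Rightarrow> complex) \<Rightarrow> ennreal" where
  "sq_norm M f = (\<integral>\<^sup>+ z. ennreal ((cmod (f z))\<^sup>2) \<partial>M)"

lemma L2_iff: "f \<in> L2 M \<longleftrightarrow> f \<in> borel_measurable M \<and> sq_norm M f < \<infinity>"
  unfolding L2_def sq_norm_def by (auto simp: integrable_iff_bounded)

lemma L2_measurable: "f \<in> L2 M \<Longrightarrow> f \<in> borel_measurable M"
  and L2_finite: "f \<in> L2 M \<Longrightarrow> sq_norm M f < \<infinity>"
  by (simp_all add: L2_iff)

lemma sq_norm_cong_AE: "AE z in M. f z = g z \<Longrightarrow> sq_norm M f = sq_norm M g"
  unfolding sq_norm_def by (intro nn_integral_cong_AE) auto

lemma sq_norm_cmult: "f \<in> borel_measurable M \<Longrightarrow> sq_norm M (\<lambda>z. c * f z) = ennreal ((cmod c)\<^sup>2) * sq_norm M f"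
  unfolding sq_norm_def
  by (subst nn_integral_cmult[symmetric]) (auto simp: norm_mult power_mult_distrib ennreal_mult)

text \<open>
  The free parameter replaces Minkowski's inequality: with small \<open>e\<close> the first coefficient is as close
  to 1 as desired, which is what continuity of the squared norm requires; \<open>e = 1\<close> serves for crude bounds.
\<close>

lemma norm_add_sq_weighted:
  fixes a b :: "'a::real_normed_vector"
  assumes "e > 0"
  shows "(norm (a + b))\<^sup>2 \<le> (1 + e) * (norm a)\<^sup>2 + (1 + 1 / e) * (norm b)\<^sup>2"
proof -
  have "(norm (a + b))\<^sup>2 \<le> (norm a + norm b)\<^sup>2"
    by (simp add: norm_triangle_ineq power_mono)
  also have "\<dots> = (norm a)\<^sup>2 + (norm b)\<^sup>2 + 2 * (sqrt e * norm a) * (norm b / sqrt e)"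
    using assms by (simp add: power2_eq_square algebra_simps)
  also have "2 * (sqrt e * norm a) * (norm b / sqrt e) \<le> (sqrt e * norm a)\<^sup>2 + (norm b / sqrt e)\<^sup>2"
    by (rule sum_squares_bound)
  also have "\<dots> = e * (norm a)\<^sup>2 + 1 / e * (norm b)\<^sup>2"
    using assms by (simp add: power_mult_distrib power_divide)
  finally show ?thesis by (simp add: algebra_simps)
qed

lemma sq_norm_add_weighted:
  assumes [measurable]: "f \<in> borel_measurable M" "g \<in> borel_measurable M" and e: "e > 0"
  shows "sq_norm M (\<lambda>z. f z + g z) \<le> ennreal (1 + e) * sq_norm M f + ennreal (1 + 1 / e) * sq_norm M g"
proof -
  have "sq_norm M (\<lambda>z. f z + g z)
      \<le> (\<integral>\<^sup>+z. ennreal (1 + e) * ennreal ((cmod (f z))\<^sup>2) + ennreal (1 + 1 / e) * ennreal ((cmod (g z))\<^sup>2) \<partial>M)"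
    unfolding sq_norm_def using e norm_add_sq_weighted[OF e]
    by (intro nn_integral_mono) (auto simp: ennreal_mult[symmetric] ennreal_plus[symmetric] simp del: ennreal_plus intro!: ennreal_leI)
  also have "\<dots> = ennreal (1 + e) * sq_norm M f + ennreal (1 + 1 / e) * sq_norm M g"
    unfolding sq_norm_def by (subst nn_integral_add) (auto simp: nn_integral_cmult)
  finally show ?thesis .
qed

lemma sq_norm_add:
  assumes "f \<in> borel_measurable M" "g \<in> borel_measurable M"
  shows "sq_norm M (\<lambda>z. f z + g z) \<le> 2 * sq_norm M f + 2 * sq_norm M g"
  using sq_norm_add_weighted[OF assms, of 1] by simp

lemma sq_norm_diff:
  assumes "f \<in> borel_measurable M" "g \<in> borel_measurable M"
  shows "sq_norm M (\<lambda>z. f z - g z) \<le> 2 * sq_norm M f + 2 * sq_norm M g"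
proof -
  have "sq_norm M (\<lambda>z. - g z) = sq_norm M g" by (simp add: sq_norm_def)
  moreover have "(\<lambda>z. - g z) \<in> borel_measurable M" using assms by simp
  ultimately show ?thesis using sq_norm_add[OF assms(1), of "\<lambda>z. - g z"] by simp
qed

lemma sq_norm_minus_commute: "sq_norm M (\<lambda>z. f z - g z) = sq_norm M (\<lambda>z. g z - f z)"
  by (simp add: sq_norm_def norm_minus_commute)

lemma L2_add: "f \<in> L2 M \<Longrightarrow> g \<in> L2 M \<Longrightarrow> (\<lambda>z. f z + g z) \<in> L2 M"
  using sq_norm_add[of f M g] by (auto simp: L2_iff ennreal_mult_less_top less_top[symmetric] top_unique ennreal_mult_eq_top_iff)

lemma L2_diff: "f \<in> L2 M \<Longrightarrow> g \<in> L2 M \<Longrightarrow> (\<lambda>z. f z - g z) \<in> L2 M"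
  using sq_norm_diff[of f M g] by (auto simp: L2_iff ennreal_mult_less_top less_top[symmetric] top_unique ennreal_mult_eq_top_iff)

lemma L2_bounded_mult:
  assumes "f \<in> L2 M" "m \<in> borel_measurable M" "\<And>z. z \<in> space M \<Longrightarrow> cmod (m z) \<le> B"
  shows "(\<lambda>z. m z * f z) \<in> L2 M"
proof -
  note [measurable] = assms(2) L2_measurable[OF assms(1)]
  have "sq_norm M (\<lambda>z. m z * f z) \<le> (\<integral>\<^sup>+z. ennreal (B\<^sup>2) * ennreal ((cmod (f z))\<^sup>2) \<partial>M)"
    unfolding sq_norm_def
    by (intro nn_integral_mono)
       (auto simp: norm_mult power_mult_distrib ennreal_mult[symmetric]
             intro!: ennreal_leI mult_right_mono power_mono assms(3))
  also have "\<dots> = ennreal (B\<^sup>2) * sq_norm M f" unfolding sq_norm_def by (rule nn_integral_cmult) simp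
  also have "\<dots> < \<infinity>" using L2_finite[OF assms(1)] by (simp add: ennreal_mult_less_top)
  finally show ?thesis by (simp add: L2_iff)
qed

lemma L2_cmult: "f \<in> L2 M \<Longrightarrow> (\<lambda>z. c * f z) \<in> L2 M"
  by (rule L2_bounded_mult[of _ _ "\<lambda>_. c" "cmod c"]) auto

lemma sq_norm_eq_0_iff:
  assumes [measurable]: "f \<in> borel_measurable M"
  shows "sq_norm M f = 0 \<longleftrightarrow> (AE z in M. f z = 0)"
  unfolding sq_norm_def by (subst nn_integral_0_iff_AE) (auto simp: ennreal_eq_0_iff)

lemma ennreal_le_mult_one_plus:
  fixes a c :: ennreal
  assumes "\<And>e::real. e > 0 \<Longrightarrow> a \<le> ennreal (1 + e) * c"
  shows "a \<le> c"
proof (cases "c = \<infinity>")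
  case False
  have "((\<lambda>n. ennreal (1 + 1 / real (Suc n)) * c) \<longlongrightarrow> ennreal (1 + 0) * c) sequentially"
    using False by (intro tendsto_mult_ennreal tendsto_ennrealI tendsto_intros LIMSEQ_Suc lim_1_over_n) auto
  moreover have "\<forall>n. a \<le> ennreal (1 + 1 / real (Suc n)) * c" using assms by auto
  ultimately show ?thesis using LIMSEQ_le_const[of _ "ennreal (1+0) * c" a] by auto
qed simp

text \<open>
  The weighted triangle inequality makes the squared norm continuous without passing to roots.
\<close>

lemma L2_tendsto_sq_norm:
  assumes u: "\<And>n. u n \<in> borel_measurable M" and g: "g \<in> borel_measurable M"
    and lim: "L2_tendsto M u g" and c: "(\<lambda>n. sq_norm M (u n)) \<longlonglongrightarrow> c"
  shows "sq_norm M g = c"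
proof (rule antisym)
  have d: "(\<lambda>n. sq_norm M (\<lambda>z. u n z - g z)) \<longlonglongrightarrow> 0"
    using lim by (simp add: L2_tendsto_def sq_norm_def)
  note [measurable] = u g
  show "sq_norm M g \<le> c"
  proof (rule ennreal_le_mult_one_plus)
    fix e :: real assume e: "e > 0"
    have "(\<lambda>n. ennreal (1 + e) * sq_norm M (u n) + ennreal (1 + 1 / e) * sq_norm M (\<lambda>z. u n z - g z))
        \<longlonglongrightarrow> ennreal (1 + e) * c + ennreal (1 + 1 / e) * 0"
      using c d by (intro tendsto_add ennreal_tendsto_cmult) auto
    moreover have "sq_norm M g \<le> ennreal (1 + e) * sq_norm M (u n) + ennreal (1 + 1 / e) * sq_norm M (\<lambda>z. u n z - g z)" for n
      using sq_norm_add_weighted[of "u n" M "\<lambda>z. g z - u n z" e] e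
      by (simp add: sq_norm_minus_commute[of M g])
    ultimately show "sq_norm M g \<le> ennreal (1 + e) * c"
      using LIMSEQ_le_const[of _ "ennreal (1 + e) * c + ennreal (1 + 1 / e) * 0" "sq_norm M g"] by auto
  qed
  show "c \<le> sq_norm M g"
  proof (rule ennreal_le_mult_one_plus)
    fix e :: real assume e: "e > 0"
    have "(\<lambda>n. ennreal (1 + e) * sq_norm M g + ennreal (1 + 1 / e) * sq_norm M (\<lambda>z. u n z - g z))
        \<longlonglongrightarrow> ennreal (1 + e) * sq_norm M g + ennreal (1 + 1 / e) * 0"
      using d by (intro tendsto_add ennreal_tendsto_cmult tendsto_const) auto
    moreover have "sq_norm M (u n) \<le> ennreal (1 + e) * sq_norm M g + ennreal (1 + 1 / e) * sq_norm M (\<lambda>z. u n z - g z)" for n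
      using sq_norm_add_weighted[of "g" M "\<lambda>z. u n z - g z" e] e by simp
    ultimately show "c \<le> ennreal (1 + e) * sq_norm M g"
      using LIMSEQ_le[OF c, of _ "ennreal (1 + e) * sq_norm M g + ennreal (1 + 1 / e) * 0"] by auto
  qed
qed

lemma L2_tendsto_unique:
  assumes u: "\<And>n. u n \<in> borel_measurable M" and g: "g \<in> borel_measurable M" "h \<in> borel_measurable M"
    and lim: "L2_tendsto M u g" "L2_tendsto M u h"
  shows "AE z in M. g z = h z"
proof -
  note [measurable] = u g
  have "(\<lambda>n. 2 * sq_norm M (\<lambda>z. u n z - g z) + 2 * sq_norm M (\<lambda>z. u n z - h z)) \<longlonglongrightarrow> 2 * 0 + 2 * 0"
    using lim by (intro tendsto_add ennreal_tendsto_cmult) (auto simp: L2_tendsto_def sq_norm_def)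
  moreover have "sq_norm M (\<lambda>z. g z - h z) \<le> 2 * sq_norm M (\<lambda>z. u n z - g z) + 2 * sq_norm M (\<lambda>z. u n z - h z)" for n
    using sq_norm_add[of "\<lambda>z. g z - u n z" M "\<lambda>z. u n z - h z"]
    by (simp add: sq_norm_minus_commute[of M g])
  ultimately have "sq_norm M (\<lambda>z. g z - h z) = 0"
    using LIMSEQ_le_const[of _ "2*0+2*0" "sq_norm M (\<lambda>z. g z - h z)"] by auto
  then show ?thesis by (subst (asm) sq_norm_eq_0_iff) auto
qed

text \<open>
  The Riesz-Fischer argument: a rapidly converging subsequence converges almost everywhere, and Fatou's lemma
  turns the Cauchy condition into convergence of the whole sequence to the pointwise limit.
\<close>

theorem L2_complete:
  fixes u :: "nat \<Rightarrow> 'a \<Rightarrow> complex"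
  assumes u: "\<And>n. u n \<in> borel_measurable M"
    and Cauchy: "\<And>e::real. e > 0 \<Longrightarrow> \<exists>N. \<forall>m\<ge>N. \<forall>n\<ge>N. sq_norm M (\<lambda>z. u m z - u n z) \<le> ennreal e"
  obtains g where "g \<in> borel_measurable M" "L2_tendsto M u g"
proof -
  note [measurable] = u
  have "\<exists>N. \<forall>m\<ge>N. \<forall>n\<ge>N. sq_norm M (\<lambda>z. u m z - u n z) \<le> ennreal ((1/8)^k)" for k
    by (rule Cauchy) simp
  \<comment> \<open>The differences along a subsequence decay like \<open>8\<^sup>-\<^sup>k\<close> in squared norm. Even with weights \<open>4\<^sup>k\<close>
    they are summable, which makes them almost everywhere \<open>O(2\<^sup>-\<^sup>k)\<close>.\<close>
  then obtain R where R: "\<And>k m n. m \<ge> R k \<Longrightarrow> n \<ge> R k \<Longrightarrow> sq_norm M (\<lambda>z. u m z - u n z) \<le> ennreal ((1/8)^k)"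
    by metis
  define r where "r k = (\<Sum>i\<le>k. R i)" for k
  have r_mono: "r i \<le> r j" if "i \<le> j" for i j unfolding r_def using that by (intro sum_mono2) auto
  have r_ge: "R k \<le> r j" if "k \<le> j" for k j
  proof -
    have "R k \<le> r k" unfolding r_def by (rule member_le_sum) auto
    then show ?thesis using r_mono[OF that] by simp
  qed
  define d where "d k z = u (r (Suc k)) z - u (r k) z" for k z
  have d_meas[measurable]: "d k \<in> borel_measurable M" for k unfolding d_def by simp
  have "(\<integral>\<^sup>+z. (\<Sum>k. ennreal (4^k * (cmod (d k z))\<^sup>2)) \<partial>M) = (\<Sum>k. \<integral>\<^sup>+z. ennreal (4^k * (cmod (d k z))\<^sup>2) \<partial>M)"
    by (rule nn_integral_suminf) simp
  also have "\<dots> = (\<Sum>k. ennreal (4^k) * sq_norm M (d k))"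
    unfolding sq_norm_def by (simp add: ennreal_mult nn_integral_cmult)
  also have "\<dots> \<le> (\<Sum>k. ennreal ((1/2)^k))"
  proof (rule suminf_le)
    fix k
    have "sq_norm M (d k) \<le> ennreal ((1/8)^k)"
      unfolding d_def using r_ge[of k k] r_ge[of k "Suc k"] by (intro R) auto
    then have "ennreal (4^k) * sq_norm M (d k) \<le> ennreal (4^k) * ennreal ((1/8)^k)"
      by (intro mult_left_mono) auto
    also have "\<dots> = ennreal ((1/2)^k)"
      by (simp add: ennreal_mult[symmetric] power_mult_distrib[symmetric])
    finally show "ennreal (4^k) * sq_norm M (d k) \<le> ennreal ((1/2)^k)" .
  qed auto
  also have "\<dots> = ennreal (\<Sum>k. (1/2)^k)"
    by (intro suminf_ennreal2) (auto intro: summable_geometric)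
  also have "\<dots> < \<infinity>" by simp
  finally have "AE z in M. (\<Sum>k. ennreal (4^k * (cmod (d k z))\<^sup>2)) \<noteq> \<infinity>"
    by (intro nn_integral_noteq_infinite) auto
  then have conv: "AE z in M. convergent (\<lambda>k. u (r k) z)"
  proof eventually_elim
    case (elim z)
    define X where "X = (\<Sum>k. ennreal (4^k * (cmod (d k z))\<^sup>2))"
    obtain C where C: "X = ennreal C" "C \<ge> 0"
      using elim unfolding X_def[symmetric] by (cases X) auto
    have le: "cmod (d k z) \<le> sqrt C * (1/2)^k" for k
    proof -
      have "ennreal (4^k * (cmod (d k z))\<^sup>2) = (\<Sum>k\<in>{k}. ennreal (4^k * (cmod (d k z))\<^sup>2))" by simp
      also have "\<dots> \<le> (\<Sum>k. ennreal (4^k * (cmod (d k z))\<^sup>2))" by (rule sum_le_suminf) auto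
      finally have "4^k * (cmod (d k z))\<^sup>2 \<le> C" unfolding X_def[symmetric] using C by simp
      then have "(2^k * cmod (d k z))\<^sup>2 \<le> C"
        by (simp add: power_mult_distrib power_mult[symmetric] mult.commute[of _ 2] power_mult)
      then have "2^k * cmod (d k z) \<le> sqrt C" by (rule real_le_rsqrt)
      then show ?thesis by (simp add: field_simps power_one_over)
    qed
    have "summable (\<lambda>k. d k z)"
      by (rule summable_comparison_test'[of "\<lambda>k. sqrt C * (1/2)^k" 0]) (use le in \<open>auto intro: summable_mult summable_geometric\<close>)
    then have "summable (\<lambda>k. u (r (Suc k)) z - u (r k) z)" by (simp add: d_def)
    then have "convergent (\<lambda>n. \<Sum>k<n. u (r (Suc k)) z - u (r k) z)"
      by (simp add: summable_iff_convergent)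
    then have "convergent (\<lambda>n. (u (r n) z - u (r 0) z) + u (r 0) z)"
      by (intro convergent_add convergent_const) (simp add: sum_lessThan_telescope[of "\<lambda>k. u (r k) z"])
    then show ?case by simp
  qed
  define g where "g z = lim (\<lambda>k. u (r k) z)" for z
  have g_meas[measurable]: "g \<in> borel_measurable M" unfolding g_def by measurable
  have g_lim: "AE z in M. (\<lambda>k. u (r k) z) \<longlonglongrightarrow> g z"
    using conv by eventually_elim (simp add: g_def convergent_LIMSEQ_iff)
  have bound: "sq_norm M (\<lambda>z. u n z - g z) \<le> ennreal ((1/8)^K)" if n: "n \<ge> r K" for n K
  proof -
    have "sq_norm M (\<lambda>z. u n z - g z) = (\<integral>\<^sup>+z. liminf (\<lambda>k. ennreal ((cmod (u n z - u (r k) z))\<^sup>2)) \<partial>M)"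
      unfolding sq_norm_def
    proof (rule nn_integral_cong_AE, use g_lim in eventually_elim)
      case (elim z)
      then have "(\<lambda>k. ennreal ((cmod (u n z - u (r k) z))\<^sup>2)) \<longlonglongrightarrow> ennreal ((cmod (u n z - g z))\<^sup>2)"
        by (intro tendsto_ennrealI tendsto_intros)
      then show ?case by (rule lim_imp_Liminf[symmetric, rotated]) simp
    qed
    also have "\<dots> \<le> liminf (\<lambda>k. sq_norm M (\<lambda>z. u n z - u (r k) z))"
      unfolding sq_norm_def by (rule nn_integral_liminf) simp
    also have "\<dots> \<le> ennreal ((1/8)^K)"
    proof (rule Liminf_le)
      have "R K \<le> n" using r_ge[of K K] n by simp
      moreover have "\<forall>k\<ge>K. R K \<le> r k" using r_ge by auto
      ultimately show "\<forall>\<^sub>F k in sequentially. sq_norm M (\<lambda>z. u n z - u (r k) z) \<le> ennreal ((1/8)^K)"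
        unfolding eventually_sequentially by (intro exI[of _ K] allI impI R) auto
    qed simp
    finally show ?thesis .
  qed
  have "(\<lambda>n. sq_norm M (\<lambda>z. u n z - g z)) \<longlonglongrightarrow> 0"
  proof (rule order_tendstoI)
    fix a :: ennreal assume "0 < a"
    then obtain c where c: "0 < c" "c < a" by (metis dense)
    then obtain b :: real where b: "0 < b" "ennreal b < a"
      by (cases c) (auto simp: top_unique ennreal_less_zero_iff)
    obtain K where "(1/8)^K < b" using real_arch_pow_inv[of b "1/8"] b by auto
    then have "ennreal ((1/8)^K) < a" using b by (meson ennreal_leI less_imp_le order_le_less_trans)
    then show "\<forall>\<^sub>F n in sequentially. sq_norm M (\<lambda>z. u n z - g z) < a"
      unfolding eventually_sequentially using bound by (meson order_le_less_trans)
  qed simp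
  then have "L2_tendsto M u g" by (simp add: L2_tendsto_def sq_norm_def)
  with g_meas that show ?thesis by blast
qed

lemma L2_tendsto_dominated:
  fixes u :: "nat \<Rightarrow> 'a \<Rightarrow> complex" and w :: "'a \<Rightarrow> real"
  assumes [measurable]: "\<And>n. u n \<in> borel_measurable M" "f \<in> borel_measurable M" "w \<in> borel_measurable M"
    and lim: "AE z in M. (\<lambda>n. u n z) \<longlonglongrightarrow> f z"
    and bound: "\<And>n. AE z in M. cmod (u n z) \<le> w z" and w: "(\<integral>\<^sup>+z. ennreal ((w z)\<^sup>2) \<partial>M) < \<infinity>"
  shows "L2_tendsto M u f"
proof -
  have all: "AE z in M. \<forall>n. cmod (u n z) \<le> w z" using bound by (simp add: AE_all_countable)
  then have le: "AE z in M. cmod (f z) \<le> w z"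
    using lim by eventually_elim (rule LIMSEQ_le_const2[OF tendsto_norm], auto)
  have "(\<lambda>n. \<integral>\<^sup>+z. ennreal ((cmod (u n z - f z))\<^sup>2) \<partial>M) \<longlonglongrightarrow> (\<integral>\<^sup>+z. 0 \<partial>M)"
  proof (rule nn_integral_dominated_convergence[where w = "\<lambda>z. 4 * ennreal ((w z)\<^sup>2)"])
    fix n
    show "AE z in M. ennreal ((cmod (u n z - f z))\<^sup>2) \<le> 4 * ennreal ((w z)\<^sup>2)"
      using all le
    proof eventually_elim
      case (elim z)
      then have "cmod (u n z - f z) \<le> 2 * w z"
        by (metis add_mono mult_2 norm_triangle_ineq4 order_trans)
      then have "(cmod (u n z - f z))\<^sup>2 \<le> (2 * w z)\<^sup>2" by (intro power_mono) auto
      then have "ennreal ((cmod (u n z - f z))\<^sup>2) \<le> ennreal (4 * (w z)\<^sup>2)"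
        by (intro ennreal_leI) (simp add: power_mult_distrib)
      then show ?case by (simp add: ennreal_mult)
    qed
  next
    show "(\<integral>\<^sup>+z. 4 * ennreal ((w z)\<^sup>2) \<partial>M) < \<infinity>"
      using w by (simp add: nn_integral_cmult ennreal_mult_less_top)
    show "AE z in M. (\<lambda>n. ennreal ((cmod (u n z - f z))\<^sup>2)) \<longlonglongrightarrow> 0"
      using lim
    proof eventually_elim
      case (elim z)
      then have "(\<lambda>n. ennreal ((cmod (u n z - f z))\<^sup>2)) \<longlonglongrightarrow> ennreal ((cmod (f z - f z))\<^sup>2)"
        by (intro tendsto_ennrealI tendsto_intros)
      then show ?case by simp
    qed
  qed auto
  then show ?thesis by (simp add: L2_tendsto_def)
qed

lemma L2_tendsto_cutoff:
  assumes f: "f \<in> L2 M" and A[measurable]: "\<And>n. A n \<in> sets M"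
    and ev: "\<And>z. z \<in> space M \<Longrightarrow> eventually (\<lambda>n. z \<in> A n) sequentially"
  shows "L2_tendsto M (\<lambda>n z. indicator (A n) z * f z) f"
proof (rule L2_tendsto_dominated[where w = "\<lambda>z. cmod (f z)"])
  note [measurable] = L2_measurable[OF f]
  show "AE z in M. (\<lambda>n. indicator (A n) z * f z) \<longlonglongrightarrow> f z"
  proof (rule AE_I2)
    fix z assume "z \<in> space M"
    from ev[OF this] have "eventually (\<lambda>n. indicator (A n) z * f z = f z) sequentially"
      by eventually_elim simp
    then show "(\<lambda>n. indicator (A n) z * f z) \<longlonglongrightarrow> f z" by (rule tendsto_eventually)
  qed
  show "(\<lambda>z. indicator (A n) z * f z) \<in> borel_measurable M" "f \<in> borel_measurable M"
    "(\<lambda>z. cmod (f z)) \<in> borel_measurable M" for n by measurable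
  show "AE z in M. cmod (indicator (A n) z * f z) \<le> cmod (f z)" for n
    by (intro AE_I2) (auto simp: indicator_def)
  show "(\<integral>\<^sup>+z. ennreal ((cmod (f z))\<^sup>2) \<partial>M) < \<infinity>"
    using L2_finite[OF f] by (simp add: sq_norm_def)
qed

lemma two_mult_ennreal: "2 * ennreal x = ennreal (2 * x)"
  by (simp add: ennreal_mult')

section \<open>Parseval's identity on the circle\<close>

abbreviation circle :: "real measure" where
  "circle \<equiv> restrict_space lborel {0..<2 * pi}"

lemma emeasure_circle: "emeasure circle (space circle) = ennreal (2 * pi)"
  by (simp add: emeasure_restrict_space space_restrict_space)

lemma space_circle [simp]: "space circle = {0..<2 * pi}"
  by (simp add: space_restrict_space)

interpretation circle: finite_measure circle
  by (rule finite_measureI) (subst emeasure_circle, simp)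

lemma (in finite_measure) L2_imp_integrable:
  fixes f :: "'a \<Rightarrow> complex"
  assumes "f \<in> L2 M"
  shows "integrable M f"
proof (rule Bochner_Integration.integrable_bound[of M "\<lambda>z. 1 + (cmod (f z))\<^sup>2"])
  show "integrable M (\<lambda>z. 1 + (cmod (f z))\<^sup>2)"
    using assms by (auto simp: L2_def)
  show "f \<in> borel_measurable M" by (rule L2_measurable[OF assms])
  have "x \<le> 1 + x\<^sup>2" for x :: real
    using sum_squares_bound[of 1 x] zero_le_power2[of x] unfolding one_power2 by linarith
  then show "AE x in M. norm (f x) \<le> norm (1 + (cmod (f x))\<^sup>2)"
    by (intro AE_I2) (metis abs_of_nonneg add_nonneg_nonneg real_norm_def zero_le_one zero_le_power2)
qed

definition trig :: "int \<Rightarrow> real \<Rightarrow> complex" where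
  "trig m y = exp (\<i> * of_real (y * of_int m))"

lemma trig_add: "trig (m + n) y = trig m y * trig n y"
  by (simp add: trig_def exp_add[symmetric] algebra_simps)

lemma trig_0 [simp]: "trig 0 y = 1" by (simp add: trig_def)

lemma cnj_trig: "cnj (trig m y) = trig (- m) y"
  by (simp add: trig_def exp_cnj)

lemma norm_trig [simp]: "cmod (trig m y) = 1"
  unfolding trig_def by (rule norm_exp_i_times)

lemma trig_measurable [measurable]: "trig m \<in> borel_measurable borel"
proof -
  have "continuous_on UNIV (trig m)" unfolding trig_def by (intro continuous_intros)
  then show ?thesis by (rule borel_measurable_continuous_onI)
qed

lemma trig_measurable_circle [measurable]: "trig m \<in> borel_measurable circle"
  by (rule measurable_restrict_space1) simp

lemma integral_trig: "(LINT y|circle. trig m y) = (if m = 0 then of_real (2 * pi) else 0)"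
proof (cases "m = 0")
  case True
  have "measure circle (space circle) = 2 * pi" by (simp only: measure_def emeasure_circle) simp
  with True show ?thesis by (simp add: scaleR_conv_of_real)
next
  case False
  have "(LINT y|circle. trig m y) = (LINT y:{0..<2*pi}|lborel. trig m y)"
    by (simp add: integral_restrict_space set_lebesgue_integral_def)
  also have "\<dots> = (LINT y:{0..2*pi}|lborel. trig m y)"
    unfolding set_lebesgue_integral_def
  proof (rule integral_cong_AE)
    have "AE y in lborel. y \<noteq> 2 * pi" by (rule AE_lborel_singleton)
    then show "AE y in lborel. indicat_real {0..<2*pi} y *\<^sub>R trig m y = indicat_real {0..2*pi} y *\<^sub>R trig m y"
      by eventually_elim (auto simp: indicator_def)
  qed auto
  also have "\<dots> = trig m (2 * pi) / (\<i> * of_int m) - trig m 0 / (\<i> * of_int m)"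
    unfolding set_lebesgue_integral_def
  proof (rule integral_FTC_Icc)
    fix x :: real assume "0 \<le> x" "x \<le> 2 * pi"
    have "((\<lambda>z. exp (\<i> * (z * of_int m)) / (\<i> * of_int m)) has_field_derivative exp (\<i> * (of_real x * of_int m))) (at (of_real x))"
      using False by (auto intro!: derivative_eq_intros) (simp add: mult.left_commute[of \<i>])
    then show "((\<lambda>x. trig m x / (\<i> * of_int m)) has_vector_derivative trig m x) (at x within {0..2 * pi})"
      unfolding trig_def of_real_mult of_real_of_int_eq by (rule has_vector_derivative_real_field)
  next
    show "continuous_on {0..2 * pi} (trig m)" unfolding trig_def by (intro continuous_intros)
  qed simp
  also have "trig m (2 * pi) = 1"
    unfolding trig_def by (subst exp_eq_1) (auto intro!: exI[of _ m])
  finally show ?thesis using False by (simp add: trig_def)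
qed

definition coef :: "(real \<Rightarrow> complex) \<Rightarrow> int \<Rightarrow> complex" where
  "coef f m = (LINT y|circle. f y * trig (- m) y)"

lemma L2_circle_trig: "f \<in> L2 circle \<Longrightarrow> (\<lambda>y. f y * trig m y) \<in> L2 circle"
  using L2_bounded_mult[of f circle "trig m" 1] by (simp add: mult.commute[of "f _"])

lemma trig_L2: "trig m \<in> L2 circle"
  using emeasure_circle by (simp add: L2_iff sq_norm_def)

lemma sum_L2: "finite A \<Longrightarrow> (\<And>i. i \<in> A \<Longrightarrow> f i \<in> L2 M) \<Longrightarrow> (\<lambda>x. \<Sum>i\<in>A. f i x) \<in> L2 M"
proof (induction A rule: finite_induct)
  case empty then show ?case by (simp add: L2_iff sq_norm_def)
next
  case (insert a A)
  have "(\<lambda>x. f a x + (\<Sum>i\<in>A. f i x)) \<in> L2 M" using insert by (intro L2_add) auto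
  then show ?case using insert by simp
qed

lemma sq_norm_eq_integral:
  assumes "f \<in> L2 M"
  shows "sq_norm M f = ennreal (LINT z|M. (cmod (f z))\<^sup>2)"
  unfolding sq_norm_def using assms by (intro nn_integral_eq_integral) (auto simp: L2_def)

lemma integral_norm_trig_sum:
  assumes A: "finite A"
  shows "(LINT y|circle. (cmod (\<Sum>m\<in>A. a m * trig m y))\<^sup>2) = 2 * pi * (\<Sum>m\<in>A. (cmod (a m))\<^sup>2)"
proof -
  let ?p = "\<lambda>y. \<Sum>m\<in>A. a m * trig m y"
  have int: "integrable circle (\<lambda>y. a m * cnj (a n) * trig (m - n) y)" for m n
    using circle.L2_imp_integrable[OF trig_L2] by (rule integrable_mult_right)
  have "complex_of_real (LINT y|circle. (cmod (?p y))\<^sup>2) = (LINT y|circle. complex_of_real ((cmod (?p y))\<^sup>2))"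
    by (rule integral_complex_of_real[symmetric])
  also have "\<dots> = (LINT y|circle. (\<Sum>m\<in>A. \<Sum>n\<in>A. a m * cnj (a n) * trig (m - n) y))"
  proof (rule Bochner_Integration.integral_cong[OF refl])
    fix y
    have "complex_of_real ((cmod (?p y))\<^sup>2) = ?p y * cnj (?p y)" by (rule complex_norm_square)
    also have "\<dots> = (\<Sum>m\<in>A. \<Sum>n\<in>A. a m * cnj (a n) * trig (m - n) y)"
      by (simp add: cnj_trig sum_product trig_add[of _ "- _", simplified] algebra_simps)
    finally show "complex_of_real ((cmod (?p y))\<^sup>2) = (\<Sum>m\<in>A. \<Sum>n\<in>A. a m * cnj (a n) * trig (m - n) y)" .
  qed
  also have "\<dots> = (\<Sum>m\<in>A. \<Sum>n\<in>A. a m * cnj (a n) * (LINT y|circle. trig (m - n) y))"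
    using int by (simp add: Bochner_Integration.integral_sum)
  also have "\<dots> = (\<Sum>m\<in>A. \<Sum>n\<in>A. if n = m then a m * cnj (a m) * of_real (2 * pi) else 0)"
    by (intro sum.cong refl) (auto simp: integral_trig)
  also have "\<dots> = (\<Sum>m\<in>A. a m * cnj (a m) * of_real (2 * pi))"
    using A by (simp add: sum.delta)
  also have "\<dots> = of_real (2 * pi * (\<Sum>m\<in>A. (cmod (a m))\<^sup>2))"
    by (simp add: complex_norm_square[symmetric] sum_distrib_left mult.commute del: of_real_power)
  finally show ?thesis using of_real_eq_iff by blast
qed

text \<open>
  Completing the square in the coefficients. Dropping the last sum shows that the Fourier coefficients give the best
  approximation, and choosing them shows Bessel's inequality; these are the two halves of Parseval's identity.
\<close>

lemma integral_norm_diff_trig_sum: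
  assumes f: "f \<in> L2 circle" and A: "finite A"
  shows "(LINT y|circle. (cmod (f y - (\<Sum>m\<in>A. a m * trig m y)))\<^sup>2)
    = (LINT y|circle. (cmod (f y))\<^sup>2) - (\<Sum>m\<in>A. (cmod (coef f m))\<^sup>2) / (2 * pi)
      + 2 * pi * (\<Sum>m\<in>A. (cmod (a m - coef f m / of_real (2 * pi)))\<^sup>2)"
proof -
  let ?p = "\<lambda>y. \<Sum>m\<in>A. a m * trig m y"
  have p: "?p \<in> L2 circle" by (intro sum_L2 A L2_cmult trig_L2)
  have intf: "integrable circle (\<lambda>y. f y * trig m y)" for m
    by (intro circle.L2_imp_integrable L2_circle_trig f)
  have fp: "f y * cnj (?p y) = (\<Sum>m\<in>A. cnj (a m) * (f y * trig (- m) y))" for y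
    by (simp add: sum_distrib_left cnj_trig algebra_simps)
  have int: "integrable circle (\<lambda>y. f y * cnj (?p y))"
    unfolding fp using intf by (intro Bochner_Integration.integrable_sum integrable_mult_right) auto
  have eq: "(cmod (u - v))\<^sup>2 = (cmod u)\<^sup>2 - 2 * Re (u * cnj v) + (cmod v)\<^sup>2" for u v :: complex
    unfolding cmod_power2 by (simp add: power2_eq_square algebra_simps)
  have "(LINT y|circle. (cmod (f y - ?p y))\<^sup>2)
     = (LINT y|circle. (cmod (f y))\<^sup>2) - 2 * (LINT y|circle. Re (f y * cnj (?p y))) + (LINT y|circle. (cmod (?p y))\<^sup>2)"
  proof -
    have *: "(LINT y|circle. a y - 2 * Re (F y) + b y) = (LINT y|circle. a y) - 2 * (LINT y|circle. Re (F y)) + (LINT y|circle. b y)"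
      if "integrable circle a" "integrable circle F" "integrable circle b" for a b :: "real \<Rightarrow> real" and F
      using that by simp
    show ?thesis unfolding eq using f p int by (intro *) (auto simp: L2_def)
  qed
  also have "(LINT y|circle. Re (f y * cnj (?p y))) = Re (LINT y|circle. f y * cnj (?p y))"
    using int by (rule integral_Re)
  also have "(LINT y|circle. f y * cnj (?p y)) = (\<Sum>m\<in>A. cnj (a m) * coef f m)"
    unfolding fp using intf by (simp add: Bochner_Integration.integral_sum coef_def)
  also have "(LINT y|circle. (cmod (?p y))\<^sup>2) = 2 * pi * (\<Sum>m\<in>A. (cmod (a m))\<^sup>2)"
    by (rule integral_norm_trig_sum[OF A])
  also have "(LINT y|circle. (cmod (f y))\<^sup>2) - 2 * Re (\<Sum>m\<in>A. cnj (a m) * coef f m) + 2 * pi * (\<Sum>m\<in>A. (cmod (a m))\<^sup>2)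
    = (LINT y|circle. (cmod (f y))\<^sup>2) + (\<Sum>m\<in>A. 2 * pi * (cmod (a m))\<^sup>2 - 2 * Re (cnj (a m) * coef f m))"
    by (simp add: sum_subtractf sum_distrib_left)
  also have "(\<Sum>m\<in>A. 2 * pi * (cmod (a m))\<^sup>2 - 2 * Re (cnj (a m) * coef f m))
    = (\<Sum>m\<in>A. 2 * pi * (cmod (a m - coef f m / of_real (2 * pi)))\<^sup>2 - (cmod (coef f m))\<^sup>2 / (2 * pi))"
  proof (rule sum.cong[OF refl])
    fix m
    show "2 * pi * (cmod (a m))\<^sup>2 - 2 * Re (cnj (a m) * coef f m)
      = 2 * pi * (cmod (a m - coef f m / of_real (2 * pi)))\<^sup>2 - (cmod (coef f m))\<^sup>2 / (2 * pi)"
    proof -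
      define b where "b = coef f m / of_real (2 * pi)"
      have b: "coef f m = of_real (2 * pi) * b" by (simp add: b_def)
      show ?thesis unfolding b_def[symmetric] unfolding b eq norm_mult power_mult_distrib norm_of_real
        by (simp add: power2_eq_square field_simps)
    qed
  qed
  finally show ?thesis by (simp add: sum_subtractf sum_distrib_left sum_divide_distrib)
qed

text \<open>
  Generation from monomials by addition matches the induction over polynomial functions of the plane
  below; the usual expression as a finite sum is recovered in \<open>trig_poly_normal_form\<close>.
\<close>

inductive trig_poly :: "(real \<Rightarrow> complex) \<Rightarrow> bool" where
  trig: "trig_poly (\<lambda>y. c * trig m y)"
| add: "trig_poly p \<Longrightarrow> trig_poly q \<Longrightarrow> trig_poly (\<lambda>y. p y + q y)"

lemma trig_poly_const: "trig_poly (\<lambda>y. c)"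
  using trig_poly.trig[of c 0] by simp

lemma trig_poly_mult:
  assumes "trig_poly p" "trig_poly q"
  shows "trig_poly (\<lambda>y. p y * q y)"
  using assms(1)
proof induction
  case (trig c m)
  from assms(2) show ?case
  proof induction
    case (trig d n)
    then show ?case using trig_poly.trig[of "c * d" "m + n"] by (simp add: trig_add mult_ac)
  next
    case (add p q)
    then show ?case using trig_poly.add[OF add.IH] by (simp add: algebra_simps)
  qed
next
  case (add p q)
  then show ?case using trig_poly.add[OF add.IH] by (simp add: algebra_simps)
qed

lemma trig_poly_normal_form:
  assumes "trig_poly p"
  shows "\<exists>A a. finite A \<and> (\<forall>m. m \<notin> A \<longrightarrow> a m = 0) \<and> p = (\<lambda>y. \<Sum>m\<in>A. a m * trig m y)"
  using assms
proof induction
  case (trig c m)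
  show ?case by (rule exI[of _ "{m}"], rule exI[of _ "\<lambda>n. if n = m then c else 0"]) auto
next
  case (add p q)
  then obtain A a B b where *: "finite A" "\<forall>m. m \<notin> A \<longrightarrow> a m = 0" "p = (\<lambda>y. \<Sum>m\<in>A. a m * trig m y)"
    "finite B" "\<forall>m. m \<notin> B \<longrightarrow> b m = 0" "q = (\<lambda>y. \<Sum>m\<in>B. b m * trig m y)" by blast
  have "p y + q y = (\<Sum>m\<in>A\<union>B. (a m + b m) * trig m y)" for y
  proof -
    have "p y = (\<Sum>m\<in>A\<union>B. a m * trig m y)" "q y = (\<Sum>m\<in>A\<union>B. b m * trig m y)"
      using * by (auto intro!: sum.mono_neutral_left)
    then show ?thesis by (simp add: sum.distrib algebra_simps)
  qed
  then show ?case using *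
    by (intro exI[of _ "A \<union> B"] exI[of _ "\<lambda>m. a m + b m"]) auto
qed

text \<open>
  It suffices to check linear functions of the point \<open>(cos y, sin y)\<close>, and both coordinates are
  combinations of the characters of frequency \<open>\<plusminus>1\<close>.
\<close>

lemma trig_poly_real_polynomial:
  assumes "real_polynomial_function q"
  shows "trig_poly (\<lambda>y. of_real (q (cis y)))"
  using assms
proof induction
  case (linear f)
  interpret bounded_linear f by fact
  have cs: "cos y = (trig 1 y + trig (-1) y) / 2" "of_real (sin y) = (trig 1 y - trig (-1) y) / (2 * \<i>)" for y :: real
    by (simp_all add: trig_def cos_exp_eq sin_exp_eq flip: cos_of_real sin_of_real)
  have "f (cis y) = cos y * f 1 + sin y * f \<i>" for y
  proof -
    have "cis y = cos y *\<^sub>R 1 + sin y *\<^sub>R \<i>" by (simp add: complex_eq_iff)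
    then have "f (cis y) = f (cos y *\<^sub>R 1 + sin y *\<^sub>R \<i>)" by (rule arg_cong)
    then show ?thesis by (simp only: add scaleR real_scaleR_def)
  qed
  then have "of_real (f (cis y)) = (of_real (f 1) / 2 + of_real (f \<i>) / (2 * \<i>)) * trig 1 y
      + (of_real (f 1) / 2 - of_real (f \<i>) / (2 * \<i>)) * trig (-1) y" for y
    by (simp add: cs algebra_simps add_divide_distrib diff_divide_distrib)
  then show ?case by (simp only:) (intro trig_poly.intros)
qed (auto intro: trig_poly_const trig_poly.add trig_poly_mult)

text \<open>
  Stone-Weierstrass on the unit circle. A function on the period becomes a function on the circle by composing with the
  argument, which jumps at the point 1; vanishing near both ends of the period removes that discontinuity.
\<close>

lemma continuous_vanishing_near_ends_trig_approx:
  fixes h :: "real \<Rightarrow> complex"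
  assumes h: "continuous_on UNIV h" and d: "0 < d" "d < pi"
    and zero: "\<And>x. x \<le> d \<Longrightarrow> h x = 0" "\<And>x. x \<ge> 2 * pi - d \<Longrightarrow> h x = 0" and e: "e > 0"
  obtains p where "trig_poly p" "\<And>x. x \<in> {0..<2*pi} \<Longrightarrow> cmod (h x - p x) < e"
proof -
  define H where "H z = h (Arg2pi z)" for z
  have "continuous_on (sphere 0 1) H"
    unfolding continuous_on_eq_continuous_within
  proof
    fix z :: complex assume z: "z \<in> sphere 0 1"
    show "continuous (at z within sphere 0 1) H"
    proof (cases "z \<in> \<real>\<^sub>\<ge>\<^sub>0")
      case False
      have "isCont h (Arg2pi z)" using h by (simp add: continuous_on_eq_continuous_at)
      then have "isCont H z" unfolding H_def using continuous_at_Arg2pi[OF False]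
        by (intro continuous_at_compose[of z Arg2pi h, unfolded o_def]) auto
      then show ?thesis by (rule continuous_at_imp_continuous_within)
    next
      case True
      with z have z1: "z = 1" by (auto simp: nonneg_Reals_def)
      have H0: "H w = 0" if w: "w \<in> sphere 0 1" "cos d < Re w" for w
      proof -
        have "w = cis (Arg2pi w)" using Arg2pi_eq[of w] w by (simp add: cis_conv_exp)
        then have "cos d < cos (Arg2pi w)" using w by (metis cis.sel(1))
        moreover have "cos (Arg2pi w) \<le> cos d" if *: "d < Arg2pi w" "Arg2pi w < 2 * pi - d"
        proof (cases "Arg2pi w \<le> pi")
          case True then show ?thesis using * d by (intro cos_monotone_0_pi_le) auto
        next
          case False
          then have "cos (2 * pi - Arg2pi w) \<le> cos d" using * d by (intro cos_monotone_0_pi_le) auto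
          then show ?thesis by (simp add: cos_diff)
        qed
        ultimately show ?thesis using zero unfolding H_def by (metis not_le)
      qed
      have "cos d < 1" using d cos_monotone_0_pi[of 0 d] by simp
      then have "eventually (\<lambda>w. cos d < Re w) (at z)"
        using z1 by (intro order_tendstoD(1)[where y = 1]) (auto intro!: tendsto_eq_intros)
      then have "eventually (\<lambda>w. H w = 0) (at z within sphere 0 1)"
        unfolding eventually_at_filter by eventually_elim (use H0 in auto)
      moreover have "H z = 0" using H0[of z] z1 \<open>cos d < 1\<close> by simp
      ultimately show ?thesis unfolding continuous_within by (simp add: tendsto_eventually)
    qed
  qed
  from Stone_Weierstrass_polynomial_function[OF compact_sphere this e]
  obtain g where g: "polynomial_function g" "\<forall>z\<in>sphere 0 1. cmod (H z - g z) < e" by auto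
  have "real_polynomial_function (Re \<circ> g)" "real_polynomial_function (Im \<circ> g)"
    using g(1) unfolding polynomial_function_def by (auto simp: bounded_linear_Re bounded_linear_Im)
  then have "trig_poly (\<lambda>y. of_real ((Re \<circ> g) (cis y)))" "trig_poly (\<lambda>y. of_real ((Im \<circ> g) (cis y)))"
    by (blast intro: trig_poly_real_polynomial)+
  then have "trig_poly (\<lambda>y. of_real (Re (g (cis y))) + \<i> * of_real (Im (g (cis y))))"
    by (intro trig_poly.add trig_poly_mult trig_poly_const) (simp_all add: o_def)
  then have "trig_poly (\<lambda>y. g (cis y))" by (simp add: complex_eq[symmetric])
  moreover have "cmod (h x - g (cis x)) < e" if x: "x \<in> {0..<2*pi}" for x
  proof -
    have "Arg2pi (cis x) = x" using x Arg2pi_unique[of 1 x "cis x"] by (simp add: cis_conv_exp)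
    then show ?thesis using g(2)[rule_format, of "cis x"] by (simp add: H_def)
  qed
  ultimately show ?thesis using that by blast
qed

text \<open>
  A measurable function is an almost everywhere limit of continuous ones. Clipped to a disc and cut off near the ends of the
  period, these converge dominatedly, hence in mean square, and the uniform approximation above applies to them.
\<close>

lemma L2_circle_bounded_trig_approx:
  assumes f[measurable]: "f \<in> borel_measurable circle" and B: "\<And>x. cmod (f x) \<le> B" and e: "(e::real) > 0"
  obtains p where "trig_poly p" "sq_norm circle (\<lambda>x. f x - p x) \<le> ennreal e"
proof -
  define F where "F x = indicator {0..<2*pi} x *\<^sub>R f x" for x
  have "F \<in> borel_measurable lborel"
    using f unfolding F_def by (subst (asm) borel_measurable_restrict_space_iff) auto
  then have "F \<in> borel_measurable (lebesgue_on UNIV)"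
    by (simp add: measurable_completion lebesgue_on_UNIV_eq)
  then have "F measurable_on UNIV" by (subst measurable_on_iff_borel_measurable) auto
  then obtain N g where N: "negligible N" and g: "\<And>n::nat. continuous_on UNIV (g n)"
    and lim: "\<And>x. x \<notin> N \<Longrightarrow> (\<lambda>n. g n x) \<longlonglongrightarrow> F x"
    unfolding measurable_on_def by auto
  have AE_N: "AE x in lborel. x \<notin> N"
    using AE_not_in[of N lebesgue] N unfolding negligible_iff_null_sets AE_completion_iff by blast
  define C where "C = max B 1"
  have C: "C \<ge> 1" "\<And>x. cmod (f x) \<le> C" using B unfolding C_def by (auto intro: order_trans[OF B])
  \<comment> \<open>\<open>K\<close> retracts the plane continuously onto the disc of radius \<open>C\<close>.\<close>
  define K where "K z = z / of_real (max 1 (cmod z / C))" for z :: complex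
  have K_bound: "cmod (K z) \<le> C" for z
  proof (cases "cmod z \<le> C")
    case True then show ?thesis using C by (simp add: K_def max_def norm_divide)
  next
    case False
    then have "max 1 (cmod z / C) = cmod z / C" using C by (simp add: max_def)
    then have "cmod (K z) = cmod z / (cmod z / C)" using C by (simp only: K_def norm_divide norm_of_real)
    moreover have "z \<noteq> 0" using C False by auto
    ultimately show ?thesis by simp
  qed
  have K_id: "K z = z" if "cmod z \<le> C" for z using that C by (simp add: K_def max_def)
  have K_cont: "continuous_on UNIV K"
    unfolding K_def using C by (intro continuous_intros) (auto simp: max_def)
  \<comment> \<open>A continuous cut-off that vanishes within \<open>1/n\<close> of both ends of the period and tends to 1 inside.\<close>
  define \<kappa> where "\<kappa> n x = max 0 (min 1 (min (real n * x - 1) (real n * (2 * pi - x) - 1)))" for n x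
  have \<kappa>: "continuous_on UNIV (\<kappa> n)" "0 \<le> \<kappa> n x" "\<kappa> n x \<le> 1" for n x
    unfolding \<kappa>_def by (auto intro!: continuous_intros)
  define h where "h n x = of_real (\<kappa> n x) * K (g n x)" for n x
  have h_cont: "continuous_on UNIV (h n)" for n
    unfolding h_def by (intro continuous_intros \<kappa>(1) continuous_on_compose2[OF K_cont g]) auto
  have h_bound: "cmod (h n x) \<le> C" for n x
    unfolding h_def using \<kappa>(2,3)[of n x] K_bound[of "g n x"]
    by (simp add: norm_mult) (metis mult_left_le_one_le norm_ge_zero order_trans)
  have h_lim: "AE x in circle. (\<lambda>n. h n x) \<longlonglongrightarrow> f x"
  proof -
    have "AE x in lborel. x \<in> {0..<2*pi} \<longrightarrow> x \<notin> N \<and> x \<noteq> 0"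
      using AE_N AE_lborel_singleton[of 0] by eventually_elim auto
    then have "AE x in circle. x \<notin> N \<and> x \<noteq> 0"
      by (subst AE_restrict_space_iff) simp_all
    moreover have "AE x in circle. x \<in> {0..<2*pi}" by (rule AE_I2) simp
    ultimately show ?thesis
    proof eventually_elim
      case (elim x)
      then have x: "x \<notin> N" "0 < x" "x < 2 * pi" by auto
      have "(\<lambda>n. K (g n x)) \<longlonglongrightarrow> K (F x)"
        using K_cont lim[OF x(1)] by (intro isCont_tendsto_compose[of _ K]) (auto simp: continuous_on_eq_continuous_at)
      also have "K (F x) = f x" using x C K_id by (simp add: F_def)
      finally have 1: "(\<lambda>n. K (g n x)) \<longlonglongrightarrow> f x" .
      have ev: "eventually (\<lambda>n. 2 \<le> real n * y) sequentially" if "0 < y" for y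
      proof -
        have "eventually (\<lambda>n. 2 / y \<le> real n) sequentially"
          by (rule eventually_ge_at_top[THEN eventually_compose_filterlim]) (rule filterlim_real_sequentially)
        then show ?thesis by eventually_elim (use that in \<open>simp add: field_simps\<close>)
      qed
      have "eventually (\<lambda>n. \<kappa> n x = 1) sequentially"
        using ev[OF x(2)] ev[OF diff_gt_0_iff_gt[THEN iffD2, OF x(3)]] by eventually_elim (simp add: \<kappa>_def)
      then have "(\<lambda>n. \<kappa> n x) \<longlonglongrightarrow> 1" by (rule tendsto_eventually)
      then have "(\<lambda>n. of_real (\<kappa> n x) * K (g n x)) \<longlonglongrightarrow> of_real 1 * f x"
        using 1 by (intro tendsto_intros)
      then show ?case by (simp add: h_def)
    qed
  qed
  have h_meas: "h n \<in> borel_measurable circle" for n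
    using borel_measurable_continuous_onI[OF h_cont, of n] by (intro measurable_restrict_space1) simp
  have "L2_tendsto circle h f"
  proof (rule L2_tendsto_dominated[where w = "\<lambda>_. C"])
    show "(\<integral>\<^sup>+z. ennreal (C\<^sup>2) \<partial>circle) < \<infinity>"
      using emeasure_circle by (simp add: ennreal_mult_less_top)
  qed (use h_meas h_lim h_bound in auto)
  then have "eventually (\<lambda>n. sq_norm circle (\<lambda>x. h n x - f x) < ennreal (e / 4)) sequentially"
    unfolding L2_tendsto_def sq_norm_def using e by (intro order_tendstoD(2)) auto
  then have "eventually (\<lambda>n. sq_norm circle (\<lambda>x. h n x - f x) < ennreal (e / 4) \<and> n \<ge> 1) sequentially"
    using eventually_ge_at_top by (rule eventually_conj)
  then obtain n where n: "sq_norm circle (\<lambda>x. h n x - f x) < ennreal (e / 4)" "n \<ge> 1"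
    unfolding eventually_sequentially by blast
  define d where "d = 1 / real n"
  have "d \<le> 1" using n by (simp add: d_def)
  then have "d < pi" using pi_gt3 by linarith
  moreover have "0 < d" using n by (simp add: d_def)
  ultimately have d: "0 < d" "d < pi" by auto
  have nd: "real n * d \<le> 1" by (simp add: d_def)
  have z1: "h n x = 0" if "x \<le> d" for x
  proof -
    have "real n * x \<le> real n * d" using that by (intro mult_left_mono) auto
    then show ?thesis using nd by (simp add: h_def \<kappa>_def)
  qed
  have z2: "h n x = 0" if "x \<ge> 2 * pi - d" for x
  proof -
    have "real n * (2 * pi - x) \<le> real n * d" using that by (intro mult_left_mono) auto
    then show ?thesis using nd by (simp add: h_def \<kappa>_def)
  qed
  define e' where "e' = sqrt (e / (8 * pi))"
  have e': "e' > 0" "e'\<^sup>2 = e / (8 * pi)" using e by (auto simp: e'_def)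
  obtain p where p: "trig_poly p" "\<And>x. x \<in> {0..<2*pi} \<Longrightarrow> cmod (h n x - p x) < e'"
    using continuous_vanishing_near_ends_trig_approx[OF h_cont d z1 z2 e'(1)] by blast
  from trig_poly_normal_form[OF p(1)] have p_meas[measurable]: "p \<in> borel_measurable circle" by auto
  note [measurable] = h_meas
  have "sq_norm circle (\<lambda>x. h n x - p x) \<le> (\<integral>\<^sup>+x. ennreal (e'\<^sup>2) \<partial>circle)"
    unfolding sq_norm_def using p(2) by (intro nn_integral_mono ennreal_leI power_mono) (auto intro: less_imp_le)
  also have "\<dots> = ennreal (e'\<^sup>2) * ennreal (2 * pi)" using emeasure_circle by simp
  also have "\<dots> = ennreal (e / 4)" using e by (simp add: e' ennreal_mult[symmetric])
  finally have hp: "sq_norm circle (\<lambda>x. h n x - p x) \<le> ennreal (e / 4)" .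
  have "sq_norm circle (\<lambda>x. f x - p x) \<le> 2 * sq_norm circle (\<lambda>x. f x - h n x) + 2 * sq_norm circle (\<lambda>x. h n x - p x)"
    using sq_norm_add[of "\<lambda>x. f x - h n x" circle "\<lambda>x. h n x - p x"] by simp
  also have "\<dots> \<le> 2 * ennreal (e / 4) + 2 * ennreal (e / 4)"
    using n(1) hp by (intro add_mono mult_left_mono) (auto simp: sq_norm_minus_commute[of _ f])
  also have "\<dots> = ennreal e" using e
    by (simp add: two_mult_ennreal ennreal_plus[symmetric] del: ennreal_plus)
  finally show ?thesis using that p(1) by blast
qed

lemma L2_circle_trig_approx:
  assumes f: "f \<in> L2 circle" and e: "(e::real) > 0"
  obtains p where "trig_poly p" "sq_norm circle (\<lambda>x. f x - p x) \<le> ennreal e"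
proof -
  note [measurable] = L2_measurable[OF f]
  define A where "A n = {x \<in> space circle. cmod (f x) \<le> real n}" for n
  have A[measurable]: "A n \<in> sets circle" for n unfolding A_def by measurable
  have "L2_tendsto circle (\<lambda>n x. indicator (A n) x * f x) f"
  proof (rule L2_tendsto_cutoff[OF f A])
    fix z assume "z \<in> space circle"
    then show "eventually (\<lambda>n. z \<in> A n) sequentially"
      using eventually_ge_at_top[of "nat \<lceil>cmod (f z)\<rceil>"]
      by (auto simp: A_def elim!: eventually_mono)
  qed
  then have "eventually (\<lambda>n. sq_norm circle (\<lambda>x. indicator (A n) x * f x - f x) < ennreal (e / 4)) sequentially"
    unfolding L2_tendsto_def sq_norm_def using e by (intro order_tendstoD(2)) auto
  then obtain n where n: "sq_norm circle (\<lambda>x. indicator (A n) x * f x - f x) < ennreal (e / 4)"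
    unfolding eventually_sequentially by blast
  have "cmod (indicator (A n) x * f x) \<le> real n" for x by (auto simp: indicator_def A_def)
  then obtain p where p: "trig_poly p" "sq_norm circle (\<lambda>x. indicator (A n) x * f x - p x) \<le> ennreal (e / 4)"
    using L2_circle_bounded_trig_approx[of "\<lambda>x. indicator (A n) x * f x" "real n" "e / 4"] e by auto
  from trig_poly_normal_form[OF p(1)] have p_meas[measurable]: "p \<in> borel_measurable circle" by auto
  have "sq_norm circle (\<lambda>x. f x - p x) \<le> 2 * sq_norm circle (\<lambda>x. f x - indicator (A n) x * f x) + 2 * sq_norm circle (\<lambda>x. indicator (A n) x * f x - p x)"
    using sq_norm_add[of "\<lambda>x. f x - indicator (A n) x * f x" circle "\<lambda>x. indicator (A n) x * f x - p x"] by simp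
  also have "\<dots> \<le> 2 * ennreal (e / 4) + 2 * ennreal (e / 4)"
    using n p(2) by (intro add_mono mult_left_mono) (auto simp: sq_norm_minus_commute[of _ f])
  also have "\<dots> = ennreal e" using e
    by (simp add: two_mult_ennreal ennreal_plus[symmetric] del: ennreal_plus)
  finally show ?thesis using that p(1) by blast
qed

lemma nn_integral_count_space_int_le:
  fixes f :: "int \<Rightarrow> ennreal"
  assumes "\<And>A. finite A \<Longrightarrow> sum f A \<le> c"
  shows "(\<integral>\<^sup>+m. f m \<partial>count_space UNIV) \<le> c"
proof -
  have "(\<integral>\<^sup>+m. f m \<partial>count_space UNIV) = (\<integral>\<^sup>+i. f (int_decode i) \<partial>count_space UNIV)"
    using bij_int_decode by (intro nn_integral_bij_count_space[symmetric])
  also have "\<dots> = (\<Sum>i. f (int_decode i))" by (rule nn_integral_count_space_nat)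
  also have "\<dots> \<le> c"
  proof (rule suminf_le_const)
    fix n
    have "(\<Sum>i<n. f (int_decode i)) = sum f (int_decode ` {..<n})"
      by (subst sum.reindex) (auto intro: inj_on_subset[OF inj_int_decode])
    also have "\<dots> \<le> c" by (rule assms) simp
    finally show "(\<Sum>i<n. f (int_decode i)) \<le> c" .
  qed simp
  finally show ?thesis .
qed

lemma sum_le_nn_integral_count_space:
  fixes f :: "'a \<Rightarrow> ennreal"
  assumes "finite A"
  shows "sum f A \<le> (\<integral>\<^sup>+m. f m \<partial>count_space UNIV)"
proof -
  have "sum f A = (\<integral>\<^sup>+m. f m \<partial>count_space A)" using assms by (simp add: nn_integral_count_space_finite)
  also have "\<dots> = (\<integral>\<^sup>+m. f m * indicator A m \<partial>count_space UNIV)" by (simp add: nn_integral_count_space_indicator)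
  also have "\<dots> \<le> (\<integral>\<^sup>+m. f m \<partial>count_space UNIV)"
    by (intro nn_integral_mono) (auto simp: indicator_def)
  finally show ?thesis .
qed

theorem Parseval_circle:
  assumes f: "f \<in> L2 circle"
  shows "(\<integral>\<^sup>+m. ennreal ((cmod (coef f m))\<^sup>2) \<partial>count_space UNIV) = ennreal (2 * pi) * sq_norm circle f"
proof (rule antisym)
  let ?I = "LINT y|circle. (cmod (f y))\<^sup>2"
  have I0: "?I \<ge> 0" by simp
  have eqI: "ennreal (2 * pi) * sq_norm circle f = ennreal (2 * pi * ?I)"
    using sq_norm_eq_integral[OF f] by (simp add: ennreal_mult)
  have bessel: "(\<Sum>m\<in>A. (cmod (coef f m))\<^sup>2) \<le> 2 * pi * ?I" if A: "finite A" for A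
  proof -
    have "0 \<le> (LINT y|circle. (cmod (f y - (\<Sum>m\<in>A. (coef f m / of_real (2 * pi)) * trig m y)))\<^sup>2)" by simp
    also have "\<dots> = ?I - (\<Sum>m\<in>A. (cmod (coef f m))\<^sup>2) / (2 * pi)"
      by (subst integral_norm_diff_trig_sum[OF f A]) simp
    finally show ?thesis by (simp add: field_simps)
  qed
  show "(\<integral>\<^sup>+m. ennreal ((cmod (coef f m))\<^sup>2) \<partial>count_space UNIV) \<le> ennreal (2 * pi) * sq_norm circle f"
    unfolding eqI
  proof (rule nn_integral_count_space_int_le)
    fix A :: "int set" assume "finite A"
    then show "(\<Sum>m\<in>A. ennreal ((cmod (coef f m))\<^sup>2)) \<le> ennreal (2 * pi * ?I)"
      using bessel by (simp add: ennreal_leI)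
  qed
  show "ennreal (2 * pi) * sq_norm circle f \<le> (\<integral>\<^sup>+m. ennreal ((cmod (coef f m))\<^sup>2) \<partial>count_space UNIV)"
  proof (rule ennreal_le_epsilon)
    fix e :: real assume e: "e > 0"
    then obtain p where p: "trig_poly p" "sq_norm circle (\<lambda>x. f x - p x) \<le> ennreal (e / (2 * pi))"
      using L2_circle_trig_approx[OF f, of "e / (2 * pi)"] by auto
    obtain A a where A: "finite A" "p = (\<lambda>y. \<Sum>m\<in>A. a m * trig m y)"
      using trig_poly_normal_form[OF p(1)] by blast
    have "p \<in> L2 circle" unfolding A(2) by (intro sum_L2 A L2_cmult trig_L2)
    then have "sq_norm circle (\<lambda>x. f x - p x) = ennreal (LINT y|circle. (cmod (f y - p y))\<^sup>2)"
      using f by (intro sq_norm_eq_integral L2_diff)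
    then have "(LINT y|circle. (cmod (f y - p y))\<^sup>2) \<le> e / (2 * pi)" using p(2) e by simp
    moreover have "?I - (\<Sum>m\<in>A. (cmod (coef f m))\<^sup>2) / (2 * pi) \<le> (LINT y|circle. (cmod (f y - p y))\<^sup>2)"
      unfolding A(2) by (subst integral_norm_diff_trig_sum[OF f A(1)]) (simp add: sum_nonneg)
    ultimately have "2 * pi * ?I \<le> (\<Sum>m\<in>A. (cmod (coef f m))\<^sup>2) + e" by (simp add: field_simps)
    then have "ennreal (2 * pi * ?I) \<le> (\<Sum>m\<in>A. ennreal ((cmod (coef f m))\<^sup>2)) + ennreal e"
      using e by (simp add: ennreal_plus[symmetric] sum_nonneg ennreal_leI del: ennreal_plus)
    also have "\<dots> \<le> (\<integral>\<^sup>+m. ennreal ((cmod (coef f m))\<^sup>2) \<partial>count_space UNIV) + ennreal e"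
      by (intro add_right_mono sum_le_nn_integral_count_space A(1))
    finally show "ennreal (2 * pi) * sq_norm circle f \<le> (\<integral>\<^sup>+m. ennreal ((cmod (coef f m))\<^sup>2) \<partial>count_space UNIV) + ennreal e"
      unfolding eqI .
  qed
qed

section \<open>Plancherel's theorem on the line\<close>

lemma of_int_measurable_count [measurable]: "real_of_int \<in> borel_measurable (count_space UNIV)"
  by simp

lemma measurable_pair_count_space:
  assumes "\<And>y::'b::countable. (\<lambda>x. f (x, y)) \<in> measurable M K"
  shows "f \<in> measurable (M \<Otimes>\<^sub>M count_space UNIV) K"
proof -
  have "(\<lambda>(y, x). f (x, y)) \<in> measurable (count_space (UNIV::'b set) \<Otimes>\<^sub>M M) K"
    by (rule measurable_pair_measure_countable1) (use assms in auto)
  from measurable_pair_swap[OF this] show ?thesis by simp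
qed

interpretation lborel_int: pair_sigma_finite "lborel :: real measure" "count_space (UNIV :: int set)"
  by (intro pair_sigma_finite.intro sigma_finite_lborel sigma_finite_measure_count_space)

text \<open>
  Each real number lies in exactly one interval \<open>[m, m + 1)\<close>.
\<close>

lemma nn_integral_periodization:
  fixes G :: "real \<Rightarrow> ennreal"
  assumes [measurable]: "G \<in> borel_measurable borel"
  shows "(\<integral>\<^sup>+s. G s \<partial>lborel) = (\<integral>\<^sup>+\<theta>\<in>{0..<1}. (\<integral>\<^sup>+m. G (of_int m + \<theta>) \<partial>count_space (UNIV::int set)) \<partial>lborel)"
proof -
  have [measurable]: "(\<lambda>(s, m). G s * indicator {of_int m..<of_int m + 1} s) \<in> borel_measurable (lborel \<Otimes>\<^sub>M count_space (UNIV::int set))"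
    by (rule measurable_pair_count_space) auto
  have [measurable]: "(\<lambda>(s, m). G (of_int m + s) * indicator {0..<1} s) \<in> borel_measurable (lborel \<Otimes>\<^sub>M count_space (UNIV::int set))"
    by (rule measurable_pair_count_space) auto
  have "(\<integral>\<^sup>+s. G s \<partial>lborel) = (\<integral>\<^sup>+s. (\<integral>\<^sup>+m. G s * indicator {of_int m..<of_int m + 1} s \<partial>count_space (UNIV::int set)) \<partial>lborel)"
  proof (rule nn_integral_cong)
    fix s :: real
    have "indicator {of_int m..<of_int m + 1} s = (indicator {\<lfloor>s\<rfloor>} m :: ennreal)" for m
      by (auto simp: indicator_def floor_unique)
    then have "(\<integral>\<^sup>+m. G s * indicator {of_int m..<of_int m + 1} s \<partial>count_space (UNIV::int set)) = (\<integral>\<^sup>+m. G s * indicator {\<lfloor>s\<rfloor>} m \<partial>count_space (UNIV::int set))"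
      by simp
    also have "\<dots> = G s" by (subst nn_integral_cmult_indicator) auto
    finally show "G s = (\<integral>\<^sup>+m. G s * indicator {of_int m..<of_int m + 1} s \<partial>count_space (UNIV::int set))" by simp
  qed
  also have "\<dots> = (\<integral>\<^sup>+m. (\<integral>\<^sup>+s. G s * indicator {of_int m..<of_int m + 1} s \<partial>lborel) \<partial>count_space (UNIV::int set))"
    by (rule lborel_int.Fubini'[symmetric]) measurable
  also have "\<dots> = (\<integral>\<^sup>+m. (\<integral>\<^sup>+s. G (of_int m + s) * indicator {0..<1} s \<partial>lborel) \<partial>count_space (UNIV::int set))"
  proof (rule nn_integral_cong)
    fix m :: int
    have "(\<integral>\<^sup>+s. G s * indicator {of_int m..<of_int m + 1} s \<partial>lborel)
       = ennreal \<bar>1\<bar> * (\<integral>\<^sup>+s. G (of_int m + 1 * s) * indicator {of_int m..<of_int m + 1} (of_int m + 1 * s) \<partial>lborel)"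
      by (rule nn_integral_real_affine) auto
    also have "\<dots> = (\<integral>\<^sup>+s. G (of_int m + s) * indicator {0..<1} s \<partial>lborel)"
      by (auto simp: indicator_def intro!: nn_integral_cong)
    finally show "(\<integral>\<^sup>+s. G s * indicator {of_int m..<of_int m + 1} s \<partial>lborel) = (\<integral>\<^sup>+s. G (of_int m + s) * indicator {0..<1} s \<partial>lborel)" .
  qed
  also have "\<dots> = (\<integral>\<^sup>+s. (\<integral>\<^sup>+m. G (of_int m + s) * indicator {0..<1} s \<partial>count_space (UNIV::int set)) \<partial>lborel)"
    by (rule lborel_int.Fubini') measurable
  also have "\<dots> = (\<integral>\<^sup>+\<theta>\<in>{0..<1}. (\<integral>\<^sup>+m. G (of_int m + \<theta>) \<partial>count_space (UNIV::int set)) \<partial>lborel)"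
    by (intro nn_integral_cong) (auto simp: indicator_def)
  finally show ?thesis .
qed

lemma sq_norm_circle: "f \<in> borel_measurable circle \<Longrightarrow> sq_norm circle f = (\<integral>\<^sup>+x\<in>{0..<2*pi}. ennreal ((cmod (f x))\<^sup>2) \<partial>lborel)"
  unfolding sq_norm_def by (subst nn_integral_restrict_space) auto

text \<open>
  A function supported in one period is a function on the circle. The Fourier coefficients of its modulation by
  \<open>\<theta>\<close> are samples of the transform on a grid shifted by \<open>\<theta>\<close>, and Parseval's identity evaluates the sum over each
  such grid, independently of \<open>\<theta>\<close>. Averaging over \<open>\<theta> \<in> [0, 1)\<close> sweeps out the whole line.
\<close>

theorem Plancherel_real:
  fixes f :: "real \<Rightarrow> complex"
  assumes f: "f \<in> L2 lborel" and supp: "\<And>x. R < \<bar>x\<bar> \<Longrightarrow> f x = 0"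
  shows "(\<integral>\<^sup>+\<xi>. ennreal ((cmod (LINT x|lborel. f x * exp (- \<i> * of_real (x * \<xi>))))\<^sup>2) \<partial>lborel)
    = ennreal (2 * pi) * sq_norm lborel f"
proof -
  have [measurable]: "f \<in> borel_measurable borel" using L2_measurable[OF f] by simp
  \<comment> \<open>Rescaling by \<open>M\<close> fits the support into an interval of length \<open>2\<pi>\<close>.\<close>
  define M where "M = max R 0 + 1"
  have M: "M > 0" "R < pi * M"
  proof -
    show "M > 0" by (simp add: M_def)
    have "R < M" by (simp add: M_def)
    also have "M \<le> pi * M" using pi_gt3 \<open>M > 0\<close> by simp
    finally show "R < pi * M" .
  qed
  \<comment> \<open>The support is moved to \<open>[0, 2\<pi>)\<close>; the shift only changes the transform by a unimodular factor.\<close>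
  define g where "g \<theta> u = f (- (M * pi) + M * u) * exp (- \<i> * of_real (u * \<theta>))" for \<theta> u
  have [measurable]: "g \<theta> \<in> borel_measurable borel" for \<theta> unfolding g_def by measurable
  have g_supp: "u \<in> {0..<2*pi}" if "f (- (M * pi) + M * u) \<noteq> 0" for u
  proof -
    have "\<bar>- (M * pi) + M * u\<bar> < pi * M" using supp[of "- (M * pi) + M * u"] that M by force
    then have "M * 0 < M * u" "M * u < M * (2 * pi)" by (auto simp: abs_less_iff algebra_simps)
    then show ?thesis using M by (simp add: zero_less_mult_iff)
  qed
  have scale: "(\<integral>\<^sup>+x. h x \<partial>lborel) = ennreal M * (\<integral>\<^sup>+u. h (- (M * pi) + M * u) \<partial>lborel)"
    if [measurable]: "h \<in> borel_measurable borel" for h :: "real \<Rightarrow> ennreal"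
    using M by (subst nn_integral_real_affine[of h M "- (M * pi)"]) auto
  have norm_g: "ennreal M * sq_norm circle (g \<theta>) = sq_norm lborel f" for \<theta>
  proof -
    have "sq_norm circle (g \<theta>) = (\<integral>\<^sup>+x\<in>{0..<2*pi}. ennreal ((cmod (g \<theta> x))\<^sup>2) \<partial>lborel)"
      by (rule sq_norm_circle) (rule measurable_restrict_space1, simp)
    also have "\<dots> = (\<integral>\<^sup>+u. ennreal ((cmod (f (- (M * pi) + M * u)))\<^sup>2) \<partial>lborel)"
      using g_supp by (intro nn_integral_cong) (force simp: indicator_def g_def norm_mult)
    finally show ?thesis unfolding sq_norm_def[of lborel] by (subst scale) auto
  qed
  have g_L2: "g \<theta> \<in> L2 circle" for \<theta>
  proof -
    have "sq_norm circle (g \<theta>) < \<infinity>"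
      using norm_g[of \<theta>] L2_finite[OF f] M by (auto simp: ennreal_mult_less_top less_top[symmetric] ennreal_mult_eq_top_iff top_unique)
    then show ?thesis by (auto simp: L2_iff intro: measurable_restrict_space1)
  qed
  define fh where "fh \<xi> = (LINT x|lborel. f x * exp (- \<i> * of_real (x * \<xi>)))" for \<xi>
  have fh_meas[measurable]: "fh \<in> borel_measurable borel" unfolding fh_def by measurable
  have fh_coef: "(cmod (fh ((of_int m + \<theta>) / M)))\<^sup>2 = M\<^sup>2 * (cmod (coef (g \<theta>) m))\<^sup>2" for m \<theta>
  proof -
    define s where "s = of_int m + \<theta>"
    have "fh (s / M) = \<bar>M\<bar> *\<^sub>R (LINT u|lborel. f (- (M * pi) + M * u) * exp (- \<i> * of_real ((- (M * pi) + M * u) * (s / M))))"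
      unfolding fh_def using M by (intro lborel_integral_real_affine) auto
    also have "(LINT u|lborel. f (- (M * pi) + M * u) * exp (- \<i> * of_real ((- (M * pi) + M * u) * (s / M))))
      = (LINT u|lborel. exp (\<i> * of_real (pi * s)) * (indicator {0..<2*pi} u *\<^sub>R (g \<theta> u * trig (- m) u)))"
    proof (rule Bochner_Integration.integral_cong[OF refl])
      fix u
      have "exp (- \<i> * of_real ((- (M * pi) + M * u) * (s / M)))
         = exp (\<i> * of_real (pi * s) + (- \<i> * of_real (u * \<theta>) + \<i> * of_real (u * of_int (- m))))"
        using M by (intro arg_cong[of _ _ exp]) (simp add: s_def field_simps)
      then have "exp (- \<i> * of_real ((- (M * pi) + M * u) * (s / M)))
         = exp (\<i> * of_real (pi * s)) * (exp (- \<i> * of_real (u * \<theta>)) * trig (- m) u)"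
        by (simp only: exp_add trig_def)
      then show "f (- (M * pi) + M * u) * exp (- \<i> * of_real ((- (M * pi) + M * u) * (s / M)))
        = exp (\<i> * of_real (pi * s)) * (indicator {0..<2*pi} u *\<^sub>R (g \<theta> u * trig (- m) u))"
        using g_supp[of u] by (cases "f (- (M * pi) + M * u) = 0") (auto simp: g_def)
    qed
    also have "\<dots> = exp (\<i> * of_real (pi * s)) * coef (g \<theta>) m"
      unfolding coef_def by (subst integral_restrict_space) (simp, rule integral_mult_right_zero)
    finally show ?thesis using M unfolding s_def[symmetric]
      by (simp add: norm_mult power_mult_distrib)
  qed
  have sum: "(\<integral>\<^sup>+m. ennreal ((cmod (fh ((of_int m + \<theta>) / M)))\<^sup>2) \<partial>count_space (UNIV::int set)) = ennreal M * (ennreal (2 * pi) * sq_norm lborel f)" for \<theta>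
  proof -
    have "(\<integral>\<^sup>+m. ennreal ((cmod (fh ((of_int m + \<theta>) / M)))\<^sup>2) \<partial>count_space (UNIV::int set))
      = ennreal (M\<^sup>2) * (\<integral>\<^sup>+m. ennreal ((cmod (coef (g \<theta>) m))\<^sup>2) \<partial>count_space (UNIV::int set))"
      unfolding fh_coef by (simp add: ennreal_mult nn_integral_cmult)
    also have "\<dots> = ennreal (M\<^sup>2) * (ennreal (2 * pi) * sq_norm circle (g \<theta>))"
      by (subst Parseval_circle[OF g_L2]) simp
    also have "\<dots> = ennreal M * (ennreal (2 * pi) * (ennreal M * sq_norm circle (g \<theta>)))"
      using M by (simp add: power2_eq_square ennreal_mult mult_ac)
    finally show ?thesis by (simp add: norm_g)
  qed
  have "(\<integral>\<^sup>+\<xi>. ennreal ((cmod (fh \<xi>))\<^sup>2) \<partial>lborel) = ennreal \<bar>1 / M\<bar> * (\<integral>\<^sup>+s. ennreal ((cmod (fh (0 + 1 / M * s)))\<^sup>2) \<partial>lborel)"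
    using M by (intro nn_integral_real_affine) auto
  also have "(\<integral>\<^sup>+s. ennreal ((cmod (fh (0 + 1 / M * s)))\<^sup>2) \<partial>lborel) = (\<integral>\<^sup>+s. ennreal ((cmod (fh (s / M)))\<^sup>2) \<partial>lborel)"
    by simp
  also have "\<dots> = (\<integral>\<^sup>+\<theta>\<in>{0..<1}. (\<integral>\<^sup>+m. ennreal ((cmod (fh ((of_int m + \<theta>) / M)))\<^sup>2) \<partial>count_space (UNIV::int set)) \<partial>lborel)"
    by (rule nn_integral_periodization) simp
  also have "\<dots> = ennreal M * (ennreal (2 * pi) * sq_norm lborel f)"
    unfolding sum by (subst nn_integral_cmult_indicator) auto
  also have "ennreal \<bar>1 / M\<bar> * (ennreal M * (ennreal (2 * pi) * sq_norm lborel f)) = ennreal (2 * pi) * sq_norm lborel f"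
    using M by (simp add: mult.assoc[symmetric] ennreal_mult[symmetric] del: ennreal_mult)
  finally show ?thesis unfolding fh_def .
qed

lemma Plancherel_real_inverse:
  fixes f :: "real \<Rightarrow> complex"
  assumes f: "f \<in> L2 lborel" and supp: "\<And>x. R < \<bar>x\<bar> \<Longrightarrow> f x = 0"
  shows "(\<integral>\<^sup>+\<xi>. ennreal ((cmod (LINT x|lborel. f x * exp (\<i> * of_real (x * \<xi>))))\<^sup>2) \<partial>lborel)
    = ennreal (2 * pi) * sq_norm lborel f"
proof -
  have [measurable]: "f \<in> borel_measurable borel" using L2_measurable[OF f] by simp
  have "(\<integral>\<^sup>+\<xi>. ennreal ((cmod (LINT x|lborel. f x * exp (\<i> * of_real (x * \<xi>))))\<^sup>2) \<partial>lborel)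
    = ennreal \<bar>-1\<bar> * (\<integral>\<^sup>+\<xi>. ennreal ((cmod (LINT x|lborel. f x * exp (\<i> * of_real (x * (0 + -1 * \<xi>)))))\<^sup>2) \<partial>lborel)"
    by (rule nn_integral_real_affine) auto
  also have "\<dots> = (\<integral>\<^sup>+\<xi>. ennreal ((cmod (LINT x|lborel. f x * exp (- \<i> * of_real (x * \<xi>))))\<^sup>2) \<partial>lborel)"
    by simp
  also have "\<dots> = ennreal (2 * pi) * sq_norm lborel f" by (rule Plancherel_real[OF f supp])
  finally show ?thesis .
qed

section \<open>Truncated transforms on the cylinder\<close>

interpretation lborel_circle: pair_sigma_finite "lborel :: real measure" circle
  by (intro pair_sigma_finite.intro sigma_finite_lborel circle.sigma_finite_measure_axioms)

interpretation cylinder: sigma_finite_measure cylinder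
  unfolding cylinder_def by (rule sigma_finite_pair_measure[OF sigma_finite_lborel circle.sigma_finite_measure_axioms])

interpretation dual_cylinder: sigma_finite_measure dual_cylinder
  unfolding dual_cylinder_def by (rule sigma_finite_pair_measure[OF sigma_finite_lborel sigma_finite_measure_count_space])

interpretation dual_cylinder_cylinder: pair_sigma_finite dual_cylinder cylinder ..

lemma space_cylinder [simp]: "space cylinder = UNIV \<times> {0..<2*pi}"
  by (simp add: cylinder_def space_pair_measure)

lemma space_dual_cylinder [simp]: "space dual_cylinder = UNIV"
  by (simp add: dual_cylinder_def space_pair_measure)

lemma fst_cylinder [measurable]: "fst \<in> borel_measurable cylinder"
  and snd_cylinder [measurable]: "snd \<in> borel_measurable cylinder"
proof -
  show "fst \<in> borel_measurable cylinder" unfolding cylinder_def by measurable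
  have "(\<lambda>y. y) \<in> borel_measurable circle" by (rule measurable_restrict_space1) simp
  then show "snd \<in> borel_measurable cylinder"
    unfolding cylinder_def using measurable_compose[of snd "lborel \<Otimes>\<^sub>M circle" circle "\<lambda>y. y"] by simp
qed

lemma fst_dual_cylinder [measurable]: "fst \<in> borel_measurable dual_cylinder"
  unfolding dual_cylinder_def by measurable

lemma snd_dual_cylinder [measurable]: "snd \<in> measurable dual_cylinder (count_space UNIV)"
  unfolding dual_cylinder_def by measurable

definition character :: "real \<times> int \<Rightarrow> real \<times> real \<Rightarrow> complex" where
  "character w z = exp (\<i> * of_real (fst z * fst w) + \<i> * of_real (snd z * of_int (snd w)))"

lemma character_measurable [measurable (raw)]:
  assumes [measurable]: "f \<in> measurable N dual_cylinder" "g \<in> measurable N cylinder"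
  shows "(\<lambda>x. character (f x) (g x)) \<in> borel_measurable N"
  unfolding character_def by measurable

lemma character_measurable2 [measurable]:
  "character w \<in> borel_measurable cylinder"
  "(\<lambda>w. character w z) \<in> borel_measurable dual_cylinder"
  unfolding character_def by measurable

lemma norm_character [simp]: "cmod (character w z) = 1"
proof -
  have "character w z = exp (\<i> * of_real (fst z * fst w + snd z * of_int (snd w)))"
    by (simp add: character_def algebra_simps)
  then show ?thesis by simp
qed

lemma character_Pair: "character (\<xi>, \<eta>) (x, y) = exp (\<i> * of_real (x * \<xi>)) * trig \<eta> y"
  by (simp add: character_def trig_def exp_add)

lemma cnj_character_Pair: "cnj (character (\<xi>, \<eta>) (x, y)) = exp (- \<i> * of_real (x * \<xi>)) * trig (- \<eta>) y"
  by (simp add: character_Pair cnj_trig exp_cnj)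

lemma nn_integral_cylinder:
  assumes "f \<in> borel_measurable cylinder"
  shows "(\<integral>\<^sup>+z. f z \<partial>cylinder) = (\<integral>\<^sup>+x. (\<integral>\<^sup>+y. f (x, y) \<partial>circle) \<partial>lborel)"
  using circle.nn_integral_fst[of f lborel] assms by (simp add: cylinder_def)

lemma nn_integral_dual_cylinder:
  assumes "f \<in> borel_measurable dual_cylinder"
  shows "(\<integral>\<^sup>+w. f w \<partial>dual_cylinder) = (\<integral>\<^sup>+\<eta>. (\<integral>\<^sup>+\<xi>. f (\<xi>, \<eta>) \<partial>lborel) \<partial>count_space UNIV)"
  using lborel_int.nn_integral_snd[of f] assms by (simp add: dual_cylinder_def)

lemma Pair_measurable_cylinder [measurable]: "(\<lambda>y. (x, y)) \<in> measurable circle cylinder"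
  unfolding cylinder_def by measurable

lemma Pair_measurable_dual_cylinder [measurable]: "(\<lambda>\<xi>. (\<xi>, \<eta>)) \<in> measurable borel dual_cylinder"
  unfolding dual_cylinder_def by measurable

lemma L2_mult_integrable:
  assumes u: "u \<in> L2 M" and v: "v \<in> L2 M"
  shows "integrable M (\<lambda>z. u z * v z)"
proof (rule Bochner_Integration.integrable_bound[of M "\<lambda>z. (cmod (u z))\<^sup>2 + (cmod (v z))\<^sup>2"])
  show "integrable M (\<lambda>z. (cmod (u z))\<^sup>2 + (cmod (v z))\<^sup>2)" using u v by (auto simp: L2_def)
  show "(\<lambda>z. u z * v z) \<in> borel_measurable M" using u v by (auto simp: L2_def)
  show "AE z in M. norm (u z * v z) \<le> norm ((cmod (u z))\<^sup>2 + (cmod (v z))\<^sup>2)"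
  proof (rule AE_I2)
    fix z
    have "2 * cmod (u z) * cmod (v z) \<le> (cmod (u z))\<^sup>2 + (cmod (v z))\<^sup>2" by (rule sum_squares_bound)
    moreover have "0 \<le> cmod (u z) * cmod (v z)" by simp
    ultimately have "cmod (u z) * cmod (v z) \<le> (cmod (u z))\<^sup>2 + (cmod (v z))\<^sup>2" by linarith
    then show "norm (u z * v z) \<le> norm ((cmod (u z))\<^sup>2 + (cmod (v z))\<^sup>2)" by (simp add: norm_mult)
  qed
qed

lemma L2_cnj: "u \<in> L2 M \<Longrightarrow> (\<lambda>z. cnj (u z)) \<in> L2 M"
  unfolding L2_def by (auto intro: borel_measurable_continuous_on[where f = cnj] continuous_intros)

lemma integral_norm_diff_sq:
  assumes u: "u \<in> L2 M" and v: "v \<in> L2 M"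
  shows "(LINT z|M. (cmod (u z - v z))\<^sup>2)
    = (LINT z|M. (cmod (u z))\<^sup>2) - 2 * Re (LINT z|M. u z * cnj (v z)) + (LINT z|M. (cmod (v z))\<^sup>2)"
proof -
  have int: "integrable M (\<lambda>z. u z * cnj (v z))" by (intro L2_mult_integrable u L2_cnj v)
  have eq: "(cmod (a - b))\<^sup>2 = (cmod a)\<^sup>2 - 2 * Re (a * cnj b) + (cmod b)\<^sup>2" for a b :: complex
    unfolding cmod_power2 by (simp add: power2_eq_square algebra_simps)
  have *: "(LINT z|M. a z - 2 * Re (F z) + b z) = (LINT z|M. a z) - 2 * Re (LINT z|M. F z) + (LINT z|M. b z)"
    if "integrable M a" "integrable M F" "integrable M b" for a b :: "'a \<Rightarrow> real" and F
    using that by simp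
  show ?thesis unfolding eq using u v int by (intro *) (auto simp: L2_def)
qed

lemma integrable_cylinder_strip: "integrable cylinder (\<lambda>z. indicat_real {-R..R} (fst z))"
proof -
  have "(\<integral>\<^sup>+z. ennreal (indicat_real {-R..R} (fst z)) \<partial>cylinder)
      = (\<integral>\<^sup>+x. ennreal (2 * pi) * indicator {-R..R} x \<partial>lborel)"
    using emeasure_circle by (subst nn_integral_cylinder) (auto simp: mult.commute ennreal_indicator)
  also have "\<dots> < \<infinity>"
    by (simp add: nn_integral_cmult_indicator ennreal_mult_less_top emeasure_lborel_Icc_eq of_nat_less_top)
  finally show ?thesis by (simp add: integrable_iff_bounded)
qed

lemma integrable_dual_cylinder_box:
  "integrable dual_cylinder (\<lambda>w. indicat_real ({-R..R} \<times> {-N..N}) w)"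
proof -
  have [measurable]: "{-R..R} \<times> {-N..N} \<in> sets dual_cylinder"
    unfolding dual_cylinder_def by auto
  have "(\<integral>\<^sup>+w. ennreal (indicat_real ({-R..R} \<times> {-N..N}) w) \<partial>dual_cylinder)
      = (\<integral>\<^sup>+\<eta>. (\<integral>\<^sup>+\<xi>. indicator {-N..N} \<eta> * indicator {-R..R} \<xi> \<partial>lborel) \<partial>count_space UNIV)"
    by (subst nn_integral_dual_cylinder)
       (auto simp: ennreal_indicator indicator_def intro!: nn_integral_cong)
  also have "\<dots> = (\<integral>\<^sup>+\<eta>. emeasure lborel {-R..R} * indicator {-N..N} \<eta> \<partial>count_space UNIV)"
    by (simp add: nn_integral_cmult mult.commute)
  also have "\<dots> < \<infinity>"
    by (simp add: nn_integral_cmult_indicator ennreal_mult_less_top emeasure_lborel_Icc_eq of_nat_less_top)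
  finally show ?thesis by (simp add: integrable_iff_bounded)
qed

lemma L2_supported_imp_integrable:
  assumes f: "f \<in> L2 M" and A: "integrable M (indicat_real A \<circ> p)" and supp: "\<And>z. p z \<notin> A \<Longrightarrow> f z = 0"
  shows "integrable M f"
proof (rule Bochner_Integration.integrable_bound[of M "\<lambda>z. indicat_real A (p z) + (cmod (f z))\<^sup>2"])
  show "integrable M (\<lambda>z. indicat_real A (p z) + (cmod (f z))\<^sup>2)" using f A by (auto simp: L2_def o_def)
  show "f \<in> borel_measurable M" by (rule L2_measurable[OF f])
  have "x \<le> 1 + x\<^sup>2" for x :: real
    using sum_squares_bound[of 1 x] zero_le_power2[of x] unfolding one_power2 by linarith
  then show "AE z in M. norm (f z) \<le> norm (indicat_real A (p z) + (cmod (f z))\<^sup>2)"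
    using supp by (intro AE_I2) (auto simp: indicator_def)
qed

definition cutoff :: "nat \<Rightarrow> (real \<times> real \<Rightarrow> complex) \<Rightarrow> real \<times> real \<Rightarrow> complex" where
  "cutoff n f = (\<lambda>z. indicator {-real n..real n} (fst z) * f z)"

definition boxcut :: "nat \<Rightarrow> (real \<times> int \<Rightarrow> complex) \<Rightarrow> real \<times> int \<Rightarrow> complex" where
  "boxcut n F = (\<lambda>w. indicator ({-real n..real n} \<times> {-int n..int n}) w * F w)"

lemma strip_sets [measurable]: "{z \<in> space cylinder. fst z \<in> {-real n..real n}} \<in> sets cylinder"
  by measurable

lemma box_sets [measurable]: "{-real n..real n} \<times> {-int n..int n} \<in> sets dual_cylinder"
  unfolding dual_cylinder_def by auto

lemma cutoff_measurable [measurable]: "f \<in> borel_measurable cylinder \<Longrightarrow> cutoff n f \<in> borel_measurable cylinder"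
  unfolding cutoff_def by measurable

lemma cutoff_L2: "f \<in> L2 cylinder \<Longrightarrow> cutoff n f \<in> L2 cylinder"
  unfolding cutoff_def by (rule L2_bounded_mult[where B = 1]) (auto simp: indicator_def)

lemma boxcut_L2: "F \<in> L2 dual_cylinder \<Longrightarrow> boxcut n F \<in> L2 dual_cylinder"
  unfolding boxcut_def by (rule L2_bounded_mult[where B = 1]) (auto simp: indicator_def)

lemma cutoff_integrable:
  assumes "f \<in> L2 cylinder"
  shows "integrable cylinder (cutoff n f)"
  by (rule L2_supported_imp_integrable[OF cutoff_L2[OF assms], where A = "{-real n..real n}" and p = fst])
     (auto simp: o_def integrable_cylinder_strip cutoff_def)

lemma boxcut_integrable:
  assumes "F \<in> L2 dual_cylinder"
  shows "integrable dual_cylinder (boxcut n F)"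
  by (rule L2_supported_imp_integrable[OF boxcut_L2[OF assms], where A = "{-real n..real n} \<times> {-int n..int n}" and p = id])
     (auto simp: o_def integrable_dual_cylinder_box boxcut_def)

lemma cutoff_tendsto:
  assumes "f \<in> L2 cylinder"
  shows "L2_tendsto cylinder (\<lambda>n. cutoff n f) f"
proof -
  have "L2_tendsto cylinder (\<lambda>n z. indicator {z \<in> space cylinder. fst z \<in> {-real n..real n}} z * f z) f"
  proof (rule L2_tendsto_cutoff[OF assms strip_sets])
    fix z assume "z \<in> space cylinder"
    then have *: "snd z \<in> {0..<2 * pi}" by auto
    show "eventually (\<lambda>n. z \<in> {z \<in> space cylinder. fst z \<in> {-real n..real n}}) sequentially"
      using eventually_ge_at_top[of "nat \<lceil>\<bar>fst z\<bar>\<rceil>"]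
      by eventually_elim (use * in \<open>auto simp: abs_le_iff mem_Times_iff\<close>)
  qed
  moreover have "(\<integral>\<^sup>+z. ennreal ((cmod (indicator {z \<in> space cylinder. fst z \<in> {-real n..real n}} z * f z - f z))\<^sup>2) \<partial>cylinder)
      = (\<integral>\<^sup>+z. ennreal ((cmod (cutoff n f z - f z))\<^sup>2) \<partial>cylinder)" for n
    by (intro nn_integral_cong) (auto simp: cutoff_def indicator_def)
  ultimately show ?thesis unfolding L2_tendsto_def by simp
qed

lemma boxcut_tendsto:
  assumes "F \<in> L2 dual_cylinder"
  shows "L2_tendsto dual_cylinder (\<lambda>n. boxcut n F) F"
  unfolding boxcut_def
proof (rule L2_tendsto_cutoff[OF assms box_sets])
  fix w :: "real \<times> int"
  show "eventually (\<lambda>n. w \<in> {-real n..real n} \<times> {-int n..int n}) sequentially"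
    using eventually_ge_at_top[of "nat \<lceil>\<bar>fst w\<bar>\<rceil>"] eventually_ge_at_top[of "nat \<bar>snd w\<bar>"]
    by eventually_elim (auto simp: abs_le_iff mem_Times_iff)
qed

definition integral_transform :: "(real \<times> real \<Rightarrow> complex) \<Rightarrow> real \<times> int \<Rightarrow> complex" where
  "integral_transform g w = (LINT z|cylinder. g z * cnj (character w z))"

lemma fourier_trunc_eq: "fourier_trunc n f = integral_transform (cutoff n f)"
proof
  fix w :: "real \<times> int"
  show "fourier_trunc n f w = integral_transform (cutoff n f) w"
    unfolding fourier_trunc_def integral_transform_def set_lebesgue_integral_def
    by (cases w) (auto simp: cutoff_def character_def exp_cnj indicator_def intro!: Bochner_Integration.integral_cong)
qed

lemma cnj_character_measurable [measurable (raw)]: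
  assumes [measurable]: "f \<in> measurable N dual_cylinder" "g \<in> measurable N cylinder"
  shows "(\<lambda>x. cnj (character (f x) (g x))) \<in> borel_measurable N"
  by (rule borel_measurable_continuous_on[where f = cnj]) (auto intro: continuous_intros)

lemma integral_transform_measurable [measurable]:
  assumes [measurable]: "g \<in> borel_measurable cylinder"
  shows "integral_transform g \<in> borel_measurable dual_cylinder"
  unfolding integral_transform_def by measurable

lemma integral_transform_integrable:
  assumes "integrable cylinder g"
  shows "integrable cylinder (\<lambda>z. g z * cnj (character w z))"
proof (rule Bochner_Integration.integrable_bound[OF assms])
  have [measurable]: "g \<in> borel_measurable cylinder" using assms by simp
  show "(\<lambda>z. g z * cnj (character w z)) \<in> borel_measurable cylinder" by measurable
qed (simp add: norm_mult)

text \<open>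
  Parseval's identity in \<open>y\<close> for almost every \<open>x\<close>, followed by Plancherel's theorem in \<open>x\<close> for each \<open>\<eta>\<close>; each contributes
  one factor \<open>2\<pi>\<close>.
\<close>

lemma sq_norm_integral_transform:
  assumes g: "g \<in> L2 cylinder" and supp: "\<And>z. R < \<bar>fst z\<bar> \<Longrightarrow> g z = 0"
  shows "sq_norm dual_cylinder (integral_transform g) = ennreal ((2 * pi)\<^sup>2) * sq_norm cylinder g"
proof -
  have [measurable]: "g \<in> borel_measurable cylinder" by (rule L2_measurable[OF g])
  have int: "integrable cylinder g"
    by (rule L2_supported_imp_integrable[OF g, where A = "{-R..R}" and p = fst])
       (use supp in \<open>auto simp: o_def integrable_cylinder_strip\<close>)
  define c where "c x \<eta> = coef (\<lambda>y. g (x, y)) \<eta>" for x \<eta>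
  have c_meas[measurable]: "(\<lambda>x. c x \<eta>) \<in> borel_measurable borel" for \<eta>
  proof -
    have "(\<lambda>(x, y). g (x, y) * trig (- \<eta>) y) \<in> borel_measurable (borel \<Otimes>\<^sub>M circle)"
    proof -
      have "g \<in> borel_measurable (borel \<Otimes>\<^sub>M circle)"
        using \<open>g \<in> borel_measurable cylinder\<close> unfolding cylinder_def
        by (subst (asm) measurable_cong_sets[OF sets_pair_measure_cong]) auto
      then show ?thesis by measurable
    qed
    then show ?thesis unfolding c_def coef_def by (rule circle.borel_measurable_lebesgue_integral)
  qed
  have c_meas2[measurable]: "(\<lambda>(x, \<eta>). ennreal ((cmod (c x \<eta>))\<^sup>2)) \<in> borel_measurable (lborel \<Otimes>\<^sub>M count_space UNIV)"
    by (rule measurable_pair_count_space) simp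
  have norm_g: "(\<integral>\<^sup>+x. sq_norm circle (\<lambda>y. g (x, y)) \<partial>lborel) = sq_norm cylinder g"
    unfolding sq_norm_def by (subst nn_integral_cylinder) auto
  have [measurable]: "(\<lambda>x. sq_norm circle (\<lambda>y. g (x, y))) \<in> borel_measurable lborel"
    unfolding sq_norm_def using \<open>g \<in> borel_measurable cylinder\<close> unfolding cylinder_def by measurable
  have "AE x in lborel. sq_norm circle (\<lambda>y. g (x, y)) \<noteq> \<infinity>"
    using norm_g L2_finite[OF g] by (intro nn_integral_noteq_infinite) auto
  then have AE_L2: "AE x in lborel. (\<lambda>y. g (x, y)) \<in> L2 circle"
    by eventually_elim (auto simp: L2_iff less_top)
  have total: "(\<integral>\<^sup>+x. (\<integral>\<^sup>+\<eta>. ennreal ((cmod (c x \<eta>))\<^sup>2) \<partial>count_space UNIV) \<partial>lborel) = ennreal (2 * pi) * sq_norm cylinder g"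
  proof -
    have "(\<integral>\<^sup>+x. (\<integral>\<^sup>+\<eta>. ennreal ((cmod (c x \<eta>))\<^sup>2) \<partial>count_space UNIV) \<partial>lborel)
       = (\<integral>\<^sup>+x. ennreal (2 * pi) * sq_norm circle (\<lambda>y. g (x, y)) \<partial>lborel)"
      by (rule nn_integral_cong_AE, use AE_L2 in eventually_elim) (simp add: c_def Parseval_circle)
    also have "\<dots> = ennreal (2 * pi) * sq_norm cylinder g"
      unfolding norm_g[symmetric] by (rule nn_integral_cmult) simp
    finally show ?thesis .
  qed
  have swap: "(\<integral>\<^sup>+\<eta>. sq_norm lborel (\<lambda>x. c x \<eta>) \<partial>count_space UNIV) = ennreal (2 * pi) * sq_norm cylinder g"
    unfolding sq_norm_def[of lborel] total[symmetric] by (rule lborel_int.Fubini') simp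
  have c_L2: "(\<lambda>x. c x \<eta>) \<in> L2 lborel" for \<eta>
  proof -
    have "sq_norm lborel (\<lambda>x. c x \<eta>) \<le> (\<integral>\<^sup>+\<eta>. sq_norm lborel (\<lambda>x. c x \<eta>) \<partial>count_space UNIV)"
      using sum_le_nn_integral_count_space[of "{\<eta>}" "\<lambda>\<eta>. sq_norm lborel (\<lambda>x. c x \<eta>)"] by simp
    also have "\<dots> < \<infinity>" unfolding swap using L2_finite[OF g] by (simp add: ennreal_mult_less_top)
    finally show ?thesis by (simp add: L2_iff)
  qed
  have c_supp: "c x \<eta> = 0" if "R < \<bar>x\<bar>" for x \<eta>
    using supp[of "(x, _)"] that by (simp add: c_def coef_def)
  have tr: "integral_transform g (\<xi>, \<eta>) = (LINT x|lborel. c x \<eta> * exp (- \<i> * of_real (x * \<xi>)))" for \<xi> \<eta>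
  proof -
    have "integral_transform g (\<xi>, \<eta>) = (LINT x|lborel. (LINT y|circle. g (x, y) * cnj (character (\<xi>, \<eta>) (x, y))))"
      unfolding integral_transform_def cylinder_def
      using integral_transform_integrable[OF int, of "(\<xi>, \<eta>)"] unfolding cylinder_def
      by (rule lborel_circle.integral_fst'[symmetric])
    also have "\<dots> = (LINT x|lborel. (LINT y|circle. exp (- \<i> * of_real (x * \<xi>)) * (g (x, y) * trig (- \<eta>) y)))"
      unfolding cnj_character_Pair by (simp only: mult_ac)
    also have "\<dots> = (LINT x|lborel. c x \<eta> * exp (- \<i> * of_real (x * \<xi>)))"
      by (simp add: c_def coef_def mult.commute)
    finally show ?thesis .
  qed
  have "sq_norm dual_cylinder (integral_transform g)
     = (\<integral>\<^sup>+\<eta>. (\<integral>\<^sup>+\<xi>. ennreal ((cmod (integral_transform g (\<xi>, \<eta>)))\<^sup>2) \<partial>lborel) \<partial>count_space UNIV)"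
    unfolding sq_norm_def by (rule nn_integral_dual_cylinder) measurable
  also have "\<dots> = (\<integral>\<^sup>+\<eta>. ennreal (2 * pi) * sq_norm lborel (\<lambda>x. c x \<eta>) \<partial>count_space UNIV)"
    unfolding tr by (subst Plancherel_real[OF c_L2 c_supp]) auto
  also have "\<dots> = ennreal (2 * pi) * (ennreal (2 * pi) * sq_norm cylinder g)"
    unfolding swap[symmetric] by (rule nn_integral_cmult) simp
  finally show ?thesis by (simp add: mult.assoc[symmetric] ennreal_mult[symmetric] power2_eq_square)
qed

definition adjoint_transform :: "(real \<times> int \<Rightarrow> complex) \<Rightarrow> real \<times> real \<Rightarrow> complex" where
  "adjoint_transform G z = (LINT w|dual_cylinder. G w * character w z)"

lemma adjoint_transform_measurable [measurable]:
  assumes [measurable]: "G \<in> borel_measurable dual_cylinder"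
  shows "adjoint_transform G \<in> borel_measurable cylinder"
  unfolding adjoint_transform_def by measurable

lemma adjoint_transform_integrable:
  assumes "integrable dual_cylinder G"
  shows "integrable dual_cylinder (\<lambda>w. G w * character w z)"
proof (rule Bochner_Integration.integrable_bound[OF assms])
  have [measurable]: "G \<in> borel_measurable dual_cylinder" using assms by simp
  show "(\<lambda>w. G w * character w z) \<in> borel_measurable dual_cylinder" by measurable
qed (simp add: norm_mult)

lemma adjoint_transform_boxcut:
  assumes F: "F \<in> L2 dual_cylinder"
  shows "adjoint_transform (boxcut n F) (x, y)
    = (\<Sum>\<eta>\<in>{-int n..int n}. (LINT \<xi>|lborel. indicator {-real n..real n} \<xi> * F (\<xi>, \<eta>) * exp (\<i> * of_real (\<xi> * x))) * trig \<eta> y)"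
proof -
  let ?h = "\<lambda>\<eta>. (LINT \<xi>|lborel. boxcut n F (\<xi>, \<eta>) * character (\<xi>, \<eta>) (x, y))"
  have "adjoint_transform (boxcut n F) (x, y) = (LINT \<eta>|count_space UNIV. ?h \<eta>)"
    unfolding adjoint_transform_def dual_cylinder_def
    using adjoint_transform_integrable[OF boxcut_integrable[OF F], of n "(x, y)"] unfolding dual_cylinder_def
    by (subst lborel_int.integral_snd[of "\<lambda>\<xi> \<eta>. boxcut n F (\<xi>, \<eta>) * character (\<xi>, \<eta>) (x, y)"]) (auto simp: case_prod_beta')
  also have "\<dots> = (\<Sum>\<eta>\<in>{-int n..int n}. ?h \<eta>)"
  proof -
    have 0: "?h \<eta> = 0" if "\<eta> \<notin> {-int n..int n}" for \<eta> using that by (auto simp: boxcut_def)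
    then have "{\<eta>. ?h \<eta> \<noteq> 0} \<subseteq> {-int n..int n}" by blast
    then show ?thesis
      by (subst lebesgue_integral_count_space_finite_support) (auto intro: finite_subset intro!: sum.mono_neutral_left)
  qed
  also have "\<dots> = (\<Sum>\<eta>\<in>{-int n..int n}. (LINT \<xi>|lborel. indicator {-real n..real n} \<xi> * F (\<xi>, \<eta>) * exp (\<i> * of_real (\<xi> * x))) * trig \<eta> y)"
  proof (rule sum.cong[OF refl])
    fix \<eta> assume "\<eta> \<in> {-int n..int n}"
    then have "?h \<eta> = (LINT \<xi>|lborel. (indicator {-real n..real n} \<xi> * F (\<xi>, \<eta>) * exp (\<i> * of_real (\<xi> * x))) * trig \<eta> y)"
      by (intro Bochner_Integration.integral_cong) (auto simp: boxcut_def character_Pair indicator_def mult_ac)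
    then show "?h \<eta> = (LINT \<xi>|lborel. indicator {-real n..real n} \<xi> * F (\<xi>, \<eta>) * exp (\<i> * of_real (\<xi> * x))) * trig \<eta> y"
      by (simp only: integral_mult_left_zero)
  qed
  finally show ?thesis .
qed

lemma inverse_fourier_trunc_eq:
  assumes F: "F \<in> L2 dual_cylinder"
  shows "inverse_fourier_trunc n F z = 1 / of_real ((2 * pi)\<^sup>2) * adjoint_transform (boxcut n F) z"
proof (cases z)
  case (Pair x y)
  have "(LINT \<xi>:{- real n..real n}|lborel. exp (\<i> * of_real (x * \<xi>) + \<i> * of_real (y * of_int \<eta>)) * F (\<xi>, \<eta>))
    = (LINT \<xi>|lborel. indicator {-real n..real n} \<xi> * F (\<xi>, \<eta>) * exp (\<i> * of_real (\<xi> * x))) * trig \<eta> y" for \<eta>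
    unfolding set_lebesgue_integral_def integral_mult_left_zero[symmetric]
    by (intro Bochner_Integration.integral_cong) (auto simp: exp_add trig_def indicator_def mult_ac)
  then show ?thesis
    unfolding Pair adjoint_transform_boxcut[OF F] inverse_fourier_trunc_def by simp
qed

text \<open>
  The mirror image of the forward computation: only finitely many \<open>\<eta>\<close> occur, so that orthogonality of characters takes
  the place of Parseval's identity.
\<close>

lemma sq_norm_inverse_fourier_trunc:
  assumes F: "F \<in> L2 dual_cylinder"
  shows "sq_norm cylinder (inverse_fourier_trunc n F) = ennreal (1 / (2 * pi)\<^sup>2) * sq_norm dual_cylinder (boxcut n F)"
proof -
  have [measurable]: "F \<in> borel_measurable dual_cylinder" by (rule L2_measurable[OF F])
  define d where "d \<eta> \<xi> = indicator {-real n..real n} \<xi> * F (\<xi>, \<eta>)" for \<eta> \<xi>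
  have [measurable]: "d \<eta> \<in> borel_measurable borel" for \<eta>
    unfolding d_def by measurable
  define D where "D \<eta> x = (LINT \<xi>|lborel. d \<eta> \<xi> * exp (\<i> * of_real (\<xi> * x)))" for \<eta> x
  have [measurable]: "D \<eta> \<in> borel_measurable borel" for \<eta> unfolding D_def by measurable
  have box: "sq_norm dual_cylinder (boxcut n F) = (\<Sum>\<eta>\<in>{-int n..int n}. sq_norm lborel (d \<eta>))"
  proof -
    have "boxcut n F \<in> borel_measurable dual_cylinder" by (rule L2_measurable[OF boxcut_L2[OF F]])
    then have "sq_norm dual_cylinder (boxcut n F) = (\<integral>\<^sup>+\<eta>. (\<integral>\<^sup>+\<xi>. ennreal ((cmod (boxcut n F (\<xi>, \<eta>)))\<^sup>2) \<partial>lborel) \<partial>count_space UNIV)"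
      unfolding sq_norm_def by (intro nn_integral_dual_cylinder) measurable
    also have "\<dots> = (\<integral>\<^sup>+\<eta>. sq_norm lborel (d \<eta>) * indicator {-int n..int n} \<eta> \<partial>count_space UNIV)"
      by (intro nn_integral_cong) (auto simp: sq_norm_def d_def boxcut_def indicator_def intro!: nn_integral_cong)
    also have "\<dots> = (\<integral>\<^sup>+\<eta>. sq_norm lborel (d \<eta>) \<partial>count_space {-int n..int n})"
      by (simp add: nn_integral_count_space_indicator)
    finally show ?thesis by (simp add: nn_integral_count_space_finite)
  qed
  have d_L2: "d \<eta> \<in> L2 lborel" if "\<eta> \<in> {-int n..int n}" for \<eta>
  proof -
    have "sq_norm lborel (d \<eta>) \<le> sq_norm dual_cylinder (boxcut n F)"
      unfolding box using that by (intro member_le_sum) auto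
    also have "\<dots> < \<infinity>" by (rule L2_finite[OF boxcut_L2[OF F]])
    finally show ?thesis by (simp add: L2_iff)
  qed
  have Pl: "sq_norm lborel (D \<eta>) = ennreal (2 * pi) * sq_norm lborel (d \<eta>)" if "\<eta> \<in> {-int n..int n}" for \<eta>
    unfolding sq_norm_def[of lborel "D \<eta>"] D_def
    by (rule Plancherel_real_inverse[OF d_L2[OF that], of "real n"]) (auto simp: d_def indicator_def)
  have inv: "inverse_fourier_trunc n F (x, y) = 1 / of_real ((2 * pi)\<^sup>2) * (\<Sum>\<eta>\<in>{-int n..int n}. D \<eta> x * trig \<eta> y)" for x y
    unfolding inverse_fourier_trunc_eq[OF F] adjoint_transform_boxcut[OF F] D_def d_def ..
  have [measurable]: "inverse_fourier_trunc n F \<in> borel_measurable cylinder"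
  proof -
    have [measurable]: "boxcut n F \<in> borel_measurable dual_cylinder" by (rule L2_measurable[OF boxcut_L2[OF F]])
    show ?thesis unfolding inverse_fourier_trunc_eq[OF F, abs_def] by measurable
  qed
  have "sq_norm cylinder (inverse_fourier_trunc n F)
     = (\<integral>\<^sup>+x. (\<integral>\<^sup>+y. ennreal ((cmod (inverse_fourier_trunc n F (x, y)))\<^sup>2) \<partial>circle) \<partial>lborel)"
    unfolding sq_norm_def by (rule nn_integral_cylinder) measurable
  also have "\<dots> = (\<integral>\<^sup>+x. ennreal (1 / (2 * pi)^3) * (\<Sum>\<eta>\<in>{-int n..int n}. ennreal ((cmod (D \<eta> x))\<^sup>2)) \<partial>lborel)"
  proof (rule nn_integral_cong)
    fix x
    let ?p = "\<lambda>y. \<Sum>\<eta>\<in>{-int n..int n}. D \<eta> x * trig \<eta> y"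
    have p: "?p \<in> L2 circle" by (intro sum_L2 L2_cmult trig_L2) simp
    have "(\<integral>\<^sup>+y. ennreal ((cmod (inverse_fourier_trunc n F (x, y)))\<^sup>2) \<partial>circle) = sq_norm circle (\<lambda>y. 1 / of_real ((2 * pi)\<^sup>2) * ?p y)"
      unfolding inv sq_norm_def ..
    also have "\<dots> = ennreal ((cmod (1 / of_real ((2 * pi)\<^sup>2)))\<^sup>2) * sq_norm circle ?p"
      by (rule sq_norm_cmult[OF L2_measurable[OF p]])
    also have "sq_norm circle ?p = ennreal (2 * pi * (\<Sum>\<eta>\<in>{-int n..int n}. (cmod (D \<eta> x))\<^sup>2))"
      unfolding sq_norm_eq_integral[OF p] by (subst integral_norm_trig_sum) auto
    also have "ennreal ((cmod (1 / of_real ((2 * pi)\<^sup>2)))\<^sup>2) * \<dots>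
        = ennreal (1 / (2 * pi)^3) * ennreal (\<Sum>\<eta>\<in>{-int n..int n}. (cmod (D \<eta> x))\<^sup>2)"
    proof -
      have "(cmod (1 / of_real ((2 * pi)\<^sup>2)))\<^sup>2 * (2 * pi * s) = 1 / (2 * pi)^3 * s" for s
        unfolding norm_divide norm_of_real by (simp add: power2_eq_square power3_eq_cube field_simps)
      then show ?thesis by (simp add: ennreal_mult[symmetric] sum_nonneg)
    qed
    finally show "(\<integral>\<^sup>+y. ennreal ((cmod (inverse_fourier_trunc n F (x, y)))\<^sup>2) \<partial>circle)
      = ennreal (1 / (2 * pi)^3) * (\<Sum>\<eta>\<in>{-int n..int n}. ennreal ((cmod (D \<eta> x))\<^sup>2))" by simp
  qed
  also have "\<dots> = ennreal (1 / (2 * pi)^3) * (\<Sum>\<eta>\<in>{-int n..int n}. sq_norm lborel (D \<eta>))"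
    unfolding sq_norm_def by (subst nn_integral_cmult) (auto simp: nn_integral_sum simp del: sum_ennreal)
  also have "\<dots> = ennreal (1 / (2 * pi)^3) * (ennreal (2 * pi) * sq_norm dual_cylinder (boxcut n F))"
    unfolding box sum_distrib_left using Pl by simp
  also have "\<dots> = ennreal (1 / (2 * pi)\<^sup>2) * sq_norm dual_cylinder (boxcut n F)"
    unfolding mult.assoc[symmetric] by (simp add: ennreal_mult[symmetric] power2_eq_square power3_eq_cube)
  finally show ?thesis .
qed

lemma inverse_fourier_trunc_L2:
  assumes F: "F \<in> L2 dual_cylinder"
  shows "inverse_fourier_trunc n F \<in> L2 cylinder"
proof -
  have [measurable]: "boxcut n F \<in> borel_measurable dual_cylinder" by (rule L2_measurable[OF boxcut_L2[OF F]])
  have "inverse_fourier_trunc n F \<in> borel_measurable cylinder"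
    unfolding inverse_fourier_trunc_eq[OF F, abs_def] by measurable
  then show ?thesis
    using L2_finite[OF boxcut_L2[OF F, of n]] by (simp add: L2_iff sq_norm_inverse_fourier_trunc[OF F] ennreal_mult_less_top)
qed

lemma integral_transform_adjoint:
  assumes g: "integrable cylinder g" and G: "integrable dual_cylinder G"
  shows "(LINT w|dual_cylinder. integral_transform g w * cnj (G w)) = (LINT z|cylinder. g z * cnj (adjoint_transform G z))"
proof -
  have [measurable]: "g \<in> borel_measurable cylinder" "G \<in> borel_measurable dual_cylinder" using g G by auto
  have G'[measurable]: "(\<lambda>w. cnj (G w)) \<in> borel_measurable dual_cylinder"
    by (rule borel_measurable_continuous_on[where f = cnj]) (auto intro: continuous_intros)
  have int: "integrable (dual_cylinder \<Otimes>\<^sub>M cylinder) (\<lambda>(w, z). g z * cnj (character w z) * cnj (G w))"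
  proof (rule Bochner_Integration.integrable_bound[of _ "\<lambda>(w, z). cmod (G w) * cmod (g z)"])
    have "(\<integral>\<^sup>+wz. ennreal (cmod (G (fst wz)) * cmod (g (snd wz))) \<partial>(dual_cylinder \<Otimes>\<^sub>M cylinder))
       = (\<integral>\<^sup>+w. (\<integral>\<^sup>+z. ennreal (cmod (G w)) * ennreal (cmod (g z)) \<partial>cylinder) \<partial>dual_cylinder)"
      by (subst cylinder.nn_integral_fst[symmetric]) (auto simp: ennreal_mult)
    also have "\<dots> = (\<integral>\<^sup>+w. ennreal (cmod (G w)) \<partial>dual_cylinder) * (\<integral>\<^sup>+z. ennreal (cmod (g z)) \<partial>cylinder)"
      by (simp add: nn_integral_cmult nn_integral_multc)
    also have "\<dots> < \<infinity>" using g G by (auto simp: integrable_iff_bounded ennreal_mult_less_top)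
    finally show "integrable (dual_cylinder \<Otimes>\<^sub>M cylinder) (\<lambda>(w, z). cmod (G w) * cmod (g z))"
      by (auto simp: integrable_iff_bounded case_prod_beta' abs_mult)
    show "(\<lambda>(w, z). g z * cnj (character w z) * cnj (G w)) \<in> borel_measurable (dual_cylinder \<Otimes>\<^sub>M cylinder)"
      by measurable
  qed (auto simp: norm_mult)
  have "(LINT w|dual_cylinder. integral_transform g w * cnj (G w))
     = (LINT w|dual_cylinder. (LINT z|cylinder. g z * cnj (character w z) * cnj (G w)))"
    unfolding integral_transform_def by simp
  also have "\<dots> = (LINT z|cylinder. (LINT w|dual_cylinder. g z * cnj (character w z) * cnj (G w)))"
    by (rule dual_cylinder_cylinder.Fubini_integral[OF int, symmetric])
  also have "\<dots> = (LINT z|cylinder. (LINT w|dual_cylinder. g z * cnj (G w * character w z)))"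
    by (simp add: mult_ac)
  also have "\<dots> = (LINT z|cylinder. g z * cnj (adjoint_transform G z))"
    unfolding adjoint_transform_def by (simp del: complex_cnj_mult)
  finally show ?thesis .
qed

lemma fourier_trunc_measurable [measurable]:
  "f \<in> borel_measurable cylinder \<Longrightarrow> fourier_trunc n f \<in> borel_measurable dual_cylinder"
  unfolding fourier_trunc_eq by measurable

lemma sq_norm_fourier_trunc:
  assumes "f \<in> L2 cylinder"
  shows "sq_norm dual_cylinder (fourier_trunc n f) = ennreal ((2 * pi)\<^sup>2) * sq_norm cylinder (cutoff n f)"
  unfolding fourier_trunc_eq
  by (rule sq_norm_integral_transform[OF cutoff_L2[OF assms], of "real n"]) (auto simp: cutoff_def indicator_def)

lemma fourier_trunc_L2:
  assumes "f \<in> L2 cylinder"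
  shows "fourier_trunc n f \<in> L2 dual_cylinder"
  using L2_finite[OF cutoff_L2[OF assms, of n]] L2_measurable[OF assms]
  by (simp add: L2_iff sq_norm_fourier_trunc[OF assms] ennreal_mult_less_top)

lemma fourier_trunc_add:
  assumes f: "f \<in> L2 cylinder" and g: "g \<in> L2 cylinder"
  shows "fourier_trunc n (\<lambda>z. a * f z + g z) w = a * fourier_trunc n f w + fourier_trunc n g w"
proof -
  have *: "integrable cylinder (\<lambda>z. cutoff n f z * cnj (character w z))" "integrable cylinder (\<lambda>z. cutoff n g z * cnj (character w z))"
    using f g by (auto intro: integral_transform_integrable cutoff_integrable)
  have "fourier_trunc n (\<lambda>z. a * f z + g z) w
    = (LINT z|cylinder. a * (cutoff n f z * cnj (character w z)) + cutoff n g z * cnj (character w z))"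
    unfolding fourier_trunc_eq integral_transform_def
    by (intro Bochner_Integration.integral_cong) (auto simp: cutoff_def algebra_simps)
  also have "\<dots> = a * fourier_trunc n f w + fourier_trunc n g w"
    using * by (simp add: fourier_trunc_eq integral_transform_def)
  finally show ?thesis .
qed

text \<open>
  This is Fourier inversion for box truncations, obtained without a pointwise inversion formula. The truncated forward and the truncated inverse
  transform are both isometries up to the factor \<open>(2\<pi>)\<^sup>2\<close>, and they are adjoint to each other. Expanding the squared distance of the
  two sides therefore gives \<open>(2\<pi>)\<^sup>2\<close> times the squared norm of the part of the inverse transform outside \<open>|x| \<le> n\<close>.
\<close>

lemma fourier_trunc_inverse_tendsto:
  assumes F: "F \<in> L2 dual_cylinder"
  shows "L2_tendsto dual_cylinder (\<lambda>n. fourier_trunc n (inverse_fourier_trunc m F)) (boxcut m F)"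
proof -
  define g where "g = inverse_fourier_trunc m F"
  have g: "g \<in> L2 cylinder" unfolding g_def by (rule inverse_fourier_trunc_L2[OF F])
  have G: "boxcut m F \<in> L2 dual_cylinder" by (rule boxcut_L2[OF F])
  let ?c = "(2 * pi)\<^sup>2"
  have *: "sq_norm dual_cylinder (\<lambda>w. fourier_trunc n g w - boxcut m F w) = ennreal ?c * sq_norm cylinder (\<lambda>z. cutoff n g z - g z)" for n
  proof -
    have c: "cutoff n g \<in> L2 cylinder" by (rule cutoff_L2[OF g])
    have adj: "adjoint_transform (boxcut m F) z = of_real ?c * g z" for z
      unfolding g_def inverse_fourier_trunc_eq[OF F] by simp
    \<comment> \<open>The three terms of the expanded square: the two isometries, and adjointness for the mixed term.\<close>
    have 1: "(LINT w|dual_cylinder. (cmod (fourier_trunc n g w))\<^sup>2) = ?c * (LINT z|cylinder. (cmod (cutoff n g z))\<^sup>2)"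
      using sq_norm_fourier_trunc[OF g, of n] unfolding sq_norm_eq_integral[OF fourier_trunc_L2[OF g]] sq_norm_eq_integral[OF c]
      by (simp add: ennreal_mult[symmetric])
    have 2: "(LINT w|dual_cylinder. (cmod (boxcut m F w))\<^sup>2) = ?c * (LINT z|cylinder. (cmod (g z))\<^sup>2)"
      using sq_norm_inverse_fourier_trunc[OF F, of m] unfolding g_def[symmetric] sq_norm_eq_integral[OF G] sq_norm_eq_integral[OF g]
      by (simp add: ennreal_mult[symmetric] divide_simps mult.commute)
    have 3: "(LINT w|dual_cylinder. fourier_trunc n g w * cnj (boxcut m F w)) = of_real ?c * (LINT z|cylinder. cutoff n g z * cnj (g z))"
      unfolding fourier_trunc_eq
      by (subst integral_transform_adjoint[OF cutoff_integrable[OF g] boxcut_integrable[OF F]])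
         (simp add: adj mult_ac flip: integral_mult_right_zero)
    have "(LINT w|dual_cylinder. (cmod (fourier_trunc n g w - boxcut m F w))\<^sup>2) = ?c * (LINT z|cylinder. (cmod (cutoff n g z - g z))\<^sup>2)"
      unfolding integral_norm_diff_sq[OF fourier_trunc_L2[OF g] G] integral_norm_diff_sq[OF c g] 1 2 3
      by (simp add: algebra_simps)
    then show ?thesis
      unfolding sq_norm_eq_integral[OF L2_diff[OF fourier_trunc_L2[OF g] G]] sq_norm_eq_integral[OF L2_diff[OF c g]]
      by (simp add: ennreal_mult[symmetric])
  qed
  have "(\<lambda>n. ennreal ?c * sq_norm cylinder (\<lambda>z. cutoff n g z - g z)) \<longlonglongrightarrow> ennreal ?c * 0"
    using cutoff_tendsto[OF g] by (intro ennreal_tendsto_cmult) (auto simp: L2_tendsto_def sq_norm_def)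
  then show ?thesis
    unfolding L2_tendsto_def sq_norm_def[symmetric] g_def[symmetric] * by simp
qed

section \<open>The Fourier transform on the cylinder\<close>

lemma L2_tendsto_isometric_image:
  assumes x: "\<And>n. x n \<in> borel_measurable M" "f \<in> borel_measurable M" and lim: "L2_tendsto M x f"
    and u: "\<And>n. u n \<in> borel_measurable N"
    and iso: "\<And>m n. sq_norm N (\<lambda>z. u m z - u n z) = ennreal c * sq_norm M (\<lambda>z. x m z - x n z)"
  obtains g where "g \<in> borel_measurable N" "L2_tendsto N u g"
proof (rule L2_complete[OF u])
  fix e :: real assume e: "e > 0"
  have "(\<lambda>n. ennreal c * sq_norm M (\<lambda>z. x n z - f z)) \<longlonglongrightarrow> ennreal c * 0"
    using lim by (intro ennreal_tendsto_cmult) (auto simp: L2_tendsto_def sq_norm_def)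
  then have "eventually (\<lambda>n. ennreal c * sq_norm M (\<lambda>z. x n z - f z) < ennreal (e / 4)) sequentially"
    using e by (intro order_tendstoD(2)) auto
  then obtain K where K: "\<And>n. n \<ge> K \<Longrightarrow> ennreal c * sq_norm M (\<lambda>z. x n z - f z) < ennreal (e / 4)"
    unfolding eventually_sequentially by blast
  have "sq_norm N (\<lambda>z. u m z - u n z) \<le> ennreal e" if mn: "m \<ge> K" "n \<ge> K" for m n
  proof -
    have "sq_norm M (\<lambda>z. x m z - x n z) \<le> 2 * sq_norm M (\<lambda>z. x m z - f z) + 2 * sq_norm M (\<lambda>z. f z - x n z)"
      using x sq_norm_add[of "\<lambda>z. x m z - f z" M "\<lambda>z. f z - x n z"] by simp
    then have "ennreal c * sq_norm M (\<lambda>z. x m z - x n z) \<le> ennreal c * (2 * sq_norm M (\<lambda>z. x m z - f z) + 2 * sq_norm M (\<lambda>z. x n z - f z))"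
      by (intro mult_left_mono) (auto simp: sq_norm_minus_commute[of M f])
    also have "\<dots> = 2 * (ennreal c * sq_norm M (\<lambda>z. x m z - f z)) + 2 * (ennreal c * sq_norm M (\<lambda>z. x n z - f z))"
      by (simp add: distrib_left mult_ac)
    also have "\<dots> \<le> 2 * ennreal (e / 4) + 2 * ennreal (e / 4)"
      using K mn by (intro add_mono mult_left_mono) (auto intro: less_imp_le)
    also have "\<dots> = ennreal e" using e
      by (simp add: two_mult_ennreal ennreal_plus[symmetric] del: ennreal_plus)
    finally show ?thesis by (simp add: iso)
  qed
  then show "\<exists>N'. \<forall>m\<ge>N'. \<forall>n\<ge>N'. sq_norm N (\<lambda>z. u m z - u n z) \<le> ennreal e" by blast
qed (rule that)

lemma L2_tendsto_iff: "L2_tendsto M u g \<longleftrightarrow> (\<lambda>n. sq_norm M (\<lambda>z. u n z - g z)) \<longlonglongrightarrow> 0"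
  by (simp add: L2_tendsto_def sq_norm_def)

lemma L2_tendsto_imp_L2:
  assumes u: "\<And>n. u n \<in> L2 M" and g: "g \<in> borel_measurable M" and lim: "L2_tendsto M u g"
  shows "g \<in> L2 M"
proof -
  have "eventually (\<lambda>n. sq_norm M (\<lambda>z. u n z - g z) < 1) sequentially"
    using lim unfolding L2_tendsto_iff by (intro order_tendstoD(2)) auto
  then obtain n where n: "sq_norm M (\<lambda>z. u n z - g z) < 1" unfolding eventually_sequentially by blast
  then have "(\<lambda>z. u n z - g z) \<in> L2 M"
    using L2_measurable[OF u] g by (auto simp: L2_iff intro: order_less_trans)
  from L2_diff[OF u[of n] this] show ?thesis by simp
qed

lemma L2_tendsto_lincomb:
  assumes m: "\<And>n. u n \<in> borel_measurable M" "\<And>n. v n \<in> borel_measurable M" "f \<in> borel_measurable M" "g \<in> borel_measurable M"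
    and lim: "L2_tendsto M u f" "L2_tendsto M v g"
  shows "L2_tendsto M (\<lambda>n z. a * u n z + v n z) (\<lambda>z. a * f z + g z)"
proof -
  note [measurable] = m
  let ?b = "\<lambda>n. 2 * (ennreal ((cmod a)\<^sup>2) * sq_norm M (\<lambda>z. u n z - f z)) + 2 * sq_norm M (\<lambda>z. v n z - g z)"
  have "sq_norm M (\<lambda>z. a * u n z + v n z - (a * f z + g z)) \<le> ?b n" for n
  proof -
    have "a * u n z + v n z - (a * f z + g z) = a * (u n z - f z) + (v n z - g z)" for z
      by (simp add: algebra_simps)
    note eq = this
    show ?thesis unfolding eq
      using sq_norm_add[of "\<lambda>z. a * (u n z - f z)" M "\<lambda>z. v n z - g z"]
        sq_norm_cmult[of "\<lambda>z. u n z - f z" M a] by simp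
  qed
  then have le: "eventually (\<lambda>n. sq_norm M (\<lambda>z. a * u n z + v n z - (a * f z + g z)) \<le> ?b n) sequentially"
    by (intro always_eventually allI)
  have "?b \<longlonglongrightarrow> 2 * (ennreal ((cmod a)\<^sup>2) * 0) + 2 * 0"
    using lim unfolding L2_tendsto_iff by (intro tendsto_add ennreal_tendsto_cmult) auto
  then have b0: "?b \<longlonglongrightarrow> 0" by simp
  have "eventually (\<lambda>n. 0 \<le> sq_norm M (\<lambda>z. a * u n z + v n z - (a * f z + g z))) sequentially" by simp
  from tendsto_sandwich[OF this le tendsto_const b0] show ?thesis unfolding L2_tendsto_iff .
qed

text \<open>
  By Fatou's lemma a pointwise limit agrees with the mean square limit; this identifies the transform defined by a limit
  with the absolutely convergent integral.
\<close>

lemma L2_tendsto_pointwise_unique: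
  assumes m[measurable]: "\<And>n. u n \<in> borel_measurable M" "g \<in> borel_measurable M" "h \<in> borel_measurable M"
    and lim: "L2_tendsto M u g" and pw: "AE z in M. (\<lambda>n. u n z) \<longlonglongrightarrow> h z"
  shows "AE z in M. g z = h z"
proof -
  have "sq_norm M (\<lambda>z. h z - g z) = (\<integral>\<^sup>+z. liminf (\<lambda>n. ennreal ((cmod (u n z - g z))\<^sup>2)) \<partial>M)"
    unfolding sq_norm_def
  proof (rule nn_integral_cong_AE, use pw in eventually_elim)
    case (elim z)
    then have "(\<lambda>n. ennreal ((cmod (u n z - g z))\<^sup>2)) \<longlonglongrightarrow> ennreal ((cmod (h z - g z))\<^sup>2)"
      by (intro tendsto_ennrealI tendsto_intros)
    then show ?case by (rule lim_imp_Liminf[symmetric, rotated]) simp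
  qed
  also have "\<dots> \<le> liminf (\<lambda>n. sq_norm M (\<lambda>z. u n z - g z))"
    unfolding sq_norm_def by (rule nn_integral_liminf) simp
  also have "\<dots> = 0" using lim unfolding L2_tendsto_iff by (rule lim_imp_Liminf[rotated]) simp
  finally have "sq_norm M (\<lambda>z. h z - g z) = 0" by simp
  then show ?thesis by (subst (asm) sq_norm_eq_0_iff) (auto elim: eventually_mono)
qed

text \<open>
  The limit that defines the transform exists: differences of truncated transforms are transforms of differences of truncations, so
  by the isometry they form a Cauchy sequence.
\<close>

lemma fourier_L2: "f \<in> L2 cylinder \<Longrightarrow> fourier f \<in> L2 dual_cylinder"
  and fourier_tendsto: "f \<in> L2 cylinder \<Longrightarrow> L2_tendsto dual_cylinder (\<lambda>n. fourier_trunc n f) (fourier f)"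
proof -
  assume f: "f \<in> L2 cylinder"
  note [measurable] = L2_measurable[OF f]
  have iso: "sq_norm dual_cylinder (\<lambda>w. fourier_trunc m f w - fourier_trunc n f w)
     = ennreal ((2 * pi)\<^sup>2) * sq_norm cylinder (\<lambda>z. cutoff m f z - cutoff n f z)" for m n
  proof -
    have "fourier_trunc m f w - fourier_trunc n f w = integral_transform (\<lambda>z. cutoff m f z - cutoff n f z) w" for w
    proof -
      have "integral_transform (\<lambda>z. cutoff m f z - cutoff n f z) w
         = (LINT z|cylinder. cutoff m f z * cnj (character w z) - cutoff n f z * cnj (character w z))"
        by (simp add: integral_transform_def left_diff_distrib)
      also have "\<dots> = fourier_trunc m f w - fourier_trunc n f w"
        unfolding fourier_trunc_eq integral_transform_def
        by (intro Bochner_Integration.integral_diff integral_transform_integrable cutoff_integrable f)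
      finally show ?thesis by simp
    qed
    moreover have "cutoff m f z - cutoff n f z = 0" if "real (max m n) < \<bar>fst z\<bar>" for z
      using that by (auto simp: cutoff_def indicator_def)
    ultimately show ?thesis
      using sq_norm_integral_transform[OF L2_diff[OF cutoff_L2[OF f] cutoff_L2[OF f]], of "real (max m n)" m n]
      by simp
  qed
  obtain F where F: "F \<in> borel_measurable dual_cylinder" "L2_tendsto dual_cylinder (\<lambda>n. fourier_trunc n f) F"
    using L2_tendsto_isometric_image[OF _ _ cutoff_tendsto[OF f] _ iso] by force
  then have "F \<in> L2 dual_cylinder" by (intro L2_tendsto_imp_L2[OF fourier_trunc_L2[OF f]])
  with F have "\<exists>F. F \<in> L2 dual_cylinder \<and> L2_tendsto dual_cylinder (\<lambda>n. fourier_trunc n f) F" by blast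
  from someI_ex[OF this]
  show "fourier f \<in> L2 dual_cylinder" "L2_tendsto dual_cylinder (\<lambda>n. fourier_trunc n f) (fourier f)"
    by (simp_all add: fourier_def)
qed

lemma fourier_unique:
  assumes f: "f \<in> L2 cylinder" and F: "F \<in> borel_measurable dual_cylinder"
    and lim: "L2_tendsto dual_cylinder (\<lambda>n. fourier_trunc n f) F"
  shows "AE w in dual_cylinder. fourier f w = F w"
  by (rule L2_tendsto_unique[OF fourier_trunc_measurable[OF L2_measurable[OF f]] L2_measurable[OF fourier_L2[OF f]] F fourier_tendsto[OF f] lim])

theorem Plancherel_cylinder:
  assumes f: "f \<in> L2 cylinder"
  shows "sq_norm dual_cylinder (fourier f) = ennreal ((2 * pi)\<^sup>2) * sq_norm cylinder f"
proof -
  have [measurable]: "f \<in> borel_measurable cylinder" by (rule L2_measurable[OF f])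
  define c where "c = (SUP n. sq_norm cylinder (cutoff n f))"
  have "incseq (\<lambda>n. sq_norm cylinder (cutoff n f))"
    unfolding incseq_def sq_norm_def
    by (intro allI impI nn_integral_mono ennreal_leI power_mono) (auto simp: cutoff_def indicator_def)
  then have lim: "(\<lambda>n. sq_norm cylinder (cutoff n f)) \<longlonglongrightarrow> c" unfolding c_def by (rule LIMSEQ_SUP)
  have c: "sq_norm cylinder f = c"
    by (rule L2_tendsto_sq_norm[OF _ _ cutoff_tendsto[OF f] lim]) measurable
  have "(\<lambda>n. sq_norm dual_cylinder (fourier_trunc n f)) \<longlonglongrightarrow> ennreal ((2 * pi)\<^sup>2) * c"
    unfolding sq_norm_fourier_trunc[OF f] by (intro ennreal_tendsto_cmult lim) simp
  from L2_tendsto_sq_norm[OF _ L2_measurable[OF fourier_L2[OF f]] fourier_tendsto[OF f] this]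
  show ?thesis unfolding c by simp
qed

lemma fourier_lincomb:
  assumes f: "f \<in> L2 cylinder" and g: "g \<in> L2 cylinder"
  shows "AE w in dual_cylinder. fourier (\<lambda>z. a * f z + g z) w = a * fourier f w + fourier g w"
proof (rule fourier_unique)
  note [measurable] = L2_measurable[OF f] L2_measurable[OF g] L2_measurable[OF fourier_L2[OF f]] L2_measurable[OF fourier_L2[OF g]]
  show "(\<lambda>z. a * f z + g z) \<in> L2 cylinder" by (intro L2_add L2_cmult f g)
  show "(\<lambda>w. a * fourier f w + fourier g w) \<in> borel_measurable dual_cylinder" by measurable
  show "L2_tendsto dual_cylinder (\<lambda>n. fourier_trunc n (\<lambda>z. a * f z + g z)) (\<lambda>w. a * fourier f w + fourier g w)"
    unfolding fourier_trunc_add[OF f g, abs_def]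
    by (rule L2_tendsto_lincomb[OF _ _ _ _ fourier_tendsto[OF f] fourier_tendsto[OF g]]) measurable
qed

lemma fourier_zero: "AE w in dual_cylinder. fourier (\<lambda>z. 0) w = 0"
proof (rule fourier_unique)
  have "fourier_trunc n (\<lambda>z. 0) = (\<lambda>w. 0)" for n
    by (auto simp: fourier_trunc_eq integral_transform_def cutoff_def)
  then show "L2_tendsto dual_cylinder (\<lambda>n. fourier_trunc n (\<lambda>z. 0)) (\<lambda>w. 0)"
    by (simp add: L2_tendsto_iff sq_norm_def)
qed (auto simp: L2_iff sq_norm_def)

lemma fourier_cmult:
  assumes f: "f \<in> L2 cylinder"
  shows "AE w in dual_cylinder. fourier (\<lambda>z. a * f z) w = a * fourier f w"
  using fourier_lincomb[OF f, of "\<lambda>z. 0" a] fourier_zero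
  by (auto simp: L2_iff sq_norm_def elim: eventually_elim2)

lemma fourier_diff:
  assumes f: "f \<in> L2 cylinder" and g: "g \<in> L2 cylinder"
  shows "AE w in dual_cylinder. fourier (\<lambda>z. f z - g z) w = fourier f w - fourier g w"
  using fourier_lincomb[OF g f, of "-1"] by simp

lemma fourier_sum:
  assumes "finite A" "\<And>i. i \<in> A \<Longrightarrow> f i \<in> L2 cylinder"
  shows "AE w in dual_cylinder. fourier (\<lambda>z. \<Sum>i\<in>A. f i z) w = (\<Sum>i\<in>A. fourier (f i) w)"
  using assms
proof (induction A rule: finite_induct)
  case empty then show ?case using fourier_zero by simp
next
  case (insert a A)
  have "AE w in dual_cylinder. fourier (\<lambda>z. 1 * f a z + (\<Sum>i\<in>A. f i z)) w = 1 * fourier (f a) w + fourier (\<lambda>z. \<Sum>i\<in>A. f i z) w"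
    using insert by (intro fourier_lincomb sum_L2) auto
  moreover have "AE w in dual_cylinder. fourier (\<lambda>z. \<Sum>i\<in>A. f i z) w = (\<Sum>i\<in>A. fourier (f i) w)"
    using insert by auto
  ultimately show ?case using insert by (auto elim!: eventually_elim2)
qed

lemma sq_norm_fourier_diff:
  assumes f: "f \<in> L2 cylinder" and g: "g \<in> L2 cylinder"
  shows "sq_norm dual_cylinder (\<lambda>w. fourier f w - fourier g w) = ennreal ((2 * pi)\<^sup>2) * sq_norm cylinder (\<lambda>z. f z - g z)"
proof -
  have "sq_norm dual_cylinder (\<lambda>w. fourier f w - fourier g w) = sq_norm dual_cylinder (fourier (\<lambda>z. f z - g z))"
    by (rule sq_norm_cong_AE, use fourier_diff[OF f g] in eventually_elim) simp
  then show ?thesis using Plancherel_cylinder[OF L2_diff[OF f g]] by simp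
qed

lemma fourier_trunc_pointwise:
  assumes f: "f \<in> L2 cylinder" and i: "integrable cylinder f"
  shows "(\<lambda>n. fourier_trunc n f w) \<longlonglongrightarrow> integral_transform f w"
  unfolding fourier_trunc_eq integral_transform_def
proof (rule integral_dominated_convergence[where w = "\<lambda>z. cmod (f z)"])
  note [measurable] = L2_measurable[OF f]
  show "(\<lambda>z. f z * cnj (character w z)) \<in> borel_measurable cylinder"
    "(\<lambda>z. cutoff n f z * cnj (character w z)) \<in> borel_measurable cylinder" for n by measurable
  show "AE z in cylinder. (\<lambda>n. cutoff n f z * cnj (character w z)) \<longlonglongrightarrow> f z * cnj (character w z)"
  proof (rule AE_I2, rule tendsto_eventually)
    fix z :: "real \<times> real"
    show "eventually (\<lambda>n. cutoff n f z * cnj (character w z) = f z * cnj (character w z)) sequentially"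
      using eventually_ge_at_top[of "nat \<lceil>\<bar>fst z\<bar>\<rceil>"] by eventually_elim (auto simp: cutoff_def abs_le_iff indicator_def)
  qed
qed (use i in \<open>auto simp: norm_mult cutoff_def indicator_def\<close>)

lemma fourier_integrable:
  assumes f: "f \<in> L2 cylinder" and i: "integrable cylinder f"
  shows "AE w in dual_cylinder. fourier f w = integral_transform f w"
proof (rule L2_tendsto_pointwise_unique[OF _ _ _ fourier_tendsto[OF f]])
  note [measurable] = L2_measurable[OF f] L2_measurable[OF fourier_L2[OF f]]
  show "fourier_trunc n f \<in> borel_measurable dual_cylinder" "fourier f \<in> borel_measurable dual_cylinder"
    "integral_transform f \<in> borel_measurable dual_cylinder" for n by measurable
qed (simp add: fourier_trunc_pointwise[OF f i])

definition shift :: "real \<Rightarrow> real \<times> int \<Rightarrow> real \<times> int" where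
  "shift h w = (fst w + h, snd w)"

lemma shift_measurable [measurable]: "shift h \<in> measurable dual_cylinder dual_cylinder"
  unfolding dual_cylinder_def shift_def by measurable

lemma nn_integral_shift:
  assumes [measurable]: "f \<in> borel_measurable dual_cylinder"
  shows "(\<integral>\<^sup>+w. f (shift h w) \<partial>dual_cylinder) = (\<integral>\<^sup>+w. f w \<partial>dual_cylinder)"
proof -
  have [measurable]: "(\<lambda>\<xi>. f (\<xi>, \<eta>)) \<in> borel_measurable borel" for \<eta> by measurable
  have "(\<integral>\<^sup>+\<xi>. f (\<xi>, \<eta>) \<partial>lborel) = ennreal \<bar>1\<bar> * (\<integral>\<^sup>+\<xi>. f (h + 1 * \<xi>, \<eta>) \<partial>lborel)" for \<eta>
    by (rule nn_integral_real_affine) auto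
  then show ?thesis
    by (simp add: nn_integral_dual_cylinder shift_def add.commute)
qed

lemma sq_norm_shift: "F \<in> borel_measurable dual_cylinder \<Longrightarrow> sq_norm dual_cylinder (\<lambda>w. F (shift h w)) = sq_norm dual_cylinder F"
  unfolding sq_norm_def by (rule nn_integral_shift) simp

lemma modulation_L2:
  assumes "f \<in> L2 cylinder"
  shows "(\<lambda>z. exp (- \<i> * of_real (h * fst z)) * f z) \<in> L2 cylinder"
  by (rule L2_bounded_mult[OF assms, where B = 1]) auto

lemma fourier_modulation:
  assumes f: "f \<in> L2 cylinder"
  shows "AE w in dual_cylinder. fourier (\<lambda>z. exp (- \<i> * of_real (h * fst z)) * f z) w = fourier f (shift h w)"
proof (rule fourier_unique[OF modulation_L2[OF f]])
  note [measurable] = L2_measurable[OF f] L2_measurable[OF fourier_L2[OF f]]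
  show "(\<lambda>w. fourier f (shift h w)) \<in> borel_measurable dual_cylinder" by measurable
  have "fourier_trunc n (\<lambda>z. exp (- \<i> * of_real (h * fst z)) * f z) w = fourier_trunc n f (shift h w)" for n w
    unfolding fourier_trunc_eq integral_transform_def
    by (intro Bochner_Integration.integral_cong)
       (auto simp: cutoff_def character_def shift_def exp_cnj exp_add exp_minus exp_diff algebra_simps)
  then have "sq_norm dual_cylinder (\<lambda>w. fourier_trunc n (\<lambda>z. exp (- \<i> * of_real (h * fst z)) * f z) w - fourier f (shift h w))
     = sq_norm dual_cylinder (\<lambda>w. fourier_trunc n f w - fourier f w)" for n
    using sq_norm_shift[of "\<lambda>w. fourier_trunc n f w - fourier f w" h] by simp
  then show "L2_tendsto dual_cylinder (\<lambda>n. fourier_trunc n (\<lambda>z. exp (- \<i> * of_real (h * fst z)) * f z)) (\<lambda>w. fourier f (shift h w))"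
    using fourier_tendsto[OF f] by (simp add: L2_tendsto_iff)
qed

lemma inverse_fourier_L2: "F \<in> L2 dual_cylinder \<Longrightarrow> inverse_fourier F \<in> L2 cylinder"
  and inverse_fourier_tendsto: "F \<in> L2 dual_cylinder \<Longrightarrow> L2_tendsto cylinder (\<lambda>n. inverse_fourier_trunc n F) (inverse_fourier F)"
proof -
  assume F: "F \<in> L2 dual_cylinder"
  have iso: "sq_norm cylinder (\<lambda>z. inverse_fourier_trunc m F z - inverse_fourier_trunc n F z)
     = ennreal (1 / (2 * pi)\<^sup>2) * sq_norm dual_cylinder (\<lambda>w. boxcut m F w - boxcut n F w)" for m n
  proof -
    define H where "H w = boxcut m F w - boxcut n F w" for w
    have H: "H \<in> L2 dual_cylinder" unfolding H_def by (intro L2_diff boxcut_L2 F)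
    have HN: "boxcut (max m n) H = H"
    proof
      fix w
      show "boxcut (max m n) H w = H w"
        by (cases w) (auto simp: boxcut_def H_def indicator_def)
    qed
    have "inverse_fourier_trunc m F z - inverse_fourier_trunc n F z = inverse_fourier_trunc (max m n) H z" for z
    proof -
      have "adjoint_transform H z = (LINT w|dual_cylinder. boxcut m F w * character w z - boxcut n F w * character w z)"
        by (simp add: adjoint_transform_def H_def left_diff_distrib)
      also have "\<dots> = adjoint_transform (boxcut m F) z - adjoint_transform (boxcut n F) z"
        unfolding adjoint_transform_def
        by (intro Bochner_Integration.integral_diff adjoint_transform_integrable boxcut_integrable F)
      finally show ?thesis
        unfolding inverse_fourier_trunc_eq[OF F] inverse_fourier_trunc_eq[OF H] HN by (simp add: right_diff_distrib)
    qed
    then show ?thesis using sq_norm_inverse_fourier_trunc[OF H, of "max m n"] unfolding HN by (simp add: H_def[abs_def])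
  qed
  obtain g where g: "g \<in> borel_measurable cylinder" "L2_tendsto cylinder (\<lambda>n. inverse_fourier_trunc n F) g"
    using L2_tendsto_isometric_image[OF L2_measurable[OF boxcut_L2[OF F]] L2_measurable[OF F] boxcut_tendsto[OF F]
      L2_measurable[OF inverse_fourier_trunc_L2[OF F]] iso] by blast
  then have "g \<in> L2 cylinder" by (intro L2_tendsto_imp_L2[OF inverse_fourier_trunc_L2[OF F]])
  with g have "\<exists>g. g \<in> L2 cylinder \<and> L2_tendsto cylinder (\<lambda>n. inverse_fourier_trunc n F) g" by blast
  from someI_ex[OF this]
  show "inverse_fourier F \<in> L2 cylinder" "L2_tendsto cylinder (\<lambda>n. inverse_fourier_trunc n F) (inverse_fourier F)"
    by (simp_all add: inverse_fourier_def)
qed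

text \<open>
  The transforms of the truncated inverses are box truncations of \<open>F\<close>; they converge to \<open>F\<close>, and by Plancherel's theorem also to the transform of
  the limit.
\<close>

theorem fourier_inverse_fourier:
  assumes F: "F \<in> L2 dual_cylinder"
  shows "AE w in dual_cylinder. fourier (inverse_fourier F) w = F w"
proof (rule L2_tendsto_unique)
  let ?u = "\<lambda>m. inverse_fourier_trunc m F"
  have u: "?u m \<in> L2 cylinder" for m by (rule inverse_fourier_trunc_L2[OF F])
  have g: "inverse_fourier F \<in> L2 cylinder" by (rule inverse_fourier_L2[OF F])
  show "fourier (?u m) \<in> borel_measurable dual_cylinder" for m by (rule L2_measurable[OF fourier_L2[OF u]])
  show "fourier (inverse_fourier F) \<in> borel_measurable dual_cylinder" by (rule L2_measurable[OF fourier_L2[OF g]])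
  show "F \<in> borel_measurable dual_cylinder" by (rule L2_measurable[OF F])
  have "(\<lambda>m. ennreal ((2 * pi)\<^sup>2) * sq_norm cylinder (\<lambda>z. ?u m z - inverse_fourier F z)) \<longlonglongrightarrow> ennreal ((2 * pi)\<^sup>2) * 0"
    using inverse_fourier_tendsto[OF F] by (intro ennreal_tendsto_cmult) (auto simp: L2_tendsto_iff)
  then show "L2_tendsto dual_cylinder (\<lambda>m. fourier (?u m)) (fourier (inverse_fourier F))"
    unfolding L2_tendsto_iff sq_norm_fourier_diff[OF u g] by simp
  have "sq_norm dual_cylinder (\<lambda>w. fourier (?u m) w - F w) = sq_norm dual_cylinder (\<lambda>w. boxcut m F w - F w)" for m
    using fourier_unique[OF u L2_measurable[OF boxcut_L2[OF F]] fourier_trunc_inverse_tendsto[OF F], of m]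
    by (intro sq_norm_cong_AE) (auto elim: eventually_mono)
  then show "L2_tendsto dual_cylinder (\<lambda>m. fourier (?u m)) F"
    using boxcut_tendsto[OF F] by (simp add: L2_tendsto_iff)
qed

lemma fourier_multiplier:
  assumes f: "f \<in> L2 cylinder" and m: "m \<in> borel_measurable dual_cylinder" "\<And>w. cmod (m w) \<le> 1"
  shows "inverse_fourier (\<lambda>w. m w * fourier f w) \<in> L2 cylinder"
    "AE w in dual_cylinder. fourier (inverse_fourier (\<lambda>w. m w * fourier f w)) w = m w * fourier f w"
proof -
  have "(\<lambda>w. m w * fourier f w) \<in> L2 dual_cylinder"
    by (rule L2_bounded_mult[OF fourier_L2[OF f], where B = 1]) (use m in auto)
  then show "inverse_fourier (\<lambda>w. m w * fourier f w) \<in> L2 cylinder"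
    "AE w in dual_cylinder. fourier (inverse_fourier (\<lambda>w. m w * fourier f w)) w = m w * fourier f w"
    by (rule inverse_fourier_L2, rule fourier_inverse_fourier)
qed

lemma dispersion_measurable [measurable]: "(\<lambda>w. dispersion (fst w) (snd w)) \<in> borel_measurable dual_cylinder"
  unfolding dispersion_def by measurable

lemma
  assumes f: "f \<in> L2 cylinder"
  shows propagator_L2: "propagator t f \<in> L2 cylinder"
    and fourier_propagator: "AE w in dual_cylinder. fourier (propagator t f) w
      = exp (\<i> * of_real (t * dispersion (fst w) (snd w))) * fourier f w"
proof -
  have eq: "propagator t f = inverse_fourier (\<lambda>w. exp (\<i> * of_real (t * dispersion (fst w) (snd w))) * fourier f w)"
    by (simp add: propagator_def case_prod_beta')
  show "propagator t f \<in> L2 cylinder" unfolding eq by (rule fourier_multiplier[OF f]) auto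
  show "AE w in dual_cylinder. fourier (propagator t f) w
      = exp (\<i> * of_real (t * dispersion (fst w) (snd w))) * fourier f w"
    unfolding eq by (rule fourier_multiplier[OF f]) auto
qed

lemma
  assumes f: "f \<in> L2 cylinder"
  shows hilbert_x_L2: "hilbert_x f \<in> L2 cylinder"
    and fourier_hilbert_x: "AE w in dual_cylinder. fourier (hilbert_x f) w = - \<i> * of_real (sgn (fst w)) * fourier f w"
proof -
  let ?g = "inverse_fourier (\<lambda>w. (- \<i> * of_real (sgn (fst w))) * fourier f w)"
  have m: "(\<lambda>w. - \<i> * of_real (sgn (fst w))) \<in> borel_measurable dual_cylinder" by measurable
  have b: "cmod (- \<i> * of_real (sgn (fst w))) \<le> 1" for w :: "real \<times> int" by (simp add: norm_mult sgn_real_def)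
  from fourier_multiplier[OF f m b] have "?g \<in> L2 cylinder \<and> (AE (\<xi>, \<eta>) in dual_cylinder. fourier ?g (\<xi>, \<eta>) = - \<i> * of_real (sgn \<xi>) * fourier f (\<xi>, \<eta>))"
    by (auto simp: case_prod_beta')
  then have "\<exists>g. g \<in> L2 cylinder \<and> (AE (\<xi>, \<eta>) in dual_cylinder. fourier g (\<xi>, \<eta>) = - \<i> * of_real (sgn \<xi>) * fourier f (\<xi>, \<eta>))"
    by blast
  from someI_ex[OF this]
  show "hilbert_x f \<in> L2 cylinder" "AE w in dual_cylinder. fourier (hilbert_x f) w = - \<i> * of_real (sgn (fst w)) * fourier f w"
    by (simp_all add: hilbert_x_def case_prod_beta')
qed

section \<open>Weights and fractional energy\<close>

lemma Pair_dual_cylinder [measurable (raw)]: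
  assumes [measurable]: "f \<in> borel_measurable N" "g \<in> measurable N (count_space UNIV)"
  shows "(\<lambda>x. (f x, g x)) \<in> measurable N dual_cylinder"
proof -
  have "f \<in> measurable N lborel" by simp
  then show ?thesis unfolding dual_cylinder_def by measurable
qed

lemma weighted_L2_iff:
  "f \<in> weighted_L2 \<theta> \<longleftrightarrow> f \<in> borel_measurable cylinder
    \<and> (\<integral>\<^sup>+z. ennreal (\<bar>fst z\<bar> powr (2 * \<theta>) * (cmod (f z))\<^sup>2) \<partial>cylinder) < \<infinity>"
proof -
  have "sq_norm (density cylinder (\<lambda>(x, y). ennreal (\<bar>x\<bar> powr (2 * \<theta>)))) f
     = (\<integral>\<^sup>+z. ennreal (\<bar>fst z\<bar> powr (2 * \<theta>) * (cmod (f z))\<^sup>2) \<partial>cylinder)" if [measurable]: "f \<in> borel_measurable cylinder"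
    unfolding sq_norm_def by (subst nn_integral_density) (auto simp: case_prod_beta' ennreal_mult)
  then show ?thesis by (auto simp: weighted_L2_def L2_iff)
qed

lemma weighted_L2_half_iff:
  "f \<in> weighted_L2 (1/2) \<longleftrightarrow> f \<in> borel_measurable cylinder
    \<and> (\<integral>\<^sup>+z. ennreal (\<bar>fst z\<bar> * (cmod (f z))\<^sup>2) \<partial>cylinder) < \<infinity>"
  by (simp add: weighted_L2_iff)

text \<open>
  The Gagliardo seminorm of order \<open>1/2\<close> in \<open>\<xi>\<close>, summed over \<open>\<eta>\<close>. The two frequencies have separate ranges so that the
  interaction between the two sides of \<open>\<xi> = 0\<close> can be singled out.
\<close>

definition energy :: "real set \<Rightarrow> real set \<Rightarrow> (real \<times> int \<Rightarrow> complex) \<Rightarrow> ennreal" where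
  "energy A B u = (\<integral>\<^sup>+w\<in>A \<times> UNIV. (\<integral>\<^sup>+\<zeta>\<in>B. ennreal ((cmod (u (\<zeta>, snd w) - u w))\<^sup>2 / (\<zeta> - fst w)\<^sup>2) \<partial>lborel) \<partial>dual_cylinder)"

lemma nn_integral_inverse_square:
  fixes a :: real
  assumes "a > 0"
  shows "(\<integral>\<^sup>+s\<in>{a..}. ennreal (1 / s\<^sup>2) \<partial>lborel) = ennreal (1 / a)"
proof -
  have "(\<integral>\<^sup>+s\<in>{a..}. ennreal (1 / s\<^sup>2) \<partial>lborel) = 0 - (- 1 / a)"
  proof (rule nn_integral_FTC_atLeast)
    show "((\<lambda>s. - 1 / s) has_real_derivative 1 / x\<^sup>2) (at x)" if "a \<le> x" for x
      using that assms by (auto intro!: derivative_eq_intros simp: power2_eq_square)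
    show "((\<lambda>s. - 1 / s :: real) \<longlongrightarrow> 0) at_top"
      by (rule tendsto_divide_0[OF tendsto_const]) (simp add: filterlim_at_top_imp_at_infinity filterlim_ident)
  qed auto
  then show ?thesis by simp
qed

lemma nn_integral_inverse_square_neg:
  fixes a :: real
  assumes "a > 0"
  shows "(\<integral>\<^sup>+s\<in>{..-a}. ennreal (1 / s\<^sup>2) \<partial>lborel) = ennreal (1 / a)"
proof -
  have "(\<integral>\<^sup>+s\<in>{..-a}. ennreal (1 / s\<^sup>2) \<partial>lborel) = (\<integral>\<^sup>+s\<in>{a..}. ennreal (1 / s\<^sup>2) \<partial>lborel)"
    using nn_integral_real_affine[of "\<lambda>s. ennreal (1 / s\<^sup>2) * indicator {..-a} s" "-1" 0]
    by (simp add: indicator_def)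
  then show ?thesis by (simp add: nn_integral_inverse_square[OF assms])
qed

lemma nn_integral_min_inverse_square_le:
  assumes "r \<ge> 0"
  shows "(\<integral>\<^sup>+h\<in>{0<..}. ennreal (min (1 / h\<^sup>2) (r\<^sup>2)) \<partial>lborel) \<le> ennreal (2 * r)"
proof (cases "r = 0")
  case True then show ?thesis by (simp add: min_absorb2)
next
  case False
  with assms have r: "r > 0" by simp
  have "(\<integral>\<^sup>+h\<in>{0<..}. ennreal (min (1 / h\<^sup>2) (r\<^sup>2)) \<partial>lborel)
    \<le> (\<integral>\<^sup>+h. ennreal (r\<^sup>2) * indicator {0..1/r} h + ennreal (1 / h\<^sup>2) * indicator {1/r..} h \<partial>lborel)"
    by (rule nn_integral_mono) (auto simp: indicator_def min_def)
  also have "\<dots> = ennreal (r\<^sup>2) * ennreal (1 / r) + ennreal (1 / (1 / r))"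
    using r by (subst nn_integral_add) (auto simp: nn_integral_cmult_indicator nn_integral_inverse_square)
  also have "\<dots> = ennreal (2 * r)"
    using r by (simp add: ennreal_mult[symmetric] ennreal_plus[symmetric] power2_eq_square del: ennreal_plus)
  finally show ?thesis .
qed

lemma cmod_exp_minus_one_le: "cmod (exp (- \<i> * of_real s) - 1) \<le> \<bar>s\<bar>" "cmod (exp (- \<i> * of_real s) - 1) \<le> 2"
proof -
  show "cmod (exp (- \<i> * of_real s) - 1) \<le> \<bar>s\<bar>"
    using Taylor_exp[of "- \<i> * of_real s" 0] by (simp add: norm_mult)
  have "cmod (exp (- \<i> * of_real s)) = 1" using norm_exp_i_times[of "- s"] by simp
  then show "cmod (exp (- \<i> * of_real s) - 1) \<le> 2"
    using norm_triangle_ineq4[of "exp (- \<i> * of_real s)" 1] by simp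
qed

text \<open>
  The constant in \<open>\<integral> |exp(-ihx) - 1|\<^sup>2/h\<^sup>2 dh = const |x|\<close>; only \<open>0 < const < \<infinity>\<close> matters.
\<close>

definition gagliardo_const :: ennreal where
  "gagliardo_const = (\<integral>\<^sup>+s. ennreal ((cmod (exp (- \<i> * of_real s) - 1))\<^sup>2 / s\<^sup>2) \<partial>lborel)"

lemma gagliardo_const_pos: "gagliardo_const > 0"
proof (rule ccontr)
  assume "\<not> gagliardo_const > 0"
  then have "AE s in lborel. ennreal ((cmod (exp (- \<i> * of_real s) - 1))\<^sup>2 / s\<^sup>2) = 0"
    unfolding gagliardo_const_def by (subst (asm) not_gr_zero, subst (asm) nn_integral_0_iff_AE) auto
  then have "AE s in lborel. s \<notin> {0<..<1::real}"
  proof eventually_elim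
    case (elim s)
    show ?case
    proof
      assume s: "s \<in> {0<..<1}"
      with elim have "exp (- \<i> * of_real s) = 1" by (auto simp: ennreal_eq_0_iff divide_le_0_iff)
      then have "Im (exp (- \<i> * of_real s)) = 0" by simp
      then have "sin s = 0" by (simp add: Im_exp)
      moreover have "sin s > 0" using s pi_gt3 by (intro sin_gt_zero) auto
      ultimately show False by simp
    qed
  qed
  then have "emeasure lborel {0<..<1::real} = 0" by (subst (asm) AE_iff_measurable[of "{0<..<1}"]) auto
  then show False by simp
qed

lemma gagliardo_const_finite: "gagliardo_const < \<infinity>"
proof -
  have "gagliardo_const \<le> (\<integral>\<^sup>+s. indicator {-1..1} s + (4 * (ennreal (1 / s\<^sup>2) * indicator {1..} s) + 4 * (ennreal (1 / s\<^sup>2) * indicator {..-1} s)) \<partial>lborel)"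
    unfolding gagliardo_const_def
  proof (rule nn_integral_mono)
    fix s :: real
    let ?e = "(cmod (exp (- \<i> * of_real s) - 1))\<^sup>2 / s\<^sup>2"
    have "(cmod (exp (- \<i> * of_real s) - 1))\<^sup>2 \<le> \<bar>s\<bar>\<^sup>2" by (intro power_mono cmod_exp_minus_one_le) auto
    then have 1: "?e \<le> 1" by (simp add: divide_le_eq_1)
    have "(cmod (exp (- \<i> * of_real s) - 1))\<^sup>2 \<le> 2\<^sup>2" by (intro power_mono cmod_exp_minus_one_le) auto
    then have "?e \<le> 4 * (1 / s\<^sup>2)" by (simp add: divide_right_mono)
    then have 2: "ennreal ?e \<le> 4 * ennreal (1 / s\<^sup>2)" using ennreal_leI ennreal_mult[of 4 "1 / s\<^sup>2"] by force
    consider "s \<in> {-1..1}" | "s > 1" | "s < -1" by force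
    then show "ennreal ?e \<le> indicator {-1..1} s + (4 * (ennreal (1 / s\<^sup>2) * indicator {1..} s) + 4 * (ennreal (1 / s\<^sup>2) * indicator {..-1} s))"
    proof cases
      case 1
      then have "ennreal ?e \<le> indicator {-1..1} s" using \<open>?e \<le> 1\<close> by simp
      then show ?thesis by (rule order_trans) simp
    qed (use 2 in auto)
  qed
  also have "\<dots> = 2 + (4 * (\<integral>\<^sup>+s\<in>{1..}. ennreal (1 / s\<^sup>2) \<partial>lborel) + 4 * (\<integral>\<^sup>+s\<in>{..-1}. ennreal (1 / s\<^sup>2) \<partial>lborel))"
    by (simp add: nn_integral_add nn_integral_cmult)
  also have "(\<integral>\<^sup>+s\<in>{..-1}. ennreal (1 / s\<^sup>2) \<partial>lborel) = (\<integral>\<^sup>+s\<in>{1..}. ennreal (1 / s\<^sup>2) \<partial>lborel)"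
    using nn_integral_inverse_square[of 1] nn_integral_inverse_square_neg[of 1] by simp
  also have "2 + (4 * (\<integral>\<^sup>+s\<in>{1..}. ennreal (1 / s\<^sup>2) \<partial>lborel) + 4 * (\<integral>\<^sup>+s\<in>{1..}. ennreal (1 / s\<^sup>2) \<partial>lborel)) < \<infinity>"
    by (simp add: nn_integral_inverse_square[of 1, simplified])
  finally show ?thesis .
qed

text \<open>
  Shifting the transform by \<open>h\<close> amounts to modulating \<open>f\<close> by \<open>exp(-ihx)\<close>. With Plancherel's theorem for every \<open>h\<close>, the energy becomes
  \<open>\<integral>\<integral> |exp(-ihx) - 1|\<^sup>2/h\<^sup>2 |f|\<^sup>2\<close>, and the substitution \<open>s = hx\<close> produces the weight \<open>|x|\<close>.
\<close>

lemma energy_fourier: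
  assumes f: "f \<in> L2 cylinder"
  shows "energy UNIV UNIV (fourier f) = ennreal ((2 * pi)\<^sup>2) * (gagliardo_const * (\<integral>\<^sup>+z. ennreal (\<bar>fst z\<bar> * (cmod (f z))\<^sup>2) \<partial>cylinder))"
proof -
  note [measurable] = L2_measurable[OF f] L2_measurable[OF fourier_L2[OF f]]
  let ?u = "fourier f"
  have "energy UNIV UNIV ?u = (\<integral>\<^sup>+w. (\<integral>\<^sup>+h. ennreal ((cmod (?u (shift h w) - ?u w))\<^sup>2 / h\<^sup>2) \<partial>lborel) \<partial>dual_cylinder)"
    unfolding energy_def
  proof (rule nn_integral_cong)
    fix w :: "real \<times> int"
    have "(\<integral>\<^sup>+\<zeta>. ennreal ((cmod (?u (\<zeta>, snd w) - ?u w))\<^sup>2 / (\<zeta> - fst w)\<^sup>2) \<partial>lborel)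
      = ennreal \<bar>1\<bar> * (\<integral>\<^sup>+h. ennreal ((cmod (?u (fst w + 1 * h, snd w) - ?u w))\<^sup>2 / (fst w + 1 * h - fst w)\<^sup>2) \<partial>lborel)"
      by (rule nn_integral_real_affine) auto
    then show "(\<integral>\<^sup>+\<zeta>\<in>UNIV. ennreal ((cmod (?u (\<zeta>, snd w) - ?u w))\<^sup>2 / (\<zeta> - fst w)\<^sup>2) \<partial>lborel) * indicator (UNIV \<times> UNIV) w
      = (\<integral>\<^sup>+h. ennreal ((cmod (?u (shift h w) - ?u w))\<^sup>2 / h\<^sup>2) \<partial>lborel)" by (simp add: shift_def)
  qed
  also have "\<dots> = (\<integral>\<^sup>+h. (\<integral>\<^sup>+w. ennreal ((cmod (?u (shift h w) - ?u w))\<^sup>2 / h\<^sup>2) \<partial>dual_cylinder) \<partial>lborel)"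
  proof -
    interpret P: pair_sigma_finite dual_cylinder "lborel :: real measure" ..
    show ?thesis unfolding shift_def by (rule P.Fubini'[symmetric]) measurable
  qed
  also have "\<dots> = (\<integral>\<^sup>+h. ennreal ((2 * pi)\<^sup>2) * (\<integral>\<^sup>+z. ennreal ((cmod (exp (- \<i> * of_real (h * fst z)) - 1))\<^sup>2 / h\<^sup>2 * (cmod (f z))\<^sup>2) \<partial>cylinder) \<partial>lborel)"
  proof (rule nn_integral_cong)
    fix h :: real
    let ?g = "\<lambda>z. exp (- \<i> * of_real (h * fst z)) * f z"
    have "(\<integral>\<^sup>+w. ennreal ((cmod (?u (shift h w) - ?u w))\<^sup>2 / h\<^sup>2) \<partial>dual_cylinder) = ennreal (1 / h\<^sup>2) * sq_norm dual_cylinder (\<lambda>w. ?u (shift h w) - ?u w)"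
      unfolding sq_norm_def by (subst nn_integral_cmult[symmetric]) (auto simp: ennreal_mult[symmetric])
    also have "sq_norm dual_cylinder (\<lambda>w. ?u (shift h w) - ?u w) = sq_norm dual_cylinder (\<lambda>w. fourier ?g w - ?u w)"
      by (rule sq_norm_cong_AE, use fourier_modulation[OF f, of h] in eventually_elim) simp
    also have "\<dots> = ennreal ((2 * pi)\<^sup>2) * sq_norm cylinder (\<lambda>z. ?g z - f z)"
      by (rule sq_norm_fourier_diff[OF modulation_L2[OF f] f])
    also have "ennreal (1 / h\<^sup>2) * (ennreal ((2 * pi)\<^sup>2) * sq_norm cylinder (\<lambda>z. ?g z - f z))
       = ennreal ((2 * pi)\<^sup>2) * (ennreal (1 / h\<^sup>2) * sq_norm cylinder (\<lambda>z. ?g z - f z))" by (simp add: mult_ac)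
    also have "ennreal (1 / h\<^sup>2) * sq_norm cylinder (\<lambda>z. ?g z - f z)
       = (\<integral>\<^sup>+z. ennreal ((cmod (exp (- \<i> * of_real (h * fst z)) - 1))\<^sup>2 / h\<^sup>2 * (cmod (f z))\<^sup>2) \<partial>cylinder)"
    proof -
      have "cmod (?g z - f z) = cmod (exp (- \<i> * of_real (h * fst z)) - 1) * cmod (f z)" for z
        by (simp add: norm_mult[symmetric] left_diff_distrib)
      then show ?thesis
        unfolding sq_norm_def by (subst nn_integral_cmult[symmetric]) (auto simp: ennreal_mult[symmetric] power_mult_distrib)
    qed
    finally show "(\<integral>\<^sup>+w. ennreal ((cmod (?u (shift h w) - ?u w))\<^sup>2 / h\<^sup>2) \<partial>dual_cylinder)
      = ennreal ((2 * pi)\<^sup>2) * (\<integral>\<^sup>+z. ennreal ((cmod (exp (- \<i> * of_real (h * fst z)) - 1))\<^sup>2 / h\<^sup>2 * (cmod (f z))\<^sup>2) \<partial>cylinder)" .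
  qed
  also have "\<dots> = ennreal ((2 * pi)\<^sup>2) * (\<integral>\<^sup>+h. (\<integral>\<^sup>+z. ennreal ((cmod (exp (- \<i> * of_real (h * fst z)) - 1))\<^sup>2 / h\<^sup>2 * (cmod (f z))\<^sup>2) \<partial>cylinder) \<partial>lborel)"
    by (rule nn_integral_cmult) measurable
  also have "(\<integral>\<^sup>+h. (\<integral>\<^sup>+z. ennreal ((cmod (exp (- \<i> * of_real (h * fst z)) - 1))\<^sup>2 / h\<^sup>2 * (cmod (f z))\<^sup>2) \<partial>cylinder) \<partial>lborel)
    = (\<integral>\<^sup>+z. (\<integral>\<^sup>+h. ennreal ((cmod (exp (- \<i> * of_real (h * fst z)) - 1))\<^sup>2 / h\<^sup>2 * (cmod (f z))\<^sup>2) \<partial>lborel) \<partial>cylinder)"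
  proof -
    interpret P: pair_sigma_finite cylinder "lborel :: real measure" ..
    show ?thesis by (rule P.Fubini') measurable
  qed
  also have "\<dots> = (\<integral>\<^sup>+z. gagliardo_const * ennreal (\<bar>fst z\<bar> * (cmod (f z))\<^sup>2) \<partial>cylinder)"
  proof (rule nn_integral_cong)
    fix z :: "real \<times> real"
    define x where "x = fst z"
    have "(\<integral>\<^sup>+h. ennreal ((cmod (exp (- \<i> * of_real (h * x)) - 1))\<^sup>2 / h\<^sup>2) \<partial>lborel) = gagliardo_const * ennreal \<bar>x\<bar>"
    proof (cases "x = 0")
      case True then show ?thesis by simp
    next
      case False
      have "(\<integral>\<^sup>+h. ennreal ((cmod (exp (- \<i> * of_real (h * x)) - 1))\<^sup>2 / h\<^sup>2) \<partial>lborel)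
        = ennreal \<bar>1 / x\<bar> * (\<integral>\<^sup>+s. ennreal ((cmod (exp (- \<i> * of_real ((0 + 1 / x * s) * x)) - 1))\<^sup>2 / (0 + 1 / x * s)\<^sup>2) \<partial>lborel)"
        using False by (intro nn_integral_real_affine) auto
      also have "(\<integral>\<^sup>+s. ennreal ((cmod (exp (- \<i> * of_real ((0 + 1 / x * s) * x)) - 1))\<^sup>2 / (0 + 1 / x * s)\<^sup>2) \<partial>lborel)
        = (\<integral>\<^sup>+s. ennreal (x\<^sup>2) * ennreal ((cmod (exp (- \<i> * of_real s) - 1))\<^sup>2 / s\<^sup>2) \<partial>lborel)"
        using False by (intro nn_integral_cong) (simp add: ennreal_mult[symmetric] power_divide field_simps)
      also have "\<dots> = ennreal (x\<^sup>2) * gagliardo_const" unfolding gagliardo_const_def by (rule nn_integral_cmult) simp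
      also have "ennreal \<bar>1 / x\<bar> * (ennreal (x\<^sup>2) * gagliardo_const) = ennreal (\<bar>1 / x\<bar> * x\<^sup>2) * gagliardo_const"
        by (subst ennreal_mult) (simp_all only: mult.assoc abs_ge_zero zero_le_power2)
      also have "\<bar>1 / x\<bar> * x\<^sup>2 = \<bar>x\<bar>" using False by (simp add: power2_eq_square abs_if)
      finally show ?thesis by (simp add: mult.commute)
    qed
    then have "(\<integral>\<^sup>+h. ennreal ((cmod (exp (- \<i> * of_real (h * x)) - 1))\<^sup>2 / h\<^sup>2) * ennreal ((cmod (f z))\<^sup>2) \<partial>lborel) = gagliardo_const * ennreal \<bar>x\<bar> * ennreal ((cmod (f z))\<^sup>2)"
      by (subst nn_integral_multc) auto
    then show "(\<integral>\<^sup>+h. ennreal ((cmod (exp (- \<i> * of_real (h * fst z)) - 1))\<^sup>2 / h\<^sup>2 * (cmod (f z))\<^sup>2) \<partial>lborel) = gagliardo_const * ennreal (\<bar>fst z\<bar> * (cmod (f z))\<^sup>2)"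
      by (simp only: x_def ennreal_mult'' zero_le_power2 mult.assoc)
  qed
  also have "\<dots> = gagliardo_const * (\<integral>\<^sup>+z. ennreal (\<bar>fst z\<bar> * (cmod (f z))\<^sup>2) \<partial>cylinder)"
    by (rule nn_integral_cmult) measurable
  finally show ?thesis .
qed

theorem weighted_L2_half_iff_energy:
  assumes f: "f \<in> L2 cylinder"
  shows "f \<in> weighted_L2 (1/2) \<longleftrightarrow> energy UNIV UNIV (fourier f) < \<infinity>"
proof -
  define X where "X = (\<integral>\<^sup>+z. ennreal (\<bar>fst z\<bar> * (cmod (f z))\<^sup>2) \<partial>cylinder)"
  have "energy UNIV UNIV (fourier f) < \<infinity> \<longleftrightarrow> X < \<infinity>"
    unfolding energy_fourier[OF f] X_def[symmetric]
    using gagliardo_const_pos gagliardo_const_finite by (auto simp: ennreal_mult_less_top)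
  then show ?thesis using L2_measurable[OF f] by (simp add: weighted_L2_half_iff X_def)
qed

section \<open>Interpolation between decay and smoothness\<close>

text \<open>
  Normalized so that its transform is the \<open>j\<close>-th derivative in \<open>\<xi>\<close> of the transform of \<open>f\<close>.
\<close>

definition moment :: "nat \<Rightarrow> (real \<times> real \<Rightarrow> complex) \<Rightarrow> real \<times> real \<Rightarrow> complex" where
  "moment j f = (\<lambda>z. (- \<i> * of_real (fst z)) ^ j * f z)"

text \<open>
  The mean of \<open>exp(-isr)\<close> over \<open>r \<in> [0, 1]\<close>. Multiplication by \<open>average_symbol (hx)\<close> averages the transform over
  \<open>[\<xi>, \<xi> + h]\<close>, and the average of a derivative is a difference quotient (\<open>average_symbol_mult\<close>).
\<close>

definition average_symbol :: "real \<Rightarrow> complex" where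
  "average_symbol s = (if s = 0 then 1 else (1 - exp (- \<i> * of_real s)) / (\<i> * of_real s))"

lemma average_symbol_measurable [measurable]: "average_symbol \<in> borel_measurable borel"
  unfolding average_symbol_def by measurable

lemma average_symbol_mult:
  assumes "h > 0"
  shows "average_symbol (h * x) * (- \<i> * of_real x) = (exp (- \<i> * of_real (h * x)) - 1) / of_real h"
  using assms by (auto simp: average_symbol_def field_simps)

lemma norm_average_symbol: "cmod (average_symbol s) \<le> 1"
proof (cases "s = 0")
  case False
  have "cmod (1 - exp (- \<i> * of_real s)) \<le> \<bar>s\<bar>"
    using cmod_exp_minus_one_le(1)[of s] by (simp add: norm_minus_commute)
  then show ?thesis using False by (simp add: average_symbol_def norm_divide norm_mult divide_le_eq_1)
qed (simp add: average_symbol_def)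

lemma norm_one_minus_average_symbol: "cmod (1 - average_symbol s) \<le> \<bar>s\<bar>"
proof (cases "s = 0")
  case False
  have eq: "1 - average_symbol s = (exp (- \<i> * of_real s) - (\<Sum>k\<le>1. (- \<i> * of_real s) ^ k / fact k)) / (\<i> * of_real s)"
    using False by (simp add: average_symbol_def field_simps)
  have "cmod (exp (- \<i> * of_real s) - (\<Sum>k\<le>1. (- \<i> * of_real s) ^ k / fact k)) \<le> \<bar>s\<bar>\<^sup>2"
    using Taylor_exp[of "- \<i> * of_real s" 1] by (simp add: norm_mult power2_eq_square)
  then have "cmod (1 - average_symbol s) \<le> \<bar>s\<bar>\<^sup>2 / \<bar>s\<bar>"
    unfolding eq norm_divide using False by (simp add: norm_mult divide_right_mono del: power2_abs)
  then show ?thesis using False by (cases "s > 0") (auto simp: power2_eq_square)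
qed (simp add: average_symbol_def)

lemma norm_one_minus_average_symbol_power:
  "(cmod (1 - average_symbol s ^ k))\<^sup>2 \<le> 4 * (real k)\<^sup>2 * min 1 (s\<^sup>2)"
proof -
  have "cmod (1 ^ k - average_symbol s ^ k) \<le> k * cmod (1 - average_symbol s)"
    by (rule norm_power_diff) (auto simp: norm_average_symbol)
  then have *: "(cmod (1 - average_symbol s ^ k))\<^sup>2 \<le> (real k)\<^sup>2 * (cmod (1 - average_symbol s))\<^sup>2"
    using power_mono[of _ _ 2] by (fastforce simp: power_mult_distrib)
  have "cmod (1 - average_symbol s) \<le> 2"
    using norm_triangle_ineq4[of 1 "average_symbol s"] norm_average_symbol[of s] by simp
  then have "(cmod (1 - average_symbol s))\<^sup>2 \<le> 2\<^sup>2" by (intro power_mono) auto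
  moreover have "(cmod (1 - average_symbol s))\<^sup>2 \<le> \<bar>s\<bar>\<^sup>2" by (intro power_mono norm_one_minus_average_symbol) auto
  ultimately have "(cmod (1 - average_symbol s))\<^sup>2 \<le> 4 * min 1 (s\<^sup>2)"
    by (cases "1 \<le> s\<^sup>2") (simp_all add: min_def, smt (verit) zero_le_power2)
  then have "(real k)\<^sup>2 * (cmod (1 - average_symbol s))\<^sup>2 \<le> (real k)\<^sup>2 * (4 * min 1 (s\<^sup>2))" by (intro mult_left_mono) auto
  with * show ?thesis by (simp add: mult_ac)
qed

lemma norm_sum_sq_le:
  fixes a :: "'a \<Rightarrow> complex"
  shows "(cmod (\<Sum>i\<in>A. a i))\<^sup>2 \<le> real (card A) * (\<Sum>i\<in>A. (cmod (a i))\<^sup>2)"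
proof -
  have "(cmod (\<Sum>i\<in>A. a i))\<^sup>2 \<le> (\<Sum>i\<in>A. cmod (a i))\<^sup>2" by (intro power_mono norm_sum) auto
  also have "\<dots> \<le> (\<Sum>i\<in>A. (cmod (a i))\<^sup>2) * card A" by (rule sum_squared_le_sum_of_squares)
  finally show ?thesis by (simp add: mult.commute)
qed

text \<open>
  The frequencies of size about \<open>1/h\<close>. Integrated against \<open>dh/h\<^sup>2\<close> these sets rebuild the weight \<open>|\<xi>|\<close> for large frequencies.
\<close>

definition annulus :: "real \<Rightarrow> real \<Rightarrow> real set" where
  "annulus h0 h = {\<xi>. 0 < h \<and> h \<le> h0 \<and> 1 / 2 < h * \<bar>\<xi>\<bar> \<and> h * \<bar>\<xi>\<bar> \<le> 1}"

lemma annulus_measurable [measurable (raw)]: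
  assumes [measurable]: "f \<in> borel_measurable M" "g \<in> borel_measurable M"
  shows "(\<lambda>x. indicator (annulus h0 (f x)) (g x) :: ennreal) \<in> borel_measurable M"
proof -
  have "(\<lambda>x. indicator (annulus h0 (f x)) (g x) :: ennreal) = (\<lambda>x. if 0 < f x \<and> f x \<le> h0 \<and> 1 / 2 < f x * \<bar>g x\<bar> \<and> f x * \<bar>g x\<bar> \<le> 1 then 1 else 0)"
    by (auto simp: annulus_def indicator_def)
  then show ?thesis by simp
qed

text \<open>
  The admissible \<open>h\<close> form an interval of length \<open>1/(2|\<xi>|)\<close>, on which \<open>1/h\<^sup>2 \<ge> \<xi>\<^sup>2\<close>.
\<close>

lemma nn_integral_annulus_ge:
  assumes "1 / h0 \<le> \<bar>\<xi>\<bar>" "h0 > 0"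
  shows "ennreal (\<bar>\<xi>\<bar> / 2) \<le> (\<integral>\<^sup>+h. ennreal (1 / h\<^sup>2) * indicator (annulus h0 h) \<xi> \<partial>lborel)"
proof -
  have \<xi>: "\<bar>\<xi>\<bar> > 0" using assms by (meson divide_pos_pos less_le_trans zero_less_one)
  have "ennreal (\<bar>\<xi>\<bar> / 2) = ennreal (\<xi>\<^sup>2) * emeasure lborel {1 / (2 * \<bar>\<xi>\<bar>)<..1 / \<bar>\<xi>\<bar>}"
  proof -
    have "1 / (2 * \<bar>\<xi>\<bar>) \<le> 1 / \<bar>\<xi>\<bar>" using \<xi> by (simp add: field_simps)
    then have "ennreal (\<xi>\<^sup>2) * emeasure lborel {1 / (2 * \<bar>\<xi>\<bar>)<..1 / \<bar>\<xi>\<bar>} = ennreal (\<xi>\<^sup>2 * (1 / \<bar>\<xi>\<bar> - 1 / (2 * \<bar>\<xi>\<bar>)))"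
      by (subst ennreal_mult) auto
    also have "\<xi>\<^sup>2 * (1 / \<bar>\<xi>\<bar> - 1 / (2 * \<bar>\<xi>\<bar>)) = \<bar>\<xi>\<bar>\<^sup>2 * (1 / \<bar>\<xi>\<bar> - 1 / (2 * \<bar>\<xi>\<bar>))" by simp
    also have "\<dots> = \<bar>\<xi>\<bar> / 2" using \<xi> by (simp add: power2_eq_square field_simps del: abs_mult_self_eq)
    finally show ?thesis by simp
  qed
  also have "\<dots> = (\<integral>\<^sup>+h. ennreal (\<xi>\<^sup>2) * indicator {1 / (2 * \<bar>\<xi>\<bar>)<..1 / \<bar>\<xi>\<bar>} h \<partial>lborel)"
    by (simp add: nn_integral_cmult_indicator)
  also have "\<dots> \<le> (\<integral>\<^sup>+h. ennreal (1 / h\<^sup>2) * indicator (annulus h0 h) \<xi> \<partial>lborel)"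
  proof (rule nn_integral_mono)
    fix h :: real
    show "ennreal (\<xi>\<^sup>2) * indicator {1 / (2 * \<bar>\<xi>\<bar>)<..1 / \<bar>\<xi>\<bar>} h \<le> ennreal (1 / h\<^sup>2) * indicator (annulus h0 h) \<xi>"
    proof (cases "h \<in> {1 / (2 * \<bar>\<xi>\<bar>)<..1 / \<bar>\<xi>\<bar>}")
      case True
      have "0 < 1 / (2 * \<bar>\<xi>\<bar>)" using \<xi> by simp
      with True have h: "h > 0" by auto
      have h1: "h * \<bar>\<xi>\<bar> \<le> 1" "1 / 2 < h * \<bar>\<xi>\<bar>" using True \<xi> by (auto simp: field_simps)
      have "1 / \<bar>\<xi>\<bar> \<le> h0" using assms \<xi> by (simp add: field_simps)
      then have "h \<le> h0" using True by auto
      then have mem: "\<xi> \<in> annulus h0 h" using h h1 by (simp add: annulus_def)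
      have "(h * \<bar>\<xi>\<bar>)\<^sup>2 \<le> 1" using h1 h by (intro power_le_one) auto
      then have "\<xi>\<^sup>2 \<le> 1 / h\<^sup>2" using h by (simp add: power_mult_distrib field_simps)
      then show ?thesis using True mem by (simp add: ennreal_leI)
    qed simp
  qed
  finally show ?thesis .
qed

text \<open>
  The choice of \<open>h0\<close> keeps \<open>kh\<close> below \<open>1/2\<close>, while the annulus lies at distance at least \<open>1/(2h) \<ge> k + 1\<close> from zero. So a
  shift by \<open>jh\<close> does not change the size of the frequency: \<open>h\<close> is still comparable to \<open>1/|\<zeta>|\<close>.
\<close>

lemma nn_integral_shifted_annulus_le:
  fixes k j :: nat
  assumes "j \<le> k" and h0: "h0 = 1 / (2 * (real k + 1))"
  shows "(\<integral>\<^sup>+h. ennreal (1 / h ^ (2 * k + 2)) * indicator (annulus h0 h) (\<zeta> - real j * h) \<partial>lborel)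
    \<le> ennreal (4 ^ (2 * k + 2) * (real k + 1) * \<bar>\<zeta>\<bar> ^ (2 * k + 1))"
proof -
  have key: "\<zeta> \<noteq> 0 \<and> h \<le> (real k + 1) / \<bar>\<zeta>\<bar> \<and> 1 / h \<le> 4 * \<bar>\<zeta>\<bar>" if "\<zeta> - real j * h \<in> annulus h0 h" for h
  proof -
    have h: "0 < h" "h \<le> h0" "1 / 2 < h * \<bar>\<zeta> - real j * h\<bar>" "h * \<bar>\<zeta> - real j * h\<bar> \<le> 1" using that by (auto simp: annulus_def)
    have "h0 * (2 * (real k + 1)) = 1" by (simp add: h0)
    moreover have "h * (2 * (real k + 1)) \<le> h0 * (2 * (real k + 1))" using h by (intro mult_right_mono) auto
    ultimately have hk: "h * (2 * (real k + 1)) \<le> 1" by simp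
    have jk: "0 \<le> real j * h" "real j * h \<le> real k * h" using assms h by (auto intro: mult_right_mono)
    have hk': "h * (2 * (real k + 1)) = 2 * (real k * h) + 2 * h" by (simp add: algebra_simps)
    have k0: "0 \<le> real k * h" using h by simp
    have hle: "h \<le> 1 / 2" using hk hk' k0 by linarith
    have kh: "h * (real k * h) \<le> 1 / 4"
    proof -
      have "real k * h \<le> 1 / 2" using hk hk' h by linarith
      then have "h * (real k * h) \<le> (1/2) * (1 / 2)" using h hle by (intro mult_mono) auto
      then show ?thesis by simp
    qed
    have hjh: "h * (real j * h) \<le> h * (real k * h)" using jk h by (intro mult_left_mono) auto
    have "\<bar>\<zeta> - real j * h\<bar> \<le> \<bar>\<zeta>\<bar> + real j * h"
      using abs_triangle_ineq4[of \<zeta> "real j * h"] unfolding abs_of_nonneg[OF jk(1)] .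
    then have "h * \<bar>\<zeta> - real j * h\<bar> \<le> h * (\<bar>\<zeta>\<bar> + real j * h)" using h by (intro mult_left_mono) auto
    then have "1 / 2 < h * \<bar>\<zeta>\<bar> + 1 / 4" using h(3) kh hjh unfolding distrib_left by linarith
    then have lower: "1 / 4 < h * \<bar>\<zeta>\<bar>" by simp
    have "\<bar>\<zeta>\<bar> \<le> \<bar>\<zeta> - real j * h\<bar> + real j * h"
      using abs_triangle_ineq[of "\<zeta> - real j * h" "real j * h"] unfolding abs_of_nonneg[OF jk(1)] by simp
    then have "h * \<bar>\<zeta>\<bar> \<le> h * (\<bar>\<zeta> - real j * h\<bar> + real j * h)" using h by (intro mult_left_mono) auto
    moreover have "h * (real k * h) \<le> real k"
    proof -
      have "h * h \<le> 1" using h hle by (intro mult_le_one) auto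
      then have "real k * (h * h) \<le> real k * 1" by (intro mult_left_mono) auto
      then show ?thesis by (simp add: mult_ac)
    qed
    ultimately have upper: "h * \<bar>\<zeta>\<bar> \<le> real k + 1"
      using h(4) hjh unfolding distrib_left by linarith
    have z: "\<bar>\<zeta>\<bar> > 0" using lower by (cases "\<zeta> = 0") auto
    have "1 \<le> 4 * \<bar>\<zeta>\<bar> * h" using lower by (simp add: mult.commute)
    then have "1 / h \<le> 4 * \<bar>\<zeta>\<bar>" using h(1) by (subst pos_divide_le_eq)
    moreover have "h \<le> (real k + 1) / \<bar>\<zeta>\<bar>" using upper z by (subst pos_le_divide_eq)
    ultimately show ?thesis using z by simp
  qed
  show ?thesis
  proof (cases "\<zeta> = 0")
    case True
    then have "indicator (annulus h0 h) (\<zeta> - real j * h) = (0::ennreal)" for h using key by (auto simp: indicator_def)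
    then show ?thesis by simp
  next
    case False
    then have z: "\<bar>\<zeta>\<bar> > 0" by simp
    have "(\<integral>\<^sup>+h. ennreal (1 / h ^ (2 * k + 2)) * indicator (annulus h0 h) (\<zeta> - real j * h) \<partial>lborel)
      \<le> (\<integral>\<^sup>+h. ennreal ((4 * \<bar>\<zeta>\<bar>) ^ (2 * k + 2)) * indicator {0..(real k + 1) / \<bar>\<zeta>\<bar>} h \<partial>lborel)"
    proof (rule nn_integral_mono)
      fix h
      show "ennreal (1 / h ^ (2 * k + 2)) * indicator (annulus h0 h) (\<zeta> - real j * h) \<le> ennreal ((4 * \<bar>\<zeta>\<bar>) ^ (2 * k + 2)) * indicator {0..(real k + 1) / \<bar>\<zeta>\<bar>} h"
      proof (cases "\<zeta> - real j * h \<in> annulus h0 h")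
        case True
        then have "h > 0" by (simp add: annulus_def)
        then have "(1 / h) ^ (2 * k + 2) \<le> (4 * \<bar>\<zeta>\<bar>) ^ (2 * k + 2)" using key[OF True] by (intro power_mono) auto
        then show ?thesis using True key[OF True] \<open>h > 0\<close> by (auto simp: power_one_over intro!: ennreal_leI)
      qed simp
    qed
    also have "\<dots> = ennreal ((4 * \<bar>\<zeta>\<bar>) ^ (2 * k + 2)) * ennreal ((real k + 1) / \<bar>\<zeta>\<bar>)"
      using z by (simp add: nn_integral_cmult_indicator)
    also have "\<dots> = ennreal (4 ^ (2 * k + 2) * (real k + 1) * \<bar>\<zeta>\<bar> ^ (2 * k + 1))"
    proof -
      have "(4 * \<bar>\<zeta>\<bar>) ^ (2 * k + 2) * ((real k + 1) / \<bar>\<zeta>\<bar>) = 4 ^ (2 * k + 2) * (real k + 1) * \<bar>\<zeta>\<bar> ^ (2 * k + 1)"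
        using z by (simp add: power_mult_distrib field_simps)
      then show ?thesis using z by (subst ennreal_mult[symmetric]) auto
    qed
    finally show ?thesis .
  qed
qed

text \<open>
  The transform \<open>\<phi>\<^sub>k\<close> of \<open>(-ix)\<^sup>k f\<close> is the \<open>k\<close>-th derivative of \<open>\<phi>\<close>, which has half a derivative more, and
  \<open>|\<xi>|\<^sup>k\<^sup>+\<^sup>1\<^sup>/\<^sup>2 \<phi>\<close> is square integrable; the claim is the intermediate statement with half a power of \<open>|\<xi>|\<close>. At frequencies
  of size \<open>1/h\<close> replace \<open>\<phi>\<^sub>k\<close> by its \<open>k\<close>-fold average at scale \<open>h\<close>. The average is a \<open>k\<close>-th difference quotient of \<open>\<phi>\<close>, of size
  \<open>h\<^sup>-\<^sup>k |\<phi>|\<close>; the error is, on the side of \<open>x\<close>, of size \<open>min(1, h|x|) |x\<^sup>k f|\<close>. Integrating both against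
  \<open>dh/h\<^sup>2\<close> yields \<open>|\<xi>|\<^sup>2\<^sup>k\<^sup>+\<^sup>1 |\<phi>|\<^sup>2\<close> and \<open>|x| |x\<^sup>k f|\<^sup>2\<close>.
\<close>

theorem fourier_moment_interpolation:
  assumes f: "f \<in> L2 cylinder" and fk: "moment k f \<in> L2 cylinder"
    and w: "(\<integral>\<^sup>+z. ennreal (\<bar>fst z\<bar> * (cmod (moment k f z))\<^sup>2) \<partial>cylinder) < \<infinity>"
    and s: "(\<integral>\<^sup>+w. ennreal (\<bar>fst w\<bar> ^ (2 * k + 1) * (cmod (fourier f w))\<^sup>2) \<partial>dual_cylinder) < \<infinity>"
  shows "(\<integral>\<^sup>+w. ennreal (\<bar>fst w\<bar> * (cmod (fourier (moment k f) w))\<^sup>2) \<partial>dual_cylinder) < \<infinity>"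
proof -
  note [measurable] = L2_measurable[OF f] L2_measurable[OF fk]
    L2_measurable[OF fourier_L2[OF f]] L2_measurable[OF fourier_L2[OF fk]]
  let ?u = "fourier f" and ?g = "fourier (moment k f)"
  \<comment> \<open>Scales above \<open>h0\<close> correspond to bounded frequencies, where square integrability is enough.\<close>
  define h0 where "h0 = 1 / (2 * (real k + 1))"
  have h0: "h0 > 0" by (simp add: h0_def)
  interpret P: pair_sigma_finite dual_cylinder "lborel :: real measure" ..
  interpret Q: pair_sigma_finite cylinder "lborel :: real measure" ..
  define c1 where "c1 = 2 * ((2 * pi)\<^sup>2 * (4 * (real k)\<^sup>2))"
  define c2 where "c2 = 2 * (real (k + 1) * (2 ^ k)\<^sup>2)"
  have c: "c1 \<ge> 0" "c2 \<ge> 0" by (auto simp: c1_def c2_def)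
  define I1 where "I1 h = (\<integral>\<^sup>+z. ennreal (min 1 ((h * fst z)\<^sup>2) * (cmod (moment k f z))\<^sup>2) \<partial>cylinder)" for h
  define I2 where "I2 j h = (\<integral>\<^sup>+w. indicator (annulus h0 h) (fst w - real j * h) * ennreal ((cmod (?u w))\<^sup>2) \<partial>dual_cylinder)" for j :: nat and h
  have [measurable]: "I1 \<in> borel_measurable lborel" "I2 j \<in> borel_measurable lborel" for j
    unfolding I1_def I2_def by measurable
  have main: "(\<integral>\<^sup>+w. indicator (annulus h0 h) (fst w) * ennreal ((cmod (?g w))\<^sup>2) \<partial>dual_cylinder)
      \<le> ennreal c1 * I1 h + ennreal (c2 / h ^ (2 * k)) * (\<Sum>j\<le>k. I2 j h)" if h: "h > 0" for h
  proof -
    let ?m = "\<lambda>z. average_symbol (h * fst z) ^ k"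
    \<comment> \<open>The function splits into \<open>r\<close>, the error of averaging \<open>k\<close> times, and the average, which by the binomial theorem
      is a sum of modulations \<open>b j\<close> of \<open>f\<close> and hence has a combination of shifts as its transform.\<close>
    define r where "r z = (1 - ?m z) * moment k f z" for z
    have r: "r \<in> L2 cylinder" unfolding r_def
    proof (rule L2_bounded_mult[OF fk, where B = "1 + 1"])
      fix z
      have "cmod (?m z) \<le> 1" unfolding norm_power by (intro power_le_one norm_average_symbol) auto
      then show "cmod (1 - ?m z) \<le> 1 + 1" using norm_triangle_ineq4[of 1 "?m z"] by simp
    qed measurable
    define b where "b j z = (of_nat (k choose j) * (-1) ^ (k - j) / of_real h ^ k) * (exp (- \<i> * of_real ((real j * h) * fst z)) * f z)" for j :: nat and z
    have b: "b j \<in> L2 cylinder" for j unfolding b_def by (intro L2_cmult modulation_L2 f)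
    have decomp: "moment k f = (\<lambda>z. 1 * r z + (\<Sum>j\<le>k. b j z))"
    proof
      fix z
      have "?m z * moment k f z = (average_symbol (h * fst z) * (- \<i> * of_real (fst z))) ^ k * f z"
        by (simp only: moment_def power_mult_distrib mult.assoc)
      also have "\<dots> = ((exp (- \<i> * of_real (h * fst z)) - 1) / of_real h) ^ k * f z"
        unfolding average_symbol_mult[OF h] ..
      also have "\<dots> = (exp (- \<i> * of_real (h * fst z)) + (- 1)) ^ k / of_real h ^ k * f z"
        by (simp add: power_divide)
      also have "\<dots> = (\<Sum>j\<le>k. b j z)"
        unfolding binomial_ring b_def sum_divide_distrib sum_distrib_right
      proof (rule sum.cong[OF refl])
        fix j
        have e: "exp (- \<i> * of_real (h * fst z)) ^ j = exp (- \<i> * of_real ((real j * h) * fst z))"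
          by (simp add: exp_of_nat_mult[symmetric] mult_ac)
        show "of_nat (k choose j) * exp (- \<i> * of_real (h * fst z)) ^ j * (- 1) ^ (k - j) / of_real h ^ k * f z
          = of_nat (k choose j) * (- 1) ^ (k - j) / of_real h ^ k * (exp (- \<i> * of_real ((real j * h) * fst z)) * f z)"
          unfolding e by simp
      qed
      finally show "moment k f z = 1 * r z + (\<Sum>j\<le>k. b j z)" by (simp add: r_def algebra_simps)
    qed
    have "AE w in dual_cylinder. ?g w = 1 * fourier r w + fourier (\<lambda>z. \<Sum>j\<le>k. b j z) w"
      by (subst decomp, rule fourier_lincomb[OF r]) (intro sum_L2 b, simp)
    moreover have "AE w in dual_cylinder. fourier (\<lambda>z. \<Sum>j\<le>k. b j z) w = (\<Sum>j\<le>k. fourier (b j) w)"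
      by (intro fourier_sum b) simp
    moreover have "AE w in dual_cylinder. \<forall>j\<in>{..k}. fourier (b j) w = (of_nat (k choose j) * (-1) ^ (k - j) / of_real h ^ k) * ?u (shift (real j * h) w)"
    proof (rule AE_finite_allI)
      fix j
      show "AE w in dual_cylinder. fourier (b j) w = (of_nat (k choose j) * (-1) ^ (k - j) / of_real h ^ k) * ?u (shift (real j * h) w)"
        unfolding b_def
        using fourier_cmult[OF modulation_L2[OF f, of "real j * h"], of "of_nat (k choose j) * (-1) ^ (k - j) / of_real h ^ k"]
          fourier_modulation[OF f, of "real j * h"]
        by eventually_elim simp
    qed simp
    ultimately have ae: "AE w in dual_cylinder. (cmod (?g w))\<^sup>2 \<le> 2 * (cmod (fourier r w))\<^sup>2 + c2 / h ^ (2 * k) * (\<Sum>j\<le>k. (cmod (?u (shift (real j * h) w)))\<^sup>2)"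
    proof eventually_elim
      case (elim w)
      let ?s = "\<lambda>j. (of_nat (k choose j) * (-1) ^ (k - j) / of_real h ^ k) * ?u (shift (real j * h) w)"
      have "?g w = fourier r w + (\<Sum>j\<le>k. ?s j)" using elim by simp
      then have "(cmod (?g w))\<^sup>2 \<le> 2 * (cmod (fourier r w))\<^sup>2 + 2 * (cmod (\<Sum>j\<le>k. ?s j))\<^sup>2"
        using norm_add_sq_weighted[of 1 "fourier r w" "\<Sum>j\<le>k. ?s j"] by simp
      also have "(cmod (\<Sum>j\<le>k. ?s j))\<^sup>2 \<le> real (k + 1) * (\<Sum>j\<le>k. (cmod (?s j))\<^sup>2)"
        using norm_sum_sq_le[of ?s "{..k}"] by simp
      also have "(\<Sum>j\<le>k. (cmod (?s j))\<^sup>2) \<le> (\<Sum>j\<le>k. (2 ^ k)\<^sup>2 / h ^ (2 * k) * (cmod (?u (shift (real j * h) w)))\<^sup>2)"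
      proof (rule sum_mono)
        fix j
        have "real (k choose j) \<le> 2 ^ k" using binomial_le_pow2[of k j] by (metis of_nat_le_iff of_nat_numeral of_nat_power)
        then have "(real (k choose j))\<^sup>2 \<le> (2 ^ k)\<^sup>2" by (intro power_mono) auto
        then have "(real (k choose j))\<^sup>2 / h ^ (2 * k) * (cmod (?u (shift (real j * h) w)))\<^sup>2 \<le> (2 ^ k)\<^sup>2 / h ^ (2 * k) * (cmod (?u (shift (real j * h) w)))\<^sup>2"
          using h by (intro mult_right_mono divide_right_mono) auto
        moreover have "(cmod (?s j))\<^sup>2 = (real (k choose j))\<^sup>2 / h ^ (2 * k) * (cmod (?u (shift (real j * h) w)))\<^sup>2"
          using h by (simp add: norm_mult norm_divide norm_power power_mult_distrib power_divide power_mult[symmetric] mult.commute)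
        ultimately show "(cmod (?s j))\<^sup>2 \<le> (2 ^ k)\<^sup>2 / h ^ (2 * k) * (cmod (?u (shift (real j * h) w)))\<^sup>2" by simp
      qed
      also have "(\<Sum>j\<le>k. (2 ^ k)\<^sup>2 / h ^ (2 * k) * (cmod (?u (shift (real j * h) w)))\<^sup>2)
          = (2 ^ k)\<^sup>2 / h ^ (2 * k) * (\<Sum>j\<le>k. (cmod (?u (shift (real j * h) w)))\<^sup>2)"
        by (rule sum_distrib_left[symmetric])
      finally show ?case by (simp add: c2_def mult.assoc)
    qed
    have "(\<integral>\<^sup>+w. indicator (annulus h0 h) (fst w) * ennreal ((cmod (?g w))\<^sup>2) \<partial>dual_cylinder)
      \<le> (\<integral>\<^sup>+w. 2 * ennreal ((cmod (fourier r w))\<^sup>2) + ennreal (c2 / h ^ (2 * k)) * (\<Sum>j\<le>k. indicator (annulus h0 h) (fst w) * ennreal ((cmod (?u (shift (real j * h) w)))\<^sup>2)) \<partial>dual_cylinder)"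
    proof (rule nn_integral_mono_AE, use ae in eventually_elim)
      case (elim w)
      have "ennreal ((cmod (?g w))\<^sup>2) \<le> ennreal (2 * (cmod (fourier r w))\<^sup>2 + c2 / h ^ (2 * k) * (\<Sum>j\<le>k. (cmod (?u (shift (real j * h) w)))\<^sup>2))"
        using elim by (rule ennreal_leI)
      also have "\<dots> = 2 * ennreal ((cmod (fourier r w))\<^sup>2) + ennreal (c2 / h ^ (2 * k)) * (\<Sum>j\<le>k. ennreal ((cmod (?u (shift (real j * h) w)))\<^sup>2))"
      proof -
        have *: "ennreal (2 * a + q * t) = 2 * ennreal a + ennreal q * ennreal t" if "0 \<le> a" "0 \<le> q" "0 \<le> t" for a q t
          using that by (simp add: ennreal_mult)
        show ?thesis using c h by (subst *) (simp_all add: sum_nonneg)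
      qed
      finally show ?case by (cases "fst w \<in> annulus h0 h") auto
    qed
    also have "\<dots> = 2 * sq_norm dual_cylinder (fourier r) + ennreal (c2 / h ^ (2 * k)) * (\<Sum>j\<le>k. (\<integral>\<^sup>+w. indicator (annulus h0 h) (fst w) * ennreal ((cmod (?u (shift (real j * h) w)))\<^sup>2) \<partial>dual_cylinder))"
    proof -
      have [measurable]: "fourier r \<in> borel_measurable dual_cylinder" by (rule L2_measurable[OF fourier_L2[OF r]])
      have *: "(\<integral>\<^sup>+w. 2 * A w + q * (\<Sum>j\<le>k. B j w) \<partial>dual_cylinder) = 2 * (\<integral>\<^sup>+w. A w \<partial>dual_cylinder) + q * (\<Sum>j\<le>k. (\<integral>\<^sup>+w. B j w \<partial>dual_cylinder))"
        if "A \<in> borel_measurable dual_cylinder" "\<And>j. B j \<in> borel_measurable dual_cylinder" for A q B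
        using that by (simp add: nn_integral_add nn_integral_cmult nn_integral_sum)
      show ?thesis unfolding sq_norm_def by (rule *) measurable
    qed
    also have "(\<Sum>j\<le>k. (\<integral>\<^sup>+w. indicator (annulus h0 h) (fst w) * ennreal ((cmod (?u (shift (real j * h) w)))\<^sup>2) \<partial>dual_cylinder)) = (\<Sum>j\<le>k. I2 j h)"
    proof (rule sum.cong[OF refl])
      fix j
      show "(\<integral>\<^sup>+w. indicator (annulus h0 h) (fst w) * ennreal ((cmod (?u (shift (real j * h) w)))\<^sup>2) \<partial>dual_cylinder) = I2 j h"
        unfolding I2_def
        by (subst nn_integral_shift[symmetric, where h = "real j * h"]) (auto simp: shift_def)
    qed
    also have "2 * sq_norm dual_cylinder (fourier r) \<le> ennreal c1 * I1 h"
    proof -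
      have "sq_norm cylinder r \<le> (\<integral>\<^sup>+z. ennreal (4 * (real k)\<^sup>2) * ennreal (min 1 ((h * fst z)\<^sup>2) * (cmod (moment k f z))\<^sup>2) \<partial>cylinder)"
        unfolding sq_norm_def
      proof (rule nn_integral_mono)
        fix z
        have "(cmod (r z))\<^sup>2 \<le> 4 * (real k)\<^sup>2 * min 1 ((h * fst z)\<^sup>2) * (cmod (moment k f z))\<^sup>2"
        proof -
          have "(cmod (r z))\<^sup>2 = (cmod (1 - ?m z))\<^sup>2 * (cmod (moment k f z))\<^sup>2"
            unfolding r_def by (simp only: norm_mult power_mult_distrib)
          then show ?thesis by (simp only:) (intro mult_right_mono norm_one_minus_average_symbol_power zero_le_power2)
        qed
        then show "ennreal ((cmod (r z))\<^sup>2) \<le> ennreal (4 * (real k)\<^sup>2) * ennreal (min 1 ((h * fst z)\<^sup>2) * (cmod (moment k f z))\<^sup>2)"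
          by (subst ennreal_mult[symmetric]) (auto intro!: ennreal_leI simp: mult.assoc)
      qed
      also have "\<dots> = ennreal (4 * (real k)\<^sup>2) * I1 h" unfolding I1_def by (rule nn_integral_cmult) measurable
      finally have le: "sq_norm cylinder r \<le> ennreal (4 * (real k)\<^sup>2) * I1 h" .
      have "2 * sq_norm dual_cylinder (fourier r) \<le> 2 * (ennreal ((2 * pi)\<^sup>2) * (ennreal (4 * (real k)\<^sup>2) * I1 h))"
        unfolding Plancherel_cylinder[OF r] by (intro mult_left_mono le) auto
      also have "\<dots> = ennreal c1 * I1 h"
      proof -
        have "ennreal c1 = 2 * (ennreal ((2 * pi)\<^sup>2) * ennreal (4 * (real k)\<^sup>2))"
          unfolding c1_def two_mult_ennreal[symmetric] by (subst ennreal_mult) auto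
        then show ?thesis by (simp only: mult.assoc)
      qed
      finally show ?thesis .
    qed
    finally show ?thesis by (simp add: add_mono)
  qed
  have annulus_int: "(\<integral>\<^sup>+h. ennreal (1 / h\<^sup>2) * (\<integral>\<^sup>+w. indicator (annulus h0 h) (fst w) * ennreal ((cmod (?g w))\<^sup>2) \<partial>dual_cylinder) \<partial>lborel) < \<infinity>"
  proof -
    have "(\<integral>\<^sup>+h. ennreal (1 / h\<^sup>2) * (\<integral>\<^sup>+w. indicator (annulus h0 h) (fst w) * ennreal ((cmod (?g w))\<^sup>2) \<partial>dual_cylinder) \<partial>lborel)
      \<le> (\<integral>\<^sup>+h. ennreal c1 * (indicator {0<..} h * (ennreal (1 / h\<^sup>2) * I1 h)) + ennreal c2 * (\<Sum>j\<le>k. ennreal (1 / h ^ (2 * k + 2)) * I2 j h) \<partial>lborel)"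
    proof (rule nn_integral_mono)
      fix h :: real
      show "ennreal (1 / h\<^sup>2) * (\<integral>\<^sup>+w. indicator (annulus h0 h) (fst w) * ennreal ((cmod (?g w))\<^sup>2) \<partial>dual_cylinder)
        \<le> ennreal c1 * (indicator {0<..} h * (ennreal (1 / h\<^sup>2) * I1 h)) + ennreal c2 * (\<Sum>j\<le>k. ennreal (1 / h ^ (2 * k + 2)) * I2 j h)"
      proof (cases "h > 0")
        case True
        have "ennreal (1 / h\<^sup>2) * (\<integral>\<^sup>+w. indicator (annulus h0 h) (fst w) * ennreal ((cmod (?g w))\<^sup>2) \<partial>dual_cylinder)
          \<le> ennreal (1 / h\<^sup>2) * (ennreal c1 * I1 h + ennreal (c2 / h ^ (2 * k)) * (\<Sum>j\<le>k. I2 j h))"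
          by (intro mult_left_mono main[OF True]) auto
        also have "\<dots> = ennreal c1 * (ennreal (1 / h\<^sup>2) * I1 h) + (ennreal (1 / h\<^sup>2) * ennreal (c2 / h ^ (2 * k))) * (\<Sum>j\<le>k. I2 j h)"
          by (simp add: distrib_left mult_ac)
        also have "ennreal (1 / h\<^sup>2) * ennreal (c2 / h ^ (2 * k)) = ennreal c2 * ennreal (1 / h ^ (2 * k + 2))"
          using True c by (simp add: ennreal_mult[symmetric] power_add mult.commute power2_eq_square)
        finally show ?thesis using True by (simp add: mult.assoc flip: sum_distrib_left)
      next
        case False
        then have "indicator (annulus h0 h) x = (0::ennreal)" for x by (auto simp: annulus_def)
        then show ?thesis by simp
      qed
    qed
    also have "\<dots> = ennreal c1 * (\<integral>\<^sup>+h. indicator {0<..} h * (ennreal (1 / h\<^sup>2) * I1 h) \<partial>lborel) + ennreal c2 * (\<Sum>j\<le>k. (\<integral>\<^sup>+h. ennreal (1 / h ^ (2 * k + 2)) * I2 j h \<partial>lborel))"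
      by (simp add: nn_integral_add nn_integral_cmult nn_integral_sum)
    also have "\<dots> < \<infinity>"
    proof -
      have "(\<integral>\<^sup>+h. indicator {0<..} h * (ennreal (1 / h\<^sup>2) * I1 h) \<partial>lborel)
        = (\<integral>\<^sup>+h. (\<integral>\<^sup>+z. (ennreal (min (1 / h\<^sup>2) (\<bar>fst z\<bar>\<^sup>2)) * indicator {0<..} h) * ennreal ((cmod (moment k f z))\<^sup>2) \<partial>cylinder) \<partial>lborel)"
      proof (rule nn_integral_cong)
        fix h :: real
        have *: "(1 / h\<^sup>2) * min 1 ((h * x)\<^sup>2) = min (1 / h\<^sup>2) (\<bar>x\<bar>\<^sup>2)" if "h > 0" for x
          using that by (simp add: min_mult_distrib_left power_mult_distrib)
        have "ennreal (1 / h\<^sup>2) * I1 h = (\<integral>\<^sup>+z. ennreal (1 / h\<^sup>2) * ennreal (min 1 ((h * fst z)\<^sup>2) * (cmod (moment k f z))\<^sup>2) \<partial>cylinder)"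
          unfolding I1_def by (rule nn_integral_cmult[symmetric]) measurable
        also have "indicator {0<..} h * \<dots> = (\<integral>\<^sup>+z. indicator {0<..} h * (ennreal (1 / h\<^sup>2) * ennreal (min 1 ((h * fst z)\<^sup>2) * (cmod (moment k f z))\<^sup>2)) \<partial>cylinder)"
          by (rule nn_integral_cmult[symmetric]) measurable
        also have "\<dots> = (\<integral>\<^sup>+z. (ennreal (min (1 / h\<^sup>2) (\<bar>fst z\<bar>\<^sup>2)) * indicator {0<..} h) * ennreal ((cmod (moment k f z))\<^sup>2) \<partial>cylinder)"
        proof (rule nn_integral_cong)
          fix z
          show "indicator {0<..} h * (ennreal (1 / h\<^sup>2) * ennreal (min 1 ((h * fst z)\<^sup>2) * (cmod (moment k f z))\<^sup>2))
            = (ennreal (min (1 / h\<^sup>2) (\<bar>fst z\<bar>\<^sup>2)) * indicator {0<..} h) * ennreal ((cmod (moment k f z))\<^sup>2)"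
          proof (cases "h > 0")
            case True
            let ?X = "min 1 ((h * fst z)\<^sup>2)" and ?Y = "(cmod (moment k f z))\<^sup>2"
            have "ennreal (1 / h\<^sup>2) * ennreal (?X * ?Y) = ennreal (1 / h\<^sup>2 * (?X * ?Y))"
              by (rule ennreal_mult'[symmetric]) simp
            also have "1 / h\<^sup>2 * (?X * ?Y) = min (1 / h\<^sup>2) (\<bar>fst z\<bar>\<^sup>2) * ?Y"
              by (simp only: *[OF True, symmetric] mult.assoc)
            also have "ennreal \<dots> = ennreal (min (1 / h\<^sup>2) (\<bar>fst z\<bar>\<^sup>2)) * ennreal ?Y"
              by (rule ennreal_mult'') simp
            finally show ?thesis using True by simp
          qed simp
        qed
        finally show "indicator {0<..} h * (ennreal (1 / h\<^sup>2) * I1 h) = (\<integral>\<^sup>+z. (ennreal (min (1 / h\<^sup>2) (\<bar>fst z\<bar>\<^sup>2)) * indicator {0<..} h) * ennreal ((cmod (moment k f z))\<^sup>2) \<partial>cylinder)" .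
      qed
      also have "\<dots> = (\<integral>\<^sup>+z. (\<integral>\<^sup>+h. (ennreal (min (1 / h\<^sup>2) (\<bar>fst z\<bar>\<^sup>2)) * indicator {0<..} h) * ennreal ((cmod (moment k f z))\<^sup>2) \<partial>lborel) \<partial>cylinder)"
        by (rule Q.Fubini') measurable
      also have "\<dots> \<le> (\<integral>\<^sup>+z. 2 * ennreal (\<bar>fst z\<bar> * (cmod (moment k f z))\<^sup>2) \<partial>cylinder)"
      proof (rule nn_integral_mono)
        fix z
        have "(\<integral>\<^sup>+h. (ennreal (min (1 / h\<^sup>2) (\<bar>fst z\<bar>\<^sup>2)) * indicator {0<..} h) * ennreal ((cmod (moment k f z))\<^sup>2) \<partial>lborel)
          = (\<integral>\<^sup>+h\<in>{0<..}. ennreal (min (1 / h\<^sup>2) (\<bar>fst z\<bar>\<^sup>2)) \<partial>lborel) * ennreal ((cmod (moment k f z))\<^sup>2)"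
          by (rule nn_integral_multc) measurable
        also have "\<dots> \<le> ennreal (2 * \<bar>fst z\<bar>) * ennreal ((cmod (moment k f z))\<^sup>2)"
          by (intro mult_right_mono nn_integral_min_inverse_square_le) auto
        finally show "(\<integral>\<^sup>+h. (ennreal (min (1 / h\<^sup>2) (\<bar>fst z\<bar>\<^sup>2)) * indicator {0<..} h) * ennreal ((cmod (moment k f z))\<^sup>2) \<partial>lborel)
          \<le> 2 * ennreal (\<bar>fst z\<bar> * (cmod (moment k f z))\<^sup>2)"
          by (simp add: ennreal_mult mult.assoc)
      qed
      also have "\<dots> < \<infinity>" using w by (simp add: nn_integral_cmult ennreal_mult_less_top)
      finally have 1: "(\<integral>\<^sup>+h. indicator {0<..} h * (ennreal (1 / h\<^sup>2) * I1 h) \<partial>lborel) < \<infinity>" .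
      have 2: "(\<integral>\<^sup>+h. ennreal (1 / h ^ (2 * k + 2)) * I2 j h \<partial>lborel) < \<infinity>" if "j \<le> k" for j
      proof -
        have "(\<integral>\<^sup>+h. ennreal (1 / h ^ (2 * k + 2)) * I2 j h \<partial>lborel)
          = (\<integral>\<^sup>+h. (\<integral>\<^sup>+w. (ennreal (1 / h ^ (2 * k + 2)) * indicator (annulus h0 h) (fst w - real j * h)) * ennreal ((cmod (?u w))\<^sup>2) \<partial>dual_cylinder) \<partial>lborel)"
          unfolding I2_def by (subst nn_integral_cmult[symmetric]) (auto simp: mult.assoc)
        also have "\<dots> = (\<integral>\<^sup>+w. (\<integral>\<^sup>+h. (ennreal (1 / h ^ (2 * k + 2)) * indicator (annulus h0 h) (fst w - real j * h)) * ennreal ((cmod (?u w))\<^sup>2) \<partial>lborel) \<partial>dual_cylinder)"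
          by (rule P.Fubini') measurable
        also have "\<dots> = (\<integral>\<^sup>+w. (\<integral>\<^sup>+h. ennreal (1 / h ^ (2 * k + 2)) * indicator (annulus h0 h) (fst w - real j * h) \<partial>lborel) * ennreal ((cmod (?u w))\<^sup>2) \<partial>dual_cylinder)"
          by (intro nn_integral_cong nn_integral_multc) measurable
        also have "\<dots> \<le> (\<integral>\<^sup>+w. ennreal (4 ^ (2 * k + 2) * (real k + 1) * \<bar>fst w\<bar> ^ (2 * k + 1)) * ennreal ((cmod (?u w))\<^sup>2) \<partial>dual_cylinder)"
          by (intro nn_integral_mono mult_right_mono nn_integral_shifted_annulus_le[OF that h0_def]) auto
        also have "\<dots> = (\<integral>\<^sup>+w. ennreal (4 ^ (2 * k + 2) * (real k + 1)) * ennreal (\<bar>fst w\<bar> ^ (2 * k + 1) * (cmod (?u w))\<^sup>2) \<partial>dual_cylinder)"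
          by (intro nn_integral_cong) (simp add: ennreal_mult[symmetric] mult.assoc del: power_Suc)
        also have "\<dots> = ennreal (4 ^ (2 * k + 2) * (real k + 1)) * (\<integral>\<^sup>+w. ennreal (\<bar>fst w\<bar> ^ (2 * k + 1) * (cmod (?u w))\<^sup>2) \<partial>dual_cylinder)"
          by (rule nn_integral_cmult) measurable
        also have "\<dots> < \<infinity>" using s by (simp add: ennreal_mult_less_top)
        finally show ?thesis .
      qed
      show ?thesis using 1 2 by (auto simp: ennreal_mult_less_top)
    qed
    finally show ?thesis .
  qed
  have "(\<integral>\<^sup>+w. ennreal (\<bar>fst w\<bar> * (cmod (?g w))\<^sup>2) \<partial>dual_cylinder)
    \<le> (\<integral>\<^sup>+w. ennreal (1 / h0) * ennreal ((cmod (?g w))\<^sup>2) + 2 * ((\<integral>\<^sup>+h. ennreal (1 / h\<^sup>2) * indicator (annulus h0 h) (fst w) \<partial>lborel) * ennreal ((cmod (?g w))\<^sup>2)) \<partial>dual_cylinder)"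
  proof (rule nn_integral_mono)
    fix w :: "real \<times> int"
    show "ennreal (\<bar>fst w\<bar> * (cmod (?g w))\<^sup>2) \<le> ennreal (1 / h0) * ennreal ((cmod (?g w))\<^sup>2) + 2 * ((\<integral>\<^sup>+h. ennreal (1 / h\<^sup>2) * indicator (annulus h0 h) (fst w) \<partial>lborel) * ennreal ((cmod (?g w))\<^sup>2))"
    proof (cases "\<bar>fst w\<bar> \<le> 1 / h0")
      case True
      then have "ennreal (\<bar>fst w\<bar> * (cmod (?g w))\<^sup>2) \<le> ennreal (1 / h0) * ennreal ((cmod (?g w))\<^sup>2)"
        unfolding ennreal_mult''[OF zero_le_power2] by (intro mult_right_mono ennreal_leI) auto
      then show ?thesis by (rule order_trans) simp
    next
      case False
      then have "ennreal (\<bar>fst w\<bar> / 2) \<le> (\<integral>\<^sup>+h. ennreal (1 / h\<^sup>2) * indicator (annulus h0 h) (fst w) \<partial>lborel)"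
        by (intro nn_integral_annulus_ge h0) auto
      then have "2 * (ennreal (\<bar>fst w\<bar> / 2) * ennreal ((cmod (?g w))\<^sup>2)) \<le> 2 * ((\<integral>\<^sup>+h. ennreal (1 / h\<^sup>2) * indicator (annulus h0 h) (fst w) \<partial>lborel) * ennreal ((cmod (?g w))\<^sup>2))"
        by (intro mult_left_mono mult_right_mono) auto
      moreover have "2 * (ennreal (\<bar>fst w\<bar> / 2) * ennreal ((cmod (?g w))\<^sup>2)) = ennreal (\<bar>fst w\<bar> * (cmod (?g w))\<^sup>2)"
        by (simp add: ennreal_mult[symmetric] two_mult_ennreal)
      ultimately show ?thesis by (simp add: add_increasing)
    qed
  qed
  also have "\<dots> = ennreal (1 / h0) * sq_norm dual_cylinder ?g + 2 * (\<integral>\<^sup>+w. (\<integral>\<^sup>+h. ennreal (1 / h\<^sup>2) * indicator (annulus h0 h) (fst w) \<partial>lborel) * ennreal ((cmod (?g w))\<^sup>2) \<partial>dual_cylinder)"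
    unfolding sq_norm_def by (simp add: nn_integral_add nn_integral_cmult)
  also have "(\<integral>\<^sup>+w. (\<integral>\<^sup>+h. ennreal (1 / h\<^sup>2) * indicator (annulus h0 h) (fst w) \<partial>lborel) * ennreal ((cmod (?g w))\<^sup>2) \<partial>dual_cylinder)
     = (\<integral>\<^sup>+w. (\<integral>\<^sup>+h. ennreal (1 / h\<^sup>2) * (indicator (annulus h0 h) (fst w) * ennreal ((cmod (?g w))\<^sup>2)) \<partial>lborel) \<partial>dual_cylinder)"
    by (subst nn_integral_multc[symmetric]) (auto simp: mult.assoc)
  also have "\<dots> = (\<integral>\<^sup>+h. (\<integral>\<^sup>+w. ennreal (1 / h\<^sup>2) * (indicator (annulus h0 h) (fst w) * ennreal ((cmod (?g w))\<^sup>2)) \<partial>dual_cylinder) \<partial>lborel)"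
    by (rule P.Fubini'[symmetric]) measurable
  also have "\<dots> = (\<integral>\<^sup>+h. ennreal (1 / h\<^sup>2) * (\<integral>\<^sup>+w. indicator (annulus h0 h) (fst w) * ennreal ((cmod (?g w))\<^sup>2) \<partial>dual_cylinder) \<partial>lborel)"
    by (intro nn_integral_cong nn_integral_cmult) measurable
  also have "ennreal (1 / h0) * sq_norm dual_cylinder ?g + 2 * \<dots> < \<infinity>"
    using annulus_int L2_finite[OF fourier_L2[OF fk]] by (auto simp: ennreal_mult_less_top)
  finally show ?thesis .
qed

section \<open>Primitives of locally integrable functions\<close>

text \<open>
  Absolute continuity, stated by the fundamental theorem of calculus. It determines \<open>v\<close> only almost everywhere, which is
  appropriate for a top-order derivative that is only square integrable, whereas \<open>u\<close> is fixed pointwise and continuous.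
\<close>

definition antideriv :: "(real \<Rightarrow> complex) \<Rightarrow> (real \<Rightarrow> complex) \<Rightarrow> bool" where
  "antideriv u v \<longleftrightarrow> (\<forall>a b. a \<le> b \<longrightarrow>
    set_integrable lborel {a..b} v \<and> u b - u a = (LINT s:{a..b}|lborel. v s))"

lemma antideriv_integrable: "antideriv u v \<Longrightarrow> set_integrable lborel {a..b} v"
  by (cases "a \<le> b") (auto simp: antideriv_def set_integrable_def)

lemma antideriv_eq: "antideriv u v \<Longrightarrow> a \<le> b \<Longrightarrow> u b - u a = (LINT s:{a..b}|lborel. v s)"
  by (auto simp: antideriv_def)

lemma antideriv_HK:
  assumes "antideriv u v" "a \<le> b"
  shows "v integrable_on {a..b}" "integral {a..b} v = u b - u a"
  using set_borel_integral_eq_integral[OF antideriv_integrable[OF assms(1)], of a b] antideriv_eq[OF assms] by auto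

lemma antideriv_continuous:
  assumes "antideriv u v"
  shows "continuous_on UNIV u"
proof (simp add: continuous_on_eq_continuous_at, rule allI)
  fix x
  have eq: "u y = u (x - 1) + integral {x - 1..y} v" if "y \<in> {x - 1..x + 1}" for y
    using antideriv_HK(2)[OF assms, of "x - 1" y] that by simp
  have "continuous_on {x - 1..x + 1} (\<lambda>y. u (x - 1) + integral {x - 1..y} v)"
    by (intro continuous_intros indefinite_integral_continuous_1 antideriv_HK(1)[OF assms]) simp
  then have "continuous_on {x - 1..x + 1} u" by (rule continuous_on_eq) (rule eq[symmetric])
  then have "continuous_on {x - 1<..<x + 1} u" by (rule continuous_on_subset) auto
  then show "isCont u x" by (simp add: continuous_on_eq_continuous_at)
qed

lemma antideriv_measurable: "antideriv u v \<Longrightarrow> u \<in> borel_measurable borel"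
  by (intro borel_measurable_continuous_onI antideriv_continuous)

lemma antideriv_add:
  assumes "antideriv u v" "antideriv u' v'"
  shows "antideriv (\<lambda>x. u x + u' x) (\<lambda>x. v x + v' x)"
  unfolding antideriv_def
proof (intro allI impI conjI)
  fix a b :: real assume ab: "a \<le> b"
  note int = assms[THEN antideriv_integrable, of a b]
  show "set_integrable lborel {a..b} (\<lambda>x. v x + v' x)" using int by (rule set_integral_add)
  show "u b + u' b - (u a + u' a) = (LINT s:{a..b}|lborel. v s + v' s)"
    using set_integral_add(2)[OF int] antideriv_eq[OF assms(1) ab] antideriv_eq[OF assms(2) ab] by (simp add: algebra_simps)
qed

lemma antideriv_cmult:
  assumes "antideriv u v"
  shows "antideriv (\<lambda>x. c * u x) (\<lambda>x. c * v x)"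
  using assms unfolding antideriv_def by (auto simp: right_diff_distrib[symmetric])

lemma antideriv_diff:
  assumes "antideriv u v" "antideriv u' v'"
  shows "antideriv (\<lambda>x. u x - u' x) (\<lambda>x. v x - v' x)"
  using antideriv_add[OF assms(1) antideriv_cmult[OF assms(2), of "-1"]] by simp

lemma antideriv_zero: "antideriv (\<lambda>x. 0) (\<lambda>x. 0)"
  by (simp add: antideriv_def set_integrable_def set_lebesgue_integral_def)

lemma antideriv_sum:
  assumes "finite A" "\<And>i. i \<in> A \<Longrightarrow> antideriv (u i) (v i)"
  shows "antideriv (\<lambda>x. \<Sum>i\<in>A. u i x) (\<lambda>x. \<Sum>i\<in>A. v i x)"
  using assms
proof (induction A rule: finite_induct)
  case empty then show ?case by (simp add: antideriv_zero)
next
  case (insert a A)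
  then have "antideriv (\<lambda>x. u a x + (\<Sum>i\<in>A. u i x)) (\<lambda>x. v a x + (\<Sum>i\<in>A. v i x))" by (intro antideriv_add) auto
  then show ?case using insert by simp
qed

lemma integrable_pair_mult:
  fixes f :: "'a \<Rightarrow> complex" and g :: "'b \<Rightarrow> complex"
  assumes "sigma_finite_measure N" and f: "integrable M f" and g: "integrable N g"
  shows "integrable (M \<Otimes>\<^sub>M N) (\<lambda>(x, y). f x * g y)"
proof -
  interpret N: sigma_finite_measure N by fact
  have [measurable]: "f \<in> borel_measurable M" "g \<in> borel_measurable N" using f g by auto
  have "(\<integral>\<^sup>+z. ennreal (cmod (f (fst z) * g (snd z))) \<partial>(M \<Otimes>\<^sub>M N))
     = (\<integral>\<^sup>+x. (\<integral>\<^sup>+y. ennreal (cmod (f x)) * ennreal (cmod (g y)) \<partial>N) \<partial>M)"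
    by (subst N.nn_integral_fst[symmetric]) (auto simp: ennreal_mult norm_mult)
  also have "\<dots> = (\<integral>\<^sup>+x. ennreal (cmod (f x)) \<partial>M) * (\<integral>\<^sup>+y. ennreal (cmod (g y)) \<partial>N)"
    by (simp add: nn_integral_cmult nn_integral_multc)
  also have "\<dots> < \<infinity>" using f g by (auto simp: integrable_iff_bounded ennreal_mult_less_top)
  finally show ?thesis by (auto simp: integrable_iff_bounded case_prod_beta')
qed

lemma antideriv_smooth:
  assumes a: "\<And>x. (a has_vector_derivative a' x) (at x)" and a': "continuous_on UNIV a'"
  shows "antideriv a a'"
  unfolding antideriv_def
proof (intro allI impI conjI)
  fix x y :: real assume "x \<le> y"
  have c: "continuous_on {x..y} a'" by (rule continuous_on_subset[OF a']) simp
  show "set_integrable lborel {x..y} a'" by (rule borel_integrable_atLeastAtMost'[OF c])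
  show "a y - a x = (LINT s:{x..y}|lborel. a' s)"
    unfolding set_lebesgue_integral_def
    by (rule integral_FTC_Icc[symmetric, OF \<open>x \<le> y\<close> _ c]) (rule has_vector_derivative_at_within[OF a])
qed

text \<open>
  Since \<open>v\<close> is only integrable, integration by parts is proved by exchanging the order of integration in
  \<open>a'(s) v(r)\<close> over the triangle \<open>r \<le> s\<close>.
\<close>

lemma antideriv_product:
  assumes u: "antideriv u v" and a: "\<And>x. (a has_vector_derivative a' x) (at x)" and a': "continuous_on UNIV a'"
  shows "antideriv (\<lambda>x. a x * u x) (\<lambda>x. a' x * u x + a x * v x)"
  unfolding antideriv_def
proof (intro allI impI)
  fix \<alpha> \<beta> :: real assume ab: "\<alpha> \<le> \<beta>"
  have aa: "antideriv a a'" by (rule antideriv_smooth[OF a a'])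
  have cont: "continuous_on {\<alpha>..\<beta>} a'" "continuous_on {\<alpha>..\<beta>} a" "continuous_on {\<alpha>..\<beta>} u"
    using a' antideriv_continuous[OF aa] antideriv_continuous[OF u] by (auto intro: continuous_on_subset)
  have iv: "set_integrable lborel {\<alpha>..\<beta>} v" by (rule antideriv_integrable[OF u])
  have ia': "set_integrable lborel {\<alpha>..\<beta>} a'" by (rule antideriv_integrable[OF aa])
  have [measurable]: "a' \<in> borel_measurable borel" by (rule borel_measurable_continuous_onI[OF a'])
  have [measurable]: "a \<in> borel_measurable borel" "u \<in> borel_measurable borel"
    by (rule antideriv_measurable[OF aa], rule antideriv_measurable[OF u])
  have 1: "set_integrable lborel {\<alpha>..\<beta>} (\<lambda>x. a' x * u x)"
    by (intro borel_integrable_atLeastAtMost' continuous_on_mult cont)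
  have "bounded (a ` {\<alpha>..\<beta>})" by (intro compact_imp_bounded compact_continuous_image cont compact_Icc)
  then obtain B where "\<forall>y\<in>a ` {\<alpha>..\<beta>}. cmod y \<le> B" unfolding bounded_iff by blast
  then have B: "cmod (a x) \<le> B" if "x \<in> {\<alpha>..\<beta>}" for x using that by blast
  have 2: "set_integrable lborel {\<alpha>..\<beta>} (\<lambda>x. a x * v x)"
  proof -
    have iv': "integrable lborel (\<lambda>x. of_real B * (indicator {\<alpha>..\<beta>} x *\<^sub>R v x))"
      using iv unfolding set_integrable_def by (rule integrable_mult_right)
    have m: "(\<lambda>x. indicator {\<alpha>..\<beta>} x *\<^sub>R v x) \<in> borel_measurable lborel"
      using iv unfolding set_integrable_def by (rule borel_measurable_integrable)
    show ?thesis unfolding set_integrable_def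
    proof (rule Bochner_Integration.integrable_bound[OF iv'])
      have "(\<lambda>x. a x * (indicator {\<alpha>..\<beta>} x *\<^sub>R v x)) \<in> borel_measurable lborel" using m by measurable
      then show "(\<lambda>x. indicator {\<alpha>..\<beta>} x *\<^sub>R (a x * v x)) \<in> borel_measurable lborel" by simp
      show "AE x in lborel. norm (indicator {\<alpha>..\<beta>} x *\<^sub>R (a x * v x)) \<le> norm (of_real B * (indicator {\<alpha>..\<beta>} x *\<^sub>R v x))"
      proof (rule AE_I2)
        fix x
        show "norm (indicator {\<alpha>..\<beta>} x *\<^sub>R (a x * v x)) \<le> norm (of_real B * (indicator {\<alpha>..\<beta>} x *\<^sub>R v x))"
          using B[of x] by (auto simp: norm_mult indicator_def intro!: mult_right_mono)
      qed
    qed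
  qed
  let ?P = "\<lambda>s. indicator {\<alpha>..\<beta>} s *\<^sub>R a' s" and ?Q = "\<lambda>r. indicator {\<alpha>..\<beta>} r *\<^sub>R v r"
  have P: "integrable lborel ?P" and Q: "integrable lborel ?Q"
    using ia' iv unfolding set_integrable_def by auto
  have PQ: "integrable (lborel \<Otimes>\<^sub>M lborel) (\<lambda>(s, r). ?P s * ?Q r)"
    by (rule integrable_pair_mult[OF sigma_finite_lborel P Q])
  have F: "integrable (lborel \<Otimes>\<^sub>M lborel) (\<lambda>(s, r). indicator {r..} s *\<^sub>R (?P s * ?Q r))"
  proof (rule Bochner_Integration.integrable_bound[OF PQ])
    have [measurable]: "?P \<in> borel_measurable borel" "?Q \<in> borel_measurable borel" using P Q by auto
    have "(\<lambda>(s, r). (if r \<le> s then 1 else 0) *\<^sub>R (?P s * ?Q r)) \<in> borel_measurable (lborel \<Otimes>\<^sub>M lborel)" by measurable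
    moreover have "(\<lambda>(s, r). (if r \<le> s then 1 else 0) *\<^sub>R (?P s * ?Q r)) = (\<lambda>(s, r). indicator {r..} s *\<^sub>R (?P s * ?Q r))"
      by (auto simp: indicator_def)
    ultimately show "(\<lambda>(s, r). indicator {r..} s *\<^sub>R (?P s * ?Q r)) \<in> borel_measurable (lborel \<Otimes>\<^sub>M lborel)" by simp
  qed (auto simp: indicator_def)
  have swap: "(LINT r|lborel. (LINT s|lborel. indicator {r..} s *\<^sub>R (?P s * ?Q r))) = (LINT s|lborel. (LINT r|lborel. indicator {r..} s *\<^sub>R (?P s * ?Q r)))"
    by (rule lborel_pair.Fubini_integral[OF F])
  have R: "(LINT s|lborel. (LINT r|lborel. indicator {r..} s *\<^sub>R (?P s * ?Q r))) = (LINT s|lborel. ?P s * (u s - u \<alpha>))"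
  proof (rule Bochner_Integration.integral_cong[OF refl])
    fix s
    show "(LINT r|lborel. indicator {r..} s *\<^sub>R (?P s * ?Q r)) = ?P s * (u s - u \<alpha>)"
    proof (cases "s \<in> {\<alpha>..\<beta>}")
      case True
      have "(LINT r|lborel. indicator {r..} s *\<^sub>R (?P s * ?Q r)) = (LINT r|lborel. ?P s * (indicator {\<alpha>..s} r *\<^sub>R v r))"
        using True by (intro Bochner_Integration.integral_cong) (auto simp: indicator_def)
      also have "\<dots> = ?P s * (LINT r|lborel. indicator {\<alpha>..s} r *\<^sub>R v r)"
        by (rule integral_mult_right_zero)
      also have "\<dots> = ?P s * (u s - u \<alpha>)"
        using True antideriv_eq[OF u, of \<alpha> s] by (simp add: set_lebesgue_integral_def)
      finally show ?thesis .
    qed simp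
  qed
  have L: "(LINT r|lborel. (LINT s|lborel. indicator {r..} s *\<^sub>R (?P s * ?Q r))) = (LINT r|lborel. (a \<beta> - a r) * ?Q r)"
  proof (rule Bochner_Integration.integral_cong[OF refl])
    fix r
    show "(LINT s|lborel. indicator {r..} s *\<^sub>R (?P s * ?Q r)) = (a \<beta> - a r) * ?Q r"
    proof (cases "r \<in> {\<alpha>..\<beta>}")
      case True
      have "(LINT s|lborel. indicator {r..} s *\<^sub>R (?P s * ?Q r)) = (LINT s|lborel. (indicator {r..\<beta>} s *\<^sub>R a' s) * ?Q r)"
        using True by (intro Bochner_Integration.integral_cong) (auto simp: indicator_def)
      also have "\<dots> = (LINT s|lborel. indicator {r..\<beta>} s *\<^sub>R a' s) * ?Q r"
        by (rule integral_mult_left_zero)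
      also have "\<dots> = (a \<beta> - a r) * ?Q r"
        using True antideriv_eq[OF aa, of r \<beta>] by (simp add: set_lebesgue_integral_def)
      finally show ?thesis .
    qed simp
  qed
  have e1: "(LINT s|lborel. ?P s * (u s - u \<alpha>)) = (LINT s:{\<alpha>..\<beta>}|lborel. a' s * u s) - (a \<beta> - a \<alpha>) * u \<alpha>"
  proof -
    have "(LINT s|lborel. ?P s * (u s - u \<alpha>)) = (LINT s|lborel. indicator {\<alpha>..\<beta>} s *\<^sub>R (a' s * u s) - ?P s * u \<alpha>)"
      by (intro Bochner_Integration.integral_cong) (auto simp: algebra_simps)
    also have "\<dots> = (LINT s:{\<alpha>..\<beta>}|lborel. a' s * u s) - (LINT s|lborel. ?P s * u \<alpha>)"
      unfolding set_lebesgue_integral_def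
      by (rule Bochner_Integration.integral_diff[OF 1[unfolded set_integrable_def]]) (rule integrable_mult_left, rule P)
    also have "(LINT s|lborel. ?P s * u \<alpha>) = (LINT s|lborel. ?P s) * u \<alpha>"
      by (rule integral_mult_left_zero)
    also have "\<dots> = (a \<beta> - a \<alpha>) * u \<alpha>"
      using antideriv_eq[OF aa ab] by (simp add: set_lebesgue_integral_def)
    finally show ?thesis .
  qed
  have e2: "(LINT r|lborel. (a \<beta> - a r) * ?Q r) = a \<beta> * (u \<beta> - u \<alpha>) - (LINT r:{\<alpha>..\<beta>}|lborel. a r * v r)"
  proof -
    have "(LINT r|lborel. (a \<beta> - a r) * ?Q r) = (LINT r|lborel. a \<beta> * ?Q r - indicator {\<alpha>..\<beta>} r *\<^sub>R (a r * v r))"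
      by (intro Bochner_Integration.integral_cong) (auto simp: algebra_simps)
    also have "\<dots> = (LINT r|lborel. a \<beta> * ?Q r) - (LINT r:{\<alpha>..\<beta>}|lborel. a r * v r)"
      unfolding set_lebesgue_integral_def
      by (rule Bochner_Integration.integral_diff[OF _ 2[unfolded set_integrable_def]]) (rule integrable_mult_right, rule Q)
    also have "(LINT r|lborel. a \<beta> * ?Q r) = a \<beta> * (LINT r|lborel. ?Q r)"
      by (rule integral_mult_right_zero)
    also have "\<dots> = a \<beta> * (u \<beta> - u \<alpha>)"
      using antideriv_eq[OF u ab] by (simp add: set_lebesgue_integral_def)
    finally show ?thesis .
  qed
  have "(LINT s:{\<alpha>..\<beta>}|lborel. a' s * u s) + (LINT r:{\<alpha>..\<beta>}|lborel. a r * v r) = a \<beta> * u \<beta> - a \<alpha> * u \<alpha>"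
    using swap unfolding R L e1 e2 by (simp add: algebra_simps)
  then show "set_integrable lborel {\<alpha>..\<beta>} (\<lambda>x. a' x * u x + a x * v x) \<and>
      a \<beta> * u \<beta> - a \<alpha> * u \<alpha> = (LINT s:{\<alpha>..\<beta>}|lborel. a' s * u s + a s * v s)"
    using set_integral_add[OF 1 2] by simp
qed

text \<open>
  Lebesgue's differentiation theorem: almost every \<open>v x\<close> is the limit of difference quotients of \<open>u\<close>.
\<close>

lemma antideriv_vanish:
  assumes D: "antideriv u v" and I: "open I" "\<And>x. x \<in> I \<Longrightarrow> u x = 0"
  shows "AE x in lborel. x \<in> I \<longrightarrow> v x = 0"
proof -
  have "v integrable_on cbox a b" for a b using antideriv_HK(1)[OF D, of a b] by (cases "a \<le> b") auto
  then obtain N where N: "negligible N" and lim: "\<And>x e. \<lbrakk>x \<notin> N; 0 < e\<rbrakk> \<Longrightarrow>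
      \<exists>d>0. \<forall>h. 0 < h \<and> h < d \<longrightarrow> norm (integral (cbox x (x + h *\<^sub>R One)) v /\<^sub>R h ^ DIM(real) - v x) < e"
    using integrable_ccontinuous_explicit[of v] by blast
  have zero: "v x = 0" if x: "x \<notin> N" "x \<in> I" for x
  proof (rule ccontr)
    assume "v x \<noteq> 0"
    then obtain d where d: "d > 0" "\<And>h. 0 < h \<Longrightarrow> h < d \<Longrightarrow> norm (integral (cbox x (x + h *\<^sub>R One)) v /\<^sub>R h ^ DIM(real) - v x) < norm (v x)"
      using lim[OF x(1), of "norm (v x)"] by auto
    obtain r where r: "r > 0" "ball x r \<subseteq> I" using I(1) x(2) open_contains_ball by blast
    define h where "h = min (d / 2) (r / 2)"
    have h: "0 < h" "h < d" "h < r" using d r by (auto simp: h_def)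
    have "x + h \<in> I" using r h by (auto simp: dist_real_def)
    then have "integral {x..x + h} v = 0" using antideriv_HK(2)[OF D, of x "x + h"] h I(2) x(2) by simp
    then show False using d(2)[OF h(1,2)] by simp
  qed
  have "AE x in lborel. x \<notin> N"
    using AE_not_in[of N lebesgue] N unfolding negligible_iff_null_sets AE_completion_iff by blast
  then show ?thesis by eventually_elim (use zero in auto)
qed

lemma continuous_AE_zero_open:
  fixes u :: "real \<Rightarrow> complex"
  assumes u: "continuous_on UNIV u" and I: "open I" and ae: "AE x in lborel. x \<in> I \<longrightarrow> u x = 0"
  shows "\<forall>x\<in>I. u x = 0"
proof (rule ccontr)
  let ?S = "I \<inter> u -` (- {0})"
  assume "\<not> (\<forall>x\<in>I. u x = 0)"
  then have ne: "?S \<noteq> {}" by auto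
  have op: "open ?S" using I u by (intro open_Int) (auto intro: open_vimage)
  have "AE x in lborel. x \<notin> ?S" using ae by eventually_elim auto
  then have "emeasure lborel ?S = 0" using op by (subst (asm) AE_iff_measurable[of ?S]) auto
  then have "?S \<in> null_sets lebesgue" using op by (auto simp: null_sets_def)
  then have "negligible ?S" by (simp add: negligible_iff_null_sets)
  then show False using open_not_negligible[OF op ne] by blast
qed

text \<open>
  Passing from one derivative to the next alternates between two steps: a continuous function that vanishes almost everywhere on an open
  set vanishes there, and then its derivative vanishes almost everywhere there.
\<close>

lemma antideriv_chain_vanish:
  assumes D: "\<And>j. j < k \<Longrightarrow> antideriv (w j) (w (Suc j))" and I: "open I"
    and z: "AE x in lborel. x \<in> I \<longrightarrow> w 0 x = 0"
  shows "j \<le> k \<Longrightarrow> AE x in lborel. x \<in> I \<longrightarrow> w j x = 0"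
proof (induction j)
  case (Suc j)
  then have D': "antideriv (w j) (w (Suc j))" by (intro D) auto
  have "\<forall>x\<in>I. w j x = 0" using Suc by (intro continuous_AE_zero_open antideriv_continuous[OF D'] I) auto
  then show ?case by (intro antideriv_vanish[OF D' I]) auto
qed (use z in simp)

definition leibniz :: "(nat \<Rightarrow> real \<Rightarrow> complex) \<Rightarrow> (nat \<Rightarrow> real \<Rightarrow> complex) \<Rightarrow> nat \<Rightarrow> real \<Rightarrow> complex" where
  "leibniz a u n x = (\<Sum>i\<le>n. of_nat (n choose i) * (a i x * u (n - i) x))"

lemma antideriv_leibniz:
  assumes u: "\<And>j. j < k \<Longrightarrow> antideriv (u j) (u (Suc j))"
    and a: "\<And>j x. (a j has_vector_derivative a (Suc j) x) (at x)" and n: "n < k"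
  shows "antideriv (leibniz a u n) (leibniz a u (Suc n))"
proof -
  have cont: "continuous_on UNIV (a j)" for j
    using a[of j] by (intro continuous_at_imp_continuous_on ballI has_vector_derivative_continuous) auto
  have "antideriv (\<lambda>x. \<Sum>i\<le>n. of_nat (n choose i) * (a i x * u (n - i) x))
     (\<lambda>x. \<Sum>i\<le>n. of_nat (n choose i) * (a (Suc i) x * u (n - i) x + a i x * u (Suc (n - i)) x))"
    by (intro antideriv_sum antideriv_cmult antideriv_product a cont u) (use n in auto)
  moreover have "(\<Sum>i\<le>n. of_nat (n choose i) * (a (Suc i) x * u (n - i) x + a i x * u (Suc (n - i)) x)) = leibniz a u (Suc n) x" for x
  proof -
    define c where "c i = a i x * u (Suc n - i) x" for i
    have "(\<Sum>i\<le>n. of_nat (n choose i) * (a (Suc i) x * u (n - i) x + a i x * u (Suc (n - i)) x))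
       = (\<Sum>i\<le>n. of_nat (n choose i) * c (Suc i)) + (\<Sum>i\<le>n. of_nat (n choose i) * c i)"
      by (simp add: sum.distrib[symmetric] distrib_left c_def Suc_diff_le)
    also have "(\<Sum>i\<le>n. of_nat (n choose i) * c i) = (\<Sum>i\<le>Suc n. of_nat (n choose i) * c i)"
      by simp
    also have "\<dots> = c 0 + (\<Sum>i\<le>n. of_nat (n choose Suc i) * c (Suc i))"
      by (subst sum.atMost_Suc_shift) simp
    also have "(\<Sum>i\<le>n. of_nat (n choose i) * c (Suc i)) + (c 0 + (\<Sum>i\<le>n. of_nat (n choose Suc i) * c (Suc i)))
      = c 0 + (\<Sum>i\<le>n. of_nat (Suc n choose Suc i) * c (Suc i))"
      by (simp add: sum.distrib[symmetric] distrib_right)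
    also have "\<dots> = (\<Sum>i\<le>Suc n. of_nat (Suc n choose i) * c i)"
      by (subst sum.atMost_Suc_shift) simp
    finally show ?thesis by (simp only: leibniz_def c_def)
  qed
  moreover have "leibniz a u n = (\<lambda>x. \<Sum>i\<le>n. of_nat (n choose i) * (a i x * u (n - i) x))"
    by (rule ext) (simp add: leibniz_def)
  ultimately show ?thesis by simp
qed

lemma norm_set_integral_sq_le:
  fixes u :: "real \<Rightarrow> complex"
  assumes int: "set_integrable lborel {a..b} u" and [measurable]: "u \<in> borel_measurable borel" and ab: "a \<le> b"
  shows "ennreal ((cmod (LINT s:{a..b}|lborel. u s))\<^sup>2) \<le> ennreal (b - a) * sq_norm lborel u"
proof -
  have "ennreal (cmod (LINT s:{a..b}|lborel. u s)) \<le> (\<integral>\<^sup>+s. ennreal (cmod (indicator {a..b} s *\<^sub>R u s)) \<partial>lborel)"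
    unfolding set_lebesgue_integral_def by (rule integral_norm_bound_ennreal[OF int[unfolded set_integrable_def]])
  also have "\<dots> = (\<integral>\<^sup>+s. indicator {a..b} s * ennreal (cmod (u s)) \<partial>lborel)"
    by (intro nn_integral_cong) (auto simp: indicator_def)
  finally have "(ennreal (cmod (LINT s:{a..b}|lborel. u s)))\<^sup>2 \<le> (\<integral>\<^sup>+s. indicator {a..b} s * ennreal (cmod (u s)) \<partial>lborel)\<^sup>2"
    by (intro power_mono) auto
  also have "\<dots> \<le> (\<integral>\<^sup>+s. (indicator {a..b} s)\<^sup>2 \<partial>lborel) * (\<integral>\<^sup>+s. (ennreal (cmod (u s)))\<^sup>2 \<partial>lborel)"
    by (rule Cauchy_Schwarz_nn_integral) auto
  also have "(\<integral>\<^sup>+s. (indicator {a..b} s)\<^sup>2 \<partial>lborel) = (\<integral>\<^sup>+s. indicator {a..b} s \<partial>lborel)"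
    by (intro nn_integral_cong) (auto simp: indicator_def)
  finally show ?thesis using ab by (simp add: ennreal_power sq_norm_def)
qed

lemma antideriv_Hoelder:
  assumes D: "antideriv u v" and v: "v \<in> borel_measurable borel"
  shows "ennreal ((cmod (u x - u y))\<^sup>2) \<le> ennreal \<bar>x - y\<bar> * sq_norm lborel v"
proof -
  have *: "ennreal ((cmod (u b - u a))\<^sup>2) \<le> ennreal (b - a) * sq_norm lborel v" if "a \<le> b" for a b
    unfolding antideriv_eq[OF D that] by (rule norm_set_integral_sq_le[OF antideriv_integrable[OF D] v that])
  show ?thesis
    using *[of y x] *[of x y] by (cases "y \<le> x") (auto simp: norm_minus_commute)
qed

text \<open>
  The integral is invariant under scaling, so the integrals over \<open>(-d, 0)\<close> and \<open>(-d/2, 0)\<close> agree, although they differ by at least \<open>1/2\<close>.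
\<close>

lemma nn_integral_inverse_abs_left_infinite:
  assumes d: "(d::real) > 0"
  shows "(\<integral>\<^sup>+s\<in>{-d<..<0}. ennreal (1 / \<bar>s\<bar>) \<partial>lborel) = \<infinity>"
proof -
  define J where "J r = (\<integral>\<^sup>+s\<in>{-r<..<0}. ennreal (1 / \<bar>s\<bar>) \<partial>lborel)" for r :: real
  have scale: "J d = J (d / 2)"
  proof -
    have "J (d / 2) = ennreal \<bar>1 / 2\<bar> * (\<integral>\<^sup>+s. ennreal (1 / \<bar>0 + 1 / 2 * s\<bar>) * indicator {- (d / 2)<..<0} (0 + 1 / 2 * s) \<partial>lborel)"
      unfolding J_def by (rule nn_integral_real_affine) auto
    also have "(\<integral>\<^sup>+s. ennreal (1 / \<bar>0 + 1 / 2 * s\<bar>) * indicator {- (d / 2)<..<0} (0 + 1 / 2 * s) \<partial>lborel) = (\<integral>\<^sup>+s. ennreal 2 * (ennreal (1 / \<bar>s\<bar>) * indicator {- d<..<0} s) \<partial>lborel)"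
      by (intro nn_integral_cong) (auto simp: indicator_def ennreal_mult[symmetric] abs_mult simp del: ennreal_numeral)
    also have "\<dots> = ennreal 2 * J d" unfolding J_def by (rule nn_integral_cmult) simp
    also have "ennreal \<bar>1 / 2\<bar> * (ennreal 2 * J d) = J d"
      by (subst mult.assoc[symmetric], subst ennreal_mult[symmetric]) auto
    finally show ?thesis by simp
  qed
  have "ennreal (1 / 2) + J (d / 2) \<le> J d"
  proof -
    have "ennreal (1 / 2) = ennreal (1 / d) * emeasure lborel {-d<..-(d/2)}"
      using d by (simp add: ennreal_mult[symmetric])
    also have "\<dots> = (\<integral>\<^sup>+s. ennreal (1 / d) * indicator {-d<..-(d/2)} s \<partial>lborel)"
      by (simp add: nn_integral_cmult_indicator)
    finally have "ennreal (1 / 2) + J (d / 2) = (\<integral>\<^sup>+s. ennreal (1 / d) * indicator {-d<..-(d/2)} s + ennreal (1 / \<bar>s\<bar>) * indicator {-(d/2)<..<0} s \<partial>lborel)"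
      unfolding J_def by (simp add: nn_integral_add)
    also have "\<dots> \<le> J d" unfolding J_def
    proof (rule nn_integral_mono)
      fix s :: real
      have "ennreal (1 / d) \<le> ennreal (1 / \<bar>s\<bar>)" if "- d < s" "s \<le> - (d / 2)"
        using that d by (intro ennreal_leI frac_le) auto
      then show "ennreal (1 / d) * indicator {-d<..-(d/2)} s + ennreal (1 / \<bar>s\<bar>) * indicator {-(d/2)<..<0} s \<le> ennreal (1 / \<bar>s\<bar>) * indicator {-d<..<0} s"
        using d by (auto simp: indicator_def)
    qed
    finally show ?thesis .
  qed
  with scale have le: "ennreal (1 / 2) + J d \<le> J d" by simp
  have "J d = \<infinity>"
  proof (rule ccontr)
    assume "J d \<noteq> \<infinity>"
    then obtain r where "J d = ennreal r" "r \<ge> 0" by (cases "J d") auto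
    with le show False by (simp add: ennreal_plus[symmetric] del: ennreal_plus)
  qed
  then show ?thesis by (simp add: J_def)
qed

text \<open>
  The weight \<open>1/|s|\<close> is just not integrable at zero, so it detects the value of a continuous function there.
\<close>

lemma continuous_zero_of_nn_integral:
  fixes u :: "real \<Rightarrow> complex"
  assumes u: "continuous_on UNIV u" and fin: "(\<integral>\<^sup>+s\<in>{-1<..<0}. ennreal ((cmod (u s))\<^sup>2 / \<bar>s\<bar>) \<partial>lborel) < \<infinity>"
  shows "u 0 = 0"
proof (rule ccontr)
  assume nz: "u 0 \<noteq> 0"
  have [measurable]: "u \<in> borel_measurable borel" by (rule borel_measurable_continuous_onI[OF u])
  define c where "c = cmod (u 0) / 2"
  have c: "c > 0" using nz by (simp add: c_def)
  have "isCont (\<lambda>x. cmod (u x)) 0" using u by (auto simp: continuous_on_eq_continuous_at intro!: continuous_norm)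
  then have "(\<lambda>x. cmod (u x)) \<midarrow>0\<rightarrow> cmod (u 0)" by (simp add: isCont_def)
  then have "eventually (\<lambda>x. c < cmod (u x)) (at 0)" using nz by (intro order_tendstoD(1)) (auto simp: c_def)
  then obtain r where r: "r > 0" "\<And>x. x \<noteq> 0 \<Longrightarrow> \<bar>x\<bar> < r \<Longrightarrow> c < cmod (u x)"
    by (auto simp: eventually_at dist_real_def)
  define d where "d = min 1 r"
  have d: "d > 0" "d \<le> 1" "d \<le> r" using r by (auto simp: d_def)
  have "\<infinity> = ennreal (c\<^sup>2) * (\<integral>\<^sup>+s\<in>{-d<..<0}. ennreal (1 / \<bar>s\<bar>) \<partial>lborel)"
    using c nn_integral_inverse_abs_left_infinite[OF d(1)] by (simp add: ennreal_mult_top ennreal_mult_eq_top_iff)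
  also have "\<dots> = (\<integral>\<^sup>+s. ennreal (c\<^sup>2) * (ennreal (1 / \<bar>s\<bar>) * indicator {-d<..<0} s) \<partial>lborel)"
    by (rule nn_integral_cmult[symmetric]) simp
  also have "\<dots> \<le> (\<integral>\<^sup>+s\<in>{-1<..<0}. ennreal ((cmod (u s))\<^sup>2 / \<bar>s\<bar>) \<partial>lborel)"
  proof (rule nn_integral_mono)
    fix s :: real
    show "ennreal (c\<^sup>2) * (ennreal (1 / \<bar>s\<bar>) * indicator {-d<..<0} s) \<le> ennreal ((cmod (u s))\<^sup>2 / \<bar>s\<bar>) * indicator {-1<..<0} s"
    proof (cases "s \<in> {-d<..<0}")
      case True
      then have "c < cmod (u s)" using d by (intro r(2)) auto
      then have "c\<^sup>2 \<le> (cmod (u s))\<^sup>2" using c by (intro power_mono) auto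
      then have "ennreal (c\<^sup>2 * (1 / \<bar>s\<bar>)) \<le> ennreal ((cmod (u s))\<^sup>2 / \<bar>s\<bar>)"
        by (intro ennreal_leI) (simp add: divide_right_mono)
      then have "ennreal (c\<^sup>2) * ennreal (1 / \<bar>s\<bar>) \<le> ennreal ((cmod (u s))\<^sup>2 / \<bar>s\<bar>)"
        by (subst ennreal_mult'[symmetric]) simp_all
      moreover have "s \<in> {-1<..<0}" using True d by auto
      ultimately show ?thesis using True by (simp only: indicator_simps mult_1_right)
    qed simp
  qed
  finally show False using fin by simp
qed

section \<open>Frequency derivatives of the transform\<close>

lemma AE_dual_cylinder_slice:
  assumes "AE w in dual_cylinder. P w"
  shows "AE \<xi> in lborel. \<forall>\<eta>. P (\<xi>, \<eta>)"
proof -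
  have "AE \<xi> in lborel. AE \<eta> in count_space UNIV. P (\<xi>, \<eta>)"
    using assms unfolding dual_cylinder_def by (rule lborel_int.AE_pair)
  then show ?thesis by (simp add: AE_count_space)
qed

lemma slice_L2:
  assumes F: "F \<in> L2 dual_cylinder"
  shows "(\<lambda>\<xi>. F (\<xi>, \<eta>)) \<in> L2 lborel" "sq_norm lborel (\<lambda>\<xi>. F (\<xi>, \<eta>)) \<le> sq_norm dual_cylinder F"
proof -
  have [measurable]: "F \<in> borel_measurable dual_cylinder" by (rule L2_measurable[OF F])
  have "sq_norm lborel (\<lambda>\<xi>. F (\<xi>, \<eta>)) \<le> (\<integral>\<^sup>+\<eta>. sq_norm lborel (\<lambda>\<xi>. F (\<xi>, \<eta>)) \<partial>count_space UNIV)"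
    using sum_le_nn_integral_count_space[of "{\<eta>}" "\<lambda>\<eta>. sq_norm lborel (\<lambda>\<xi>. F (\<xi>, \<eta>))"] by simp
  also have "\<dots> = sq_norm dual_cylinder F"
    unfolding sq_norm_def by (subst nn_integral_dual_cylinder) auto
  finally show le: "sq_norm lborel (\<lambda>\<xi>. F (\<xi>, \<eta>)) \<le> sq_norm dual_cylinder F" .
  have "(\<lambda>\<xi>. F (\<xi>, \<eta>)) \<in> borel_measurable lborel" by measurable
  with le L2_finite[OF F] show "(\<lambda>\<xi>. F (\<xi>, \<eta>)) \<in> L2 lborel" by (auto simp: L2_iff)
qed

lemma L2_set_integrable:
  fixes u :: "real \<Rightarrow> complex"
  assumes u: "u \<in> L2 lborel"
  shows "set_integrable lborel {a..b} u"
proof -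
  have "sq_norm lborel (indicator {a..b} :: real \<Rightarrow> complex) = (\<integral>\<^sup>+x. indicator {a..b} x \<partial>lborel)"
    unfolding sq_norm_def by (intro nn_integral_cong) (auto simp: indicator_def)
  then have "(indicator {a..b} :: real \<Rightarrow> complex) \<in> L2 lborel"
    by (auto simp: L2_iff emeasure_lborel_Icc_eq)
  from L2_mult_integrable[OF this u]
  have "integrable lborel (\<lambda>x. indicator {a..b} x * u x)" .
  moreover have "indicator {a..b} x * u x = indicator {a..b} x *\<^sub>R u x" for x by (auto simp: indicator_def)
  ultimately show ?thesis by (simp add: set_integrable_def)
qed

text \<open>
  Differentiation under the integral sign, in integrated form: Fubini's theorem for the derivative of the character.
\<close>

lemma fourier_trunc_antideriv:
  assumes g: "g \<in> L2 cylinder" and g1: "moment 1 g \<in> L2 cylinder" and ab: "a \<le> b"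
  shows "fourier_trunc n g (b, \<eta>) - fourier_trunc n g (a, \<eta>) = (LINT s:{a..b}|lborel. fourier_trunc n (moment 1 g) (s, \<eta>))"
proof -
  let ?c = "\<lambda>s z. cnj (character (s, \<eta>) z)"
  have [measurable]: "g \<in> borel_measurable cylinder" "moment 1 g \<in> borel_measurable cylinder"
    using g g1 by (auto intro: L2_measurable)
  have diff: "?c b z - ?c a z = (LINT s:{a..b}|lborel. (- \<i> * of_real (fst z)) * ?c s z)" for z
  proof -
    have c: "?c s z = exp (- \<i> * of_real (fst z) * of_real s) * trig (- \<eta>) (snd z)" for s
      using cnj_character_Pair[of s \<eta> "fst z" "snd z"] by (simp add: mult.assoc)
    have "((\<lambda>s. ?c s z) has_vector_derivative (- \<i> * of_real (fst z)) * ?c s z) (at s)" for s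
    proof -
      have "((\<lambda>s. exp (- \<i> * of_real (fst z) * s) * trig (- \<eta>) (snd z)) has_field_derivative
        (- \<i> * of_real (fst z)) * (exp (- \<i> * of_real (fst z) * of_real s) * trig (- \<eta>) (snd z))) (at (of_real s))"
        by (auto intro!: derivative_eq_intros)
      then show ?thesis unfolding c by (rule has_vector_derivative_real_field)
    qed
    moreover have "continuous_on UNIV (\<lambda>s. (- \<i> * of_real (fst z)) * ?c s z)"
      unfolding c by (intro continuous_intros)
    ultimately have "antideriv (\<lambda>s. ?c s z) (\<lambda>s. (- \<i> * of_real (fst z)) * ?c s z)" by (rule antideriv_smooth)
    from antideriv_eq[OF this ab] show ?thesis .
  qed
  interpret P: pair_sigma_finite "lborel :: real measure" cylinder ..
  let ?h = "\<lambda>z. cutoff n (moment 1 g) z"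
  have h: "integrable cylinder ?h" by (rule cutoff_integrable[OF g1])
  have ind: "integrable lborel (indicator {a..b} :: real \<Rightarrow> complex)"
  proof -
    have "integrable lborel (\<lambda>x. complex_of_real (indicator {a..b} x))" by (intro integrable_of_real) (auto simp: emeasure_lborel_Icc_eq)
    moreover have "complex_of_real (indicator {a..b} x) = indicator {a..b} x" for x :: real by (auto simp: indicator_def)
    ultimately show ?thesis by simp
  qed
  have F: "integrable (lborel \<Otimes>\<^sub>M cylinder) (\<lambda>(s, z). indicator {a..b} s *\<^sub>R (?h z * ?c s z))"
  proof (rule Bochner_Integration.integrable_bound[OF integrable_pair_mult[OF cylinder.sigma_finite_measure_axioms ind h]])
    have [measurable]: "?h \<in> borel_measurable cylinder" by measurable
    show "(\<lambda>(s, z). indicator {a..b} s *\<^sub>R (?h z * ?c s z)) \<in> borel_measurable (lborel \<Otimes>\<^sub>M cylinder)"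
      by measurable
  qed (auto simp: norm_mult indicator_def)
  have int: "integrable cylinder (\<lambda>z. cutoff n g z * ?c s z)" for s
    by (intro integral_transform_integrable cutoff_integrable g)
  have "fourier_trunc n g (b, \<eta>) - fourier_trunc n g (a, \<eta>) = (LINT z|cylinder. cutoff n g z * (?c b z - ?c a z))"
    using int by (simp add: fourier_trunc_eq integral_transform_def right_diff_distrib)
  also have "\<dots> = (LINT z|cylinder. (LINT s|lborel. indicator {a..b} s *\<^sub>R (?h z * ?c s z)))"
  proof (rule Bochner_Integration.integral_cong[OF refl])
    fix z
    have "cutoff n g z * (?c b z - ?c a z) = (LINT s|lborel. cutoff n g z * (indicator {a..b} s *\<^sub>R ((- \<i> * of_real (fst z)) * ?c s z)))"
      unfolding diff set_lebesgue_integral_def by (rule integral_mult_right_zero[symmetric])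
    then show "cutoff n g z * (?c b z - ?c a z) = (LINT s|lborel. indicator {a..b} s *\<^sub>R (?h z * ?c s z))"
      by (simp add: cutoff_def moment_def mult_ac)
  qed
  also have "\<dots> = (LINT s|lborel. (LINT z|cylinder. indicator {a..b} s *\<^sub>R (?h z * ?c s z)))"
    by (rule P.Fubini_integral[OF F])
  finally show ?thesis by (simp add: set_lebesgue_integral_def fourier_trunc_eq integral_transform_def)
qed

text \<open>
  Passage to the limit in the identity for truncated transforms. The left hand side converges at every point because \<open>g\<close> is integrable, the
  right hand side because mean square convergence implies convergence of integrals over bounded intervals. Any
  representative \<open>G\<close> of the derivative will do, so that a continuous one can be chosen later.
\<close>

lemma antideriv_integral_transform:
  assumes g: "g \<in> L2 cylinder" and i: "integrable cylinder g" and g1: "moment 1 g \<in> L2 cylinder"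
    and G[measurable]: "G \<in> borel_measurable dual_cylinder" and GF: "AE w in dual_cylinder. fourier (moment 1 g) w = G w"
  shows "antideriv (\<lambda>\<xi>. integral_transform g (\<xi>, \<eta>)) (\<lambda>\<xi>. G (\<xi>, \<eta>))"
  unfolding antideriv_def
proof (intro allI impI conjI)
  fix a b :: real assume ab: "a \<le> b"
  let ?F = "fourier (moment 1 g)"
  have F: "?F \<in> L2 dual_cylinder" by (rule fourier_L2[OF g1])
  have FM[measurable]: "?F \<in> borel_measurable dual_cylinder" by (rule L2_measurable[OF F])
  have ae: "AE \<xi> in lborel. ?F (\<xi>, \<eta>) = G (\<xi>, \<eta>)"
    using AE_dual_cylinder_slice[OF GF] by eventually_elim simp
  have "sq_norm lborel (\<lambda>\<xi>. G (\<xi>, \<eta>)) = sq_norm lborel (\<lambda>\<xi>. ?F (\<xi>, \<eta>))"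
    by (rule sq_norm_cong_AE, use ae in eventually_elim) simp
  then have GL: "(\<lambda>\<xi>. G (\<xi>, \<eta>)) \<in> L2 lborel" using slice_L2(1)[OF F, of \<eta>] by (auto simp: L2_iff)
  show "set_integrable lborel {a..b} (\<lambda>\<xi>. G (\<xi>, \<eta>))" by (rule L2_set_integrable[OF GL])
  let ?T = "\<lambda>n s. fourier_trunc n (moment 1 g) (s, \<eta>)"
  have TL: "?T n \<in> L2 lborel" for n by (rule slice_L2(1)[OF fourier_trunc_L2[OF g1]])
  have FL: "(\<lambda>s. ?F (s, \<eta>)) \<in> L2 lborel" by (rule slice_L2(1)[OF F])
  have eqG: "(LINT s:{a..b}|lborel. G (s, \<eta>)) = (LINT s:{a..b}|lborel. ?F (s, \<eta>))"
    unfolding set_lebesgue_integral_def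
  proof (rule integral_cong_AE)
    show "(\<lambda>s. indicator {a..b} s *\<^sub>R G (s, \<eta>)) \<in> borel_measurable lborel"
      "(\<lambda>s. indicator {a..b} s *\<^sub>R ?F (s, \<eta>)) \<in> borel_measurable lborel" by measurable
    show "AE s in lborel. indicator {a..b} s *\<^sub>R G (s, \<eta>) = indicator {a..b} s *\<^sub>R ?F (s, \<eta>)"
      using ae by eventually_elim (simp only:)
  qed
  have d0: "(\<lambda>n. (LINT s:{a..b}|lborel. ?T n s) - (LINT s:{a..b}|lborel. ?F (s, \<eta>))) \<longlonglongrightarrow> 0"
  proof -
    let ?e = "\<lambda>n. (LINT s:{a..b}|lborel. ?T n s) - (LINT s:{a..b}|lborel. ?F (s, \<eta>))"
    have le: "ennreal ((cmod (?e n))\<^sup>2) \<le> ennreal (b - a) * sq_norm dual_cylinder (\<lambda>w. fourier_trunc n (moment 1 g) w - ?F w)" for n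
    proof -
      have "?e n = (LINT s:{a..b}|lborel. ?T n s - ?F (s, \<eta>))"
        using set_integral_diff(2)[OF L2_set_integrable[OF TL[of n]] L2_set_integrable[OF FL], of a b] by simp
      then have "ennreal ((cmod (?e n))\<^sup>2) \<le> ennreal (b - a) * sq_norm lborel (\<lambda>s. ?T n s - ?F (s, \<eta>))"
        using norm_set_integral_sq_le[OF L2_set_integrable[OF L2_diff[OF TL FL]] _ ab] L2_measurable[OF L2_diff[OF TL[of n] FL]] by simp
      also have "\<dots> \<le> ennreal (b - a) * sq_norm dual_cylinder (\<lambda>w. fourier_trunc n (moment 1 g) w - ?F w)"
        by (intro mult_left_mono slice_L2(2)[OF L2_diff[OF fourier_trunc_L2[OF g1] F]]) auto
      finally show ?thesis .
    qed
    have "(\<lambda>n. ennreal (b - a) * sq_norm dual_cylinder (\<lambda>w. fourier_trunc n (moment 1 g) w - ?F w)) \<longlonglongrightarrow> ennreal (b - a) * 0"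
      using fourier_tendsto[OF g1] by (intro ennreal_tendsto_cmult) (auto simp: L2_tendsto_iff)
    then have lim: "(\<lambda>n. ennreal (b - a) * sq_norm dual_cylinder (\<lambda>w. fourier_trunc n (moment 1 g) w - ?F w)) \<longlonglongrightarrow> 0" by simp
    have ev1: "eventually (\<lambda>n. 0 \<le> ennreal ((cmod (?e n))\<^sup>2)) sequentially" by simp
    have ev2: "eventually (\<lambda>n. ennreal ((cmod (?e n))\<^sup>2) \<le> ennreal (b - a) * sq_norm dual_cylinder (\<lambda>w. fourier_trunc n (moment 1 g) w - ?F w)) sequentially"
      using le by (intro always_eventually allI)
    have "(\<lambda>n. ennreal ((cmod (?e n))\<^sup>2)) \<longlonglongrightarrow> ennreal 0"
      using tendsto_sandwich[OF ev1 ev2 tendsto_const lim] by simp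
    then have "(\<lambda>n. (cmod (?e n))\<^sup>2) \<longlonglongrightarrow> 0" by (subst (asm) tendsto_ennreal_iff) auto
    then have "(\<lambda>n. sqrt ((cmod (?e n))\<^sup>2)) \<longlonglongrightarrow> sqrt 0" by (rule tendsto_real_sqrt)
    then have "(\<lambda>n. cmod (?e n)) \<longlonglongrightarrow> 0" by simp
    then show ?thesis by (rule tendsto_norm_zero_cancel)
  qed
  have l1: "(\<lambda>n. fourier_trunc n g (b, \<eta>) - fourier_trunc n g (a, \<eta>)) \<longlonglongrightarrow> integral_transform g (b, \<eta>) - integral_transform g (a, \<eta>)"
    by (intro tendsto_diff fourier_trunc_pointwise g i)
  have "(\<lambda>n. ((LINT s:{a..b}|lborel. ?T n s) - (LINT s:{a..b}|lborel. ?F (s, \<eta>))) + (LINT s:{a..b}|lborel. ?F (s, \<eta>))) \<longlonglongrightarrow> 0 + (LINT s:{a..b}|lborel. ?F (s, \<eta>))"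
    by (intro tendsto_add d0 tendsto_const)
  then have l2: "(\<lambda>n. fourier_trunc n g (b, \<eta>) - fourier_trunc n g (a, \<eta>)) \<longlonglongrightarrow> (LINT s:{a..b}|lborel. ?F (s, \<eta>))"
    unfolding fourier_trunc_antideriv[OF g g1 ab] by simp
  show "integral_transform g (b, \<eta>) - integral_transform g (a, \<eta>) = (LINT s:{a..b}|lborel. G (s, \<eta>))"
    unfolding eqG by (rule LIMSEQ_unique[OF l1 l2])
qed

section \<open>Multipliers on functions of finite energy\<close>

lemma energy_inner_measurable [measurable]:
  assumes [measurable]: "u \<in> borel_measurable dual_cylinder" "B \<in> sets borel"
  shows "(\<lambda>w. \<integral>\<^sup>+\<zeta>\<in>B. ennreal ((cmod (u (\<zeta>, snd w) - u w))\<^sup>2 / (\<zeta> - fst w)\<^sup>2) \<partial>lborel) \<in> borel_measurable dual_cylinder"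
  by measurable

lemma strip_dual_sets [measurable]: "A \<in> sets borel \<Longrightarrow> A \<times> UNIV \<in> sets dual_cylinder"
  unfolding dual_cylinder_def by auto

lemma energy_cong_AE:
  assumes "AE w in dual_cylinder. u w = v w"
  shows "energy A B u = energy A B v"
  unfolding energy_def
proof (rule nn_integral_cong_AE, use assms in eventually_elim)
  case (elim w)
  have "(\<integral>\<^sup>+\<zeta>\<in>B. ennreal ((cmod (u (\<zeta>, snd w) - u w))\<^sup>2 / (\<zeta> - fst w)\<^sup>2) \<partial>lborel)
    = (\<integral>\<^sup>+\<zeta>\<in>B. ennreal ((cmod (v (\<zeta>, snd w) - v w))\<^sup>2 / (\<zeta> - fst w)\<^sup>2) \<partial>lborel)"
    by (rule nn_integral_cong_AE, use AE_dual_cylinder_slice[OF assms] in eventually_elim) (use elim in simp)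
  then show ?case by simp
qed

lemma energy_mono_sets:
  assumes "A \<subseteq> A'" "B \<subseteq> B'"
  shows "energy A B u \<le> energy A' B' u"
proof -
  have "(\<integral>\<^sup>+\<zeta>\<in>B. F \<zeta> \<partial>lborel) \<le> (\<integral>\<^sup>+\<zeta>\<in>B'. F \<zeta> \<partial>lborel)" for F :: "real \<Rightarrow> ennreal"
    using assms by (intro nn_integral_mono) (auto simp: indicator_def)
  then show ?thesis unfolding energy_def
    using assms by (intro nn_integral_mono) (auto simp: indicator_def)
qed

lemma ennreal_le_lincomb:
  assumes "x \<le> p * a + q * b" "0 \<le> p" "0 \<le> a" "0 \<le> q" "0 \<le> b"
  shows "ennreal x \<le> ennreal p * ennreal a + ennreal q * ennreal b"
  using assms by (simp add: ennreal_mult[symmetric] ennreal_plus[symmetric] ennreal_leI del: ennreal_plus)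

lemma energy_add:
  assumes [measurable]: "u \<in> borel_measurable dual_cylinder" "v \<in> borel_measurable dual_cylinder" "A \<in> sets borel" "B \<in> sets borel"
  shows "energy A B (\<lambda>w. u w + v w) \<le> 2 * energy A B u + 2 * energy A B v"
proof -
  let ?d = "\<lambda>u w \<zeta>. ennreal ((cmod (u (\<zeta>, snd w) - u w))\<^sup>2 / (\<zeta> - fst w)\<^sup>2)"
  have pt: "?d (\<lambda>w. u w + v w) w \<zeta> \<le> 2 * ?d u w \<zeta> + 2 * ?d v w \<zeta>" for w \<zeta>
  proof -
    have "(cmod ((u (\<zeta>, snd w) - u w) + (v (\<zeta>, snd w) - v w)))\<^sup>2 \<le> 2 * (cmod (u (\<zeta>, snd w) - u w))\<^sup>2 + 2 * (cmod (v (\<zeta>, snd w) - v w))\<^sup>2"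
      using norm_add_sq_weighted[of 1 "u (\<zeta>, snd w) - u w" "v (\<zeta>, snd w) - v w"] by simp
    then have "(cmod (u (\<zeta>, snd w) + v (\<zeta>, snd w) - (u w + v w)))\<^sup>2 / (\<zeta> - fst w)\<^sup>2
       \<le> 2 * ((cmod (u (\<zeta>, snd w) - u w))\<^sup>2 / (\<zeta> - fst w)\<^sup>2) + 2 * ((cmod (v (\<zeta>, snd w) - v w))\<^sup>2 / (\<zeta> - fst w)\<^sup>2)"
      unfolding add_diff_add[symmetric] times_divide_eq_right add_divide_distrib[symmetric] by (rule divide_right_mono) simp
    from ennreal_le_lincomb[OF this] show ?thesis by simp
  qed
  have inner: "(\<integral>\<^sup>+\<zeta>\<in>B. ?d (\<lambda>w. u w + v w) w \<zeta> \<partial>lborel) \<le> 2 * (\<integral>\<^sup>+\<zeta>\<in>B. ?d u w \<zeta> \<partial>lborel) + 2 * (\<integral>\<^sup>+\<zeta>\<in>B. ?d v w \<zeta> \<partial>lborel)" for w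
  proof -
    have "(\<integral>\<^sup>+\<zeta>\<in>B. ?d (\<lambda>w. u w + v w) w \<zeta> \<partial>lborel) \<le> (\<integral>\<^sup>+\<zeta>. 2 * (?d u w \<zeta> * indicator B \<zeta>) + 2 * (?d v w \<zeta> * indicator B \<zeta>) \<partial>lborel)"
      using pt by (intro nn_integral_mono) (simp add: indicator_def)
    also have "\<dots> = 2 * (\<integral>\<^sup>+\<zeta>\<in>B. ?d u w \<zeta> \<partial>lborel) + 2 * (\<integral>\<^sup>+\<zeta>\<in>B. ?d v w \<zeta> \<partial>lborel)"
      by (simp add: nn_integral_add nn_integral_cmult)
    finally show ?thesis .
  qed
  have "energy A B (\<lambda>w. u w + v w) \<le> (\<integral>\<^sup>+w. 2 * ((\<integral>\<^sup>+\<zeta>\<in>B. ?d u w \<zeta> \<partial>lborel) * indicator (A \<times> UNIV) w) + 2 * ((\<integral>\<^sup>+\<zeta>\<in>B. ?d v w \<zeta> \<partial>lborel) * indicator (A \<times> UNIV) w) \<partial>dual_cylinder)"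
    unfolding energy_def using inner by (intro nn_integral_mono) (simp add: indicator_def)
  also have "\<dots> = 2 * energy A B u + 2 * energy A B v"
    unfolding energy_def by (subst nn_integral_add) (auto simp: nn_integral_cmult)
  finally show ?thesis .
qed

lemma energy_add_finite:
  assumes "u \<in> borel_measurable dual_cylinder" "v \<in> borel_measurable dual_cylinder" "A \<in> sets borel" "B \<in> sets borel"
    and "energy A B u < \<infinity>" "energy A B v < \<infinity>"
  shows "energy A B (\<lambda>w. u w + v w) < \<infinity>"
  using energy_add[OF assms(1-4)] assms(5,6)
  by (elim le_less_trans) (simp add: ennreal_mult_less_top)

text \<open>
  The product rule for differences, \<open>\<Delta>(m u) = m \<Delta>u + \<Delta>m u\<close>: besides a bound for \<open>m\<close>, only the
  difference quotient of the multiplier enters, as the weight \<open>K\<close>.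
\<close>

lemma energy_mult_finite:
  assumes [measurable]: "u \<in> borel_measurable dual_cylinder" "m \<in> borel_measurable dual_cylinder" "A \<in> sets borel" "B \<in> sets borel" "K \<in> borel_measurable borel"
    and bound: "\<And>w. fst w \<in> B \<Longrightarrow> cmod (m w) \<le> c"
    and K: "\<And>w. fst w \<in> A \<Longrightarrow> (\<integral>\<^sup>+\<zeta>\<in>B. ennreal ((cmod (m (\<zeta>, snd w) - m w))\<^sup>2 / (\<zeta> - fst w)\<^sup>2) \<partial>lborel) \<le> ennreal (K (fst w))"
    and fin: "energy A B u < \<infinity>" "(\<integral>\<^sup>+w\<in>A \<times> UNIV. ennreal (K (fst w)) * ennreal ((cmod (u w))\<^sup>2) \<partial>dual_cylinder) < \<infinity>"
  shows "energy A B (\<lambda>w. m w * u w) < \<infinity>"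
proof -
  let ?d = "\<lambda>u w \<zeta>. ennreal ((cmod (u (\<zeta>, snd w) - u w))\<^sup>2 / (\<zeta> - fst w)\<^sup>2)"
  have pt: "?d (\<lambda>w. m w * u w) w \<zeta> \<le> ennreal (2 * c\<^sup>2) * ?d u w \<zeta> + 2 * (?d m w \<zeta> * ennreal ((cmod (u w))\<^sup>2))" if "\<zeta> \<in> B" for w \<zeta>
  proof -
    let ?z = "(\<zeta>, snd w)"
    have "m ?z * u ?z - m w * u w = m ?z * (u ?z - u w) + (m ?z - m w) * u w" by (simp add: algebra_simps)
    then have "(cmod (m ?z * u ?z - m w * u w))\<^sup>2 \<le> 2 * (cmod (m ?z * (u ?z - u w)))\<^sup>2 + 2 * (cmod ((m ?z - m w) * u w))\<^sup>2"
      using norm_add_sq_weighted[of 1 "m ?z * (u ?z - u w)" "(m ?z - m w) * u w"] by simp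
    also have "\<dots> \<le> 2 * (c\<^sup>2 * (cmod (u ?z - u w))\<^sup>2) + 2 * ((cmod (m ?z - m w))\<^sup>2 * (cmod (u w))\<^sup>2)"
      unfolding norm_mult power_mult_distrib
      using bound[of ?z] that by (intro add_mono mult_left_mono mult_right_mono power_mono) auto
    finally have "(cmod (m ?z * u ?z - m w * u w))\<^sup>2 / (\<zeta> - fst w)\<^sup>2 \<le> (2 * (c\<^sup>2 * (cmod (u ?z - u w))\<^sup>2) + 2 * ((cmod (m ?z - m w))\<^sup>2 * (cmod (u w))\<^sup>2)) / (\<zeta> - fst w)\<^sup>2"
      by (rule divide_right_mono) simp
    also have "\<dots> = 2 * c\<^sup>2 * ((cmod (u ?z - u w))\<^sup>2 / (\<zeta> - fst w)\<^sup>2) + 2 * ((cmod (m ?z - m w))\<^sup>2 / (\<zeta> - fst w)\<^sup>2 * (cmod (u w))\<^sup>2)"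
      by (simp add: add_divide_distrib)
    finally have "ennreal ((cmod (m ?z * u ?z - m w * u w))\<^sup>2 / (\<zeta> - fst w)\<^sup>2)
      \<le> ennreal (2 * c\<^sup>2) * ennreal ((cmod (u ?z - u w))\<^sup>2 / (\<zeta> - fst w)\<^sup>2) + ennreal 2 * ennreal ((cmod (m ?z - m w))\<^sup>2 / (\<zeta> - fst w)\<^sup>2 * (cmod (u w))\<^sup>2)"
      by (rule ennreal_le_lincomb) auto
    then show ?thesis unfolding ennreal_mult''[OF zero_le_power2] by simp
  qed
  have inner: "(\<integral>\<^sup>+\<zeta>\<in>B. ?d (\<lambda>w. m w * u w) w \<zeta> \<partial>lborel) \<le> ennreal (2 * c\<^sup>2) * (\<integral>\<^sup>+\<zeta>\<in>B. ?d u w \<zeta> \<partial>lborel) + 2 * (ennreal (K (fst w)) * ennreal ((cmod (u w))\<^sup>2))" if "fst w \<in> A" for w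
  proof -
    have "(\<integral>\<^sup>+\<zeta>\<in>B. ?d (\<lambda>w. m w * u w) w \<zeta> \<partial>lborel) \<le> (\<integral>\<^sup>+\<zeta>. ennreal (2 * c\<^sup>2) * (?d u w \<zeta> * indicator B \<zeta>) + 2 * (?d m w \<zeta> * indicator B \<zeta> * ennreal ((cmod (u w))\<^sup>2)) \<partial>lborel)"
      using pt by (intro nn_integral_mono) (simp add: indicator_def)
    also have "\<dots> = ennreal (2 * c\<^sup>2) * (\<integral>\<^sup>+\<zeta>\<in>B. ?d u w \<zeta> \<partial>lborel) + 2 * ((\<integral>\<^sup>+\<zeta>\<in>B. ?d m w \<zeta> \<partial>lborel) * ennreal ((cmod (u w))\<^sup>2))"
      by (simp add: nn_integral_add nn_integral_cmult nn_integral_multc)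
    also have "\<dots> \<le> ennreal (2 * c\<^sup>2) * (\<integral>\<^sup>+\<zeta>\<in>B. ?d u w \<zeta> \<partial>lborel) + 2 * (ennreal (K (fst w)) * ennreal ((cmod (u w))\<^sup>2))"
      by (intro add_left_mono mult_left_mono mult_right_mono K that) auto
    finally show ?thesis .
  qed
  have "energy A B (\<lambda>w. m w * u w) \<le> (\<integral>\<^sup>+w. ennreal (2 * c\<^sup>2) * ((\<integral>\<^sup>+\<zeta>\<in>B. ?d u w \<zeta> \<partial>lborel) * indicator (A \<times> UNIV) w) + 2 * (ennreal (K (fst w)) * ennreal ((cmod (u w))\<^sup>2) * indicator (A \<times> UNIV) w) \<partial>dual_cylinder)"
    unfolding energy_def using inner by (intro nn_integral_mono) (auto simp: indicator_def)
  also have "\<dots> = ennreal (2 * c\<^sup>2) * energy A B u + 2 * (\<integral>\<^sup>+w\<in>A \<times> UNIV. ennreal (K (fst w)) * ennreal ((cmod (u w))\<^sup>2) \<partial>dual_cylinder)"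
    unfolding energy_def by (subst nn_integral_add) (auto simp: nn_integral_cmult)
  also have "\<dots> < \<infinity>" using fin by (simp add: ennreal_mult_less_top)
  finally show ?thesis .
qed

definition phase :: "real \<Rightarrow> real \<times> int \<Rightarrow> complex" where
  "phase T w = exp (\<i> * of_real (T * ((fst w)\<^sup>2 + (of_int (snd w))\<^sup>2)))"

lemma phase_measurable [measurable]: "phase T \<in> borel_measurable dual_cylinder"
  unfolding phase_def by measurable

lemma norm_phase [simp]: "cmod (phase T w) = 1"
  unfolding phase_def by (rule norm_exp_i_times)

lemma norm_exp_i_diff_le: "cmod (exp (\<i> * of_real a) - exp (\<i> * of_real b)) \<le> \<bar>a - b\<bar>"
proof -
  have "exp (\<i> * of_real a) = exp (\<i> * of_real b) * exp (- \<i> * of_real (b - a))"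
    by (simp add: exp_add[symmetric] algebra_simps)
  then have "exp (\<i> * of_real a) - exp (\<i> * of_real b) = exp (\<i> * of_real b) * (exp (- \<i> * of_real (b - a)) - 1)"
    by (simp add: right_diff_distrib)
  then have "cmod (exp (\<i> * of_real a) - exp (\<i> * of_real b)) = cmod (exp (- \<i> * of_real (b - a)) - 1)"
    by (simp only: norm_mult norm_exp_i_times mult_1_left)
  also have "\<dots> \<le> \<bar>b - a\<bar>" by (rule cmod_exp_minus_one_le)
  finally show ?thesis by (simp add: abs_minus_commute)
qed

text \<open>
  The phase has derivative of size \<open>|\<xi>|\<close> in \<open>\<xi>\<close> and is bounded, so its half derivative has size \<open>|\<xi>|\<^sup>1\<^sup>/\<^sup>2\<close>. The bound does not
  depend on \<open>\<eta>\<close>, which only contributes a constant phase.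
\<close>

lemma phase_difference_quotient:
  "(\<integral>\<^sup>+\<zeta>. ennreal ((cmod (phase T (\<zeta>, snd w) - phase T w))\<^sup>2 / (\<zeta> - fst w)\<^sup>2) \<partial>lborel) \<le> ennreal ((8 * T\<^sup>2 + 8) * (1 + \<bar>fst w\<bar>))"
proof -
  define \<xi> where "\<xi> = fst w"
  \<comment> \<open>Up to distance \<open>1/r\<close> the phase is used as a Lipschitz function with constant \<open>2|T|r\<close>, beyond only as a bounded one; at this
    distance the two contributions balance.\<close>
  define r where "r = 1 + \<bar>\<xi>\<bar>"
  have r: "r \<ge> 1" "r > 0" by (auto simp: r_def)
  let ?D = "\<lambda>h. (cmod (phase T (\<xi> + h, snd w) - phase T w))\<^sup>2"
  have [measurable]: "(\<lambda>h. phase T (\<xi> + h, snd w)) \<in> borel_measurable borel" by measurable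
  have "(\<integral>\<^sup>+\<zeta>. ennreal ((cmod (phase T (\<zeta>, snd w) - phase T w))\<^sup>2 / (\<zeta> - fst w)\<^sup>2) \<partial>lborel)
    = ennreal \<bar>1\<bar> * (\<integral>\<^sup>+h. ennreal ((cmod (phase T (\<xi> + 1 * h, snd w) - phase T w))\<^sup>2 / (\<xi> + 1 * h - fst w)\<^sup>2) \<partial>lborel)"
    by (rule nn_integral_real_affine) auto
  also have "\<dots> = (\<integral>\<^sup>+h. ennreal (?D h / h\<^sup>2) \<partial>lborel)" by (simp add: \<xi>_def)
  also have "\<dots> \<le> (\<integral>\<^sup>+h. ennreal (4 * T\<^sup>2 * r\<^sup>2) * indicator {-(1/r)..1/r} h
       + (4 * (ennreal (1 / h\<^sup>2) * indicator {1/r..} h) + 4 * (ennreal (1 / h\<^sup>2) * indicator {..-(1/r)} h)) \<partial>lborel)"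
  proof (rule nn_integral_mono)
    fix h :: real
    have "cmod (phase T (\<xi> + h, snd w) - phase T w) \<le> 2"
      using norm_triangle_ineq4[of "phase T (\<xi> + h, snd w)" "phase T w"] by simp
    then have "?D h \<le> 2\<^sup>2" by (intro power_mono) auto
    then have "?D h / h\<^sup>2 \<le> 4 * (1 / h\<^sup>2)" by (simp add: divide_right_mono)
    then have far: "ennreal (?D h / h\<^sup>2) \<le> 4 * ennreal (1 / h\<^sup>2)" using ennreal_leI ennreal_mult[of 4 "1 / h\<^sup>2"] by force
    have near: "ennreal (?D h / h\<^sup>2) \<le> ennreal (4 * T\<^sup>2 * r\<^sup>2)" if h: "\<bar>h\<bar> \<le> 1 / r"
    proof -
      have "1 / r \<le> 1" using r by simp
      with h have h1: "\<bar>h\<bar> \<le> 1" by linarith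
      have "cmod (phase T (\<xi> + h, snd w) - phase T w) \<le> \<bar>T * ((\<xi> + h)\<^sup>2 + (of_int (snd w))\<^sup>2) - T * (\<xi>\<^sup>2 + (of_int (snd w))\<^sup>2)\<bar>"
        unfolding phase_def \<xi>_def fst_conv snd_conv by (rule norm_exp_i_diff_le)
      also have "T * ((\<xi> + h)\<^sup>2 + (of_int (snd w))\<^sup>2) - T * (\<xi>\<^sup>2 + (of_int (snd w))\<^sup>2) = T * (h * (2 * \<xi> + h))"
        by (simp add: power2_eq_square algebra_simps)
      also have "\<bar>T * (h * (2 * \<xi> + h))\<bar> = \<bar>T\<bar> * (\<bar>h\<bar> * \<bar>2 * \<xi> + h\<bar>)" by (simp add: abs_mult)
      also have "\<dots> \<le> \<bar>T\<bar> * (\<bar>h\<bar> * (2 * r))"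
        using h1 by (intro mult_left_mono) (auto simp: r_def)
      finally have "?D h \<le> (\<bar>T\<bar> * (\<bar>h\<bar> * (2 * r)))\<^sup>2" by (intro power_mono) auto
      also have "\<dots> = 4 * T\<^sup>2 * r\<^sup>2 * h\<^sup>2" by (simp add: power_mult_distrib)
      finally have "?D h / h\<^sup>2 \<le> 4 * T\<^sup>2 * r\<^sup>2 * h\<^sup>2 / h\<^sup>2" by (rule divide_right_mono) simp
      also have "\<dots> \<le> 4 * T\<^sup>2 * r\<^sup>2" by (cases "h = 0") auto
      finally show ?thesis by (rule ennreal_leI)
    qed
    consider "\<bar>h\<bar> \<le> 1 / r" | "h > 1 / r" | "h < - (1 / r)" by linarith
    then show "ennreal (?D h / h\<^sup>2) \<le> ennreal (4 * T\<^sup>2 * r\<^sup>2) * indicator {-(1/r)..1/r} h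
       + (4 * (ennreal (1 / h\<^sup>2) * indicator {1/r..} h) + 4 * (ennreal (1 / h\<^sup>2) * indicator {..-(1/r)} h))"
    proof cases
      case 1
      then have "ennreal (?D h / h\<^sup>2) \<le> ennreal (4 * T\<^sup>2 * r\<^sup>2) * indicator {-(1/r)..1/r} h"
        using near by (simp add: abs_le_iff)
      then show ?thesis by (rule order_trans) simp
    next
      case 2
      then have "4 * ennreal (1 / h\<^sup>2) = 4 * (ennreal (1 / h\<^sup>2) * indicator {1/r..} h)" by simp
      with far have "ennreal (?D h / h\<^sup>2) \<le> 4 * (ennreal (1 / h\<^sup>2) * indicator {1/r..} h)" by simp
      then show ?thesis by (rule order_trans) (simp add: add_increasing)
    next
      case 3
      then have "4 * ennreal (1 / h\<^sup>2) = 4 * (ennreal (1 / h\<^sup>2) * indicator {..-(1/r)} h)" by simp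
      with far have "ennreal (?D h / h\<^sup>2) \<le> 4 * (ennreal (1 / h\<^sup>2) * indicator {..-(1/r)} h)" by simp
      then show ?thesis by (rule order_trans) (simp add: add_increasing)
    qed
  qed
  also have "\<dots> = ennreal (4 * T\<^sup>2 * r\<^sup>2) * ennreal (2 / r) + (4 * ennreal r + 4 * ennreal r)"
  proof -
    have "emeasure lborel {-(1/r)..1/r} = ennreal (2 / r)" using r by simp
    then show ?thesis
      using r nn_integral_inverse_square[of "1/r"] nn_integral_inverse_square_neg[of "1/r"]
      by (simp add: nn_integral_add nn_integral_cmult nn_integral_cmult_indicator)
  qed
  also have "\<dots> = ennreal ((8 * T\<^sup>2 + 8) * r)"
  proof -
    have 4: "4 * ennreal r = ennreal (4 * r)" by (simp add: ennreal_mult')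
    have "4 * T\<^sup>2 * r\<^sup>2 * (2 / r) = 8 * T\<^sup>2 * r" using r by (simp add: power2_eq_square)
    then show ?thesis unfolding 4 using r
      by (simp add: ennreal_mult[symmetric] ennreal_plus[symmetric] algebra_simps del: ennreal_plus)
  qed
  finally show ?thesis by (simp add: r_def \<xi>_def)
qed

text \<open>
  This is why \<open>|\<xi>|\<^sup>1\<^sup>/\<^sup>2 u\<close> has to be square integrable: it pays for the growing oscillation of the phase.
\<close>

lemma energy_phase_finite:
  assumes u: "u \<in> L2 dual_cylinder" and e: "energy UNIV UNIV u < \<infinity>"
    and w: "(\<integral>\<^sup>+w. ennreal (\<bar>fst w\<bar> * (cmod (u w))\<^sup>2) \<partial>dual_cylinder) < \<infinity>"
  shows "energy UNIV UNIV (\<lambda>w. phase T w * u w) < \<infinity>"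
proof (rule energy_mult_finite[where K = "\<lambda>\<xi>. (8 * T\<^sup>2 + 8) * (1 + \<bar>\<xi>\<bar>)" and c = 1])
  show [measurable]: "u \<in> borel_measurable dual_cylinder" by (rule L2_measurable[OF u])
  have "(\<integral>\<^sup>+w\<in>UNIV \<times> UNIV. ennreal ((8 * T\<^sup>2 + 8) * (1 + \<bar>fst w\<bar>)) * ennreal ((cmod (u w))\<^sup>2) \<partial>dual_cylinder)
     = (\<integral>\<^sup>+w. ennreal (8 * T\<^sup>2 + 8) * (ennreal ((cmod (u w))\<^sup>2) + ennreal (\<bar>fst w\<bar> * (cmod (u w))\<^sup>2)) \<partial>dual_cylinder)"
    by (intro nn_integral_cong) (auto simp: ennreal_mult[symmetric] ennreal_plus[symmetric] algebra_simps simp del: ennreal_plus)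
  also have "\<dots> = ennreal (8 * T\<^sup>2 + 8) * (sq_norm dual_cylinder u + (\<integral>\<^sup>+w. ennreal (\<bar>fst w\<bar> * (cmod (u w))\<^sup>2) \<partial>dual_cylinder))"
    unfolding sq_norm_def by (simp add: nn_integral_cmult nn_integral_add)
  also have "\<dots> < \<infinity>" using L2_finite[OF u] w by (simp add: ennreal_mult_less_top)
  finally show "(\<integral>\<^sup>+w\<in>UNIV \<times> UNIV. ennreal ((8 * T\<^sup>2 + 8) * (1 + \<bar>fst w\<bar>)) * ennreal ((cmod (u w))\<^sup>2) \<partial>dual_cylinder) < \<infinity>" .
qed (use e phase_difference_quotient in auto)

lemma energy_cmult_finite:
  assumes [measurable]: "u \<in> borel_measurable dual_cylinder" "A \<in> sets borel" "B \<in> sets borel" and "energy A B u < \<infinity>"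
  shows "energy A B (\<lambda>w. c * u w) < \<infinity>"
  by (rule energy_mult_finite[where m = "\<lambda>_. c" and K = "\<lambda>_. 0" and c = "cmod c"]) (use assms in auto)

section \<open>Cutting off at frequency zero\<close>

text \<open>
  The borderline Hardy integral. Half a derivative is just too little to bound it, so its finiteness is an independent condition on the
  behaviour of \<open>u\<close> at \<open>\<xi> = 0\<close>.
\<close>

definition hardy :: "real set \<Rightarrow> (real \<times> int \<Rightarrow> complex) \<Rightarrow> ennreal" where
  "hardy A u = (\<integral>\<^sup>+w\<in>A \<times> UNIV. ennreal ((cmod (u w))\<^sup>2 / \<bar>fst w\<bar>) \<partial>dual_cylinder)"

lemma hardy_mono: "A \<subseteq> A' \<Longrightarrow> hardy A u \<le> hardy A' u"
  unfolding hardy_def by (intro nn_integral_mono) (auto simp: indicator_def)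

lemma hardy_add_finite:
  assumes [measurable]: "u \<in> borel_measurable dual_cylinder" "v \<in> borel_measurable dual_cylinder" "A \<in> sets borel"
    and fin: "hardy A u < \<infinity>" "hardy A v < \<infinity>"
  shows "hardy A (\<lambda>w. u w + v w) < \<infinity>"
proof -
  have "hardy A (\<lambda>w. u w + v w) \<le> (\<integral>\<^sup>+w. 2 * (ennreal ((cmod (u w))\<^sup>2 / \<bar>fst w\<bar>) * indicator (A \<times> UNIV) w) + 2 * (ennreal ((cmod (v w))\<^sup>2 / \<bar>fst w\<bar>) * indicator (A \<times> UNIV) w) \<partial>dual_cylinder)"
    unfolding hardy_def
  proof (rule nn_integral_mono)
    fix w
    have "(cmod (u w + v w))\<^sup>2 / \<bar>fst w\<bar> \<le> (2 * (cmod (u w))\<^sup>2 + 2 * (cmod (v w))\<^sup>2) / \<bar>fst w\<bar>"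
      using norm_add_sq_weighted[of 1 "u w" "v w"] by (intro divide_right_mono) auto
    also have "\<dots> = 2 * ((cmod (u w))\<^sup>2 / \<bar>fst w\<bar>) + 2 * ((cmod (v w))\<^sup>2 / \<bar>fst w\<bar>)" by (simp add: add_divide_distrib)
    finally have "ennreal ((cmod (u w + v w))\<^sup>2 / \<bar>fst w\<bar>) \<le> ennreal 2 * ennreal ((cmod (u w))\<^sup>2 / \<bar>fst w\<bar>) + ennreal 2 * ennreal ((cmod (v w))\<^sup>2 / \<bar>fst w\<bar>)"
      by (rule ennreal_le_lincomb) auto
    then show "ennreal ((cmod (u w + v w))\<^sup>2 / \<bar>fst w\<bar>) * indicator (A \<times> UNIV) w \<le> 2 * (ennreal ((cmod (u w))\<^sup>2 / \<bar>fst w\<bar>) * indicator (A \<times> UNIV) w) + 2 * (ennreal ((cmod (v w))\<^sup>2 / \<bar>fst w\<bar>) * indicator (A \<times> UNIV) w)"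
      by (simp add: indicator_def)
  qed
  also have "\<dots> = 2 * hardy A u + 2 * hardy A v"
    unfolding hardy_def by (subst nn_integral_add) (auto simp: nn_integral_cmult)
  also have "\<dots> < \<infinity>" using fin by (simp add: ennreal_mult_less_top)
  finally show ?thesis .
qed

lemma hardy_mult_finite:
  assumes [measurable]: "u \<in> borel_measurable dual_cylinder" "A \<in> sets borel"
    and m: "\<And>w. fst w \<in> A \<Longrightarrow> cmod (m w) \<le> c" and fin: "hardy A u < \<infinity>"
  shows "hardy A (\<lambda>w. m w * u w) < \<infinity>"
proof -
  have "hardy A (\<lambda>w. m w * u w) \<le> (\<integral>\<^sup>+w. ennreal (c\<^sup>2) * (ennreal ((cmod (u w))\<^sup>2 / \<bar>fst w\<bar>) * indicator (A \<times> UNIV) w) \<partial>dual_cylinder)"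
    unfolding hardy_def
  proof (rule nn_integral_mono)
    fix w
    show "ennreal ((cmod (m w * u w))\<^sup>2 / \<bar>fst w\<bar>) * indicator (A \<times> UNIV) w \<le> ennreal (c\<^sup>2) * (ennreal ((cmod (u w))\<^sup>2 / \<bar>fst w\<bar>) * indicator (A \<times> UNIV) w)"
    proof (cases "fst w \<in> A")
      case True
      have "(cmod (m w * u w))\<^sup>2 / \<bar>fst w\<bar> = (cmod (m w))\<^sup>2 * ((cmod (u w))\<^sup>2 / \<bar>fst w\<bar>)" by (simp add: norm_mult power_mult_distrib)
      also have "\<dots> \<le> c\<^sup>2 * ((cmod (u w))\<^sup>2 / \<bar>fst w\<bar>)" using m[OF True] by (intro mult_right_mono power_mono) auto
      finally show ?thesis using True
        by (subst mult.assoc[symmetric], subst ennreal_mult[symmetric]) (auto intro!: mult_right_mono ennreal_leI)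
    qed (auto simp: indicator_def mem_Times_iff)
  qed
  also have "\<dots> = ennreal (c\<^sup>2) * hardy A u" unfolding hardy_def by (rule nn_integral_cmult) measurable
  also have "\<dots> < \<infinity>" using fin by (simp add: ennreal_mult_less_top)
  finally show ?thesis .
qed

text \<open>
  Away from zero the weight is bounded.
\<close>

lemma hardy_half_line_finite_iff:
  assumes u: "u \<in> L2 dual_cylinder"
  shows "hardy {..<0} u < \<infinity> \<longleftrightarrow> hardy {-1<..<0} u < \<infinity>"
proof
  note [measurable] = L2_measurable[OF u]
  show "hardy {..<0} u < \<infinity> \<Longrightarrow> hardy {-1<..<0} u < \<infinity>"
    by (rule le_less_trans[OF hardy_mono]) auto
  assume fin: "hardy {-1<..<0} u < \<infinity>"
  have "hardy {..<0} u \<le> (\<integral>\<^sup>+w. ennreal ((cmod (u w))\<^sup>2 / \<bar>fst w\<bar>) * indicator ({-1<..<0} \<times> UNIV) w + ennreal ((cmod (u w))\<^sup>2) \<partial>dual_cylinder)"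
    unfolding hardy_def
  proof (rule nn_integral_mono)
    fix w :: "real \<times> int"
    show "ennreal ((cmod (u w))\<^sup>2 / \<bar>fst w\<bar>) * indicator ({..<0} \<times> UNIV) w
      \<le> ennreal ((cmod (u w))\<^sup>2 / \<bar>fst w\<bar>) * indicator ({-1<..<0} \<times> UNIV) w + ennreal ((cmod (u w))\<^sup>2)"
    proof (cases "fst w \<le> -1")
      case True
      then have "(cmod (u w))\<^sup>2 / \<bar>fst w\<bar> \<le> (cmod (u w))\<^sup>2 / 1" by (intro divide_left_mono) auto
      then show ?thesis using True by (auto simp: indicator_def intro!: ennreal_leI)
    qed (auto simp: indicator_def mem_Times_iff)
  qed
  also have "\<dots> = hardy {-1<..<0} u + sq_norm dual_cylinder u"
    unfolding hardy_def sq_norm_def by (rule nn_integral_add) measurable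
  also have "\<dots> < \<infinity>" using fin L2_finite[OF u] by simp
  finally show "hardy {..<0} u < \<infinity>" .
qed

definition neg_part :: "(real \<times> int \<Rightarrow> complex) \<Rightarrow> real \<times> int \<Rightarrow> complex" where
  "neg_part u w = (if fst w < 0 then u w else 0)"

lemma neg_part_measurable [measurable]:
  assumes [measurable]: "u \<in> borel_measurable dual_cylinder"
  shows "neg_part u \<in> borel_measurable dual_cylinder"
  unfolding neg_part_def by measurable

lemma nn_integral_opposite_half_line:
  fixes \<xi> :: real
  assumes "\<xi> < 0"
  shows "(\<integral>\<^sup>+\<zeta>\<in>{0..}. ennreal (1 / (\<zeta> - \<xi>)\<^sup>2) \<partial>lborel) = ennreal (1 / \<bar>\<xi>\<bar>)"
proof -
  have "(\<integral>\<^sup>+s\<in>{\<bar>\<xi>\<bar>..}. ennreal (1 / s\<^sup>2) \<partial>lborel)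
    = ennreal \<bar>1\<bar> * (\<integral>\<^sup>+\<zeta>. ennreal (1 / (- \<xi> + 1 * \<zeta>)\<^sup>2) * indicator {\<bar>\<xi>\<bar>..} (- \<xi> + 1 * \<zeta>) \<partial>lborel)"
    by (rule nn_integral_real_affine) auto
  also have "\<dots> = (\<integral>\<^sup>+\<zeta>\<in>{0..}. ennreal (1 / (\<zeta> - \<xi>)\<^sup>2) \<partial>lborel)"
    using assms by (auto simp: indicator_def intro!: nn_integral_cong)
  finally show ?thesis using assms by (simp add: nn_integral_inverse_square)
qed

text \<open>
  The cut changes only the interaction of a negative with a nonnegative frequency. There the difference becomes
  \<open>|u(\<xi>)|\<^sup>2/(\<zeta> - \<xi>)\<^sup>2\<close>, and integrating over \<open>\<zeta> \<ge> 0\<close> gives \<open>|u(\<xi>)|\<^sup>2/|\<xi>|\<close>.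
\<close>

lemma energy_neg_part_finite_iff:
  assumes u[measurable]: "u \<in> borel_measurable dual_cylinder" and e: "energy UNIV UNIV u < \<infinity>"
  shows "energy UNIV UNIV (neg_part u) < \<infinity> \<longleftrightarrow> hardy {..<0} u < \<infinity>"
proof
  have cross: "(\<integral>\<^sup>+\<zeta>. ennreal ((cmod (u w))\<^sup>2 / (\<zeta> - fst w)\<^sup>2) * indicator {0..} \<zeta> \<partial>lborel) = ennreal ((cmod (u w))\<^sup>2 / \<bar>fst w\<bar>)" if "fst w < 0" for w
  proof -
    have "(\<integral>\<^sup>+\<zeta>. ennreal ((cmod (u w))\<^sup>2 / (\<zeta> - fst w)\<^sup>2) * indicator {0..} \<zeta> \<partial>lborel)
      = (\<integral>\<^sup>+\<zeta>. ennreal ((cmod (u w))\<^sup>2) * (ennreal (1 / (\<zeta> - fst w)\<^sup>2) * indicator {0..} \<zeta>) \<partial>lborel)"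
      by (intro nn_integral_cong) (simp add: ennreal_mult'[symmetric] indicator_def)
    also have "\<dots> = ennreal ((cmod (u w))\<^sup>2) * ennreal (1 / \<bar>fst w\<bar>)"
      by (subst nn_integral_cmult) (auto simp: nn_integral_opposite_half_line[OF that])
    finally show ?thesis by (simp add: ennreal_mult'[symmetric])
  qed
  have "hardy {..<0} u \<le> energy UNIV UNIV (neg_part u)"
    unfolding hardy_def energy_def
  proof (rule nn_integral_mono)
    fix w :: "real \<times> int"
    show "ennreal ((cmod (u w))\<^sup>2 / \<bar>fst w\<bar>) * indicator ({..<0} \<times> UNIV) w
      \<le> (\<integral>\<^sup>+\<zeta>\<in>UNIV. ennreal ((cmod (neg_part u (\<zeta>, snd w) - neg_part u w))\<^sup>2 / (\<zeta> - fst w)\<^sup>2) \<partial>lborel) * indicator (UNIV \<times> UNIV) w"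
    proof (cases "fst w < 0")
      case True
      have "ennreal ((cmod (u w))\<^sup>2 / \<bar>fst w\<bar>) \<le> (\<integral>\<^sup>+\<zeta>. ennreal ((cmod (neg_part u (\<zeta>, snd w) - neg_part u w))\<^sup>2 / (\<zeta> - fst w)\<^sup>2) \<partial>lborel)"
        unfolding cross[OF True, symmetric]
        by (intro nn_integral_mono) (use True in \<open>auto simp: indicator_def neg_part_def\<close>)
      then show ?thesis using True by (simp add: mem_Times_iff)
    qed (simp add: indicator_def mem_Times_iff)
  qed
  then show "energy UNIV UNIV (neg_part u) < \<infinity> \<Longrightarrow> hardy {..<0} u < \<infinity>" by (rule le_less_trans)
  assume h: "hardy {..<0} u < \<infinity>"
  let ?d = "\<lambda>u w \<zeta>. ennreal ((cmod (u (\<zeta>, snd w) - u w))\<^sup>2 / (\<zeta> - fst w)\<^sup>2)"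
  \<comment> \<open>The interactions across zero, once with the inner and once with the outer variable on the nonnegative side.\<close>
  let ?c1 = "\<lambda>w \<zeta>. ennreal ((cmod (u w))\<^sup>2 / (\<zeta> - fst w)\<^sup>2) * indicator {0..} \<zeta> * indicator {..<0} (fst w)"
  let ?c2 = "\<lambda>w \<zeta>. ennreal ((cmod (u (\<zeta>, snd w)))\<^sup>2 / (fst w - \<zeta>)\<^sup>2) * indicator {0..} (fst w) * indicator {..<0} \<zeta>"
  have "energy UNIV UNIV (neg_part u) \<le> (\<integral>\<^sup>+w. (\<integral>\<^sup>+\<zeta>. ?d u w \<zeta> + (?c1 w \<zeta> + ?c2 w \<zeta>) \<partial>lborel) \<partial>dual_cylinder)"
    unfolding energy_def
  proof (intro nn_integral_mono)
    fix w :: "real \<times> int"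
    have "?d (neg_part u) w \<zeta> \<le> ?d u w \<zeta> + (?c1 w \<zeta> + ?c2 w \<zeta>)" for \<zeta>
      by (cases "fst w < 0"; cases "\<zeta> < 0") (auto simp: neg_part_def indicator_def mem_Times_iff power2_commute[of \<zeta>])
    then have "(\<integral>\<^sup>+\<zeta>. ?d (neg_part u) w \<zeta> \<partial>lborel) \<le> (\<integral>\<^sup>+\<zeta>. ?d u w \<zeta> + (?c1 w \<zeta> + ?c2 w \<zeta>) \<partial>lborel)" by (intro nn_integral_mono)
    then show "(\<integral>\<^sup>+\<zeta>\<in>UNIV. ?d (neg_part u) w \<zeta> \<partial>lborel) * indicator (UNIV \<times> UNIV) w \<le> (\<integral>\<^sup>+\<zeta>. ?d u w \<zeta> + (?c1 w \<zeta> + ?c2 w \<zeta>) \<partial>lborel)"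
      by simp
  qed
  also have "\<dots> = energy UNIV UNIV u + ((\<integral>\<^sup>+w. (\<integral>\<^sup>+\<zeta>. ?c1 w \<zeta> \<partial>lborel) \<partial>dual_cylinder) + (\<integral>\<^sup>+w. (\<integral>\<^sup>+\<zeta>. ?c2 w \<zeta> \<partial>lborel) \<partial>dual_cylinder))"
  proof -
    have *: "(\<integral>\<^sup>+w. (\<integral>\<^sup>+\<zeta>. a w \<zeta> + (b w \<zeta> + c w \<zeta>) \<partial>lborel) \<partial>dual_cylinder)
       = (\<integral>\<^sup>+w. (\<integral>\<^sup>+\<zeta>. a w \<zeta> \<partial>lborel) \<partial>dual_cylinder) + ((\<integral>\<^sup>+w. (\<integral>\<^sup>+\<zeta>. b w \<zeta> \<partial>lborel) \<partial>dual_cylinder) + (\<integral>\<^sup>+w. (\<integral>\<^sup>+\<zeta>. c w \<zeta> \<partial>lborel) \<partial>dual_cylinder))"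
      if [measurable]: "(\<lambda>(w, \<zeta>). a w \<zeta>) \<in> borel_measurable (dual_cylinder \<Otimes>\<^sub>M lborel)" "(\<lambda>(w, \<zeta>). b w \<zeta>) \<in> borel_measurable (dual_cylinder \<Otimes>\<^sub>M lborel)"
        "(\<lambda>(w, \<zeta>). c w \<zeta>) \<in> borel_measurable (dual_cylinder \<Otimes>\<^sub>M lborel)" for a b c :: "real \<times> int \<Rightarrow> real \<Rightarrow> ennreal"
      by (simp add: nn_integral_add)
    have "energy UNIV UNIV u = (\<integral>\<^sup>+w. (\<integral>\<^sup>+\<zeta>. ?d u w \<zeta> \<partial>lborel) \<partial>dual_cylinder)" by (simp add: energy_def)
    moreover have "(\<lambda>(w, \<zeta>). ?d u w \<zeta>) \<in> borel_measurable (dual_cylinder \<Otimes>\<^sub>M lborel)" by measurable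
    moreover have "(\<lambda>(w, \<zeta>). ?c1 w \<zeta>) \<in> borel_measurable (dual_cylinder \<Otimes>\<^sub>M lborel)" by measurable
    moreover have "(\<lambda>(w, \<zeta>). ?c2 w \<zeta>) \<in> borel_measurable (dual_cylinder \<Otimes>\<^sub>M lborel)" by measurable
    ultimately show ?thesis using *[of "\<lambda>w \<zeta>. ?d u w \<zeta>" ?c1 ?c2] by (simp only:)
  qed
  also have "(\<integral>\<^sup>+w. (\<integral>\<^sup>+\<zeta>. ?c1 w \<zeta> \<partial>lborel) \<partial>dual_cylinder) = hardy {..<0} u"
    unfolding hardy_def
  proof (rule nn_integral_cong)
    fix w :: "real \<times> int"
    show "(\<integral>\<^sup>+\<zeta>. ?c1 w \<zeta> \<partial>lborel) = ennreal ((cmod (u w))\<^sup>2 / \<bar>fst w\<bar>) * indicator ({..<0} \<times> UNIV) w"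
      by (cases "fst w < 0") (auto simp: cross mem_Times_iff)
  qed
  also have "(\<integral>\<^sup>+w. (\<integral>\<^sup>+\<zeta>. ?c2 w \<zeta> \<partial>lborel) \<partial>dual_cylinder) = hardy {..<0} u"
  proof -
    have "(\<integral>\<^sup>+w. (\<integral>\<^sup>+\<zeta>. ?c2 w \<zeta> \<partial>lborel) \<partial>dual_cylinder) = (\<integral>\<^sup>+\<eta>. (\<integral>\<^sup>+\<xi>. (\<integral>\<^sup>+\<zeta>. ?c2 (\<xi>, \<eta>) \<zeta> \<partial>lborel) \<partial>lborel) \<partial>count_space UNIV)"
      by (rule nn_integral_dual_cylinder) measurable
    also have "\<dots> = (\<integral>\<^sup>+\<eta>. (\<integral>\<^sup>+\<zeta>. (\<integral>\<^sup>+\<xi>. ?c2 (\<xi>, \<eta>) \<zeta> \<partial>lborel) \<partial>lborel) \<partial>count_space UNIV)"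
      by (intro nn_integral_cong lborel_pair.Fubini') measurable
    also have "\<dots> = (\<integral>\<^sup>+\<eta>. (\<integral>\<^sup>+\<zeta>. ennreal ((cmod (u (\<zeta>, \<eta>)))\<^sup>2 / \<bar>\<zeta>\<bar>) * indicator {..<0} \<zeta> \<partial>lborel) \<partial>count_space UNIV)"
    proof (intro nn_integral_cong)
      fix \<eta> :: int and \<zeta> :: real
      show "(\<integral>\<^sup>+\<xi>. ?c2 (\<xi>, \<eta>) \<zeta> \<partial>lborel) = ennreal ((cmod (u (\<zeta>, \<eta>)))\<^sup>2 / \<bar>\<zeta>\<bar>) * indicator {..<0} \<zeta>"
        using cross[of "(\<zeta>, \<eta>)"] by (cases "\<zeta> < 0") auto
    qed
    also have "\<dots> = (\<integral>\<^sup>+\<eta>. (\<integral>\<^sup>+\<zeta>. ennreal ((cmod (u (\<zeta>, \<eta>)))\<^sup>2 / \<bar>fst (\<zeta>, \<eta>)\<bar>) * indicator ({..<0} \<times> UNIV) (\<zeta>, \<eta>) \<partial>lborel) \<partial>count_space UNIV)"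
      by (intro nn_integral_cong) (simp add: indicator_def)
    also have "\<dots> = hardy {..<0} u"
      unfolding hardy_def by (rule nn_integral_dual_cylinder[symmetric]) measurable
    finally show ?thesis .
  qed
  also have "energy UNIV UNIV u + (hardy {..<0} u + hardy {..<0} u) < \<infinity>" using e h by simp
  finally show "energy UNIV UNIV (neg_part u) < \<infinity>" .
qed

text \<open>
  The local form of the same principle: as \<open>u\<close> vanishes for positive frequencies, those in \<open>(0, |\<xi>|)\<close> alone contribute at least \<open>|u(\<xi>)|\<^sup>2/(4|\<xi>|)\<close>
  to the energy.
\<close>

lemma local_energy_imp_hardy_finite:
  assumes u[measurable]: "u \<in> borel_measurable dual_cylinder" and z: "\<And>\<eta>. AE \<xi> in lborel. 0 < \<xi> \<longrightarrow> u (\<xi>, \<eta>) = 0"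
    and e: "energy {-1<..<0} {0<..<1} u < \<infinity>"
  shows "hardy {-1<..<0} u < \<infinity>"
proof -
  have "ennreal (1 / 4) * hardy {-1<..<0} u = (\<integral>\<^sup>+w. ennreal (1 / 4) * (ennreal ((cmod (u w))\<^sup>2 / \<bar>fst w\<bar>) * indicator ({-1<..<0} \<times> UNIV) w) \<partial>dual_cylinder)"
    unfolding hardy_def by (rule nn_integral_cmult[symmetric]) measurable
  also have "\<dots> \<le> energy {-1<..<0} {0<..<1} u"
    unfolding energy_def
  proof (rule nn_integral_mono)
    fix w :: "real \<times> int"
    show "ennreal (1 / 4) * (ennreal ((cmod (u w))\<^sup>2 / \<bar>fst w\<bar>) * indicator ({-1<..<0} \<times> UNIV) w)
      \<le> (\<integral>\<^sup>+\<zeta>\<in>{0<..<1}. ennreal ((cmod (u (\<zeta>, snd w) - u w))\<^sup>2 / (\<zeta> - fst w)\<^sup>2) \<partial>lborel) * indicator ({-1<..<0} \<times> UNIV) w"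
    proof (cases "fst w \<in> {-1<..<0}")
      case True
      define a where "a = - fst w"
      have a: "0 < a" "a < 1" using True by (auto simp: a_def)
      have "ennreal (1 / 4) * ennreal ((cmod (u w))\<^sup>2 / \<bar>fst w\<bar>) = ennreal ((cmod (u w))\<^sup>2 / (4 * a\<^sup>2)) * emeasure lborel {0<..<a}"
        using a by (simp add: ennreal_mult'[symmetric] a_def power2_eq_square)
      also have "\<dots> = (\<integral>\<^sup>+\<zeta>. ennreal ((cmod (u w))\<^sup>2 / (4 * a\<^sup>2)) * indicator {0<..<a} \<zeta> \<partial>lborel)"
        by (simp add: nn_integral_cmult_indicator)
      also have "\<dots> \<le> (\<integral>\<^sup>+\<zeta>\<in>{0<..<1}. ennreal ((cmod (u (\<zeta>, snd w) - u w))\<^sup>2 / (\<zeta> - fst w)\<^sup>2) \<partial>lborel)"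
      proof (rule nn_integral_mono_AE, use z[of "snd w"] in eventually_elim)
        case (elim \<zeta>)
        show ?case
        proof (cases "\<zeta> \<in> {0<..<a}")
          case True
          then have "u (\<zeta>, snd w) = 0" using elim by auto
          moreover have "(\<zeta> - fst w)\<^sup>2 \<le> (2 * a)\<^sup>2" using True a by (intro power_mono) (auto simp: a_def)
          then have "(cmod (u w))\<^sup>2 / (4 * a\<^sup>2) \<le> (cmod (u w))\<^sup>2 / (\<zeta> - fst w)\<^sup>2"
            using True a by (intro divide_left_mono) (auto simp: power_mult_distrib a_def)
          ultimately show ?thesis using True a by (auto intro!: ennreal_leI)
        qed simp
      qed
      finally show ?thesis using True by (simp add: mem_Times_iff)
    qed (auto simp: indicator_def mem_Times_iff)
  qed
  finally have "ennreal (1 / 4) * hardy {-1<..<0} u < \<infinity>" using e by (rule le_less_trans)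
  then show ?thesis by (auto simp: ennreal_mult_less_top)
qed

lemma hardy_slice_finite:
  assumes [measurable]: "u \<in> borel_measurable dual_cylinder" "A \<in> sets borel" and fin: "hardy A u < \<infinity>"
  shows "(\<integral>\<^sup>+\<xi>\<in>A. ennreal ((cmod (u (\<xi>, \<eta>)))\<^sup>2 / \<bar>\<xi>\<bar>) \<partial>lborel) < \<infinity>"
proof -
  let ?h = "\<lambda>\<eta>. (\<integral>\<^sup>+\<xi>\<in>A. ennreal ((cmod (u (\<xi>, \<eta>)))\<^sup>2 / \<bar>\<xi>\<bar>) \<partial>lborel)"
  have "?h \<eta> \<le> (\<integral>\<^sup>+\<eta>. ?h \<eta> \<partial>count_space UNIV)"
    using sum_le_nn_integral_count_space[of "{\<eta>}" ?h] by simp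
  also have "\<dots> = hardy A u"
    unfolding hardy_def by (subst nn_integral_dual_cylinder) (auto simp: indicator_def)
  finally show ?thesis using fin by (rule le_less_trans)
qed

section \<open>Leibniz expansions of the propagated transform\<close>

text \<open>
  The polynomial factors of the \<open>\<xi>\<close>-derivatives of \<open>exp(iT\<xi>\<^sup>2)\<close>, from
  \<open>(e p)' = e (p' + 2iT\<xi> p)\<close>.
\<close>

primrec osc_poly :: "real \<Rightarrow> nat \<Rightarrow> complex poly" where
  "osc_poly T 0 = 1"
| "osc_poly T (Suc j) = pderiv (osc_poly T j) + [:0, 2 * \<i> * of_real T:] * osc_poly T j"

definition osc :: "real \<Rightarrow> nat \<Rightarrow> real \<times> int \<Rightarrow> complex" where
  "osc T j w = phase T w * poly (osc_poly T j) (of_real (fst w))"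

lemma osc_measurable [measurable]: "osc T j \<in> borel_measurable dual_cylinder"
proof -
  have "continuous_on UNIV (\<lambda>x::real. poly (osc_poly T j) (of_real x))" by (intro continuous_intros)
  then have [measurable]: "(\<lambda>x::real. poly (osc_poly T j) (of_real x)) \<in> borel_measurable borel"
    by (rule borel_measurable_continuous_onI)
  show ?thesis unfolding osc_def by measurable
qed

lemma osc_0: "osc T 0 w = phase T w"
  and osc_1: "osc T 1 w = phase T w * (2 * \<i> * of_real T * of_real (fst w))"
  and osc_2: "osc T 2 (0, \<eta>) = phase T (0, \<eta>) * (2 * \<i> * of_real T)"
  by (simp_all add: osc_def numeral_2_eq_2 pderiv_pCons)

lemma osc_derivative:
  "((\<lambda>\<xi>. osc T j (\<xi>, \<eta>)) has_vector_derivative osc T (Suc j) (\<xi>, \<eta>)) (at \<xi>)"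
proof -
  let ?e = "\<lambda>z. exp (\<i> * (of_real T * (z\<^sup>2 + (of_int \<eta>)\<^sup>2)))"
  have "((\<lambda>z. ?e z * poly (osc_poly T j) z) has_field_derivative
      ?e (of_real \<xi>) * poly (osc_poly T (Suc j)) (of_real \<xi>)) (at (of_real \<xi>))"
    by (auto intro!: derivative_eq_intros simp: algebra_simps)
  then have "((\<lambda>\<xi>. ?e (of_real \<xi>) * poly (osc_poly T j) (of_real \<xi>)) has_vector_derivative
      ?e (of_real \<xi>) * poly (osc_poly T (Suc j)) (of_real \<xi>)) (at \<xi>)"
    by (rule has_vector_derivative_real_field)
  then show ?thesis by (simp add: osc_def phase_def)
qed

lemma osc_continuous: "continuous_on UNIV (\<lambda>\<xi>. osc T j (\<xi>, \<eta>))"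
  by (intro continuous_at_imp_continuous_on ballI has_vector_derivative_continuous[OF osc_derivative])

lemma osc_bounded:
  obtains C where "C \<ge> 0" "\<And>w. \<bar>fst w\<bar> \<le> 1 \<Longrightarrow> cmod (osc T j w) \<le> C"
proof -
  have "compact (poly (osc_poly T j) ` cball 0 1)"
    by (intro compact_continuous_image continuous_intros compact_cball)
  then obtain C where C: "\<forall>y\<in>poly (osc_poly T j) ` cball 0 1. cmod y \<le> C"
    using compact_imp_bounded bounded_iff by metis
  have b: "cmod (osc T j w) \<le> C" if "\<bar>fst w\<bar> \<le> 1" for w
  proof -
    have "complex_of_real (fst w) \<in> cball 0 1" using that by simp
    then show ?thesis using C by (simp add: osc_def norm_mult)
  qed
  have "0 \<le> C" using b[of "(0, 0)"] norm_ge_zero[of "osc T j (0, 0)"] by (simp del: norm_ge_zero)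
  then show ?thesis using that b by blast
qed

lemma osc_lipschitz:
  assumes C: "\<And>w. \<bar>fst w\<bar> \<le> 1 \<Longrightarrow> cmod (osc T (Suc j) w) \<le> C" and ab: "a \<le> b" "\<bar>a\<bar> \<le> 1" "\<bar>b\<bar> \<le> 1"
  shows "cmod (osc T j (b, \<eta>) - osc T j (a, \<eta>)) \<le> C * (b - a)"
proof -
  have D: "antideriv (\<lambda>\<xi>. osc T j (\<xi>, \<eta>)) (\<lambda>\<xi>. osc T (Suc j) (\<xi>, \<eta>))"
    by (intro antideriv_smooth osc_derivative osc_continuous)
  have "continuous_on {a..b} (\<lambda>\<xi>. osc T (Suc j) (\<xi>, \<eta>))" by (rule continuous_on_subset[OF osc_continuous]) simp
  moreover have "\<forall>s\<in>{a..b}. cmod (osc T (Suc j) (s, \<eta>)) \<le> C" using ab by (auto intro!: C)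
  ultimately have "cmod (integral {a..b} (\<lambda>\<xi>. osc T (Suc j) (\<xi>, \<eta>))) \<le> C * (b - a)"
    using ab(1) by (intro integral_bound) auto
  then show ?thesis using antideriv_HK(2)[OF D ab(1)] by simp
qed

text \<open>
  On bounded frequencies the derivatives of the phase are Lipschitz uniformly in \<open>\<eta>\<close>, hence multipliers for the energy.
\<close>

lemma energy_osc_local_finite:
  assumes u: "u \<in> L2 dual_cylinder" and e: "energy {-1<..<0} {0<..<1} u < \<infinity>"
  shows "energy {-1<..<0} {0<..<1} (\<lambda>w. osc T j w * u w) < \<infinity>"
proof -
  note [measurable] = L2_measurable[OF u]
  obtain C where C: "C \<ge> 0" "\<And>w. \<bar>fst w\<bar> \<le> 1 \<Longrightarrow> cmod (osc T j w) \<le> C" using osc_bounded by blast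
  obtain L where L: "L \<ge> 0" "\<And>w. \<bar>fst w\<bar> \<le> 1 \<Longrightarrow> cmod (osc T (Suc j) w) \<le> L" using osc_bounded by blast
  show ?thesis
  proof (rule energy_mult_finite[where c = C and K = "\<lambda>_. L\<^sup>2"])
    fix w :: "real \<times> int" assume w: "fst w \<in> {-1<..<0}"
    have "(\<integral>\<^sup>+\<zeta>\<in>{0<..<1}. ennreal ((cmod (osc T j (\<zeta>, snd w) - osc T j w))\<^sup>2 / (\<zeta> - fst w)\<^sup>2) \<partial>lborel)
      \<le> (\<integral>\<^sup>+\<zeta>. ennreal (L\<^sup>2) * indicator {0<..<1::real} \<zeta> \<partial>lborel)"
    proof (rule nn_integral_mono)
      fix \<zeta> :: real
      show "ennreal ((cmod (osc T j (\<zeta>, snd w) - osc T j w))\<^sup>2 / (\<zeta> - fst w)\<^sup>2) * indicator {0<..<1} \<zeta> \<le> ennreal (L\<^sup>2) * indicator {0<..<1} \<zeta>"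
      proof (cases "\<zeta> \<in> {0<..<1}")
        case True
        have "cmod (osc T j (\<zeta>, snd w) - osc T j (fst w, snd w)) \<le> L * (\<zeta> - fst w)"
          using True w by (intro osc_lipschitz L) auto
        then have "(cmod (osc T j (\<zeta>, snd w) - osc T j w))\<^sup>2 \<le> (L * (\<zeta> - fst w))\<^sup>2" by (intro power_mono) auto
        then have "(cmod (osc T j (\<zeta>, snd w) - osc T j w))\<^sup>2 / (\<zeta> - fst w)\<^sup>2 \<le> (L * (\<zeta> - fst w))\<^sup>2 / (\<zeta> - fst w)\<^sup>2"
          by (rule divide_right_mono) simp
        also have "\<dots> = L\<^sup>2" using True w by (simp add: power_mult_distrib)
        finally show ?thesis using True by (auto intro: ennreal_leI)
      qed simp
    qed
    also have "\<dots> = ennreal (L\<^sup>2)" by (simp add: nn_integral_cmult_indicator)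
    finally show "(\<integral>\<^sup>+\<zeta>\<in>{0<..<1}. ennreal ((cmod (osc T j (\<zeta>, snd w) - osc T j w))\<^sup>2 / (\<zeta> - fst w)\<^sup>2) \<partial>lborel) \<le> ennreal (L\<^sup>2)" .
  next
    have "(\<integral>\<^sup>+w\<in>{-1<..<0} \<times> UNIV. ennreal (L\<^sup>2) * ennreal ((cmod (u w))\<^sup>2) \<partial>dual_cylinder) \<le> (\<integral>\<^sup>+w. ennreal (L\<^sup>2) * ennreal ((cmod (u w))\<^sup>2) \<partial>dual_cylinder)"
      by (intro nn_integral_mono) (auto simp: indicator_def)
    also have "\<dots> = ennreal (L\<^sup>2) * sq_norm dual_cylinder u" unfolding sq_norm_def by (rule nn_integral_cmult) measurable
    also have "\<dots> < \<infinity>" using L2_finite[OF u] by (simp add: ennreal_mult_less_top)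
    finally show "(\<integral>\<^sup>+w\<in>{-1<..<0} \<times> UNIV. ennreal (L\<^sup>2) * ennreal ((cmod (u w))\<^sup>2) \<partial>dual_cylinder) < \<infinity>" .
  qed (use C e in auto)
qed

lemma moment_0: "moment 0 f = f"
  and moment_Suc: "moment (Suc j) f = moment 1 (moment j f)"
  by (simp_all add: moment_def mult.assoc)

text \<open>
  What membership in the weighted space of order \<open>k + 1/2\<close> provides on the side of \<open>x\<close>: up to order \<open>k\<close> the moments have half a
  power of decay to spare, and below order \<open>k\<close> their transforms are absolutely convergent integrals.
\<close>

definition admissible :: "nat \<Rightarrow> (real \<times> real \<Rightarrow> complex) \<Rightarrow> bool" where
  "admissible k f \<longleftrightarrow> (\<forall>j\<le>k. moment j f \<in> L2 cylinder \<and> moment j f \<in> weighted_L2 (1/2))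
    \<and> (\<forall>j<k. integrable cylinder (moment j f))"

text \<open>
  The \<open>j\<close>-th \<open>\<xi>\<close>-derivative of the transform. Below order \<open>k\<close> it is given by the integral and therefore continuous, so that its value
  at \<open>\<xi> = 0\<close> makes sense; at order \<open>k\<close> it is an arbitrary representative of a class.
\<close>

definition jet :: "nat \<Rightarrow> (real \<times> real \<Rightarrow> complex) \<Rightarrow> nat \<Rightarrow> real \<times> int \<Rightarrow> complex" where
  "jet k f j = (if j < k then integral_transform (moment j f) else fourier (moment j f))"

lemma
  assumes f: "admissible k f" and j: "j \<le> k"
  shows jet_AE: "AE w in dual_cylinder. fourier (moment j f) w = jet k f j w"
    and jet_L2: "jet k f j \<in> L2 dual_cylinder"
    and jet_energy: "energy UNIV UNIV (jet k f j) < \<infinity>"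
proof -
  have m: "moment j f \<in> L2 cylinder" "moment j f \<in> weighted_L2 (1/2)" and i: "j < k \<Longrightarrow> integrable cylinder (moment j f)"
    using f j by (auto simp: admissible_def)
  show ae: "AE w in dual_cylinder. fourier (moment j f) w = jet k f j w"
    using fourier_integrable[OF m(1) i] by (auto simp: jet_def)
  have "jet k f j \<in> borel_measurable dual_cylinder"
    using L2_measurable[OF m(1)] L2_measurable[OF fourier_L2[OF m(1)]] by (auto simp: jet_def)
  moreover have "sq_norm dual_cylinder (jet k f j) = sq_norm dual_cylinder (fourier (moment j f))"
    by (rule sq_norm_cong_AE, use ae in eventually_elim) simp
  ultimately show "jet k f j \<in> L2 dual_cylinder" using fourier_L2[OF m(1)] by (simp add: L2_iff)
  have "energy UNIV UNIV (jet k f j) = energy UNIV UNIV (fourier (moment j f))"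
    by (rule energy_cong_AE, use ae in eventually_elim) simp
  then show "energy UNIV UNIV (jet k f j) < \<infinity>" using weighted_L2_half_iff_energy[OF m(1)] m(2) by simp
qed

lemma jet_antideriv:
  assumes f: "admissible k f" and j: "j < k"
  shows "antideriv (\<lambda>\<xi>. jet k f j (\<xi>, \<eta>)) (\<lambda>\<xi>. jet k f (Suc j) (\<xi>, \<eta>))"
proof -
  have "antideriv (\<lambda>\<xi>. integral_transform (moment j f) (\<xi>, \<eta>)) (\<lambda>\<xi>. jet k f (Suc j) (\<xi>, \<eta>))"
  proof (rule antideriv_integral_transform)
    show "jet k f (Suc j) \<in> borel_measurable dual_cylinder" using jet_L2[OF f, of "Suc j"] j by (auto intro: L2_measurable)
    show "AE w in dual_cylinder. fourier (moment 1 (moment j f)) w = jet k f (Suc j) w"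
      using jet_AE[OF f, of "Suc j"] j by (simp add: moment_Suc[of j])
    show "moment j f \<in> L2 cylinder" using f j by (auto simp: admissible_def)
    show "integrable cylinder (moment j f)" using f j by (auto simp: admissible_def)
    have "moment (Suc j) f \<in> L2 cylinder" using f j by (auto simp: admissible_def)
    then show "moment 1 (moment j f) \<in> L2 cylinder" by (simp add: moment_Suc[of j])
  qed
  then show ?thesis using j by (simp add: jet_def)
qed

text \<open>
  The \<open>j\<close>-th \<open>\<xi>\<close>-derivative of \<open>phase T\<close> times the transform of \<open>f\<close>, by Leibniz' formula.
\<close>

definition product_jet :: "real \<Rightarrow> nat \<Rightarrow> (real \<times> real \<Rightarrow> complex) \<Rightarrow> nat \<Rightarrow> real \<times> int \<Rightarrow> complex" where
  "product_jet T k f j w = (\<Sum>i\<le>j. of_nat (j choose i) * (osc T i w * jet k f (j - i) w))"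

lemma product_jet_leibniz:
  "product_jet T k f j (\<xi>, \<eta>) = leibniz (\<lambda>i \<xi>. osc T i (\<xi>, \<eta>)) (\<lambda>i \<xi>. jet k f i (\<xi>, \<eta>)) j \<xi>"
  by (simp add: product_jet_def leibniz_def)

lemma product_jet_antideriv:
  assumes f: "admissible k f" and j: "j < k"
  shows "antideriv (\<lambda>\<xi>. product_jet T k f j (\<xi>, \<eta>)) (\<lambda>\<xi>. product_jet T k f (Suc j) (\<xi>, \<eta>))"
  unfolding product_jet_leibniz
  by (rule antideriv_leibniz[where k = k and u = "\<lambda>i \<xi>. jet k f i (\<xi>, \<eta>)" and a = "\<lambda>i \<xi>. osc T i (\<xi>, \<eta>)"])
     (simp_all add: jet_antideriv[OF f] osc_derivative j)

text \<open>
  If two transforms agree up to a phase on an open set of frequencies, so do all their derivatives; below the top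
  order continuity extends this to the closure, in particular to \<open>\<xi> = 0\<close>.
\<close>

lemma
  assumes f: "admissible k f" and v: "admissible k v" and I: "open I"
    and eq: "AE w in dual_cylinder. fst w \<in> I \<longrightarrow> fourier v w = phase T w * fourier f w"
  shows product_jet_match_AE: "j \<le> k \<Longrightarrow> AE \<xi> in lborel. \<xi> \<in> I \<longrightarrow> product_jet T k f j (\<xi>, \<eta>) - jet k v j (\<xi>, \<eta>) = 0"
    and product_jet_match: "j < k \<Longrightarrow> \<xi> \<in> closure I \<Longrightarrow> product_jet T k f j (\<xi>, \<eta>) = jet k v j (\<xi>, \<eta>)"
proof -
  let ?w = "\<lambda>j \<xi>. product_jet T k f j (\<xi>, \<eta>) - jet k v j (\<xi>, \<eta>)"
  have D: "antideriv (?w j) (?w (Suc j))" if "j < k" for j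
    by (intro antideriv_diff product_jet_antideriv jet_antideriv f v that)
  have "AE w in dual_cylinder. fst w \<in> I \<longrightarrow> product_jet T k f 0 w - jet k v 0 w = 0"
    using eq jet_AE[OF f le0] jet_AE[OF v le0]
    by eventually_elim (simp add: product_jet_def osc_0 moment_0)
  then have z: "AE \<xi> in lborel. \<xi> \<in> I \<longrightarrow> ?w 0 \<xi> = 0"
    by (auto dest!: AE_dual_cylinder_slice elim: eventually_mono)
  show ae: "AE \<xi> in lborel. \<xi> \<in> I \<longrightarrow> ?w j \<xi> = 0" if "j \<le> k" for j
    by (rule antideriv_chain_vanish[OF D I z that])
  show "product_jet T k f j (\<xi>, \<eta>) = jet k v j (\<xi>, \<eta>)" if j: "j < k" and \<xi>: "\<xi> \<in> closure I" for \<xi>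
  proof -
    have c: "continuous_on UNIV (?w j)" by (rule antideriv_continuous[OF D[OF j]])
    have "\<forall>x\<in>I. ?w j x = 0" using ae[of j] j by (intro continuous_AE_zero_open c I) auto
    moreover have "closed (?w j -` {0})" by (intro closed_vimage c closed_singleton)
    ultimately have "closure I \<subseteq> ?w j -` {0}" by (intro closure_minimal) auto
    then show ?thesis using \<xi> by auto
  qed
qed

section \<open>Jumps at frequency zero\<close>

text \<open>
  For \<open>i = 0\<close> this is the difference of the two phases between which the propagator switches at \<open>\<xi> = 0\<close>; in general it is the \<open>i\<close>-th derivative of that difference.
\<close>

definition jump :: "real \<Rightarrow> nat \<Rightarrow> real \<times> int \<Rightarrow> complex" where
  "jump t i w = osc t i w - osc (- t) i w"

lemma jump_measurable [measurable]: "jump t i \<in> borel_measurable dual_cylinder"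
  unfolding jump_def by measurable

lemma jump_bounded:
  obtains C where "\<And>w. \<bar>fst w\<bar> \<le> 1 \<Longrightarrow> cmod (jump t i w) \<le> C"
proof -
  obtain C1 where C1: "\<And>w. \<bar>fst w\<bar> \<le> 1 \<Longrightarrow> cmod (osc t i w) \<le> C1" using osc_bounded by blast
  obtain C2 where C2: "\<And>w. \<bar>fst w\<bar> \<le> 1 \<Longrightarrow> cmod (osc (- t) i w) \<le> C2" using osc_bounded by blast
  have "cmod (jump t i w) \<le> C1 + C2" if "\<bar>fst w\<bar> \<le> 1" for w
    unfolding jump_def using norm_triangle_ineq4 C1[OF that] C2[OF that] by (smt (verit))
  then show ?thesis using that by blast
qed

lemma jump_1_0: "jump t 1 (0, \<eta>) = 0" by (simp only: jump_def osc_1) simp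

text \<open>
  Orders 0 and 2 cannot both match: if the phases agree at \<open>\<xi> = 0\<close>, then their second derivatives there are that common value times \<open>\<plusminus>2it\<close>.
\<close>

lemma jump_2_0:
  assumes t: "t \<noteq> 0" and z: "jump t 0 (0, \<eta>) = 0"
  shows "jump t 2 (0, \<eta>) \<noteq> 0"
proof -
  have eq: "phase (- t) (0, \<eta>) = phase t (0, \<eta>)" using z by (simp add: jump_def osc_0)
  have "jump t 2 (0, \<eta>) = phase t (0, \<eta>) * (4 * \<i> * of_real t)"
    unfolding jump_def osc_2 eq by (simp add: algebra_simps)
  moreover have "phase t (0, \<eta>) \<noteq> 0" by (simp add: phase_def)
  ultimately show ?thesis using t by simp
qed

text \<open>
  The jets at zero satisfy such a system of binomial convolution equations, one for each \<open>j < k\<close>. If \<open>d 0 \<noteq> 0\<close> it is triangular.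
\<close>

lemma convolution_vanish_0:
  fixes d p :: "nat \<Rightarrow> complex"
  assumes eq: "\<And>j. j < k \<Longrightarrow> (\<Sum>i\<le>j. of_nat (j choose i) * (d i * p (j - i))) = 0" and d: "d 0 \<noteq> 0"
  shows "j < k \<Longrightarrow> p j = 0"
proof (induction j rule: less_induct)
  case (less j)
  have "(\<Sum>i\<le>j. of_nat (j choose i) * (d i * p (j - i))) = (\<Sum>i\<in>{0}. of_nat (j choose i) * (d i * p (j - i)))"
    using less by (intro sum.mono_neutral_right) auto
  then show ?case using eq[OF less.prems] d by simp
qed

text \<open>
  The same elimination when the leading coefficient is \<open>d 2\<close>; the equation of order \<open>j + 2\<close> determines \<open>p j\<close>, whence the loss of two orders.
\<close>

lemma convolution_vanish_2:
  fixes d p :: "nat \<Rightarrow> complex"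
  assumes eq: "\<And>j. j < k \<Longrightarrow> (\<Sum>i\<le>j. of_nat (j choose i) * (d i * p (j - i))) = 0" and d: "d 0 = 0" "d 1 = 0" "d 2 \<noteq> 0"
  shows "j + 2 < k \<Longrightarrow> p j = 0"
proof (induction j rule: less_induct)
  case (less j)
  have z: "d i * p (j + 2 - i) = 0" if "i \<noteq> 2" "i \<le> j + 2" for i
  proof -
    consider "i = 0" | "i = 1" | "i > 2" using \<open>i \<noteq> 2\<close> by linarith
    then show ?thesis
    proof cases
      case 3
      then have "p (j + 2 - i) = 0" using that less.prems by (intro less.IH) auto
      then show ?thesis by simp
    qed (use d in auto)
  qed
  have "(\<Sum>i\<le>j + 2. of_nat ((j + 2) choose i) * (d i * p (j + 2 - i))) = (\<Sum>i\<in>{2}. of_nat ((j + 2) choose i) * (d i * p (j + 2 - i)))"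
    using z by (intro sum.mono_neutral_right) auto
  then have "of_nat ((j + 2) choose 2) * (d 2 * p j) = (0::complex)" using eq[OF less.prems] by simp
  moreover have "(j + 2) choose 2 \<noteq> 0" by (simp add: binomial_eq_0_iff)
  ultimately show ?case using d by (simp only: mult_eq_0_iff of_nat_eq_0_iff) simp
qed

lemma hardy_cong_AE:
  assumes [measurable]: "u \<in> borel_measurable dual_cylinder" "v \<in> borel_measurable dual_cylinder" "A \<in> sets borel"
    and ae: "\<And>\<eta>. AE \<xi> in lborel. \<xi> \<in> A \<longrightarrow> u (\<xi>, \<eta>) = v (\<xi>, \<eta>)"
  shows "hardy A u = hardy A v"
proof -
  have "(\<integral>\<^sup>+\<xi>. ennreal ((cmod (u (\<xi>, \<eta>)))\<^sup>2 / \<bar>fst (\<xi>, \<eta>)\<bar>) * indicator (A \<times> UNIV) (\<xi>, \<eta>) \<partial>lborel)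
     = (\<integral>\<^sup>+\<xi>. ennreal ((cmod (v (\<xi>, \<eta>)))\<^sup>2 / \<bar>fst (\<xi>, \<eta>)\<bar>) * indicator (A \<times> UNIV) (\<xi>, \<eta>) \<partial>lborel)" for \<eta> :: int
    by (rule nn_integral_cong_AE, use ae[of \<eta>] in eventually_elim) (auto simp: indicator_def)
  then show ?thesis unfolding hardy_def by (subst (1 2) nn_integral_dual_cylinder) simp_all
qed

lemma hardy_sum_finite:
  assumes "finite I" and "A \<in> sets borel" "\<And>i. i \<in> I \<Longrightarrow> u i \<in> borel_measurable dual_cylinder" "\<And>i. i \<in> I \<Longrightarrow> hardy A (u i) < \<infinity>"
  shows "hardy A (\<lambda>w. \<Sum>i\<in>I. u i w) < \<infinity>"
  using assms
proof (induction I rule: finite_induct)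
  case empty then show ?case by (simp add: hardy_def)
next
  case (insert a I)
  have "hardy A (\<lambda>w. u a w + (\<Sum>i\<in>I. u i w)) < \<infinity>"
    using insert by (intro hardy_add_finite borel_measurable_sum) auto
  then show ?case using insert by simp
qed

text \<open>
  A function vanishing at zero satisfies \<open>|u(\<xi>)|\<^sup>2 \<le> |\<xi>| \<integral>|u'|\<^sup>2\<close>, which cancels the weight on a bounded interval.
\<close>

lemma hardy_jet_finite:
  assumes f: "admissible k f" and i: "i < k" and z: "\<And>\<eta>. jet k f i (0, \<eta>) = 0"
  shows "hardy {-1<..<0} (jet k f i) < \<infinity>"
proof -
  have L: "jet k f i \<in> L2 dual_cylinder" "jet k f (Suc i) \<in> L2 dual_cylinder" using i by (auto intro!: jet_L2 f)
  note [measurable] = L2_measurable[OF L(1)] L2_measurable[OF L(2)]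
  have "hardy {-1<..<0} (jet k f i) = (\<integral>\<^sup>+\<eta>. (\<integral>\<^sup>+\<xi>. ennreal ((cmod (jet k f i (\<xi>, \<eta>)))\<^sup>2 / \<bar>fst (\<xi>, \<eta>)\<bar>) * indicator ({-1<..<0} \<times> UNIV) (\<xi>, \<eta>) \<partial>lborel) \<partial>count_space UNIV)"
    unfolding hardy_def by (rule nn_integral_dual_cylinder) measurable
  also have "\<dots> \<le> (\<integral>\<^sup>+\<eta>. (\<integral>\<^sup>+\<xi>. (\<integral>\<^sup>+s. ennreal ((cmod (jet k f (Suc i) (s, \<eta>)))\<^sup>2) \<partial>lborel) * indicator {-1<..<0::real} \<xi> \<partial>lborel) \<partial>count_space UNIV)"
  proof (intro nn_integral_mono)
    fix \<eta> :: int and \<xi> :: real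
    let ?Q = "\<integral>\<^sup>+s. ennreal ((cmod (jet k f (Suc i) (s, \<eta>)))\<^sup>2) \<partial>lborel"
    show "ennreal ((cmod (jet k f i (\<xi>, \<eta>)))\<^sup>2 / \<bar>fst (\<xi>, \<eta>)\<bar>) * indicator ({-1<..<0} \<times> UNIV) (\<xi>, \<eta>) \<le> ?Q * indicator {-1<..<0} \<xi>"
    proof (cases "\<xi> \<in> {-1<..<0}")
      case True
      have "ennreal ((cmod (jet k f i (\<xi>, \<eta>) - jet k f i (0, \<eta>)))\<^sup>2) \<le> ennreal \<bar>\<xi> - 0\<bar> * ?Q"
        using antideriv_Hoelder[OF jet_antideriv[OF f i], of \<eta> \<xi> 0] by (simp add: sq_norm_def)
      then have "ennreal (1 / \<bar>\<xi>\<bar>) * ennreal ((cmod (jet k f i (\<xi>, \<eta>)))\<^sup>2) \<le> ennreal (1 / \<bar>\<xi>\<bar>) * (ennreal \<bar>\<xi>\<bar> * ?Q)"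
        by (intro mult_left_mono) (auto simp: z)
      also have "\<dots> = ?Q" using True by (simp add: mult.assoc[symmetric] ennreal_mult'[symmetric])
      finally show ?thesis using True by (simp add: ennreal_mult'[symmetric])
    qed simp
  qed
  also have "\<dots> = (\<integral>\<^sup>+\<eta>. (\<integral>\<^sup>+s. ennreal ((cmod (jet k f (Suc i) (s, \<eta>)))\<^sup>2) \<partial>lborel) \<partial>count_space UNIV)"
    by (simp add: nn_integral_cmult_indicator)
  also have "\<dots> = sq_norm dual_cylinder (jet k f (Suc i))"
    unfolding sq_norm_def by (rule nn_integral_dual_cylinder[symmetric]) measurable
  also have "\<dots> < \<infinity>" by (rule L2_finite[OF L(2)])
  finally show ?thesis .
qed

text \<open>
  The first derivatives of the phases are \<open>\<plusminus>2it\<xi>\<close> times the phases, so this jump vanishes to first order at \<open>\<xi> = 0\<close>.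
\<close>

lemma hardy_jump_1_finite:
  assumes u: "u \<in> L2 dual_cylinder"
  shows "hardy {-1<..<0} (\<lambda>w. jump t 1 w * u w) < \<infinity>"
proof -
  note [measurable] = L2_measurable[OF u]
  have "hardy {-1<..<0} (\<lambda>w. jump t 1 w * u w) \<le> (\<integral>\<^sup>+w. ennreal (16 * t\<^sup>2) * ennreal ((cmod (u w))\<^sup>2) \<partial>dual_cylinder)"
    unfolding hardy_def
  proof (rule nn_integral_mono)
    fix w :: "real \<times> int"
    show "ennreal ((cmod (jump t 1 w * u w))\<^sup>2 / \<bar>fst w\<bar>) * indicator ({-1<..<0} \<times> UNIV) w \<le> ennreal (16 * t\<^sup>2) * ennreal ((cmod (u w))\<^sup>2)"
    proof (cases "fst w \<in> {-1<..<0}")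
      case True
      have "cmod (jump t 1 w) \<le> cmod (osc t 1 w) + cmod (osc (- t) 1 w)" unfolding jump_def by (rule norm_triangle_ineq4)
      also have "\<dots> = 4 * \<bar>t\<bar> * \<bar>fst w\<bar>" unfolding osc_1 norm_mult by simp
      finally have "(cmod (jump t 1 w))\<^sup>2 \<le> (4 * \<bar>t\<bar> * \<bar>fst w\<bar>)\<^sup>2" by (intro power_mono) auto
      also have "\<dots> = 16 * t\<^sup>2 * \<bar>fst w\<bar> * \<bar>fst w\<bar>" 
      proof -
        have "(fst w)\<^sup>2 = \<bar>fst w\<bar> * \<bar>fst w\<bar>" by (simp add: power2_eq_square)
        then show ?thesis by (simp only: power_mult_distrib power2_abs) simp
      qed
      also have "\<dots> \<le> 16 * t\<^sup>2 * \<bar>fst w\<bar> * 1" using True by (intro mult_left_mono mult_nonneg_nonneg) auto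
      finally have "(cmod (jump t 1 w))\<^sup>2 / \<bar>fst w\<bar> \<le> 16 * t\<^sup>2"
        using True by (subst pos_divide_le_eq) auto
      then have "(cmod (jump t 1 w))\<^sup>2 / \<bar>fst w\<bar> * (cmod (u w))\<^sup>2 \<le> 16 * t\<^sup>2 * (cmod (u w))\<^sup>2" by (intro mult_right_mono) auto
      then have "ennreal ((cmod (jump t 1 w * u w))\<^sup>2 / \<bar>fst w\<bar>) \<le> ennreal (16 * t\<^sup>2) * ennreal ((cmod (u w))\<^sup>2)"
        by (subst ennreal_mult[symmetric]) (auto intro!: ennreal_leI simp: norm_mult power_mult_distrib)
      then show ?thesis using True by (simp add: mem_Times_iff)
    qed (auto simp: indicator_def mem_Times_iff)
  qed
  also have "\<dots> = ennreal (16 * t\<^sup>2) * sq_norm dual_cylinder u" unfolding sq_norm_def by (rule nn_integral_cmult) measurable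
  also have "\<dots> < \<infinity>" using L2_finite[OF u] by (simp add: ennreal_mult_less_top)
  finally show ?thesis .
qed

lemma closure_half_lines: "closure {0<..} = {0::real..}" "closure {..<0} = {..0::real}"
  by (auto intro: closure_greaterThan closure_lessThan)

text \<open>
  Here \<open>v\<close> plays the role of the propagated function. Both statements compare the term of order 0 in a Leibniz expansion whose total Hardy
  integral is finite with the remaining terms: all terms of order at least 3 and that of order 1 are individually finite, so that only the term of order 2 matters,
  and it is governed by the derivative of order \<open>k - 2\<close> at zero.
\<close>

theorem jump_hardy:
  assumes f: "admissible k f" and v: "admissible k v" and t: "t \<noteq> 0"
    and fv: "AE w in dual_cylinder. fourier v w = exp (\<i> * of_real (t * dispersion (fst w) (snd w))) * fourier f w"
  shows jump_hardy_low: "k \<le> 1 \<Longrightarrow> hardy {-1<..<0} (\<lambda>w. jump t 0 w * jet k f k w) < \<infinity>"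
    and jump_hardy_high: "2 \<le> k \<Longrightarrow> hardy {-1<..<0} (\<lambda>w. jump t 0 w * jet k f k w) < \<infinity>
      \<longleftrightarrow> (\<forall>\<eta>. jet k f (k - 2) (0, \<eta>) = 0)"
proof -
  let ?J = "{-1<..<0::real}"
  have pos: "AE w in dual_cylinder. fst w \<in> {0<..} \<longrightarrow> fourier v w = phase t w * fourier f w"
    using fv by eventually_elim (simp add: phase_def dispersion_def)
  have neg: "AE w in dual_cylinder. fst w \<in> {..<0} \<longrightarrow> fourier v w = phase (- t) w * fourier f w"
    using fv
  proof eventually_elim
    case (elim w)
    have "t * dispersion (fst w) (snd w) = - t * ((fst w)\<^sup>2 + (of_int (snd w))\<^sup>2)" if "fst w < 0"
      using that by (simp add: dispersion_def algebra_simps)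
    then show ?case using elim unfolding phase_def by (metis lessThan_iff)
  qed
  have L: "jet k f j \<in> L2 dual_cylinder" "jet k v j \<in> L2 dual_cylinder" if "j \<le> k" for j
    using that by (auto intro: jet_L2 f v)
  have meas[measurable]: "jet k f j \<in> borel_measurable dual_cylinder" "jet k v j \<in> borel_measurable dual_cylinder" if "j \<le> k" for j
    using L[OF that] by (auto intro: L2_measurable)
  have loc: "energy ?J {0<..<1} (jet k f j) < \<infinity>" "energy ?J {0<..<1} (jet k v j) < \<infinity>" if "j \<le> k" for j
    using jet_energy[OF f that] jet_energy[OF v that]
    by (auto intro: le_less_trans[OF energy_mono_sets[of _ UNIV _ UNIV]])
  \<comment> \<open>The Leibniz terms of the \<open>k\<close>-th derivative of the difference of the two phases times the transform of \<open>f\<close>.\<close>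
  define D where "D i w = of_nat (k choose i) * (jump t i w * jet k f (k - i) w)" for i w
  have D_meas[measurable]: "D i \<in> borel_measurable dual_cylinder" for i unfolding D_def by measurable
  have pj_meas: "product_jet t k f k \<in> borel_measurable dual_cylinder"
    unfolding product_jet_def by (intro borel_measurable_sum borel_measurable_times borel_measurable_const osc_measurable meas) auto
  \<comment> \<open>\<open>\<rho>\<close> vanishes for positive frequencies; for negative ones, where the transform of \<open>v\<close> carries the opposite phase,
    it is the sum of the terms \<open>D i\<close>.\<close>
  define \<rho> where "\<rho> w = product_jet t k f k w + (-1) * jet k v k w" for w
  have \<rho>_meas[measurable]: "\<rho> \<in> borel_measurable dual_cylinder"
    unfolding \<rho>_def using pj_meas meas(2)[of k] by measurable
  have total: "hardy ?J (\<lambda>w. \<Sum>i\<le>k. D i w) < \<infinity>"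
  proof -
    have "energy ?J {0<..<1} (product_jet t k f k) < \<infinity>"
    proof -
      have "energy ?J {0<..<1} (\<lambda>w. \<Sum>i\<in>I. of_nat (k choose i) * (osc t i w * jet k f (k - i) w)) < \<infinity>" if "finite I" for I
        using that
      proof (induction I rule: finite_induct)
        case empty then show ?case by (simp add: energy_def)
      next
        case (insert a I)
        have m: "(\<lambda>w. osc t i w * jet k f (k - i) w) \<in> borel_measurable dual_cylinder" for i
          by (intro borel_measurable_times osc_measurable meas) simp
        have "energy ?J {0<..<1} (\<lambda>w. of_nat (k choose a) * (osc t a w * jet k f (k - a) w) + (\<Sum>i\<in>I. of_nat (k choose i) * (osc t i w * jet k f (k - i) w))) < \<infinity>"
        proof (rule energy_add_finite)
          show "energy ?J {0<..<1} (\<lambda>w. of_nat (k choose a) * (osc t a w * jet k f (k - a) w)) < \<infinity>"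
            by (intro energy_cmult_finite m energy_osc_local_finite L loc) auto
        qed (use insert m in \<open>auto intro!: borel_measurable_sum borel_measurable_times\<close>)
        then show ?case using insert by simp
      qed
      then show ?thesis unfolding product_jet_def by simp
    qed
    then have "energy ?J {0<..<1} \<rho> < \<infinity>"
      unfolding \<rho>_def
      by (intro energy_add_finite energy_cmult_finite pj_meas meas loc borel_measurable_times borel_measurable_const) auto
    moreover have "AE \<xi> in lborel. 0 < \<xi> \<longrightarrow> \<rho> (\<xi>, \<eta>) = 0" for \<eta>
      using product_jet_match_AE[OF f v open_greaterThan pos, of k \<eta>] by (auto simp: \<rho>_def)
    ultimately have "hardy ?J \<rho> < \<infinity>" by (intro local_energy_imp_hardy_finite \<rho>_meas) auto
    moreover have "hardy ?J \<rho> = hardy ?J (\<lambda>w. \<Sum>i\<le>k. D i w)"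
    proof (rule hardy_cong_AE)
      fix \<eta> :: int
      have sum: "(\<Sum>i\<le>k. D i w) = product_jet t k f k w - product_jet (- t) k f k w" for w
        by (simp add: product_jet_def D_def jump_def sum_subtractf[symmetric] algebra_simps)
      show "AE \<xi> in lborel. \<xi> \<in> ?J \<longrightarrow> \<rho> (\<xi>, \<eta>) = (\<Sum>i\<le>k. D i (\<xi>, \<eta>))"
        using product_jet_match_AE[OF f v open_lessThan neg, of k \<eta>]
        by (auto simp: \<rho>_def sum elim!: eventually_mono)
    qed auto
    ultimately show ?thesis by simp
  qed
  \<comment> \<open>Approached from either side of zero, the continuous derivatives of the transform of \<open>v\<close> have the same value.\<close>
  have jets: "(\<Sum>i\<le>j. of_nat (j choose i) * (jump t i (0, \<eta>) * jet k f (j - i) (0, \<eta>))) = 0" if j: "j < k" for j \<eta>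
  proof -
    have "product_jet t k f j (0, \<eta>) = product_jet (- t) k f j (0, \<eta>)"
      using product_jet_match[OF f v open_greaterThan pos j, of 0 \<eta>] product_jet_match[OF f v open_lessThan neg j, of 0 \<eta>]
      by (simp add: closure_half_lines)
    then show ?thesis
      by (simp add: product_jet_def jump_def sum_subtractf left_diff_distrib right_diff_distrib)
  qed
  have v0: "jet k f j (0, \<eta>) = 0" if "jump t 0 (0, \<eta>) \<noteq> 0" "j < k" for j \<eta>
    by (rule convolution_vanish_0[of k "\<lambda>i. jump t i (0, \<eta>)" "\<lambda>i. jet k f i (0, \<eta>)"]) (use jets that in auto)
  have v2: "jet k f j (0, \<eta>) = 0" if "j + 2 < k" for j \<eta>
  proof (cases "jump t 0 (0, \<eta>) = 0")
    case True
    show ?thesis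
      by (rule convolution_vanish_2[of k "\<lambda>i. jump t i (0, \<eta>)" "\<lambda>i. jet k f i (0, \<eta>)"])
         (use jets that True jump_1_0[of t \<eta>] jump_2_0[OF t True] in auto)
  qed (use v0 that in auto)
  have D1: "hardy ?J (D 1) < \<infinity>" if "1 \<le> k"
  proof -
    have "hardy ?J (\<lambda>w. jump t 1 w * jet k f (k - 1) w) < \<infinity>" by (intro hardy_jump_1_finite L) simp
    moreover have "(\<lambda>w. jump t 1 w * jet k f (k - 1) w) \<in> borel_measurable dual_cylinder"
      by (intro borel_measurable_times jump_measurable meas) simp
    ultimately have "hardy ?J (\<lambda>w. of_nat (k choose 1) * (jump t 1 w * jet k f (k - 1) w)) < \<infinity>"
      using hardy_mult_finite[of _ ?J "\<lambda>_. of_nat (k choose 1)" "real (k choose 1)"] by simp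
    then show ?thesis unfolding D_def .
  qed
  have Dvan: "hardy ?J (D i) < \<infinity>" if i: "1 \<le> i" "i \<le> k" and z: "\<And>\<eta>. jet k f (k - i) (0, \<eta>) = 0" for i
  proof -
    obtain C where C: "\<And>w. \<bar>fst w\<bar> \<le> 1 \<Longrightarrow> cmod (jump t i w) \<le> C" using jump_bounded by blast
    have "hardy ?J (\<lambda>w. jump t i w * jet k f (k - i) w) < \<infinity>"
    proof (rule hardy_mult_finite[where c = C])
      show "hardy ?J (jet k f (k - i)) < \<infinity>" using i z by (intro hardy_jet_finite[OF f]) auto
    qed (use i C in auto)
    moreover have "(\<lambda>w. jump t i w * jet k f (k - i) w) \<in> borel_measurable dual_cylinder"
      by (intro borel_measurable_times jump_measurable meas) simp
    ultimately have "hardy ?J (\<lambda>w. of_nat (k choose i) * (jump t i w * jet k f (k - i) w)) < \<infinity>"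
      using hardy_mult_finite[of _ ?J "\<lambda>_. of_nat (k choose i)" "real (k choose i)"] by simp
    then show ?thesis unfolding D_def .
  qed
  have D0: "D 0 = (\<lambda>w. jump t 0 w * jet k f k w)" by (auto simp: D_def)
  \<comment> \<open>As the total is finite, any part of the sum is finite whenever the remaining terms are.\<close>
  have split: "hardy ?J (\<lambda>w. \<Sum>i\<in>A. D i w) < \<infinity>" if A: "A \<subseteq> {..k}" and B: "\<And>i. i \<le> k \<Longrightarrow> i \<notin> A \<Longrightarrow> hardy ?J (D i) < \<infinity>" for A
  proof -
    have fin: "finite A" using A by (rule finite_subset) simp
    have "(\<Sum>i\<in>A. D i w) = (\<Sum>i\<le>k. D i w) + (-1) * (\<Sum>i\<in>{..k} - A. D i w)" for w
      using sum.subset_diff[OF A, of "\<lambda>i. D i w"] by simp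
    moreover have "hardy ?J (\<lambda>w. (\<Sum>i\<le>k. D i w) + (-1) * (\<Sum>i\<in>{..k} - A. D i w)) < \<infinity>"
    proof (rule hardy_add_finite[OF _ _ _ total])
      have s: "hardy ?J (\<lambda>w. \<Sum>i\<in>{..k} - A. D i w) < \<infinity>"
        by (rule hardy_sum_finite) (use B in auto)
      show "hardy ?J (\<lambda>w. (-1) * (\<Sum>i\<in>{..k} - A. D i w)) < \<infinity>"
        by (rule hardy_mult_finite[OF _ _ _ s, where m = "\<lambda>_. -1" and c = 1]) auto
    qed measurable
    ultimately show ?thesis by simp
  qed
  show "hardy ?J (\<lambda>w. jump t 0 w * jet k f k w) < \<infinity>" if k: "k \<le> 1"
  proof -
    have "hardy ?J (D i) < \<infinity>" if "i \<le> k" "i \<notin> {0}" for i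
    proof -
      have "i = 1" "1 \<le> k" using that k by auto
      then show ?thesis using D1 by simp
    qed
    then have "hardy ?J (\<lambda>w. \<Sum>i\<in>{0}. D i w) < \<infinity>" by (intro split) auto
    then show ?thesis by (simp add: D0)
  qed
  show "hardy ?J (\<lambda>w. jump t 0 w * jet k f k w) < \<infinity> \<longleftrightarrow> (\<forall>\<eta>. jet k f (k - 2) (0, \<eta>) = 0)" if k: "2 \<le> k"
  proof
    have big: "hardy ?J (D i) < \<infinity>" if "i \<le> k" "3 \<le> i" for i
      using that v2[of "k - i"] by (intro Dvan) auto
    assume fin: "hardy ?J (\<lambda>w. jump t 0 w * jet k f k w) < \<infinity>"
    have "hardy ?J (D i) < \<infinity>" if i: "i \<le> k" "i \<notin> {2}" for i
    proof -
      consider "i = 0" | "i = 1" | "3 \<le> i" using i by fastforce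
      then show ?thesis using fin D1 big i k by cases (auto simp: D0)
    qed
    then have "hardy ?J (\<lambda>w. \<Sum>i\<in>{2}. D i w) < \<infinity>" using k by (intro split) auto
    then have h2: "hardy ?J (D 2) < \<infinity>" by simp
    show "\<forall>\<eta>. jet k f (k - 2) (0, \<eta>) = 0"
    proof
      fix \<eta>
      show "jet k f (k - 2) (0, \<eta>) = 0"
      proof (cases "jump t 0 (0, \<eta>) = 0")
        case True
        have "continuous_on UNIV (\<lambda>\<xi>. jet k f (k - 2) (\<xi>, \<eta>))"
          using k by (intro antideriv_continuous[OF jet_antideriv[OF f]]) auto
        then have "continuous_on UNIV (\<lambda>\<xi>. D 2 (\<xi>, \<eta>))"
          unfolding D_def jump_def by (intro continuous_intros osc_continuous)
        then have "D 2 (0, \<eta>) = 0"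
          by (rule continuous_zero_of_nn_integral) (rule hardy_slice_finite[OF D_meas _ h2], simp)
        moreover have "k choose 2 \<noteq> 0" using k by (simp add: binomial_eq_0_iff)
        ultimately show ?thesis using jump_2_0[OF t True] by (simp add: D_def)
      qed (use v0 k in auto)
    qed
  next
    assume z: "\<forall>\<eta>. jet k f (k - 2) (0, \<eta>) = 0"
    have "hardy ?J (D i) < \<infinity>" if i: "i \<le> k" "i \<notin> {0}" for i
    proof -
      consider "i = 1" | "i = 2" | "3 \<le> i" using i by fastforce
      then show ?thesis
      proof cases
        case 1 then show ?thesis using D1 k by simp
      next
        case 2 then show ?thesis using z k by (intro Dvan) auto
      next
        case 3 then show ?thesis using i v2[of "k - i"] by (intro Dvan) auto
      qed
    qed
    then have "hardy ?J (\<lambda>w. \<Sum>i\<in>{0}. D i w) < \<infinity>" by (intro split) auto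
    then show "hardy ?J (\<lambda>w. jump t 0 w * jet k f k w) < \<infinity>" by (simp add: D0)
  qed
qed

section \<open>The two equivalences\<close>

lemma powr_odd_half: "\<bar>x\<bar> powr (2 * (real k + 1 / 2)) = \<bar>x\<bar> ^ (2 * k + 1)"
proof (cases "x = 0")
  case False
  have "2 * (real k + 1 / 2) = real (2 * k + 1)" by simp
  moreover have "\<bar>x\<bar> powr real (2 * k + 1) = \<bar>x\<bar> ^ (2 * k + 1)" using False by (intro powr_realpow) simp
  ultimately show ?thesis by (simp only:)
qed simp

lemma moment_measurable [measurable]: "f \<in> borel_measurable cylinder \<Longrightarrow> moment j f \<in> borel_measurable cylinder"
  unfolding moment_def by measurable

lemma norm_moment: "cmod (moment j f z) = \<bar>fst z\<bar> ^ j * cmod (f z)"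
  by (simp add: moment_def norm_mult norm_power)

lemma power_weight_finite:
  assumes f: "f \<in> L2 cylinder" and w: "f \<in> weighted_L2 (real k + 1 / 2)" and m: "m \<le> 2 * k + 1"
  shows "(\<integral>\<^sup>+z. ennreal (\<bar>fst z\<bar> ^ m * (cmod (f z))\<^sup>2) \<partial>cylinder) < \<infinity>"
proof -
  note [measurable] = L2_measurable[OF f]
  have "(\<integral>\<^sup>+z. ennreal (\<bar>fst z\<bar> ^ m * (cmod (f z))\<^sup>2) \<partial>cylinder)
     \<le> (\<integral>\<^sup>+z. ennreal ((cmod (f z))\<^sup>2) + ennreal (\<bar>fst z\<bar> ^ (2 * k + 1) * (cmod (f z))\<^sup>2) \<partial>cylinder)"
  proof (rule nn_integral_mono)
    fix z :: "real \<times> real"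
    have "\<bar>fst z\<bar> ^ m \<le> 1 + \<bar>fst z\<bar> ^ (2 * k + 1)"
    proof (cases "\<bar>fst z\<bar> \<le> 1")
      case True
      then have "\<bar>fst z\<bar> ^ m \<le> 1" by (intro power_le_one) auto
      moreover have "0 \<le> \<bar>fst z\<bar> ^ (2 * k + 1)" by (intro zero_le_power) simp
      ultimately show ?thesis by linarith
    next
      case False
      then have "\<bar>fst z\<bar> ^ m \<le> \<bar>fst z\<bar> ^ (2 * k + 1)" using m by (intro power_increasing) auto
      then show ?thesis by linarith
    qed
    then have "\<bar>fst z\<bar> ^ m * (cmod (f z))\<^sup>2 \<le> (1 + \<bar>fst z\<bar> ^ (2 * k + 1)) * (cmod (f z))\<^sup>2" by (intro mult_right_mono) auto
    then have "\<bar>fst z\<bar> ^ m * (cmod (f z))\<^sup>2 \<le> 1 * (cmod (f z))\<^sup>2 + 1 * (\<bar>fst z\<bar> ^ (2 * k + 1) * (cmod (f z))\<^sup>2)" by (simp add: distrib_right)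
    from ennreal_le_lincomb[OF this]
    show "ennreal (\<bar>fst z\<bar> ^ m * (cmod (f z))\<^sup>2) \<le> ennreal ((cmod (f z))\<^sup>2) + ennreal (\<bar>fst z\<bar> ^ (2 * k + 1) * (cmod (f z))\<^sup>2)" by simp
  qed
  also have "\<dots> = sq_norm cylinder f + (\<integral>\<^sup>+z. ennreal (\<bar>fst z\<bar> ^ (2 * k + 1) * (cmod (f z))\<^sup>2) \<partial>cylinder)"
    unfolding sq_norm_def by (rule nn_integral_add) measurable
  also have "\<dots> < \<infinity>" using w L2_finite[OF f] unfolding weighted_L2_iff powr_odd_half by simp
  finally show ?thesis .
qed

lemma integrable_cylinder_decay: "integrable cylinder (\<lambda>z. 1 / (1 + \<bar>fst z\<bar>)\<^sup>2)"
proof -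
  have "(\<integral>\<^sup>+z. ennreal (1 / (1 + \<bar>fst z\<bar>)\<^sup>2) \<partial>cylinder) = (\<integral>\<^sup>+x. ennreal (1 / (1 + \<bar>x\<bar>)\<^sup>2) * ennreal (2 * pi) \<partial>lborel)"
    using emeasure_circle by (subst nn_integral_cylinder) auto
  also have "\<dots> = (\<integral>\<^sup>+x. ennreal (1 / (1 + \<bar>x\<bar>)\<^sup>2) \<partial>lborel) * ennreal (2 * pi)"
    by (rule nn_integral_multc) measurable
  also have "(\<integral>\<^sup>+x. ennreal (1 / (1 + \<bar>x\<bar>)\<^sup>2) \<partial>lborel)
     \<le> (\<integral>\<^sup>+x. indicator {-1..1} x + (ennreal (1 / x\<^sup>2) * indicator {1..} x + ennreal (1 / x\<^sup>2) * indicator {..-1} x) \<partial>lborel)"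
  proof (rule nn_integral_mono)
    fix x :: real
    have 1: "1 / (1 + \<bar>x\<bar>)\<^sup>2 \<le> 1" by (simp add: divide_le_eq_1)
    have 2: "1 / (1 + \<bar>x\<bar>)\<^sup>2 \<le> 1 / x\<^sup>2" if "x \<noteq> 0"
    proof -
      have "\<bar>x\<bar>\<^sup>2 \<le> (1 + \<bar>x\<bar>)\<^sup>2" by (intro power_mono) auto
      then show ?thesis using that by (intro divide_left_mono) auto
    qed
    consider "x \<in> {-1..1}" | "x > 1" | "x < -1" by force
    then show "ennreal (1 / (1 + \<bar>x\<bar>)\<^sup>2) \<le> indicator {-1..1} x + (ennreal (1 / x\<^sup>2) * indicator {1..} x + ennreal (1 / x\<^sup>2) * indicator {..-1} x)"
    proof cases
      case 1
      then have "ennreal (1 / (1 + \<bar>x\<bar>)\<^sup>2) \<le> indicator {-1..1} x" using \<open>1 / (1 + \<bar>x\<bar>)\<^sup>2 \<le> 1\<close> by simp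
      then show ?thesis by (rule order_trans) simp
    qed (use 2 in \<open>auto intro: ennreal_leI\<close>)
  qed
  also have "\<dots> = 2 + (1 + 1)"
    using nn_integral_inverse_square[of 1] nn_integral_inverse_square_neg[of 1] by (simp add: nn_integral_add)
  finally have "(\<integral>\<^sup>+z. ennreal (1 / (1 + \<bar>fst z\<bar>)\<^sup>2) \<partial>cylinder) \<le> (2 + (1 + 1)) * ennreal (2 * pi)"
    by (simp add: mult_right_mono)
  also have "\<dots> < \<infinity>" by (simp add: ennreal_mult_less_top)
  finally show ?thesis by (auto simp: integrable_iff_bounded)
qed

text \<open>
  Below order \<open>k\<close> there is a full power of \<open>|x|\<close> to spare, so that \<open>x\<^sup>j f\<close> is the product of the square integrable functions
  \<open>(1 + |x|) x\<^sup>j f\<close> and \<open>1/(1 + |x|)\<close>, hence integrable.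
\<close>

lemma weighted_L2_imp_admissible:
  assumes f: "f \<in> L2 cylinder" and w: "f \<in> weighted_L2 (real k + 1 / 2)"
  shows "admissible k f"
  unfolding admissible_def
proof (intro conjI allI impI)
  note [measurable] = L2_measurable[OF f]
  have sq: "(cmod (moment j f z))\<^sup>2 = \<bar>fst z\<bar> ^ (2 * j) * (cmod (f z))\<^sup>2" for j z
    by (simp add: norm_moment power_mult_distrib power_mult[symmetric] mult.commute)
  fix j
  show L: "moment j f \<in> L2 cylinder" if "j \<le> k"
    using power_weight_finite[OF f w, of "2 * j"] that by (simp add: L2_iff sq_norm_def sq)
  show "moment j f \<in> weighted_L2 (1 / 2)" if "j \<le> k"
    using power_weight_finite[OF f w, of "Suc (2 * j)"] that by (simp add: weighted_L2_half_iff sq mult.assoc)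
  show "integrable cylinder (moment j f)" if j: "j < k"
  proof (rule Bochner_Integration.integrable_bound)
    have a: "integrable cylinder (\<lambda>z. \<bar>fst z\<bar> ^ m * (cmod (f z))\<^sup>2)" if "m \<le> 2 * k + 1" for m
      using power_weight_finite[OF f w that] by (auto simp: integrable_iff_bounded)
    show "integrable cylinder (\<lambda>z. 1 / (1 + \<bar>fst z\<bar>)\<^sup>2 + (2 * (\<bar>fst z\<bar> ^ (2 * j) * (cmod (f z))\<^sup>2) + 2 * (\<bar>fst z\<bar> ^ (2 * j + 2) * (cmod (f z))\<^sup>2)))"
      using j by (intro Bochner_Integration.integrable_add integrable_cylinder_decay integrable_mult_right a) auto
    show "moment j f \<in> borel_measurable cylinder" by measurable
    show "AE z in cylinder. norm (moment j f z) \<le> norm (1 / (1 + \<bar>fst z\<bar>)\<^sup>2 + (2 * (\<bar>fst z\<bar> ^ (2 * j) * (cmod (f z))\<^sup>2) + 2 * (\<bar>fst z\<bar> ^ (2 * j + 2) * (cmod (f z))\<^sup>2)))"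
    proof (rule AE_I2)
      fix z :: "real \<times> real"
      define x where "x = \<bar>fst z\<bar>"
      have x: "x \<ge> 0" by (simp add: x_def)
      define p where "p = x ^ j * cmod (f z)"
      have p: "p \<ge> 0" using x by (simp add: p_def)
      have "2 * (1 / (1 + x)) * ((1 + x) * p) \<le> (1 / (1 + x))\<^sup>2 + ((1 + x) * p)\<^sup>2" by (rule sum_squares_bound)
      then have "2 * p \<le> 1 / (1 + x)\<^sup>2 + (1 + x)\<^sup>2 * p\<^sup>2" using x by (simp add: power_divide power_mult_distrib)
      also have "(1 + x)\<^sup>2 * p\<^sup>2 \<le> (2 + 2 * x\<^sup>2) * p\<^sup>2"
        using sum_squares_bound[of 1 x] by (intro mult_right_mono) (auto simp: power2_eq_square algebra_simps)
      also have "(2 + 2 * x\<^sup>2) * p\<^sup>2 = 2 * (x ^ (2 * j) * (cmod (f z))\<^sup>2) + 2 * (x ^ (2 * j + 2) * (cmod (f z))\<^sup>2)"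
      proof -
        have "p\<^sup>2 = x ^ (2 * j) * (cmod (f z))\<^sup>2"
          by (simp add: p_def power_mult_distrib power_mult[symmetric] mult.commute[of 2 j])
        then show ?thesis by (simp add: power_add power2_eq_square[of x] algebra_simps)
      qed
      finally have "p \<le> 1 / (1 + x)\<^sup>2 + (2 * (x ^ (2 * j) * (cmod (f z))\<^sup>2) + 2 * (x ^ (2 * j + 2) * (cmod (f z))\<^sup>2))" using p by linarith
      then show "norm (moment j f z) \<le> norm (1 / (1 + \<bar>fst z\<bar>)\<^sup>2 + (2 * (\<bar>fst z\<bar> ^ (2 * j) * (cmod (f z))\<^sup>2) + 2 * (\<bar>fst z\<bar> ^ (2 * j + 2) * (cmod (f z))\<^sup>2)))"
        unfolding norm_moment x_def[symmetric] p_def[symmetric] real_norm_def by linarith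
    qed
  qed
qed

lemma sobolev_x_weight_finite:
  assumes "f \<in> sobolev_x (real k + 1 / 2)"
  shows "(\<integral>\<^sup>+w. ennreal (\<bar>fst w\<bar> ^ (2 * k + 1) * (cmod (fourier f w))\<^sup>2) \<partial>dual_cylinder) < \<infinity>"
proof -
  obtain g where g: "g \<in> L2 cylinder" and ae: "AE w in dual_cylinder. fourier g w = of_real (jbracket (fst w) powr (real k + 1 / 2)) * fourier f w"
    using assms by (auto simp: sobolev_x_def case_prod_beta')
  have "(\<integral>\<^sup>+w. ennreal (\<bar>fst w\<bar> ^ (2 * k + 1) * (cmod (fourier f w))\<^sup>2) \<partial>dual_cylinder) \<le> sq_norm dual_cylinder (fourier g)"
    unfolding sq_norm_def
  proof (rule nn_integral_mono_AE, use ae in eventually_elim)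
    case (elim w)
    let ?J = "jbracket (fst w)"
    have "\<bar>fst w\<bar> \<le> ?J" unfolding jbracket_def by (rule real_le_rsqrt) simp
    moreover have J: "?J > 0" unfolding jbracket_def by (simp add: add_pos_nonneg)
    ultimately have "\<bar>fst w\<bar> ^ (2 * k + 1) \<le> ?J ^ (2 * k + 1)" by (intro power_mono) auto
    also have "?J ^ (2 * k + 1) = (?J powr (real k + 1 / 2))\<^sup>2"
      using powr_odd_half[of ?J k] J by (simp add: power2_eq_square powr_add[symmetric])
    finally have "\<bar>fst w\<bar> ^ (2 * k + 1) * (cmod (fourier f w))\<^sup>2 \<le> (?J powr (real k + 1 / 2))\<^sup>2 * (cmod (fourier f w))\<^sup>2"
      by (intro mult_right_mono) auto
    then show ?case unfolding elim norm_mult power_mult_distrib by (intro ennreal_leI) simp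
  qed
  also have "\<dots> < \<infinity>" by (rule L2_finite[OF fourier_L2[OF g]])
  finally show ?thesis .
qed

lemma AE_dual_cylinder_nonzero: "AE w in dual_cylinder. fst w \<noteq> 0"
proof -
  let ?f = "\<lambda>w::real \<times> int. if fst w = 0 then 1 else (0::complex)"
  have m: "?f \<in> borel_measurable dual_cylinder" by measurable
  have "(\<integral>\<^sup>+\<xi>. ennreal ((cmod (?f (\<xi>, \<eta>)))\<^sup>2) \<partial>lborel) = (\<integral>\<^sup>+\<xi>. indicator {0::real} \<xi> \<partial>lborel)" for \<eta>
    by (intro nn_integral_cong) (auto simp: indicator_def)
  then have slice: "(\<integral>\<^sup>+\<xi>. ennreal ((cmod (?f (\<xi>, \<eta>)))\<^sup>2) \<partial>lborel) = 0" for \<eta> by simp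
  have "sq_norm dual_cylinder ?f = (\<integral>\<^sup>+\<eta>. (\<integral>\<^sup>+\<xi>. ennreal ((cmod (?f (\<xi>, \<eta>)))\<^sup>2) \<partial>lborel) \<partial>count_space UNIV)"
    unfolding sq_norm_def by (rule nn_integral_dual_cylinder) (use m in measurable)
  also have "\<dots> = 0" unfolding slice by simp
  finally have "sq_norm dual_cylinder ?f = 0" .
  then have "AE w in dual_cylinder. ?f w = 0" using sq_norm_eq_0_iff[OF m] by simp
  then show ?thesis by eventually_elim (auto split: if_splits)
qed

text \<open>
  The form in which the three transforms of interest appear: a function of finite energy, corrected on the negative frequencies by another one.
\<close>

lemma energy_add_neg_part_finite_iff:
  assumes [measurable]: "A \<in> borel_measurable dual_cylinder" "B \<in> borel_measurable dual_cylinder"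
    and fin: "energy UNIV UNIV A < \<infinity>" "energy UNIV UNIV B < \<infinity>" and c: "c \<noteq> 0"
    and eq: "AE w in dual_cylinder. F w = A w + c * neg_part B w"
  shows "energy UNIV UNIV F < \<infinity> \<longleftrightarrow> hardy {..<0} B < \<infinity>"
proof -
  have F: "energy UNIV UNIV F = energy UNIV UNIV (\<lambda>w. A w + c * neg_part B w)" by (rule energy_cong_AE[OF eq])
  have "energy UNIV UNIV (\<lambda>w. A w + c * neg_part B w) < \<infinity> \<longleftrightarrow> energy UNIV UNIV (neg_part B) < \<infinity>"
  proof
    assume *: "energy UNIV UNIV (\<lambda>w. A w + c * neg_part B w) < \<infinity>"
    have 1: "energy UNIV UNIV (\<lambda>w. (1 / c) * (A w + c * neg_part B w)) < \<infinity>"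
      by (rule energy_cmult_finite[OF _ _ _ *]) auto
    have 2: "energy UNIV UNIV (\<lambda>w. (- 1 / c) * A w) < \<infinity>"
      by (rule energy_cmult_finite[OF _ _ _ fin(1)]) auto
    have "energy UNIV UNIV (\<lambda>w. (1 / c) * (A w + c * neg_part B w) + (- 1 / c) * A w) < \<infinity>"
      by (rule energy_add_finite[OF _ _ _ _ 1 2]) auto
    then show "energy UNIV UNIV (neg_part B) < \<infinity>" using c by (simp add: algebra_simps)
  next
    assume "energy UNIV UNIV (neg_part B) < \<infinity>"
    then show "energy UNIV UNIV (\<lambda>w. A w + c * neg_part B w) < \<infinity>"
      using fin by (intro energy_add_finite energy_cmult_finite) auto
  qed
  then show ?thesis unfolding F using energy_neg_part_finite_iff[OF _ fin(2)] by simp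
qed

lemma phase_minus: "phase (- T) w * phase T w = 1"
  by (simp add: phase_def exp_add[symmetric])

lemma exp_dispersion:
  assumes "fst w \<noteq> 0"
  shows "exp (\<i> * of_real (t * dispersion (fst w) (snd w))) = (if fst w < 0 then phase (- t) w else phase t w)"
proof -
  have "t * dispersion (fst w) (snd w) = (if fst w < 0 then - t else t) * ((fst w)\<^sup>2 + (of_int (snd w))\<^sup>2)"
    using assms by (simp add: dispersion_def algebra_simps sgn_real_def)
  then show ?thesis unfolding phase_def by presburger
qed

lemma fourier_propagator_phase:
  assumes "f \<in> L2 cylinder"
  shows "AE w in dual_cylinder. fourier (propagator t f) w = (if fst w < 0 then phase (- t) w else phase t w) * fourier f w"
  using fourier_propagator[OF assms, of t] AE_dual_cylinder_nonzero
proof eventually_elim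
  case (elim w)
  show ?case unfolding elim(1) exp_dispersion[OF elim(2)] ..
qed

theorem corollary1p4:
  fixes k :: nat and f :: "real \<times> real \<Rightarrow> complex" and t :: real
  assumes "f \<in> sobolev_x (real k + 1/2) \<inter> weighted_L2 (real k + 1/2)"
    and "t \<noteq> 0"
    and "propagator t f \<in> weighted_L2 (real k + 1/2)"
  shows "(k = 0 \<or> k = 1 \<longrightarrow>
      (propagator t (hilbert_x (mult_x_pow k f)) \<in> weighted_L2 (1/2) \<longleftrightarrow>
       hilbert_x (mult_x_pow k f) \<in> weighted_L2 (1/2)))
    \<and> (k \<ge> 2 \<longrightarrow>
      (propagator t (mult_x_pow k f) \<in> weighted_L2 (1/2) \<longleftrightarrow>
       (\<forall>\<eta>::int. (LINT (x, y)|cylinder.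
          exp (- \<i> * of_real (of_int \<eta> * y)) * mult_x_pow (k - 2) f (x, y)) = 0))
      \<and> (propagator t (mult_x_pow k f) \<in> weighted_L2 (1/2) \<or>
         (\<forall>\<eta>::int. (LINT (x, y)|cylinder.
            exp (- \<i> * of_real (of_int \<eta> * y)) * mult_x_pow (k - 2) f (x, y)) = 0) \<longrightarrow>
         (propagator t (hilbert_x (mult_x_pow k f)) \<in> weighted_L2 (1/2) \<longleftrightarrow>
          hilbert_x (mult_x_pow k f) \<in> weighted_L2 (1/2))))"
proof -
  have fL: "f \<in> L2 cylinder" using assms(1) by (simp add: sobolev_x_def)
  have adm: "admissible k f" using assms(1) by (intro weighted_L2_imp_admissible fL) auto
  have vL: "propagator t f \<in> L2 cylinder" by (rule propagator_L2[OF fL])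
  have admv: "admissible k (propagator t f)" by (rule weighted_L2_imp_admissible[OF vL assms(3)])
  have mL: "moment k f \<in> L2 cylinder" and mW: "moment k f \<in> weighted_L2 (1/2)" using adm by (auto simp: admissible_def)
  define u where "u = mult_x_pow k f"
  have ii: "\<i> ^ j * (- \<i>) ^ j = 1" for j by (simp add: power_mult_distrib[symmetric])
  have mult_eq: "mult_x_pow j f z = \<i> ^ j * moment j f z" for j z
  proof -
    have "(- \<i> * of_real (fst z)) ^ j = (- \<i>) ^ j * of_real (fst z) ^ j" by (rule power_mult_distrib)
    then have "\<i> ^ j * moment j f z = (\<i> ^ j * (- \<i>) ^ j) * (of_real (fst z) ^ j * f z)" by (simp only: moment_def mult_ac)
    then show ?thesis unfolding ii by (simp add: mult_x_pow_def case_prod_beta')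
  qed
  have u_eq: "u = (\<lambda>z. \<i> ^ k * moment k f z)" unfolding u_def using mult_eq by blast
  have uL: "u \<in> L2 cylinder" unfolding u_eq by (rule L2_cmult[OF mL])
  have uW: "u \<in> weighted_L2 (1/2)"
    using mW L2_measurable[OF uL] by (simp add: weighted_L2_half_iff u_eq norm_mult norm_power)
  define G where "G = fourier u"
  have GL: "G \<in> L2 dual_cylinder" unfolding G_def by (rule fourier_L2[OF uL])
  note [measurable] = L2_measurable[OF GL]
  have G_AE: "AE w in dual_cylinder. G w = \<i> ^ k * fourier (moment k f) w"
    unfolding G_def u_eq by (rule fourier_cmult[OF mL])
  have Ge: "energy UNIV UNIV G < \<infinity>" using weighted_L2_half_iff_energy[OF uL] uW by (simp add: G_def)
  have Gw: "(\<integral>\<^sup>+w. ennreal (\<bar>fst w\<bar> * (cmod (G w))\<^sup>2) \<partial>dual_cylinder) < \<infinity>"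
  proof -
    have "(\<integral>\<^sup>+w. ennreal (\<bar>fst w\<bar> * (cmod (G w))\<^sup>2) \<partial>dual_cylinder) = (\<integral>\<^sup>+w. ennreal (\<bar>fst w\<bar> * (cmod (fourier (moment k f) w))\<^sup>2) \<partial>dual_cylinder)"
      by (rule nn_integral_cong_AE, use G_AE in eventually_elim) (simp add: norm_mult norm_power)
    also have "\<dots> < \<infinity>"
      using mW assms(1) by (intro fourier_moment_interpolation fL mL sobolev_x_weight_finite) (auto simp: weighted_L2_half_iff)
    finally show ?thesis .
  qed
  have phG: "energy UNIV UNIV (\<lambda>w. phase T w * G w) < \<infinity>" for T by (rule energy_phase_finite[OF GL Ge Gw])
  \<comment> \<open>Seen from the phase \<open>P(t)\<close> on the whole line, the propagator is off by \<open>?dif\<close> on the negative frequencies; the additional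
    sign change of the Hilbert transform turns the difference into \<open>?sum\<close>.\<close>
  let ?dif = "\<lambda>w. jump t 0 w * G w" and ?sum = "\<lambda>w. (phase t w + phase (- t) w) * G w"
  have difE: "energy UNIV UNIV ?dif < \<infinity>"
  proof -
    have "energy UNIV UNIV (\<lambda>w. phase t w * G w + (-1) * (phase (- t) w * G w)) < \<infinity>"
      by (intro energy_add_finite energy_cmult_finite phG) auto
    then show ?thesis by (simp add: jump_def osc_0 left_diff_distrib)
  qed
  have sumE: "energy UNIV UNIV ?sum < \<infinity>"
  proof -
    have "energy UNIV UNIV (\<lambda>w. phase t w * G w + phase (- t) w * G w) < \<infinity>"
      by (intro energy_add_finite phG) auto
    then show ?thesis by (simp add: distrib_right)
  qed
  have a: "propagator t u \<in> weighted_L2 (1/2) \<longleftrightarrow> hardy {..<0} ?dif < \<infinity>"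
    unfolding weighted_L2_half_iff_energy[OF propagator_L2[OF uL]]
  proof (rule energy_add_neg_part_finite_iff[OF _ _ phG[of t] difE])
    show "AE w in dual_cylinder. fourier (propagator t u) w = phase t w * G w + (-1) * neg_part ?dif w"
      using fourier_propagator_phase[OF uL, of t]
      by eventually_elim (simp add: G_def neg_part_def jump_def osc_0 algebra_simps)
  qed auto
  define h where "h = hilbert_x u"
  have hL: "h \<in> L2 cylinder" unfolding h_def by (rule hilbert_x_L2[OF uL])
  have h_AE: "AE w in dual_cylinder. fourier h w = - \<i> * of_real (sgn (fst w)) * G w"
    unfolding h_def G_def by (rule fourier_hilbert_x[OF uL])
  have b: "propagator t h \<in> weighted_L2 (1/2) \<longleftrightarrow> hardy {..<0} ?sum < \<infinity>"
    unfolding weighted_L2_half_iff_energy[OF propagator_L2[OF hL]]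
  proof (rule energy_add_neg_part_finite_iff[OF _ _ energy_cmult_finite[OF _ _ _ phG[of t], of "- \<i>"] sumE])
    show "AE w in dual_cylinder. fourier (propagator t h) w = - \<i> * (phase t w * G w) + \<i> * neg_part ?sum w"
      using fourier_propagator_phase[OF hL, of t] h_AE AE_dual_cylinder_nonzero
      by eventually_elim (auto simp: neg_part_def algebra_simps)
  qed auto
  have c: "h \<in> weighted_L2 (1/2) \<longleftrightarrow> hardy {..<0} G < \<infinity>"
    unfolding weighted_L2_half_iff_energy[OF hL]
  proof (rule energy_add_neg_part_finite_iff[OF _ _ energy_cmult_finite[OF _ _ _ Ge, of "- \<i>"] Ge])
    show "AE w in dual_cylinder. fourier h w = - \<i> * G w + (2 * \<i>) * neg_part G w"
      using h_AE AE_dual_cylinder_nonzero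
      by eventually_elim (auto simp: neg_part_def algebra_simps sgn_real_def)
  qed auto
  have d: "hardy {..<0} ?sum < \<infinity> \<longleftrightarrow> hardy {..<0} G < \<infinity>" if dif: "hardy {..<0} ?dif < \<infinity>"
  proof
    assume "hardy {..<0} ?sum < \<infinity>"
    then have s: "hardy {..<0} (\<lambda>w. ?sum w + ?dif w) < \<infinity>" using dif by (intro hardy_add_finite) auto
    have "hardy {..<0} (\<lambda>w. (phase (- t) w / 2) * (?sum w + ?dif w)) < \<infinity>"
      by (rule hardy_mult_finite[OF _ _ _ s, where c = 1]) (auto simp: norm_divide)
    moreover have "(phase (- t) w / 2) * (?sum w + ?dif w) = G w" for w
    proof -
      have "?sum w + ?dif w = 2 * (phase t w * G w)" by (simp add: jump_def osc_0 algebra_simps)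
      then have "(phase (- t) w / 2) * (?sum w + ?dif w) = (phase (- t) w * phase t w) * G w" by simp
      then show ?thesis by (simp add: phase_minus)
    qed
    ultimately show "hardy {..<0} G < \<infinity>" by simp
  next
    assume "hardy {..<0} G < \<infinity>"
    then show "hardy {..<0} ?sum < \<infinity>"
      by (rule hardy_mult_finite[where c = 2, rotated 3]) (auto intro: order_trans[OF norm_triangle_ineq])
  qed
  \<comment> \<open>\<open>G\<close> differs from the top-order jet only by a unimodular constant, and only frequencies near zero matter.\<close>
  have dif_jet: "hardy {..<0} ?dif < \<infinity> \<longleftrightarrow> hardy {-1<..<0} (\<lambda>w. jump t 0 w * jet k f k w) < \<infinity>"
  proof -
    have difL: "?dif \<in> L2 dual_cylinder"
      by (rule L2_bounded_mult[OF GL, where B = 2]) (auto simp: jump_def osc_0 intro: order_trans[OF norm_triangle_ineq4])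
    have [measurable]: "jet k f k \<in> borel_measurable dual_cylinder" by (rule L2_measurable[OF jet_L2[OF adm order_refl]])
    have "hardy {-1<..<0} ?dif = hardy {-1<..<0} (\<lambda>w. \<i> ^ k * (jump t 0 w * jet k f k w))"
    proof (rule hardy_cong_AE)
      fix \<eta>
      have "AE w in dual_cylinder. ?dif w = \<i> ^ k * (jump t 0 w * jet k f k w)"
        using G_AE jet_AE[OF adm order_refl] by eventually_elim simp
      from AE_dual_cylinder_slice[OF this]
      show "AE \<xi> in lborel. \<xi> \<in> {-1<..<0} \<longrightarrow> ?dif (\<xi>, \<eta>) = \<i> ^ k * (jump t 0 (\<xi>, \<eta>) * jet k f k (\<xi>, \<eta>))"
        by eventually_elim simp
    qed auto
    also have "\<dots> = hardy {-1<..<0} (\<lambda>w. jump t 0 w * jet k f k w)"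
      by (simp add: hardy_def norm_mult norm_power)
    finally show ?thesis using hardy_half_line_finite_iff[OF difL] by simp
  qed
  \<comment> \<open>At \<open>\<xi> = 0\<close> the integral defining the jet of order \<open>k - 2\<close> is the moment in question.\<close>
  have cond: "(LINT (x, y)|cylinder. exp (- \<i> * of_real (of_int \<eta> * y)) * mult_x_pow (k - 2) f (x, y)) = 0
      \<longleftrightarrow> jet k f (k - 2) (0, \<eta>) = 0" if "k \<ge> 2" for \<eta>
  proof -
    have "(LINT (x, y)|cylinder. exp (- \<i> * of_real (of_int \<eta> * y)) * mult_x_pow (k - 2) f (x, y))
      = (LINT z|cylinder. \<i> ^ (k - 2) * (moment (k - 2) f z * cnj (character (0, \<eta>) z)))"
      by (intro Bochner_Integration.integral_cong)
         (auto simp: mult_eq cnj_character_Pair trig_def mult_ac)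
    also have "\<dots> = \<i> ^ (k - 2) * jet k f (k - 2) (0, \<eta>)"
      using that by (simp add: jet_def integral_transform_def)
    finally show ?thesis by simp
  qed
  note low = jump_hardy_low[OF adm admv assms(2) fourier_propagator[OF fL]]
  note high = jump_hardy_high[OF adm admv assms(2) fourier_propagator[OF fL]]
  show ?thesis
    unfolding u_def[symmetric] h_def[symmetric]
  proof (intro conjI impI)
    assume "k = 0 \<or> k = 1"
    then have "hardy {..<0} ?dif < \<infinity>" using low dif_jet by auto
    then show "(propagator t h \<in> weighted_L2 (1/2)) = (h \<in> weighted_L2 (1/2))" using b c d by simp
  next
    assume k: "2 \<le> k"
    show main: "(propagator t u \<in> weighted_L2 (1/2)) = (\<forall>\<eta>. (LINT (x, y)|cylinder. exp (- \<i> * of_real (of_int \<eta> * y)) * mult_x_pow (k - 2) f (x, y)) = 0)"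
      unfolding a dif_jet cond[OF k] by (rule high[OF k])
    assume "propagator t u \<in> weighted_L2 (1/2) \<or> (\<forall>\<eta>. (LINT (x, y)|cylinder. exp (- \<i> * of_real (of_int \<eta> * y)) * mult_x_pow (k - 2) f (x, y)) = 0)"
    then have "hardy {..<0} ?dif < \<infinity>" using main a by auto
    then show "(propagator t h \<in> weighted_L2 (1/2)) = (h \<in> weighted_L2 (1/2))" using b c d by simp
  qed
qed

end
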